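(* Fix $l\ge1$ and $c>0$, set $\kappa=\kappa_N=c\sqrt N$, and let $L=\{1,\dots,l\}$. Let $\Upsilon$ be a random spanning tree of $K_N\cup\{\Delta\}$ with law $\mathbb P^{(N),c\sqrt N}$, and let $\Upsilon_L$, $Q_L$, $\Pi_N$, binary bouquets, $C_{l,r}$ and $I_{l,r}(c)$ be as in the context. Then: (a) The probability that (the $L$-reduction of) $\Upsilon_L$ is not a binary bouquet tends to $0$ as $N\to\infty$. (b) Let $\pi=\{B_1,\dots,B_r\}$ be a partition of $L$ into $r$ blocks and, for each $j$, let $\alpha_j$ be a binary class on the leaf set $B_j$. Then $\mathbb P^{(N),c\sqrt N}\bigl(Q_L=(\pi,(\alpha_j)_{1\le j\le r})\bigr)\to I_{l,r}(c)$. In particular $\mathbb P^{(N),c\sqrt N}(|\Pi_N|=r)\to C_{l,r}I_{l,r}(c)$ for $1\le r\le l$, and conditionally on $|\Pi_N|=r$ the reduced configuration $(\pi,(\alpha_j))$ is asymptotically uniform over the $C_{l,r}$ possibilities. (c) For such $(\pi,(\alpha_j))$ with $r$ blocks, and $t\in\mathbb R_+^{2l-r}$ with $\sigma=\sum_{i=1}^{2l-r}t_i$, \[ \lim_{N\to\infty}N^{(2l-r)/2}\,\mathbb P^{(N),c\sqrt N}\bigl(Q_L=(\pi,(\alpha_j)),\ u=[t\sqrt N]\bigr)=c^{r-1}(\sigma+c)\exp\Bigl(-\frac{\sigma^2}{2}-c\sigma\Bigr), \] where $[t\sqrt N]$ denotes componentwise integer parts.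
   Context: $K_N\cup\{\Delta\}$ is the complete graph on $\{1,\dots,N,\Delta\}$; $\mathbb P^{(N),\kappa}$ is the probability on its spanning trees $T$ with $\mathbb P^{(N),\kappa}(T)\propto\kappa^{\deg_T(\Delta)}$. Trees are rooted at $\Delta$ (parent = neighbour towards $\Delta$; children of $x$ = vertices with parent $x$). $\Upsilon_L$ is the smallest subtree of $\Upsilon$ containing $L\cup\{\Delta\}$; a node is a vertex of $\Upsilon_L$ with at least two children. The $L$-reduction has vertices $\Delta$, elements of $L$ and nodes, each $v\neq\Delta$ joined to the first such vertex strictly below it; $Q_L$ is its class under permutations of $\{l+1,\dots,N\}$. It is a binary bouquet of $r$ trees if every element of $L$ has no child, every childless vertex $\neq\Delta$ is in $L$, every other vertex $\neq\Delta$ has exactly two children, and $\Delta$ has exactly $r$ children; then it is identified with a partition $\pi$ of $L$ into $r$ blocks (elements of $L$ in the same subtree hanging from a child of $\Delta$) and a binary class $\alpha_j$ on each block $B_j$ (binary: $\Delta$ has one child, internal vertices two children, leaves exactly $B_j$). There are $c_m=\prod_{i=1}^{m-1}(2i-1)$ binary classes on $m$ leaves. Such a bouquet has $2l-r$ edges, enumerated in a fixed order; $u\in\mathbb N^{2l-r}$ gives for each edge the number of intermediate vertices of $\Upsilon_L$ strictly between its endpoints. $\Pi_N$ is the partition of $L$ into the sets of elements of $L$ lying in the same component of $\Upsilon$ with $\Delta$ removed. $C_{l,r}=\sum_{\pi}\prod_{B\in\pi}c_{|B|}$, the sum over partitions $\pi$ of $L$ into $r$ blocks. $I_{1,1}(c)=1$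 and for $l\ge2$, $1\le r\le l$, \[ I_{l,r}(c)=\frac{c^{r-1}}{(2l-r-1)!}\int_0^\infty(\sigma+c)\sigma^{2l-r-1}e^{-\sigma^2/2-c\sigma}d\sigma=\frac{c^{r-1}}{(2l-r-2)!}\int_0^\infty s^{2l-r-2}e^{-s^2/2-cs}ds. \] *)

theory Defs
  imports
    "HOL-Probability.Probability"
    "HOL-Combinatorics.Permutations"
begin

section \<open>Finite simple graphs and trees\<close>

text \<open>
  Graphs are undirected, with edges as two-element sets of vertices. The extra vertex \<open>\<Delta>\<close> is
  encoded as \<open>0\<close>, so that \<open>{1,\<dots>,N,\<Delta>}\<close> is the set \<open>{0..N}\<close>.
\<close>

abbreviation (input) Root :: nat (\<open>\<Delta>\<close>)
  where "\<Delta> \<equiv> 0"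

type_synonym graph = "nat set \<times> nat set set"

abbreviation verts :: "graph \<Rightarrow> nat set" where "verts \<equiv> fst"
abbreviation edges :: "graph \<Rightarrow> nat set set" where "edges \<equiv> snd"

definition all_edges :: "nat set \<Rightarrow> nat set set"
  where "all_edges V = {{x, y} | x y. x \<in> V \<and> y \<in> V \<and> x \<noteq> y}"

definition simple_graph :: "graph \<Rightarrow> bool"
  where "simple_graph G \<longleftrightarrow> finite (verts G) \<and> edges G \<subseteq> all_edges (verts G)"

definition gpath :: "graph \<Rightarrow> nat \<Rightarrow> nat list \<Rightarrow> nat \<Rightarrow> bool"
  where "gpath G x p y \<longleftrightarrow>
    p \<noteq> [] \<and> hd p = x \<and> last p = y \<and> distinct p \<and> set p \<subseteq> verts G \<and>
    successively (\<lambda>a b. {a, b} \<in> edges G) p"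

definition gcycle :: "graph \<Rightarrow> nat list \<Rightarrow> bool"
  where "gcycle G p \<longleftrightarrow>
    length p \<ge> 3 \<and> distinct p \<and> set p \<subseteq> verts G \<and>
    successively (\<lambda>a b. {a, b} \<in> edges G) p \<and> {last p, hd p} \<in> edges G"

definition connected_graph :: "graph \<Rightarrow> bool"
  where "connected_graph G \<longleftrightarrow>
    verts G \<noteq> {} \<and> (\<forall>x\<in>verts G. \<forall>y\<in>verts G. \<exists>p. gpath G x p y)"

definition is_tree :: "graph \<Rightarrow> bool"
  where "is_tree G \<longleftrightarrow> simple_graph G \<and> connected_graph G \<and> (\<nexists>p. gcycle G p)"

definition subgraph :: "graph \<Rightarrow> graph \<Rightarrow> bool"
  where "subgraph H G \<longleftrightarrow> verts H \<subseteq> verts G \<and> edges H \<subseteq> edges G"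

definition degree :: "graph \<Rightarrow> nat \<Rightarrow> nat"
  where "degree G x = card {e \<in> edges G. x \<in> e}"

definition remove_vertex :: "graph \<Rightarrow> nat \<Rightarrow> graph"
  where "remove_vertex G x = (verts G - {x}, {e \<in> edges G. x \<notin> e})"


section \<open>The random spanning tree\<close>

definition complete_graph :: "nat \<Rightarrow> graph"
  where "complete_graph N = ({0..N}, all_edges {0..N})"

definition spanning_trees :: "nat \<Rightarrow> graph set"
  where "spanning_trees N =
    {T. is_tree T \<and> subgraph T (complete_graph N) \<and> verts T = verts (complete_graph N)}"

definition tree_law :: "nat \<Rightarrow> real \<Rightarrow> graph measure"
  where "tree_law N \<kappa> = point_measure (spanning_trees N)
    (\<lambda>T. ennreal (\<kappa> ^ degree T \<Delta> / (\<Sum>S\<in>spanning_trees N. \<kappa> ^ degree S \<Delta>)))"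


section \<open>Trees rooted at \<open>\<Delta>\<close>\<close>

definition tree_path :: "graph \<Rightarrow> nat \<Rightarrow> nat \<Rightarrow> nat list"
  where "tree_path G x y = (THE p. gpath G x p y)"

definition parent :: "graph \<Rightarrow> nat \<Rightarrow> nat"
  where "parent G x = tree_path G x \<Delta> ! 1"

definition children :: "graph \<Rightarrow> nat \<Rightarrow> nat set"
  where "children G x = {y \<in> verts G - {\<Delta>}. parent G y = x}"

definition spanned_subtree :: "graph \<Rightarrow> nat set \<Rightarrow> graph"
  where "spanned_subtree T L = (THE H.
    is_tree H \<and> subgraph H T \<and> L \<union> {\<Delta>} \<subseteq> verts H \<and>
    (\<forall>H'. is_tree H' \<and> subgraph H' T \<and> L \<union> {\<Delta>} \<subseteq> verts H' \<longrightarrow> subgraph H H'))"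

definition nodes :: "graph \<Rightarrow> nat set \<Rightarrow> nat set"
  where "nodes T L =
    (let H = spanned_subtree T L in {x \<in> verts H. card (children H x) \<ge> 2})"

definition reduction :: "graph \<Rightarrow> nat set \<Rightarrow> graph"
  where "reduction T L =
    (let H = spanned_subtree T L; R = {\<Delta>} \<union> L \<union> nodes T L
     in (R, {{v, hd (filter (\<lambda>x. x \<in> R) (tl (tree_path H v \<Delta>)))} | v. v \<in> R - {\<Delta>}}))"

definition component_partition :: "graph \<Rightarrow> nat set \<Rightarrow> nat set set"
  where "component_partition T L =
    L // {(x, y). x \<in> L \<and> y \<in> L \<and> (\<exists>p. gpath (remove_vertex T \<Delta>) x p y)}"


section \<open>Classes up to relabelling, and binary bouquets\<close>

definition relabel :: "(nat \<Rightarrow> nat) \<Rightarrow> graph \<Rightarrow> graph"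
  where "relabel s G = (s ` verts G, (`) s ` edges G)"

definition relabel_class :: "nat set \<Rightarrow> graph \<Rightarrow> graph set"
  where "relabel_class S G = {relabel s G | s. s permutes S}"

definition Q_class :: "nat \<Rightarrow> nat \<Rightarrow> graph \<Rightarrow> graph set"
  where "Q_class l N T = relabel_class {l+1..N} (reduction T {1..l})"

definition binary_bouquet :: "nat set \<Rightarrow> nat \<Rightarrow> graph \<Rightarrow> bool"
  where "binary_bouquet L r G \<longleftrightarrow>
    is_tree G \<and> \<Delta> \<in> verts G \<and> L \<subseteq> verts G - {\<Delta>} \<and>
    (\<forall>x\<in>L. children G x = {}) \<and>
    (\<forall>x\<in>verts G - {\<Delta>}. children G x = {} \<longrightarrow> x \<in> L) \<and>
    (\<forall>x\<in>verts G - {\<Delta>} - L. card (children G x) = 2) \<and>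
    card (children G \<Delta>) = r"

text \<open>
  The labels of the inner vertices of a binary tree on \<open>B\<close> are arbitrary elements outside
  \<open>B \<union> {\<Delta>}\<close>, which makes the notion of a binary class on \<open>B\<close> independent of \<open>N\<close>.
\<close>

definition binary_classes :: "nat set \<Rightarrow> graph set set"
  where "binary_classes B = {relabel_class (- (B \<union> {\<Delta>})) G | G. binary_bouquet B 1 G}"

text \<open>The part of \<open>G\<close> hanging from the child \<open>w\<close> of \<open>\<Delta>\<close>, together with \<open>\<Delta>\<close> and the edge \<open>{w, \<Delta>}\<close>.\<close>

definition hanging_tree :: "graph \<Rightarrow> nat \<Rightarrow> graph"
  where "hanging_tree G w =
    (let V = {\<Delta>} \<union> {v \<in> verts G. w \<in> set (tree_path G v \<Delta>)} in (V, {e \<in> edges G. e \<subseteq> V}))"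

definition represents :: "nat set \<Rightarrow> graph \<Rightarrow> nat set set \<Rightarrow> (nat set \<Rightarrow> graph set) \<Rightarrow> bool"
  where "represents L G \<pi> \<alpha> \<longleftrightarrow>
    binary_bouquet L (card \<pi>) G \<and>
    \<pi> = (\<lambda>w. L \<inter> verts (hanging_tree G w)) ` children G \<Delta> \<and>
    (\<forall>w\<in>children G \<Delta>. hanging_tree G w \<in> \<alpha> (L \<inter> verts (hanging_tree G w)))"

text \<open>
  The class, under permutations of \<open>{l+1,\<dots>,N}\<close>, of binary bouquets that is identified with
  the pair \<open>(\<pi>, \<alpha>)\<close>.
\<close>

definition bouquet_class :: "nat \<Rightarrow> nat \<Rightarrow> nat set set \<Rightarrow> (nat set \<Rightarrow> graph set) \<Rightarrow> graph set"
  where "bouquet_class l N \<pi> \<alpha> = {G. verts G \<subseteq> {0..N} \<and> represents {1..l} G \<pi> \<alpha>}"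

definition configurations :: "nat \<Rightarrow> nat \<Rightarrow> (nat set set \<times> (nat set \<Rightarrow> graph set)) set"
  where "configurations l r =
    {(\<pi>, \<alpha>). partition_on {1..l} \<pi> \<and> card \<pi> = r \<and> \<alpha> \<in> (\<Pi>\<^sub>E B\<in>\<pi>. binary_classes B)}"

definition intermediate :: "graph \<Rightarrow> nat set \<Rightarrow> nat set"
  where "intermediate H e =
    {z \<in> verts H - e. \<exists>x y p. e = {x, y} \<and> gpath H x p y \<and> z \<in> set p}"

text \<open>
  The vector \<open>u\<close>. A fixed order on the edges of the bouquets in one class is given by an enumeration
  \<open>\<epsilon>\<close> of the edges of one representative \<open>G\<close>, transported to the actual reduction along the
  relabelling. The transported edge does not depend on the choice of the relabelling, because a
  binary bouquet has no nontrivial automorphism that fixes \<open>\<Delta>\<close> and its leaves.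
\<close>

definition edge_count :: "nat \<Rightarrow> graph \<Rightarrow> (nat \<Rightarrow> nat set) \<Rightarrow> graph \<Rightarrow> nat \<Rightarrow> nat"
  where "edge_count l G \<epsilon> T i =
    (let s = (SOME s. s permutes {l+1..} \<and> relabel s G = reduction T {1..l})
     in card (intermediate (spanned_subtree T {1..l}) (s ` \<epsilon> i)))"


section \<open>The constants\<close>

definition c_num :: "nat \<Rightarrow> nat"
  where "c_num m = (\<Prod>i=1..m-1. 2 * i - 1)"

definition C_num :: "nat \<Rightarrow> nat \<Rightarrow> nat"
  where "C_num l r = (\<Sum>\<pi> | partition_on {1..l} \<pi> \<and> card \<pi> = r. \<Prod>B\<in>\<pi>. c_num (card B))"

definition I_lim :: "nat \<Rightarrow> nat \<Rightarrow> real \<Rightarrow> real"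
  where "I_lim l r c =
    (if l = 1 \<and> r = 1 then 1
     else c ^ (r - 1) / fact (2 * l - r - 1) *
       (LBINT \<sigma>:{0..}. (\<sigma> + c) * \<sigma> ^ (2 * l - r - 1) * exp (- \<sigma>\<^sup>2 / 2 - c * \<sigma>)))"


section \<open>Consistency of the definitions\<close>

lemma finite_spanning_trees: "finite (spanning_trees N)"
proof (rule finite_subset)
  show "spanning_trees N \<subseteq> {{0..N}} \<times> Pow (Pow {0..N})"
    by (auto simp: spanning_trees_def complete_graph_def subgraph_def all_edges_def)
qed auto

definition star_graph :: "nat \<Rightarrow> graph"
  where "star_graph N = ({0..N}, {{x, \<Delta>} | x. x \<in> {1..N}})"

lemma star_in_spanning_trees: "star_graph N \<in> spanning_trees N"
proof -
  have E: "{a, b} \<in> edges (star_graph N) \<longleftrightarrow>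
      (a = 0 \<and> b \<in> {1..N}) \<or> (b = 0 \<and> a \<in> {1..N})" for a b
    by (auto simp: star_graph_def doubleton_eq_iff)
  have "\<exists>p. gpath (star_graph N) x p y" if "x \<le> N" "y \<le> N" for x y
  proof -
    have V: "verts (star_graph N) = {0..N}" by (simp add: star_graph_def)
    consider "x = y" | "x \<noteq> y" "x = 0 \<or> y = 0" | "x \<noteq> y" "x \<noteq> 0" "y \<noteq> 0" by blast
    then show ?thesis
    proof cases
      case 1 then show ?thesis using that by (intro exI[of _ "[x]"]) (simp add: gpath_def V)
    next
      case 2 then show ?thesis using that
        by (intro exI[of _ "[x, y]"]) (auto simp: gpath_def V E)
    next
      case 3 then show ?thesis using that
        by (intro exI[of _ "[x, 0, y]"]) (auto simp: gpath_def V E)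
    qed
  qed
  then have conn: "connected_graph (star_graph N)"
    by (auto simp: connected_graph_def star_graph_def)
  have "\<not> gcycle (star_graph N) p" for p
  proof
    assume *: "gcycle (star_graph N) p"
    then obtain a b c q where p: "p = a # b # c # q"
      by (auto simp: gcycle_def numeral_3_eq_3 Suc_le_length_iff)
    have "last (c # q) \<in> set (c # q)" by (rule last_in_set) simp
    then have "last p \<noteq> a" "last p \<noteq> b" using * by (auto simp: gcycle_def p)
    then show False using * by (auto simp: gcycle_def p E)
  qed
  moreover have "edges (star_graph N) \<subseteq> all_edges {0..N}"
    by (fastforce simp: star_graph_def all_edges_def)
  ultimately show ?thesis using conn
    by (auto simp: spanning_trees_def is_tree_def simple_graph_def subgraph_def
        complete_graph_def star_graph_def)
qed

lemma prob_space_tree_law: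
  assumes "\<kappa> > 0"
  shows "prob_space (tree_law N \<kappa>)"
proof -
  let ?Z = "\<Sum>S\<in>spanning_trees N. \<kappa> ^ degree S \<Delta>"
  have "?Z > 0"
    using assms star_in_spanning_trees[of N] by (intro sum_pos finite_spanning_trees) auto
  then have "(\<Sum>T\<in>spanning_trees N. \<kappa> ^ degree T \<Delta> / ?Z) = 1"
    by (simp flip: sum_divide_distrib)
  then show ?thesis unfolding tree_law_def
    using assms \<open>?Z > 0\<close> finite_spanning_trees
    by (intro prob_space_point_measure) (auto simp: sum_ennreal)
qed

lemma I_lim_altdef:
  assumes l: "l \<ge> 2" and r: "1 \<le> r" "r \<le> l" and c: "c > 0"
  shows "I_lim l r c = c ^ (r - 1) / fact (2 * l - r - 2) *
    (LBINT s:{0..}. s ^ (2 * l - r - 2) * exp (- s\<^sup>2 / 2 - c * s))"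
proof -
  define m where "m = 2 * l - r - 2"
  have m: "2 * l - r - 1 = Suc m" using l r by (simp add: m_def)
  define g where "g = (\<lambda>s::real. exp (- s\<^sup>2 / 2 - c * s))"
  have int: "set_integrable lborel {0..} (\<lambda>s. s ^ k * g s)" for k
  proof (unfold set_integrable_def, rule Bochner_Integration.integrable_bound)
    show "integrable lborel (\<lambda>s. sqrt (2 * pi) * (std_normal_density s * \<bar>s\<bar> ^ k))"
      by (intro integrable_mult_right integrable_std_normal_moment_abs)
    show "(\<lambda>s. indicator {0..} s *\<^sub>R (s ^ k * g s)) \<in> borel_measurable lborel"
      unfolding g_def by measurable
    show "AE s in lborel. norm (indicator {0..} s *\<^sub>R (s ^ k * g s))
        \<le> norm (sqrt (2 * pi) * (std_normal_density s * \<bar>s\<bar> ^ k))"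
    proof (rule AE_I2)
      fix s :: real
      have "s ^ k * g s \<le> s ^ k * exp (- s\<^sup>2 / 2)" if "s \<ge> 0"
        using that c by (intro mult_left_mono) (auto simp: g_def)
      then show "norm (indicator {0..} s *\<^sub>R (s ^ k * g s))
          \<le> norm (sqrt (2 * pi) * (std_normal_density s * \<bar>s\<bar> ^ k))"
        by (auto simp: indicator_def std_normal_density_def g_def abs_mult power_abs real_sqrt_mult
            mult_ac)
    qed
  qed
  let ?f = "\<lambda>s. (s + c) * s ^ Suc m * g s - (real m + 1) * (s ^ m * g s)"
  have fint: "set_integrable lborel {0..} (\<lambda>s. (s + c) * s ^ Suc m * g s)"
  proof -
    have "set_integrable lborel {0..} (\<lambda>s. s ^ (m + 2) * g s + c * (s ^ Suc m * g s))"
      by (intro set_integral_add set_integrable_mult_right int)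
    also have "(\<lambda>s. s ^ (m + 2) * g s + c * (s ^ Suc m * g s)) = (\<lambda>s. (s + c) * s ^ Suc m * g s)"
      by (auto simp: algebra_simps)
    finally show ?thesis .
  qed
  have gint: "set_integrable lborel {0..} (\<lambda>s. (real m + 1) * (s ^ m * g s))"
    by (intro set_integrable_mult_right int)
  have D: "((\<lambda>s. - (s ^ Suc m * g s)) has_real_derivative ?f s) (at s)" for s
  proof -
    have "((\<lambda>s. s ^ Suc m) has_real_derivative (real m + 1) * s ^ m) (at s)"
      using DERIV_pow[of "Suc m" s] by (simp add: add.commute)
    moreover have "(g has_real_derivative - (s + c) * g s) (at s)"
      unfolding g_def by (auto intro!: derivative_eq_intros simp: algebra_simps)
    ultimately have "((\<lambda>s. s ^ Suc m * g s) has_real_derivative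
        (real m + 1) * s ^ m * g s + - (s + c) * g s * s ^ Suc m) (at s)"
      by (rule DERIV_mult)
    from DERIV_minus[OF this] show ?thesis by (simp add: algebra_simps)
  qed
  have lim: "((\<lambda>s. - (s ^ Suc m * g s)) \<longlongrightarrow> 0) at_top"
  proof -
    have "((\<lambda>s::real. s ^ Suc m * exp (- s)) \<longlongrightarrow> 0) at_top"
      using tendsto_power_div_exp_0[of "Suc m"] by (simp add: exp_minus field_simps)
    moreover have "eventually (\<lambda>s. norm (s ^ Suc m * g s) \<le> s ^ Suc m * exp (- s)) at_top"
      using eventually_ge_at_top[of 2]
    proof eventually_elim
      case (elim s)
      have "s * 2 \<le> s * s" using elim by (intro mult_left_mono) auto
      moreover have "0 \<le> c * s" using elim c by simp
      ultimately have "g s \<le> exp (- s)" by (simp add: g_def power2_eq_square)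
      then show ?case using elim by (simp add: g_def abs_mult)
    qed
    ultimately have "((\<lambda>s. s ^ Suc m * g s) \<longlongrightarrow> 0) at_top"
      by (rule Lim_null_comparison[rotated])
    then show ?thesis using tendsto_minus by fastforce
  qed
  have "(LBINT s=ereal 0..\<infinity>. ?f s) = 0 - 0"
  proof (rule interval_integral_FTC_integrable[where F = "\<lambda>s. - (s ^ Suc m * g s)"])
    show "((\<lambda>s. - (s ^ Suc m * g s)) has_vector_derivative ?f s) (at s)" for s
      using D by (simp add: has_real_derivative_iff_has_vector_derivative)
    show "isCont ?f s" for s unfolding g_def by (intro continuous_intros) auto
    have "set_integrable lborel {0..} ?f" using fint gint by (rule set_integral_diff)
    then show "set_integrable lborel (einterval (ereal 0) \<infinity>) ?f"
      by (rule set_integrable_subset) (auto simp: einterval_def)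
    have "isCont (\<lambda>s. - (s ^ Suc m * g s)) 0" unfolding g_def by (intro continuous_intros) auto
    then have "((\<lambda>s. - (s ^ Suc m * g s)) \<longlongrightarrow> 0) (at 0)" by (simp add: isCont_def)
    then have "((\<lambda>s. - (s ^ Suc m * g s)) \<longlongrightarrow> 0) (at_right 0)"
      by (rule tendsto_within_subset) auto
    then show "(((\<lambda>s. - (s ^ Suc m * g s)) \<circ> real_of_ereal) \<longlongrightarrow> 0) (at_right (ereal 0))"
      by (simp add: ereal_tendsto_simps1)
    show "(((\<lambda>s. - (s ^ Suc m * g s)) \<circ> real_of_ereal) \<longlongrightarrow> 0) (at_left \<infinity>)"
      using lim by (simp add: ereal_tendsto_simps1)
  qed simp
  then have "(LBINT s:{0<..}. ?f s) = 0"
    by (simp add: interval_integral_to_infinity_eq)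
  also have "(LBINT s:{0<..}. ?f s) = (LBINT s:{0..}. ?f s)"
  proof (unfold set_lebesgue_integral_def, rule integral_cong_AE)
    show "AE s in lborel. indicator {0<..} s *\<^sub>R ?f s = indicator {0..} s *\<^sub>R ?f s"
      using AE_lborel_singleton[of "0::real"] by eventually_elim (auto simp: indicator_def)
  qed (simp_all add: g_def)
  also have "(LBINT s:{0..}. ?f s) =
      (LBINT s:{0..}. (s + c) * s ^ Suc m * g s) - (real m + 1) * (LBINT s:{0..}. s ^ m * g s)"
    using fint gint by (subst set_integral_diff) auto
  finally have eq: "(LBINT s:{0..}. (s + c) * s ^ Suc m * g s) =
      (real m + 1) * (LBINT s:{0..}. s ^ m * g s)" by simp
  have "I_lim l r c = c ^ (r - 1) / fact (Suc m) * (LBINT s:{0..}. (s + c) * s ^ Suc m * g s)"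
    using l unfolding I_lim_def m g_def by simp
  also have "\<dots> = c ^ (r - 1) / fact m * (LBINT s:{0..}. s ^ m * g s)"
    unfolding eq by (simp add: add.commute)
  finally show ?thesis unfolding g_def m_def .
qed

end

theory Submission
  imports Defs
begin

text \<open>
  A spanning tree is encoded by its parent function. The cluster of a vertex \<open>v\<close> is the set of
  elements of \<open>L\<close> whose path to \<open>\<Delta>\<close> passes through \<open>v\<close>. The nonempty clusters form a laminar family
  that is the same for \<open>\<Upsilon>\<close>, \<open>\<Upsilon>\<^sub>L\<close> and the \<open>L\<close>-reduction, and the reduction is a binary bouquet iff
  every cluster that is not a singleton is the disjoint union of two clusters; the binary bouquets up
  to relabelling are thus the binary hierarchies on \<open>L\<close>, the blocks of \<open>\<pi>\<close> being the maximal clusters.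
  Inserting a leaf into a hierarchy shows that the number \<open>K l r\<close> of hierarchies with \<open>r\<close> maximal
  clusters satisfies \<open>K (l+1) r = K l (r-1) + (2l-r) K l r\<close>.

  A tree whose hierarchy is \<open>F\<close> and whose numbers of vertices per cluster are prescribed, with total
  \<open>m\<close>, is an injective labelling of \<open>m - l\<close> places together with a forest on the other \<open>N - m\<close>
  vertices attached to the \<open>m\<close> given ones and \<open>\<Delta>\<close>. Since forests on \<open>n\<close> vertices over roots of total
  weight \<open>W\<close> have total weight \<open>W (W+n)^(n-1)\<close>, the event has probability
  \<open>(N-l)!/(N-m)! \<kappa>^(r-1) (m+\<kappa>) (N+\<kappa>)^(-m)\<close>, from which (c) follows. Summing over all vectors with
  the same total and applying dominated convergence gives (b). Integration by parts and the recursion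
  for \<open>K\<close> show that the limits \<open>I\<^bsub>l,r\<^esub>(c)\<close> sum to \<open>1\<close> over all hierarchies, so no mass
  is left for trees whose reduction is not a binary bouquet.
\<close>

section \<open>Trees given by parent functions\<close>

text \<open>Clusters are used because they forget the names of the inner vertices: trees in which
  every vertex has its own nonempty cluster are isomorphic over \<open>\<Delta>\<close> and
  \<open>L\<close> as soon as their cluster families agree. Relabelling classes thus become
  equalities of set families, and each entry of \<open>u\<close> is one less than the number of
  vertices sharing a cluster. The law is exact for every N because the quantity W+n in the forest
  weight is N + \<kappa> both for the whole tree and for the forest left over after m vertices have
  been prescribed; dividing one weight by the other leaves only the factor m + \<kappa> and a power
  of N + \<kappa>. Part (a) is not estimated directly: no bound on non-binary reductions is ever
  made. It rests on an identity for M_j, the integral of (s+c) s^j exp(-s^2/2 - c s) over s \<ge> 0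
  divided by j!, namely (j+1) M_(j+2) + c M_(j+1) = M_j. With j = 2l-r-1 its terms mirror leaf
  insertion: each of the j+1 places inside a hierarchy raises the index by two, and the place at
  \<open>\<Delta>\<close> raises it by one and costs a factor c. Hence adding a leaf preserves the
  total mass.\<close>

definition rooted :: "nat set \<Rightarrow> (nat \<Rightarrow> nat) \<Rightarrow> bool"
  where "rooted V p \<longleftrightarrow> finite V \<and> 0 \<in> V \<and> (\<forall>x. x \<notin> V - {0} \<longrightarrow> p x = 0) \<and>
    (\<forall>x\<in>V. p x \<in> V) \<and> (\<forall>x. \<exists>k. (p ^^ k) x = 0)"

definition anc :: "(nat \<Rightarrow> nat) \<Rightarrow> nat \<Rightarrow> nat \<Rightarrow> bool"
  where "anc p x y \<longleftrightarrow> (\<exists>k. (p ^^ k) x = y)"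

definition depth :: "(nat \<Rightarrow> nat) \<Rightarrow> nat \<Rightarrow> nat"
  where "depth p x = (LEAST k. (p ^^ k) x = 0)"

text \<open>Since \<open>rooted\<close> forces the value 0 at \<open>\<Delta>\<close> and off
  \<open>V\<close>, a tree has exactly one parent function, and sums over trees can be taken over
  functions.\<close>

definition tree_of :: "nat set \<Rightarrow> (nat \<Rightarrow> nat) \<Rightarrow> graph"
  where "tree_of V p = (V, {{x, p x} | x. x \<in> V - {0}})"

definition tpath :: "(nat \<Rightarrow> nat) \<Rightarrow> nat \<Rightarrow> nat list"
  where "tpath p x = map (\<lambda>k. (p ^^ k) x) [0..<Suc (depth p x)]"

lemma verts_tree_of [simp]: "verts (tree_of V p) = V"
  by (simp add: tree_of_def)

lemma edges_tree_of: "edges (tree_of V p) = {{x, p x} | x. x \<in> V - {0}}"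
  by (simp add: tree_of_def)

section \<open>Ancestors and depth\<close>

lemma anc_refl [simp, intro]: "anc p x x"
  unfolding anc_def by (rule exI[of _ 0]) simp

lemma anc_parent [intro]: "anc p x (p x)"
  unfolding anc_def by (rule exI[of _ 1]) simp

lemma anc_trans [trans]: "anc p x y \<Longrightarrow> anc p y z \<Longrightarrow> anc p x z"
proof -
  assume "anc p x y" "anc p y z"
  then obtain k j where "(p ^^ k) x = y" "(p ^^ j) y = z" by (auto simp: anc_def)
  then have "(p ^^ (j + k)) x = z" by (simp add: funpow_add)
  then show ?thesis by (auto simp: anc_def)
qed

lemma anc_step: "anc p (p x) y \<Longrightarrow> anc p x y"
  by (rule anc_trans[OF anc_parent])

lemma anc_cases: "anc p x y \<Longrightarrow> x = y \<or> anc p (p x) y"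
proof -
  assume "anc p x y"
  then obtain k where k: "(p ^^ k) x = y" by (auto simp: anc_def)
  show ?thesis
  proof (cases k)
    case 0 then show ?thesis using k by simp
  next
    case (Suc j)
    then have "(p ^^ j) (p x) = y" using k by (simp add: funpow_swap1)
    then show ?thesis by (auto simp: anc_def)
  qed
qed

lemma anc_linear: "anc p x y \<Longrightarrow> anc p x z \<Longrightarrow> anc p y z \<or> anc p z y"
proof -
  assume "anc p x y" "anc p x z"
  then obtain k j where k: "(p ^^ k) x = y" and j: "(p ^^ j) x = z" by (auto simp: anc_def)
  show ?thesis
  proof (cases "k \<le> j")
    case True
    then obtain d where "j = d + k" by (metis add.commute le_Suc_ex)
    then have "z = (p ^^ d) y" using j k by (simp add: funpow_add)
    then show ?thesis by (auto simp: anc_def)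
  next
    case False
    then obtain d where "k = d + j" by (metis add.commute le_Suc_ex nat_le_linear)
    then have "y = (p ^^ d) z" using j k by (simp add: funpow_add)
    then show ?thesis by (auto simp: anc_def)
  qed
qed

context
  fixes V p assumes r: "rooted V p"
begin

lemma rooted_finite: "finite V" and rooted_0: "0 \<in> V"
  and rooted_outside: "x \<notin> V - {0} \<Longrightarrow> p x = 0"
  and rooted_closed: "x \<in> V \<Longrightarrow> p x \<in> V"
  and rooted_reach: "\<exists>k. (p ^^ k) x = 0"
  using r unfolding rooted_def by simp_all

lemma rooted_p0 [simp]: "p 0 = 0"
  by (rule rooted_outside) simp

lemma anc_root [simp, intro]: "anc p x 0"
  using rooted_reach by (simp add: anc_def)

lemma anc_from_root: "anc p 0 y \<longleftrightarrow> y = 0"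
proof -
  have "(p ^^ k) 0 = 0" for k by (induction k) auto
  then show ?thesis by (auto simp: anc_def)
qed

lemma depth_root [simp]: "depth p 0 = 0"
  unfolding depth_def by (rule Least_eq_0) simp

lemma depth_Suc:
  assumes "x \<noteq> 0" shows "depth p x = Suc (depth p (p x))"
proof -
  obtain k where k: "(p ^^ k) x = 0" using rooted_reach by blast
  show ?thesis unfolding depth_def
    using Least_Suc[of "\<lambda>k. (p ^^ k) x = 0" k, OF k] assms
    by (simp add: funpow_swap1)
qed

lemma depth_anc: "anc p x y \<Longrightarrow> depth p y \<le> depth p x"
proof -
  have "depth p ((p ^^ k) x) \<le> depth p x" for k
  proof (induction k)
    case (Suc k)
    have "depth p (p z) \<le> depth p z" for z
      using depth_Suc[of z] by (cases "z = 0") auto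
    then show ?case using Suc by (auto intro: order_trans)
  qed simp
  then show "anc p x y \<Longrightarrow> depth p y \<le> depth p x" by (auto simp: anc_def)
qed

lemma depth_anc_less: "anc p x y \<Longrightarrow> x \<noteq> y \<Longrightarrow> depth p y < depth p x"
proof -
  assume a: "anc p x y" "x \<noteq> y"
  then have "x \<noteq> 0" using anc_from_root by metis
  moreover have "anc p (p x) y" using a anc_cases by blast
  ultimately show ?thesis using depth_anc[of "p x" y] depth_Suc[of x] by simp
qed

lemma anc_antisym: "anc p x y \<Longrightarrow> anc p y x \<Longrightarrow> x = y"
  using depth_anc_less[of x y] depth_anc[of y x] by force

lemma parent_not_anc: "x \<noteq> 0 \<Longrightarrow> \<not> anc p (p x) x"
  using depth_anc[of "p x" x] depth_Suc[of x] by auto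

lemma parent_neq: "x \<noteq> 0 \<Longrightarrow> p x \<noteq> x"
  using parent_not_anc[of x] anc_refl[of p x] by metis

lemma anc_closed: "anc p x y \<Longrightarrow> x \<in> V \<Longrightarrow> y \<in> V"
proof -
  have "x \<in> V \<Longrightarrow> (p ^^ k) x \<in> V" for k by (induction k) (auto simp: rooted_closed)
  then show "anc p x y \<Longrightarrow> x \<in> V \<Longrightarrow> y \<in> V" by (auto simp: anc_def)
qed

text \<open>Iteration of \<open>p\<close> exposes the first step of a path; clusters are decomposed
  over the children of \<open>v\<close>, so the last step before \<open>v\<close> is needed.\<close>

lemma anc_last_step:
  assumes "anc p x v" "x \<noteq> v"
  obtains y where "anc p x y" "p y = v" "y \<noteq> 0"
  using assms
proof (induction "depth p x" arbitrary: x thesis rule: less_induct)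
  case less
  have x0: "x \<noteq> 0" using less.prems anc_from_root by metis
  show ?case
  proof (cases "p x = v")
    case True then show ?thesis using less.prems(1)[of x] x0 by auto
  next
    case False
    have "anc p (p x) v" using less.prems anc_cases by blast
    then obtain y where "anc p (p x) y" "p y = v" "y \<noteq> 0"
      using less.hyps[of "p x"] False depth_Suc[OF x0] by auto
    then show ?thesis using less.prems(1) anc_step by blast
  qed
qed

section \<open>Paths towards the root\<close>

lemma tpath_root [simp]: "tpath p 0 = [0]"
  by (simp add: tpath_def)

lemma tpath_step: "x \<noteq> 0 \<Longrightarrow> tpath p x = x # tpath p (p x)"
proof -
  assume x: "x \<noteq> 0"
  have "[0..<Suc (Suc n)] = 0 # map Suc [0..<Suc n]" for n
    by (metis map_Suc_upt upt_conv_Cons zero_less_Suc)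
  then have "tpath p x = x # map (\<lambda>k. (p ^^ Suc k) x) [0..<Suc (depth p (p x))]"
    unfolding tpath_def depth_Suc[OF x] by (simp del: upt_Suc)
  also have "\<dots> = x # tpath p (p x)" unfolding tpath_def by (simp add: funpow_swap1 del: upt_Suc)
  finally show ?thesis .
qed

lemma depth_induct [case_names root step]:
  assumes "P 0" "\<And>x. x \<noteq> 0 \<Longrightarrow> P (p x) \<Longrightarrow> P x" shows "P x"
proof (induction "depth p x" arbitrary: x rule: less_induct)
  case less
  then show ?case using assms depth_Suc[of x] by (cases "x = 0") auto
qed

lemma set_tpath: "set (tpath p x) = {y. anc p x y}"
proof (induction x rule: depth_induct)
  case root then show ?case by (auto simp: anc_from_root)
next
  case (step x)
  then show ?case using anc_cases anc_step by (auto simp: tpath_step)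
qed

lemma hd_tpath [simp]: "hd (tpath p x) = x"
  by (cases "x = 0") (auto simp: tpath_step)

lemma tpath_not_Nil [simp]: "tpath p x \<noteq> []"
  by (simp add: tpath_def)

lemma edge_tree_of_iff:
  "{a, b} \<in> edges (tree_of V p) \<longleftrightarrow> a \<in> V - {0} \<and> b = p a \<or> b \<in> V - {0} \<and> a = p b"
  unfolding edges_tree_of by (auto simp: doubleton_eq_iff)

lemma gpath_tpath: "x \<in> V \<Longrightarrow> gpath (tree_of V p) x (tpath p x) 0"
proof (induction x rule: depth_induct)
  case root then show ?case by (simp add: gpath_def)
next
  case (step x)
  then have g: "gpath (tree_of V p) (p x) (tpath p (p x)) 0" using rooted_closed by blast
  have "x \<notin> set (tpath p (p x))" using parent_not_anc step(1) by (simp add: set_tpath)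
  moreover have "{x, p x} \<in> edges (tree_of V p)" using step by (auto simp: edge_tree_of_iff)
  ultimately show ?case using g step
    by (auto simp: gpath_def tpath_step successively_Cons)
qed

text \<open>After a step away from the root, the next vertex is a neighbour of \<open>b\<close>
  other than its parent \<open>a\<close>, which the path has already visited; so it is again a
  child.\<close>

lemma down_path:
  assumes "distinct (a # b # q)" "successively (\<lambda>a b. {a, b} \<in> edges (tree_of V p)) (a # b # q)"
    "a = p b"
  shows "anc p (last (b # q)) b"
  using assms
proof (induction q arbitrary: a b)
  case (Cons c q)
  have "{b, c} \<in> edges (tree_of V p)" using Cons.prems by simp
  then have "b = p c" using Cons.prems by (auto simp: edge_tree_of_iff)
  then have "anc p (last (c # q)) c" using Cons.IH[of b c] Cons.prems by simp
  then have "anc p (last (c # q)) b" using \<open>b = p c\<close> anc_trans by blast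
  then show ?case by simp
qed simp

text \<open>A path whose first step leads away from the root can never turn back.\<close>

lemma gpath_up:
  assumes g: "gpath (tree_of V p) x q y" and a: "anc p x y"
  shows "x = y \<and> q = [x] \<or> x \<noteq> y \<and> (\<exists>q'. q = x # q' \<and> gpath (tree_of V p) (p x) q' y)"
proof (cases "x = y")
  case True
  then show ?thesis using g unfolding gpath_def
    by (metis distinct.simps(2) last.simps last_in_set list.collapse)
next
  case False
  then obtain b q' where q: "q = x # b # q'" using g unfolding gpath_def
    by (metis last.simps list.collapse)
  have e: "{x, b} \<in> edges (tree_of V p)" using g by (simp add: gpath_def q)
  have "x \<noteq> p b \<or> b = p x"
  proof (rule ccontr)
    assume "\<not> ?thesis"
    then have xb: "x = p b" "b \<noteq> p x" by auto
    have "anc p (last (b # q')) b" by (rule down_path[of x]) (use g xb in \<open>auto simp: gpath_def q\<close>)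
    moreover have "last (b # q') = y" using g by (auto simp: gpath_def q)
    ultimately have "anc p y b" by simp
    then have "anc p y x" using xb anc_trans by blast
    then show False using anc_antisym a False by blast
  qed
  then have "b = p x" using e by (auto simp: edge_tree_of_iff)
  then show ?thesis using g False by (auto simp: q gpath_def)
qed

lemma set_gpath_up:
  "gpath (tree_of V p) x q y \<Longrightarrow> anc p x y \<Longrightarrow> set q = {z. anc p x z \<and> anc p z y}"
proof (induction x arbitrary: q rule: depth_induct)
  case root then show ?case using gpath_up[OF root] by (auto simp: anc_from_root)
next
  case (step x)
  show ?case
  proof (cases "x = y")
    case True
    then show ?thesis using gpath_up[OF step.prems] anc_antisym by auto
  next
    case False
    then obtain q' where q: "q = x # q'" and g: "gpath (tree_of V p) (p x) q' y"
      using gpath_up[OF step.prems] by blast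
    have a: "anc p (p x) y" using anc_cases step.prems False by blast
    have "set q = insert x {z. anc p (p x) z \<and> anc p z y}" using step.IH[OF g a] q by simp
    then show ?thesis using step.prems anc_cases anc_step by auto
  qed
qed

lemma gpath_unique:
  "gpath (tree_of V p) x q y \<Longrightarrow> gpath (tree_of V p) x q' y \<Longrightarrow> anc p x y \<Longrightarrow> q = q'"
proof (induction x arbitrary: q q' rule: depth_induct)
  case root then show ?case using gpath_up by (metis anc_from_root)
next
  case (step x)
  show ?case
  proof (cases "x = y")
    case True then show ?thesis using step.prems gpath_up by blast
  next
    case False
    then have "anc p (p x) y" using step.prems anc_cases by blast
    then show ?thesis using False step.prems gpath_up step.IH by metis
  qed
qed

lemma tree_path_tree_of: "x \<in> V \<Longrightarrow> tree_path (tree_of V p) x 0 = tpath p x"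
  unfolding tree_path_def using gpath_tpath gpath_unique by (intro the_equality) auto

lemma parent_tree_of: "x \<in> V - {0} \<Longrightarrow> parent (tree_of V p) x = p x"
proof -
  assume "x \<in> V - {0}"
  then have "parent (tree_of V p) x = tpath p (p x) ! 0"
    by (simp add: parent_def tree_path_tree_of tpath_step)
  also have "\<dots> = p x" by (metis hd_conv_nth hd_tpath tpath_not_Nil)
  finally show ?thesis .
qed

lemma children_tree_of: "children (tree_of V p) x = {y \<in> V - {0}. p y = x}"
  by (auto simp: children_def parent_tree_of)

end

section \<open>Every finite tree containing the root has a parent function\<close>

lemma gpath_extend:
  assumes "gpath G x q y" "{y, z} \<in> edges G" "z \<in> verts G"
  shows "\<exists>q'. gpath G x q' z"
\<comment> \<open>Paths have distinct vertices, so a path that already visits \<open>z\<close> is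
  cut there instead of being extended.\<close>
proof (cases "z \<in> set q")
  case True
  then obtain q1 q2 where q: "q = q1 @ z # q2" by (meson split_list)
  have "gpath G x (q1 @ [z]) z" using assms(1)
    by (auto simp: gpath_def q successively_append_iff successively_Cons hd_append split: if_splits)
  then show ?thesis by blast
next
  case False
  have "gpath G x (q @ [z]) z" using assms False
    by (auto simp: gpath_def successively_append_iff)
  then show ?thesis by blast
qed

lemma gpath_rev: "gpath G x q y \<Longrightarrow> gpath G y (rev q) x"
  by (auto simp: gpath_def hd_rev last_rev insert_commute)

lemma gpath_subgraph: "gpath H x q y \<Longrightarrow> subgraph H G \<Longrightarrow> gpath G x q y"
  unfolding gpath_def subgraph_def by (auto elim: successively_mono)

text \<open>Acyclicity comes from depth: both cycle neighbours of a deepest vertex of a cycle would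
  have to be its parent.\<close>

lemma is_tree_tree_of:
  assumes r: "rooted V p" shows "is_tree (tree_of V p)"
proof -
  have "edges (tree_of V p) \<subseteq> all_edges V"
  proof
    fix e assume "e \<in> edges (tree_of V p)"
    then obtain x where "e = {x, p x}" "x \<in> V - {0}" by (auto simp: edges_tree_of)
    then show "e \<in> all_edges V" unfolding all_edges_def
      using parent_neq[OF r, of x] rooted_closed[OF r, of x] by auto
  qed
  then have s: "simple_graph (tree_of V p)"
    using rooted_finite[OF r] by (simp add: simple_graph_def)
  have "\<exists>q. gpath (tree_of V p) x q y" if "x \<in> V" "y \<in> V" for x y
    using that(2)
  proof (induction y rule: depth_induct[OF r, case_names root step])
    case root then show ?case using gpath_tpath[OF r] that by blast
  next
    case (step y)
    then have "p y \<in> V" using rooted_closed[OF r] by blast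
    then obtain q where "gpath (tree_of V p) x q (p y)" using step by blast
    then show ?case using step by (intro gpath_extend[of _ _ q]) (auto simp: edge_tree_of_iff[OF r])
  qed
  then have c: "connected_graph (tree_of V p)"
    using rooted_0[OF r] by (auto simp: connected_graph_def)
  have "\<not> gcycle (tree_of V p) q" for q
  proof
    assume g: "gcycle (tree_of V p) q"
    define n where "n = length q"
    have n: "n \<ge> 3" using g by (simp add: gcycle_def n_def)
    have adj: "{q ! i, q ! (Suc i mod n)} \<in> edges (tree_of V p)" if "i < n" for i
    proof (cases "Suc i < n")
      case True then show ?thesis using g successively_nth by (fastforce simp: gcycle_def n_def)
    next
      case False
      then have "i = n - 1" using that by simp
      moreover have "last q = q ! (n - 1)" "hd q = q ! 0"
        using n by (cases q; simp add: n_def last_conv_nth)+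
      ultimately show ?thesis using g n by (simp add: gcycle_def)
    qed
    have "finite (set q)" "set q \<noteq> {}" using n by (auto simp: n_def)
    then have "Max (depth p ` set q) \<in> depth p ` set q" by (intro Max_in) auto
    then obtain v where "v \<in> set q" "depth p v = Max (depth p ` set q)" by auto
    then have v: "v \<in> set q" "\<And>y. y \<in> set q \<Longrightarrow> depth p y \<le> depth p v" by auto
    then obtain i where i: "i < n" "q ! i = v" by (auto simp: in_set_conv_nth n_def)
    \<comment> \<open>\<open>j\<close> and \<open>k\<close> are the positions before and after the
      deepest vertex \<open>v\<close>. Both carry \<open>p v\<close>, so they coincide, which means
      i + 2 = i modulo n and contradicts n \<ge> 3.\<close>
    define j where "j = (i + (n - 1)) mod n"
    have j: "j < n" "Suc j mod n = i" using n i by (auto simp: j_def mod_Suc_eq)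
    define k where "k = Suc i mod n"
    have k: "k < n" using n by (simp add: k_def)
    have nb: "y = p v" if "{v, y} \<in> edges (tree_of V p)" "y \<in> set q" for y
    proof (rule ccontr)
      assume "y \<noteq> p v"
      then have "y \<noteq> 0" "v = p y" using that(1) by (auto simp: edge_tree_of_iff[OF r])
      then show False using depth_Suc[OF r, of y] v(2)[OF that(2)] by simp
    qed
    have "q ! k = p v" using adj[OF i(1)] i k by (intro nb) (auto simp: k_def n_def)
    moreover have "q ! j = p v" using adj[OF j(1)] i j
      by (intro nb) (auto simp: n_def insert_commute)
    moreover have "distinct q" using g by (simp add: gcycle_def)
    ultimately have "j = k" using j k by (metis n_def nth_eq_iff_index_eq)
    then have "Suc k mod n = i" using j by simp
    then have "(i + 2) mod n = i" by (simp add: k_def mod_Suc_eq)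
    then show False using n i by (auto simp: mod_if split: if_splits)
  qed
  then show ?thesis using s c by (auto simp: is_tree_def)
qed

text \<open>A vertex set closed under parents carries its own parent function with the same
  ancestors. It serves both the subtree spanned by \<open>L\<close> and the trees hanging from the
  children of \<open>\<Delta>\<close>.\<close>

lemma rooted_subset:
  assumes r: "rooted V p" and W: "0 \<in> W" "W \<subseteq> V" "\<And>x. x \<in> W \<Longrightarrow> p x \<in> W"
  defines "p' \<equiv> \<lambda>x. if x \<in> W - {0} then p x else 0"
  shows "rooted W p'" and "x \<in> W \<Longrightarrow> anc p' x y \<longleftrightarrow> anc p x y"
proof -
  have it: "x \<in> W \<Longrightarrow> (p' ^^ k) x = (p ^^ k) x \<and> (p ^^ k) x \<in> W" for x k
    by (induction k) (auto simp: p'_def rooted_p0[OF r] W)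
  have "\<exists>k. (p' ^^ k) x = 0" for x
  proof (cases "x \<in> W")
    case True then show ?thesis using it rooted_reach[OF r] by metis
  next
    case False then show ?thesis by (intro exI[of _ 1]) (simp add: p'_def)
  qed
  then show "rooted W p'" unfolding rooted_def
    using W finite_subset[OF W(2) rooted_finite[OF r]] by (auto simp: p'_def)
  show "x \<in> W \<Longrightarrow> anc p' x y \<longleftrightarrow> anc p x y" using it by (auto simp: anc_def)
qed

text \<open>The parent of \<open>x\<close> is chosen as a neighbour with a shorter path to
  \<open>\<Delta>\<close>, so iteration reaches \<open>\<Delta>\<close>. The chosen edges already
  connect all vertices, and one further edge of \<open>G\<close> would close the path between its
  ends to a cycle.\<close>

lemma tree_imp_rooted:
  assumes t: "is_tree G" and "0 \<in> verts G"
  obtains p where "rooted (verts G) p" "G = tree_of (verts G) p"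
proof -
  define V where "V = verts G"
  have fin: "finite V" and ae: "edges G \<subseteq> all_edges V"
    using t by (auto simp: is_tree_def simple_graph_def V_def)
  define d where "d = (\<lambda>x. LEAST n. \<exists>q. gpath G x q 0 \<and> length q = n)"
  have "\<exists>b. {x, b} \<in> edges G \<and> b \<in> V \<and> d b < d x" if x: "x \<in> V - {0}" for x
  proof -
    have "\<exists>q. gpath G x q 0"
      using t x \<open>0 \<in> verts G\<close> by (auto simp: is_tree_def connected_graph_def V_def)
    then have "\<exists>q. gpath G x q 0 \<and> length q = d x" unfolding d_def
      using LeastI_ex[of "\<lambda>n. \<exists>q. gpath G x q 0 \<and> length q = n"] by blast
    then obtain q where q: "gpath G x q 0" "length q = d x" by blast
    then obtain b q' where q': "q = x # b # q'" using x unfolding gpath_def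
      by (metis Diff_iff last.simps list.collapse singletonI)
    have "gpath G b (b # q') 0" using q by (auto simp: gpath_def q')
    then have "d b \<le> length (b # q')" unfolding d_def by (intro Least_le) blast
    then show ?thesis using q by (intro exI[of _ b]) (auto simp: q' gpath_def V_def)
  qed
  then obtain f where f: "\<And>x. x \<in> V - {0} \<Longrightarrow> {x, f x} \<in> edges G \<and> f x \<in> V \<and> d (f x) < d x"
    by metis
  define p where "p = (\<lambda>x. if x \<in> V - {0} then f x else 0)"
  have "\<exists>k. (p ^^ k) x = 0" for x
  proof (induction "d x" arbitrary: x rule: less_induct)
    case less
    show ?case
    proof (cases "x \<in> V - {0}")
      case True
      then obtain k where "(p ^^ k) (p x) = 0" using less[of "p x"] f[OF True] by (auto simp: p_def)
      then show ?thesis by (intro exI[of _ "Suc k"]) (simp add: funpow_swap1)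
    next
      case False
      then have "p x = 0" unfolding p_def by argo
      then show ?thesis by (intro exI[of _ 1]) simp
    qed
  qed
  then have r: "rooted V p" unfolding rooted_def using fin f \<open>0 \<in> verts G\<close> by (auto simp: p_def V_def)
  have sub: "edges (tree_of V p) \<subseteq> edges G"
  proof
    fix e assume "e \<in> edges (tree_of V p)"
    then obtain x where x: "x \<in> V - {0}" "e = {x, p x}" unfolding edges_tree_of by blast
    then show "e \<in> edges G" using f[OF x(1)] by (simp add: p_def)
  qed
  have "edges G \<subseteq> edges (tree_of V p)"
  proof
    fix e assume e: "e \<in> edges G"
    then obtain a b where ab: "e = {a, b}" "a \<in> V" "b \<in> V" "a \<noteq> b" using ae by (auto simp: all_edges_def)
    show "e \<in> edges (tree_of V p)"
    proof (rule ccontr)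
      assume n: "e \<notin> edges (tree_of V p)"
      obtain q where q: "gpath (tree_of V p) a q b"
        using is_tree_tree_of[OF r] ab unfolding is_tree_def connected_graph_def verts_tree_of by blast
      then obtain q' where q': "q = a # q'" "q' \<noteq> []" using ab(4) unfolding gpath_def
        by (metis last.simps list.collapse)
      have "tl q' \<noteq> []"
      proof
        assume "tl q' = []"
        then have "q' = [b]" using q q' unfolding gpath_def
          by (metis last.simps list.collapse)
        then show False using q n by (simp add: q' gpath_def ab)
      qed
      then have "length q \<ge> 3" using q' by (cases q'; cases "tl q'") auto
      moreover have "gpath G a q b"
        by (rule gpath_subgraph[OF q]) (use sub in \<open>auto simp: subgraph_def V_def\<close>)
      ultimately have "gcycle G q" using e ab by (auto simp: gpath_def gcycle_def insert_commute)
      then show False using t by (auto simp: is_tree_def)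
    qed
  qed
  then have "G = tree_of V p" using sub by (auto simp: prod_eq_iff V_def)
  then show ?thesis using that r by (simp add: V_def)
qed

text \<open>The parent function, with the junk values of \<open>parent\<close> at \<open>\<Delta>\<close> and outside the tree replaced
  by \<open>\<Delta>\<close>.\<close>

definition gpar :: "graph \<Rightarrow> nat \<Rightarrow> nat"
  where "gpar G x = (if x \<in> verts G - {0} then parent G x else 0)"

lemma gpar_tree_of: "rooted V p \<Longrightarrow> gpar (tree_of V p) = p"
  by (auto simp: gpar_def parent_tree_of rooted_outside intro!: ext)

lemma tree_gpar:
  assumes "is_tree G" "0 \<in> verts G"
  shows "rooted (verts G) (gpar G)" "tree_of (verts G) (gpar G) = G"
proof -
  obtain p where p: "rooted (verts G) p" "G = tree_of (verts G) p"
    using tree_imp_rooted[OF assms] .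
  then have "gpar G = p" using gpar_tree_of by metis
  then show "rooted (verts G) (gpar G)" "tree_of (verts G) (gpar G) = G" using p by auto
qed

section \<open>Clusters\<close>

definition clus :: "(nat \<Rightarrow> nat) \<Rightarrow> nat set \<Rightarrow> nat \<Rightarrow> nat set"
  where "clus p L v = {i \<in> L. anc p i v}"

text \<open>\<open>\<Delta>\<close> is excluded because its cluster is always \<open>L\<close>; as a
  member it would be the only maximal one and hide the partition into components.\<close>

definition phier :: "(nat \<Rightarrow> nat) \<Rightarrow> nat set \<Rightarrow> nat set set"
  where "phier p L = {clus p L v | v. v \<noteq> 0} - {{}}"

definition maxes :: "'a set set \<Rightarrow> 'a set set"
  where "maxes F = {A \<in> F. \<forall>B\<in>F. A \<subseteq> B \<longrightarrow> B = A}"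

definition span_verts :: "(nat \<Rightarrow> nat) \<Rightarrow> nat set \<Rightarrow> nat set"
  where "span_verts p L = insert 0 {v. clus p L v \<noteq> {}}"

definition span_par :: "(nat \<Rightarrow> nat) \<Rightarrow> nat set \<Rightarrow> nat \<Rightarrow> nat"
  where "span_par p L x = (if x \<in> span_verts p L - {0} then p x else 0)"

text \<open>Nodes are judged by their children inside the spanned subtree, that is, by the children
  with nonempty cluster.\<close>

definition red_verts :: "(nat \<Rightarrow> nat) \<Rightarrow> nat set \<Rightarrow> nat set"
  where "red_verts p L = {0} \<union> L \<union>
    {x \<in> span_verts p L. card {y. y \<noteq> 0 \<and> clus p L y \<noteq> {} \<and> p y = x} \<ge> 2}"

definition red_par :: "(nat \<Rightarrow> nat) \<Rightarrow> nat set \<Rightarrow> nat \<Rightarrow> nat"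
  where "red_par p L v = (if v \<in> red_verts p L - {0}
    then hd (filter (\<lambda>x. x \<in> red_verts p L) (tpath p (p v))) else 0)"

lemma clus_mono: "anc p v z \<Longrightarrow> clus p L v \<subseteq> clus p L z"
  unfolding clus_def using anc_trans by blast

lemma clus_meet: "clus p L y \<inter> clus p L z \<noteq> {} \<Longrightarrow> anc p y z \<or> anc p z y"
  unfolding clus_def using anc_linear by blast

lemma clus_subset: "clus p L v \<subseteq> L"
  by (auto simp: clus_def)

lemma clus_self: "i \<in> L \<Longrightarrow> i \<in> clus p L i"
  by (auto simp: clus_def)

lemma phier_iff: "A \<in> phier p L \<longleftrightarrow> A \<noteq> {} \<and> (\<exists>v. v \<noteq> 0 \<and> A = clus p L v)"
  by (auto simp: phier_def)

lemma phier_laminar: "A \<in> phier p L \<Longrightarrow> B \<in> phier p L \<Longrightarrow> A \<inter> B = {} \<or> A \<subseteq> B \<or> B \<subseteq> A"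
  unfolding phier_iff using clus_meet clus_mono by metis

text \<open>A vertex with cluster \<open>{i}\<close> lies on the path from \<open>i\<close> to
  \<open>\<Delta>\<close>, so its cluster contains that of \<open>i\<close>. Membership of
  \<open>{i}\<close> therefore means that no other element of \<open>L\<close> has \<open>i\<close>
  on its path.\<close>

lemma clus_singleton:
  assumes "i \<in> L" "{i} \<in> phier p L" shows "clus p L i = {i}"
proof -
  obtain v where v: "{i} = clus p L v" using assms by (auto simp: phier_iff)
  then have "anc p i v" by (auto simp: clus_def)
  then have "clus p L i \<subseteq> {i}" using clus_mono v by metis
  then show ?thesis using clus_self[OF assms(1)] by blast
qed

context
  fixes V p L assumes r: "rooted V p" and L: "L \<subseteq> V - {0}"
begin

text \<open>Induction from the children of a vertex to the vertex. The measure is the number of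
  vertices whose path to \<open>\<Delta>\<close> passes through \<open>x\<close>.\<close>

lemma up_induct [consumes 1, case_names up]:
  assumes "x \<in> V" "\<And>x. x \<in> V \<Longrightarrow> (\<And>y. y \<noteq> 0 \<Longrightarrow> y \<in> V \<Longrightarrow> p y = x \<Longrightarrow> P y) \<Longrightarrow> P x"
  shows "P x"
  using assms(1)
proof (induction "card {z \<in> V. anc p z x}" arbitrary: x rule: less_induct)
  case less
  show ?case
  proof (rule assms(2)[OF less.prems])
    fix y assume y: "y \<noteq> 0" "y \<in> V" "p y = x"
    have "{z \<in> V. anc p z y} \<subseteq> {z \<in> V. anc p z x}" using y anc_trans anc_parent by blast
    moreover have "\<not> anc p x y" using parent_not_anc[OF r y(1)] y(3) by simp
    ultimately have "{z \<in> V. anc p z y} \<subset> {z \<in> V. anc p z x}" using less.prems by auto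
    then have "card {z \<in> V. anc p z y} < card {z \<in> V. anc p z x}"
      using rooted_finite[OF r] by (intro psubset_card_mono) auto
    then show "P y" using less.hyps y by blast
  qed
qed

lemma clus_in_verts: "clus p L v \<noteq> {} \<Longrightarrow> v \<in> V"
  unfolding clus_def using anc_closed[OF r] L by blast

lemma span_subset: "span_verts p L \<subseteq> V"
  using clus_in_verts rooted_0[OF r] by (auto simp: span_verts_def)

lemma L_span: "L \<subseteq> span_verts p L"
  using clus_self by (auto simp: span_verts_def)

lemma L_red: "L \<subseteq> red_verts p L"
  by (auto simp: red_verts_def)

lemma red_span: "red_verts p L \<subseteq> span_verts p L"
  using L_span by (auto simp: red_verts_def span_verts_def)

lemma clus_children: "v \<notin> L \<Longrightarrow> clus p L v = (\<Union>y\<in>{y. y \<noteq> 0 \<and> p y = v}. clus p L y)"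
proof
  assume v: "v \<notin> L"
  show "clus p L v \<subseteq> (\<Union>y\<in>{y. y \<noteq> 0 \<and> p y = v}. clus p L y)"
  proof
    fix i assume "i \<in> clus p L v"
    then have i: "i \<in> L" "anc p i v" "i \<noteq> v" using v by (auto simp: clus_def)
    obtain y where "anc p i y" "p y = v" "y \<noteq> 0" using anc_last_step[OF r i(2,3)] .
    then show "i \<in> (\<Union>y\<in>{y. y \<noteq> 0 \<and> p y = v}. clus p L y)" using i by (auto simp: clus_def)
  qed
  show "(\<Union>y\<in>{y. y \<noteq> 0 \<and> p y = v}. clus p L y) \<subseteq> clus p L v"
    using clus_mono[OF anc_parent] by fast
qed

lemma siblings: "p y = p z \<Longrightarrow> y \<noteq> 0 \<Longrightarrow> z \<noteq> 0 \<Longrightarrow> anc p y z \<Longrightarrow> y = z"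
  using anc_cases[of p y z] parent_not_anc[OF r, of z] by auto

lemma siblings_disjoint:
  "p y = p z \<Longrightarrow> y \<noteq> 0 \<Longrightarrow> z \<noteq> 0 \<Longrightarrow> y \<noteq> z \<Longrightarrow> clus p L y \<inter> clus p L z = {}"
  using clus_meet[of p L y z] siblings[of y z] siblings[of z y] by metis

lemma span_closed: "x \<in> span_verts p L \<Longrightarrow> p x \<in> span_verts p L"
proof -
  assume x: "x \<in> span_verts p L"
  show ?thesis
  proof (cases "x = 0")
    case False
    then have "clus p L x \<noteq> {}" using x by (simp add: span_verts_def)
    then have "clus p L (p x) \<noteq> {}" using clus_mono[OF anc_parent, of p L x] by blast
    then show ?thesis by (simp add: span_verts_def)
  qed (simp add: rooted_p0[OF r] span_verts_def)
qed

section \<open>The spanned subtree and its reduction\<close>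

lemma rooted_span: "rooted (span_verts p L) (span_par p L)"
  and anc_span: "x \<in> span_verts p L \<Longrightarrow> anc (span_par p L) x y \<longleftrightarrow> anc p x y"
proof -
  have "0 \<in> span_verts p L" by (simp add: span_verts_def)
  note * = rooted_subset[OF r this span_subset span_closed]
  have "(\<lambda>x. if x \<in> span_verts p L - {0} then p x else 0) = span_par p L"
    by (auto simp: span_par_def)
  then show "rooted (span_verts p L) (span_par p L)"
    "x \<in> span_verts p L \<Longrightarrow> anc (span_par p L) x y \<longleftrightarrow> anc p x y" using * by auto
qed

lemma tpath_span: "x \<in> span_verts p L \<Longrightarrow> tpath (span_par p L) x = tpath p x"
proof (induction x rule: depth_induct[OF r, case_names root step])
  case root then show ?case by (simp add: tpath_root[OF r] tpath_root[OF rooted_span])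
next
  case (step x)
  then have "span_par p L x = p x" by (simp add: span_par_def)
  then show ?case using step span_closed[of x] tpath_step[OF r step(1)] tpath_step[OF rooted_span step(1)]
    by simp
qed

text \<open>Leastness rests on uniqueness of paths: a subtree containing \<open>i\<close> and
  \<open>\<Delta>\<close> contains a path between them, which can only be \<open>tpath p i\<close>;
  so it contains every vertex on it together with the edge to the parent.\<close>

lemma spanned_subtree_tree_of:
  "spanned_subtree (tree_of V p) L = tree_of (span_verts p L) (span_par p L)"
proof -
  let ?S = "tree_of (span_verts p L) (span_par p L)"
  have edge: "edges ?S = {{x, p x} | x. x \<in> span_verts p L - {0}}"
    by (auto simp: edges_tree_of span_par_def)
  have sub: "subgraph ?S (tree_of V p)"
    unfolding subgraph_def edge using span_subset by (auto simp: edges_tree_of)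
  have least: "subgraph ?S H" if H: "is_tree H" "subgraph H (tree_of V p)" "L \<union> {0} \<subseteq> verts H" for H
  proof -
    have *: "v \<in> verts H \<and> (v \<noteq> 0 \<longrightarrow> {v, p v} \<in> edges H)" if i: "i \<in> L" "anc p i v" for i v
    proof -
      obtain q where q: "gpath H i q 0"
        using H i unfolding is_tree_def connected_graph_def by blast
      then have "gpath (tree_of V p) i q 0" using gpath_subgraph H by blast
      moreover have "gpath (tree_of V p) i (tpath p i) 0" using i L by (intro gpath_tpath[OF r]) auto
      ultimately have q': "q = tpath p i" using gpath_unique[OF r] anc_root[OF r] by blast
      have "v \<in> set q" using i by (simp add: q' set_tpath[OF r])
      moreover have "{v, p v} \<in> edges H" if "v \<noteq> 0" "successively (\<lambda>a b. {a, b} \<in> edges H) (tpath p i)"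
        using i(2) that(2)
      proof (induction i rule: depth_induct[OF r, case_names root step])
        case root then show ?case using that by (simp add: anc_from_root[OF r])
      next
        case (step i)
        have t: "tpath p i = i # tpath p (p i)" using tpath_step[OF r step(1)] .
        show ?case
        proof (cases "i = v")
          case True
          have "successively (\<lambda>a b. {a, b} \<in> edges H) (i # tpath p (p i))" using step.prems t by simp
          then show ?thesis using True by (simp add: successively_Cons tpath_not_Nil[OF r] hd_tpath[OF r])
        next
          case False
          then have "anc p (p i) v" using step.prems anc_cases by blast
          then show ?thesis using step by (simp add: t successively_Cons tpath_not_Nil[OF r])
        qed
      qed
      ultimately show ?thesis using q q' by (auto simp: gpath_def)
    qed
    have "v \<in> verts H \<and> (v \<noteq> 0 \<longrightarrow> {v, p v} \<in> edges H)" if "v \<in> span_verts p L" for v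
      using that * H by (auto simp: span_verts_def clus_def)
    then show ?thesis by (auto simp: subgraph_def edge)
  qed
  show ?thesis unfolding spanned_subtree_def
  proof (rule the_equality)
    show "is_tree ?S \<and> subgraph ?S (tree_of V p) \<and> L \<union> {0} \<subseteq> verts ?S \<and>
      (\<forall>H'. is_tree H' \<and> subgraph H' (tree_of V p) \<and> L \<union> {0} \<subseteq> verts H' \<longrightarrow> subgraph ?S H')"
      using sub least is_tree_tree_of[OF rooted_span] L_span by (auto simp: span_verts_def)
    then show "H = ?S" if "is_tree H \<and> subgraph H (tree_of V p) \<and> L \<union> {0} \<subseteq> verts H \<and>
      (\<forall>H'. is_tree H' \<and> subgraph H' (tree_of V p) \<and> L \<union> {0} \<subseteq> verts H' \<longrightarrow> subgraph H H')" for H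
      using that unfolding subgraph_def by (metis prod_eq_iff subset_antisym)
  qed
qed

lemma nodes_tree_of:
  "nodes (tree_of V p) L =
    {x \<in> span_verts p L. card {y. y \<noteq> 0 \<and> clus p L y \<noteq> {} \<and> p y = x} \<ge> 2}"
proof -
  have "children (tree_of (span_verts p L) (span_par p L)) x =
      {y. y \<noteq> 0 \<and> clus p L y \<noteq> {} \<and> p y = x}" for x
    unfolding children_tree_of[OF rooted_span] by (auto simp: span_par_def span_verts_def)
  then show ?thesis unfolding nodes_def spanned_subtree_tree_of by simp
qed

text \<open>The third property makes \<open>f y\<close> the nearest element of \<open>R\<close> on
  the way to \<open>\<Delta>\<close>; it replaces all later reasoning about the filtered
  list.\<close>

lemma first_anc:
  assumes "0 \<in> R"
  defines "f \<equiv> \<lambda>y. hd (filter (\<lambda>x. x \<in> R) (tpath p y))"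
  shows "f y \<in> R" "anc p y (f y)" "z \<in> R \<Longrightarrow> anc p y z \<Longrightarrow> anc p (f y) z"
proof -
  have f: "f y = (if y \<in> R then y else f (p y))" for y
  proof (cases "y = 0")
    case True then show ?thesis using assms by (simp add: tpath_root[OF r])
  next
    case False then show ?thesis by (simp add: f_def tpath_step[OF r])
  qed
  have "f y \<in> R \<and> anc p y (f y) \<and> (\<forall>z\<in>R. anc p y z \<longrightarrow> anc p (f y) z)"
  proof (induction y rule: depth_induct[OF r, case_names root step])
    case root then show ?case using f[of 0] assms(1) by simp
  next
    case (step y)
    show ?case
    proof (cases "y \<in> R")
      case True then show ?thesis using f[of y] by simp
    next
      case False
      then have "f y = f (p y)" using f[of y] by simp
      then show ?thesis using step False anc_step anc_cases by metis
    qed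
  qed
  then show "f y \<in> R" "anc p y (f y)" "z \<in> R \<Longrightarrow> anc p y z \<Longrightarrow> anc p (f y) z" by auto
qed

lemma reduction_tree_of: "reduction (tree_of V p) L = tree_of (red_verts p L) (red_par p L)"
proof -
  have R: "{0} \<union> L \<union> nodes (tree_of V p) L = red_verts p L"
    by (simp add: nodes_tree_of red_verts_def)
  have *: "hd (filter (\<lambda>x. x \<in> red_verts p L) (tl (tree_path (tree_of (span_verts p L) (span_par p L)) v 0)))
      = red_par p L v" if v: "v \<in> red_verts p L - {0}" for v
  proof -
    have vs: "v \<in> span_verts p L" using v red_span by auto
    then have "tree_path (tree_of (span_verts p L) (span_par p L)) v 0 = v # tpath p (p v)"
      using tree_path_tree_of[OF rooted_span vs] tpath_span[OF vs] tpath_step[OF r] v by simp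
    then show ?thesis using v by (simp add: red_par_def)
  qed
  show ?thesis unfolding reduction_def Let_def R spanned_subtree_tree_of
    unfolding tree_of_def[of "red_verts p L"] using * by (auto; metis *)
qed

lemma zero_red: "0 \<in> red_verts p L"
  by (simp add: red_verts_def)

lemma red_par_props:
  assumes "v \<in> red_verts p L" "v \<noteq> 0"
  shows "red_par p L v \<in> red_verts p L" "anc p (p v) (red_par p L v)"
    "z \<in> red_verts p L \<Longrightarrow> anc p (p v) z \<Longrightarrow> anc p (red_par p L v) z"
  using first_anc[OF zero_red] assms by (simp_all add: red_par_def)

text \<open>The reduction only skips vertices, so its ancestor relation is the restriction of the
  old one. Invariance of the clusters follows from this alone.\<close>

lemma rooted_red: "rooted (red_verts p L) (red_par p L)"
  and anc_red: "x \<in> red_verts p L \<Longrightarrow> anc (red_par p L) x y \<longleftrightarrow> anc p x y \<and> y \<in> red_verts p L"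
proof -
  let ?R = "red_verts p L" and ?q = "red_par p L"
  have q0: "?q x = 0" if "x \<notin> ?R - {0}" for x using that unfolding red_par_def by argo
  have qR: "?q x \<in> ?R" for x
    using red_par_props(1)[of x] zero_red q0[of x] by (cases "x \<in> ?R - {0}") auto
  have up: "anc p x y \<Longrightarrow> x \<in> ?R \<Longrightarrow> y \<in> ?R \<Longrightarrow> anc ?q x y" for x y
  proof (induction "depth p x" arbitrary: x rule: less_induct)
    case less
    show ?case
    proof (cases "x = y")
      case False
      then have x0: "x \<noteq> 0" using less.prems(1) anc_from_root[OF r] by metis
      have "anc p (p x) y" using less.prems False anc_cases by blast
      then have "anc p (?q x) y" using red_par_props(3) less.prems x0 by blast
      moreover have "depth p (?q x) < depth p x"
        using depth_anc[OF r red_par_props(2)[OF less.prems(2) x0]] depth_Suc[OF r x0] by simp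
      ultimately have "anc ?q (?q x) y" using less.hyps qR less.prems by blast
      then show ?thesis by (rule anc_step)
    qed simp
  qed
  have "\<exists>k. (?q ^^ k) x = 0" for x
  proof (cases "x \<in> ?R")
    case True
    then show ?thesis using up[of x 0] zero_red anc_root[OF r] by (auto simp: anc_def)
  next
    case False
    then show ?thesis using q0[of x] by (intro exI[of _ 1]) simp
  qed
  moreover have "finite ?R" using red_span span_subset rooted_finite[OF r] by (meson finite_subset)
  ultimately show "rooted ?R ?q" unfolding rooted_def using q0 qR zero_red by blast
  have "(?q ^^ k) x \<in> ?R \<and> anc p x ((?q ^^ k) x)" if "x \<in> ?R" for x k
  proof (induction k)
    case (Suc k)
    let ?z = "(?q ^^ k) x"
    have "anc p ?z (?q ?z)"
    proof (cases "?z = 0")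
      case False then show ?thesis using red_par_props(2) Suc anc_step by blast
    qed (simp add: anc_root[OF r] q0)
    then show ?case using Suc qR anc_trans by (auto intro: anc_trans)
  qed (use that in simp)
  then have "anc ?q x y \<Longrightarrow> anc p x y \<and> y \<in> ?R" if "x \<in> ?R" for x y
    using that by (auto simp: anc_def[of ?q])
  then show "x \<in> ?R \<Longrightarrow> anc ?q x y \<longleftrightarrow> anc p x y \<and> y \<in> ?R" using up by blast
qed

lemma clus_red: "v \<in> red_verts p L \<Longrightarrow> clus (red_par p L) L v = clus p L v"
  using anc_red L_red by (auto simp: clus_def)

text \<open>A vertex that is neither in \<open>L\<close> nor a node has exactly one child with
  nonempty cluster, and that child has the same cluster. Moving away from the root in this way ends
  at a vertex of the reduction.\<close>

lemma red_top:
  assumes "x \<noteq> 0" "clus p L x \<noteq> {}"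
  shows "\<exists>v\<in>red_verts p L - {0}. anc p v x \<and> clus p L v = clus p L x"
proof -
  have "x \<in> V" using clus_in_verts assms by blast
  then show ?thesis using assms
  proof (induction x rule: up_induct)
    case (up x)
    show ?case
    proof (cases "x \<in> red_verts p L")
      case True then show ?thesis using up.prems by blast
    next
      case False
      let ?C = "{y. y \<noteq> 0 \<and> clus p L y \<noteq> {} \<and> p y = x}"
      have "x \<notin> L" "card ?C < 2" using False up.prems by (auto simp: red_verts_def span_verts_def)
      have cx: "clus p L x = (\<Union>y\<in>?C. clus p L y)" using clus_children[OF \<open>x \<notin> L\<close>] by auto
      have "?C \<subseteq> V" using clus_in_verts by auto
      then have "finite ?C" using rooted_finite[OF r] finite_subset by blast
      moreover have "?C \<noteq> {}" using cx up.prems by blast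
      ultimately have "card ?C \<noteq> 0" by simp
      then have "card ?C = 1" using \<open>card ?C < 2\<close> by linarith
      then obtain y where y: "?C = {y}" by (auto simp: card_1_singleton_iff)
      then have y': "y \<noteq> 0" "clus p L y \<noteq> {}" "p y = x" "clus p L x = clus p L y" using cx by auto
      then obtain v where "v \<in> red_verts p L - {0}" "anc p v y" "clus p L v = clus p L y"
        using up.IH[OF y'(1) clus_in_verts[OF y'(2)] y'(3) y'(1,2)] by auto
      then show ?thesis using y' anc_trans[of p v y x] anc_parent[of p y] by auto
    qed
  qed
qed

lemma phier_red: "phier (red_par p L) L = phier p L"
proof (intro equalityI subsetI)
  fix A assume "A \<in> phier (red_par p L) L"
  then obtain v where v: "A \<noteq> {}" "v \<noteq> 0" "A = clus (red_par p L) L v" by (auto simp: phier_iff)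
  then have "v \<in> red_verts p L" using anc_red L_red by (auto simp: clus_def)
  then show "A \<in> phier p L" using v clus_red by (auto simp: phier_iff)
next
  fix A assume "A \<in> phier p L"
  then obtain v where v: "A \<noteq> {}" "v \<noteq> 0" "A = clus p L v" by (auto simp: phier_iff)
  then obtain w where "w \<in> red_verts p L - {0}" "clus p L w = A" using red_top by metis
  then show "A \<in> phier (red_par p L) L" using v clus_red unfolding phier_iff by (metis DiffE singletonI)
qed

section \<open>Vertices sharing a cluster and intermediate vertices\<close>

context
  assumes sing: "\<And>i. i \<in> L \<Longrightarrow> {i} \<in> phier p L"
begin

text \<open>Vertices with equal nonempty clusters lie on one path. If the one nearer to
  \<open>\<Delta>\<close> is a node, its second child contributes leaves that the other vertex
  lacks; if it belongs to \<open>L\<close>, it would have the other vertex on its own path.\<close>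

lemma inj_red: "inj_on (clus p L) (red_verts p L - {0})"
proof -
  have *: "v = z" if "v \<in> red_verts p L - {0}" "z \<in> red_verts p L - {0}" "clus p L v = clus p L z"
    and vz: "anc p v z" for v z
  proof (rule ccontr)
    assume "v \<noteq> z"
    have ne: "clus p L v \<noteq> {}" using that red_span by (auto simp: span_verts_def)
    show False
    proof (cases "z \<in> L")
      case True
      then have "anc p z v" using clus_singleton[OF True sing[OF True]] that by (auto simp: clus_def)
      then show False using anc_antisym[OF r] vz \<open>v \<noteq> z\<close> by blast
    next
      case False
      then have c2: "card {y. y \<noteq> 0 \<and> clus p L y \<noteq> {} \<and> p y = z} \<ge> 2" (is "card ?C \<ge> 2")
        using that by (auto simp: red_verts_def)
      obtain y where y: "anc p v y" "p y = z" "y \<noteq> 0"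
        using anc_last_step[OF r vz \<open>v \<noteq> z\<close>] .
      have "\<not> ?C \<subseteq> {y}" using c2 card_mono[of "{y}" ?C] by auto
      then obtain y' where y': "y' \<noteq> 0" "clus p L y' \<noteq> {}" "p y' = z" "y' \<noteq> y" by blast
      have "clus p L y' \<inter> clus p L y = {}" using siblings_disjoint y y' by auto
      moreover have "clus p L y' \<subseteq> clus p L z" using clus_mono y' anc_parent by metis
      moreover have "clus p L v \<subseteq> clus p L y" using clus_mono y by blast
      ultimately show False using y' that by blast
    qed
  qed
  show ?thesis
  proof (rule inj_onI)
    fix v z assume vz: "v \<in> red_verts p L - {0}" "z \<in> red_verts p L - {0}" "clus p L v = clus p L z"
    have "clus p L v \<noteq> {}" using vz red_span by (auto simp: span_verts_def)
    then have "anc p v z \<or> anc p z v" using clus_meet[of p L v z] vz by auto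
    then show "v = z" using * vz by metis
  qed
qed

text \<open>For \<open>z\<close> strictly between \<open>v\<close> and its reduced parent,
  \<open>red_top\<close> gives a reduced vertex with the cluster of \<open>z\<close> whose path
  meets \<open>z\<close>. No reduced vertex lies strictly in between, so that path runs through
  \<open>v\<close>, and \<open>z\<close> has the cluster of \<open>v\<close>. Conversely,
  injectivity on reduced vertices keeps a vertex with this cluster from lying beyond the reduced
  parent.\<close>

lemma intermediate_eq:
  assumes v: "v \<in> red_verts p L" "v \<noteq> 0"
  shows "intermediate (tree_of (span_verts p L) (span_par p L)) {v, red_par p L v} =
    {z. z \<noteq> 0 \<and> clus p L z = clus p L v} - {v}" (is "intermediate ?H {v, ?w} = _")
proof -
  note q = red_par_props[OF v]
  have vs: "v \<in> span_verts p L" "?w \<in> span_verts p L" using v q(1) red_span by auto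
  have vw: "anc p v ?w" using q(2) anc_step by blast
  have ne: "clus p L v \<noteq> {}" using vs v by (auto simp: span_verts_def)
  \<comment> \<open>The edge does not say which end a path starts from; reversal does not change its
    set of vertices.\<close>
  have path: "set s = {z. anc p v z \<and> anc p z ?w}"
    if "{v, ?w} = {x, y}" "gpath ?H x s y" for x y s
  proof -
    have "gpath ?H v s ?w \<or> gpath ?H v (rev s) ?w"
      using that gpath_rev[of ?H] unfolding doubleton_eq_iff by blast
    then obtain s' where s': "gpath ?H v s' ?w" "set s' = set s" by (metis set_rev)
    have "anc (span_par p L) v ?w" using vw anc_span[OF vs(1)] by simp
    from set_gpath_up[OF rooted_span s'(1) this]
    have "set s = {z. anc (span_par p L) v z \<and> anc (span_par p L) z ?w}" using s' by simp
    also have "\<dots> = {z. anc p v z \<and> anc p z ?w}"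
      using anc_span[OF vs(1)] anc_span anc_closed[OF rooted_span _ vs(1)] by blast
    finally show ?thesis .
  qed
  obtain s where s: "gpath ?H v s ?w"
    using is_tree_tree_of[OF rooted_span] vs unfolding is_tree_def connected_graph_def verts_tree_of by blast
  have "z \<in> span_verts p L" if "anc p v z" for z
    using that anc_span[OF vs(1)] anc_closed[OF rooted_span _ vs(1)] by blast
  then have "intermediate ?H {v, ?w} = {z. anc p v z \<and> anc p z ?w} - {v, ?w}"
    unfolding intermediate_def using path s path[OF refl s] by (auto; blast)
  also have "\<dots> = {z. z \<noteq> 0 \<and> clus p L z = clus p L v} - {v}"
  proof (intro equalityI subsetI)
    fix z assume "z \<in> {z. anc p v z \<and> anc p z ?w} - {v, ?w}"
    then have z: "anc p v z" "anc p z ?w" "z \<noteq> v" "z \<noteq> ?w" by auto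
    have z0: "z \<noteq> 0" using z anc_from_root[OF r] by metis
    have sub: "clus p L v \<subseteq> clus p L z" using z clus_mono by blast
    then have "clus p L z \<noteq> {}" using ne by auto
    then obtain v' where v': "v' \<in> red_verts p L - {0}" "anc p v' z" "clus p L v' = clus p L z"
      using red_top[OF z0] by blast
    have "anc p v' v"
    proof (rule ccontr)
      assume n: "\<not> anc p v' v"
      then have "anc p v v'" using clus_meet[of p L v v'] v' sub ne by blast
      then have "anc p (p v) v'" using n anc_cases anc_refl by metis
      then have "anc p ?w v'" using q(3) v' by blast
      then have "anc p ?w z" using v' anc_trans by blast
      then show False using anc_antisym[OF r] z by blast
    qed
    then have "clus p L z \<subseteq> clus p L v" using clus_mono[of p v' v L] v' by auto
    then show "z \<in> {z. z \<noteq> 0 \<and> clus p L z = clus p L v} - {v}" using sub z z0 by auto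
  next
    fix z assume "z \<in> {z. z \<noteq> 0 \<and> clus p L z = clus p L v} - {v}"
    then have z: "z \<noteq> 0" "clus p L z = clus p L v" "z \<noteq> v" by auto
    have vz: "anc p v z"
    proof (rule ccontr)
      assume n: "\<not> anc p v z"
      obtain v' where v': "v' \<in> red_verts p L - {0}" "anc p v' z" "clus p L v' = clus p L z"
        using red_top[OF z(1)] ne z(2) by auto
      then have "v' = v" using inj_onD[OF inj_red] v z by auto
      then show False using v' n by simp
    qed
    then have pz: "anc p (p v) z" using anc_cases z by blast
    have "\<not> anc p ?w z"
    proof
      assume wz: "anc p ?w z"
      then have w0: "?w \<noteq> 0" using z anc_from_root[OF r] by metis
      have "clus p L ?w = clus p L v" using clus_mono[OF vw, of L] clus_mono[OF wz, of L] z by auto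
      then have "?w = v" using inj_onD[OF inj_red] v w0 q(1) by auto
      then show False using q(2) parent_not_anc[OF r] v by simp
    qed
    moreover have "anc p z ?w \<or> anc p ?w z" using anc_linear[OF vz vw] .
    ultimately show "z \<in> {z. anc p v z \<and> anc p z ?w} - {v, ?w}" using vz z by auto
  qed
  finally show ?thesis .
qed

text \<open>The 1 subtracted stands for \<open>v\<close> itself, an endpoint of the edge that shares
  its cluster.\<close>

lemma card_intermediate:
  assumes v: "v \<in> red_verts p L" "v \<noteq> 0"
  shows "card (intermediate (tree_of (span_verts p L) (span_par p L)) {v, red_par p L v}) =
    card {z. z \<noteq> 0 \<and> clus p L z = clus p L v} - 1"
proof -
  have "clus p L v \<noteq> {}" using v red_span by (auto simp: span_verts_def)
  then have "{z. z \<noteq> 0 \<and> clus p L z = clus p L v} \<subseteq> V" using clus_in_verts by auto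
  then have "finite {z. z \<noteq> 0 \<and> clus p L z = clus p L v}"
    using rooted_finite[OF r] finite_subset by blast
  then show ?thesis using v by (simp add: intermediate_eq[OF v])
qed

end

section \<open>Components after removal of the root\<close>

lemma gpath_remove_root_iff:
  assumes "x \<in> V - {0}" "y \<in> V - {0}"
  shows "(\<exists>s. gpath (remove_vertex (tree_of V p) 0) x s y) \<longleftrightarrow> (\<exists>w. w \<noteq> 0 \<and> anc p x w \<and> anc p y w)"
proof -
  let ?H = "remove_vertex (tree_of V p) 0"
  have VH: "verts ?H = V - {0}" by (simp add: remove_vertex_def)
  have EH: "{a, b} \<in> edges ?H \<longleftrightarrow> a \<noteq> 0 \<and> b \<noteq> 0 \<and> {a, b} \<in> edges (tree_of V p)" for a b
    by (auto simp: remove_vertex_def)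
  have ext: "\<exists>s. gpath ?H x s ((p ^^ k) y) \<Longrightarrow> (p ^^ k) y \<noteq> 0 \<Longrightarrow> y \<in> V - {0} \<Longrightarrow> \<exists>s. gpath ?H x s y" for x y k
  proof (induction k arbitrary: y)
    case (Suc k)
    have e: "(p ^^ k) (p y) = (p ^^ Suc k) y" by (simp add: funpow_swap1)
    have "p y \<noteq> 0"
    proof
      assume "p y = 0"
      then have "anc p 0 ((p ^^ Suc k) y)" unfolding e[symmetric] by (auto simp: anc_def)
      then show False using Suc.prems anc_from_root[OF r] by metis
    qed
    then have py: "p y \<in> V - {0}" using rooted_closed[OF r] Suc.prems by auto
    then obtain s where "gpath ?H x s (p y)" using Suc.IH[of "p y"] Suc.prems e by auto
    moreover have "{p y, y} \<in> edges ?H" using Suc.prems py by (auto simp: EH edge_tree_of_iff[OF r])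
    ultimately show ?case using Suc.prems VH by (intro gpath_extend) auto
  qed simp
  show ?thesis
  proof
    assume "\<exists>w. w \<noteq> 0 \<and> anc p x w \<and> anc p y w"
    then obtain w where w: "w \<noteq> 0" "anc p x w" "anc p y w" by blast
    then have wV: "w \<in> V - {0}" using anc_closed[OF r] assms by auto
    have "gpath ?H w [w] w" using wV by (simp add: gpath_def VH)
    obtain k j where k: "(p ^^ k) x = w" and j: "(p ^^ j) y = w" using w by (auto simp: anc_def)
    have "\<exists>s. gpath ?H w s ((p ^^ k) x)" using \<open>gpath ?H w [w] w\<close> k by blast
    then have "\<exists>s. gpath ?H w s x" using ext[of w k x] w k assms by blast
    then have "\<exists>s. gpath ?H x s w" using gpath_rev by blast
    then show "\<exists>s. gpath ?H x s y" using ext[of x j y] w j assms by blast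
  next
    assume "\<exists>s. gpath ?H x s y"
    then obtain s where "gpath ?H x s y" by blast
    then show "\<exists>w. w \<noteq> 0 \<and> anc p x w \<and> anc p y w"
    \<comment> \<open>Each edge of a path avoiding \<open>\<Delta>\<close> leads to a parent or to a
      child. A common nonzero ancestor persists in both cases, possibly replaced by \<open>x\<close>
      itself.\<close>
    proof (induction s arbitrary: x)
      case Nil then show ?case by (simp add: gpath_def)
    next
      case (Cons a s)
      then have a: "a = x" by (simp add: gpath_def)
      show ?case
      proof (cases s)
        case Nil
        then have "x = y" "x \<noteq> 0" using Cons.prems by (auto simp: gpath_def VH)
        then show ?thesis by auto
      next
        case (Cons b s')
        then have "gpath ?H b s y" and e: "{x, b} \<in> edges ?H" using Cons.prems a by (auto simp: gpath_def)
        then obtain w where w: "w \<noteq> 0" "anc p b w" "anc p y w" using Cons.IH by blast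
        have "b = p x \<or> x = p b" "x \<noteq> 0" using e by (auto simp: EH edge_tree_of_iff[OF r])
        then show ?thesis
        proof (elim disjE)
          assume "b = p x" then show ?thesis using w anc_step by blast
        next
          assume "x = p b"
          then have "anc p w x \<or> anc p x w" using w anc_linear[of p b] by auto
          then show ?thesis using w \<open>x \<noteq> 0\<close> anc_trans anc_refl by metis
        qed
      qed
    qed
  qed
qed

lemma top_exists:
  assumes "x \<noteq> 0" obtains w where "w \<noteq> 0" "p w = 0" "anc p x w"
  using anc_last_step[OF r anc_root[OF r] assms] by blast

text \<open>Every nonzero vertex reaches \<open>\<Delta>\<close> through some child \<open>w\<close>
  of it, whose cluster is at least as large. A vertex whose cluster contains that of
  \<open>w\<close> is comparable with \<open>w\<close>, and beyond \<open>w\<close> there is only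
  \<open>\<Delta>\<close>.\<close>

lemma maxes_phier: "maxes (phier p L) = {clus p L w | w. w \<noteq> 0 \<and> p w = 0} - {{}}"
proof (intro equalityI subsetI)
  fix A assume "A \<in> maxes (phier p L)"
  then have A: "A \<in> phier p L" and m: "\<And>B. B \<in> phier p L \<Longrightarrow> A \<subseteq> B \<Longrightarrow> B = A"
    by (auto simp: maxes_def)
  then obtain v where v: "A \<noteq> {}" "A = clus p L v" "v \<noteq> 0" by (auto simp: phier_iff)
  obtain w where w: "w \<noteq> 0" "p w = 0" "anc p v w" using top_exists[OF v(3)] .
  then have "A \<subseteq> clus p L w" using clus_mono v by blast
  moreover have "clus p L w \<in> phier p L" using calculation v w by (auto simp: phier_iff)
  ultimately have "A = clus p L w" using m by blast
  then show "A \<in> {clus p L w | w. w \<noteq> 0 \<and> p w = 0} - {{}}" using v w by blast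
next
  fix A assume "A \<in> {clus p L w | w. w \<noteq> 0 \<and> p w = 0} - {{}}"
  then obtain w where w: "A \<noteq> {}" "A = clus p L w" "w \<noteq> 0" "p w = 0" by blast
  have "B = A" if "B \<in> phier p L" "A \<subseteq> B" for B
  proof -
    obtain z where z: "z \<noteq> 0" "B = clus p L z" using \<open>B \<in> phier p L\<close> by (auto simp: phier_iff)
    have "anc p w z \<or> anc p z w" using clus_meet[of p L w z] w z that by blast
    then have "anc p z w" using anc_cases[of p w z] w(4) z(1) anc_from_root[OF r] by auto
    then show ?thesis using clus_mono that w z by blast
  qed
  then show "A \<in> maxes (phier p L)" using w by (auto simp: maxes_def phier_iff)
qed

lemma component_partition_tree_of: "component_partition (tree_of V p) L = maxes (phier p L)"
proof -
  let ?E = "{(x, y). x \<in> L \<and> y \<in> L \<and> (\<exists>s. gpath (remove_vertex (tree_of V p) 0) x s y)}"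
  have E: "?E = {(x, y). x \<in> L \<and> y \<in> L \<and> (\<exists>w. w \<noteq> 0 \<and> anc p x w \<and> anc p y w)}"
    using gpath_remove_root_iff L by blast
  have cls: "?E `` {x} = clus p L w" if "x \<in> L" "w \<noteq> 0" "p w = 0" "anc p x w" for x w
  proof -
    have "anc p y w" if "z \<noteq> 0" "anc p x z" "anc p y z" for y z
    proof -
      have "anc p z w"
        using anc_linear[of p x z w] that \<open>anc p x w\<close> \<open>p w = 0\<close> anc_cases[of p w z] anc_from_root[OF r]
        by (metis anc_refl)
      then show ?thesis using that anc_trans by blast
    qed
    then show ?thesis using that unfolding E by (auto simp: clus_def)
  qed
  show ?thesis
  proof (intro equalityI subsetI)
    fix A assume "A \<in> component_partition (tree_of V p) L"
    then obtain x where x: "x \<in> L" "A = ?E `` {x}" by (auto simp: component_partition_def quotient_def)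
    obtain w where w: "w \<noteq> 0" "p w = 0" "anc p x w" using top_exists[of x] x L by blast
    then have "A = clus p L w" "x \<in> clus p L w" using x cls by (auto simp: clus_def)
    then show "A \<in> maxes (phier p L)" using w unfolding maxes_phier by blast
  next
    fix A assume "A \<in> maxes (phier p L)"
    then obtain w where w: "A \<noteq> {}" "A = clus p L w" "w \<noteq> 0" "p w = 0" unfolding maxes_phier by blast
    then obtain x where x: "x \<in> L" "anc p x w" by (auto simp: clus_def)
    then have "A = ?E `` {x}" using cls w by simp
    then show "A \<in> component_partition (tree_of V p) L"
      using x by (auto simp: component_partition_def quotient_def)
  qed
qed

end

section \<open>Laminar families and their realisation by parent functions\<close>

definition laminar_on :: "nat set \<Rightarrow> nat set set \<Rightarrow> bool"
  where "laminar_on L F \<longleftrightarrow> finite L \<and> F \<subseteq> Pow L - {{}} \<and> (\<forall>i\<in>L. {i} \<in> F) \<and>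
    (\<forall>A\<in>F. \<forall>B\<in>F. A \<inter> B = {} \<or> A \<subseteq> B \<or> B \<subseteq> A)"

text \<open>The two parts are proper: \<open>laminar_on\<close> excludes the empty set.\<close>

definition bin_hier :: "nat set \<Rightarrow> nat set set \<Rightarrow> bool"
  where "bin_hier L F \<longleftrightarrow> laminar_on L F \<and>
    (\<forall>A\<in>F. card A \<noteq> 1 \<longrightarrow> (\<exists>A1\<in>F. \<exists>A2\<in>F. A1 \<inter> A2 = {} \<and> A1 \<union> A2 = A))"

text \<open>For a nonmaximal member this is the next larger one, the cluster of the next node. For a
  maximal member the intersection is over nothing and has no meaning; \<open>slot_next\<close> tests
  for that case first.\<close>

definition up_set :: "nat set set \<Rightarrow> nat set \<Rightarrow> nat set"
  where "up_set F A = \<Inter>{B \<in> F. A \<subset> B}"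

lemma laminar_onD:
  assumes "laminar_on L F"
  shows "finite L" "finite F" "A \<in> F \<Longrightarrow> A \<subseteq> L" "A \<in> F \<Longrightarrow> A \<noteq> {}" "i \<in> L \<Longrightarrow> {i} \<in> F"
    "A \<in> F \<Longrightarrow> B \<in> F \<Longrightarrow> A \<inter> B \<noteq> {} \<Longrightarrow> A \<subseteq> B \<or> B \<subseteq> A" "A \<in> F \<Longrightarrow> finite A"
proof -
  show fL: "finite L" using assms by (simp add: laminar_on_def)
  have "F \<subseteq> Pow L" using assms by (auto simp: laminar_on_def)
  then show "finite F" "A \<in> F \<Longrightarrow> finite A" using fL by (auto intro: finite_subset)
  show "A \<in> F \<Longrightarrow> B \<in> F \<Longrightarrow> A \<inter> B \<noteq> {} \<Longrightarrow> A \<subseteq> B \<or> B \<subseteq> A"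
    using assms unfolding laminar_on_def by metis
qed (use assms in \<open>auto simp: laminar_on_def\<close>)

text \<open>All members strictly containing \<open>A\<close> share the nonempty set
  \<open>A\<close>, so laminarity makes them a chain; the smallest in cardinality is the
  least.\<close>

lemma up_set:
  assumes F: "laminar_on L F" and A: "A \<in> F" "A \<notin> maxes F"
  shows "up_set F A \<in> F" "A \<subset> up_set F A" "B \<in> F \<Longrightarrow> A \<subset> B \<Longrightarrow> up_set F A \<subseteq> B"
proof -
  let ?C = "{B \<in> F. A \<subset> B}"
  have "?C \<noteq> {}" "finite ?C" using A laminar_onD(2)[OF F] by (auto simp: maxes_def)
  then have "Min (card ` ?C) \<in> card ` ?C" by (intro Min_in) auto
  then obtain M where M: "M \<in> ?C" "card M = Min (card ` ?C)" unfolding image_iff by metis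
  have "M \<subseteq> B" if B: "B \<in> ?C" for B
  proof -
    have "A \<noteq> {}" using laminar_onD(4)[OF F A(1)] .
    then have "M \<subseteq> B \<or> B \<subseteq> M" using laminar_onD(6)[OF F, of M B] M B by blast
    moreover have "card M \<le> card B" unfolding M(2) using B \<open>finite ?C\<close> by (intro Min_le) auto
    ultimately show ?thesis using card_seteq[of M B] laminar_onD(7)[OF F] M by auto
  qed
  then have "up_set F A = M" using M unfolding up_set_def by blast
  then show "up_set F A \<in> F" "A \<subset> up_set F A" "B \<in> F \<Longrightarrow> A \<subset> B \<Longrightarrow> up_set F A \<subseteq> B"
    using M \<open>\<And>B. B \<in> ?C \<Longrightarrow> M \<subseteq> B\<close> by auto
qed

text \<open>A tree whose clusters form \<open>F\<close>, with \<open>n A\<close> vertices of cluster \<open>A\<close>, is an injective labelling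
  of the slots \<open>(A, j)\<close>, \<open>j < n A\<close>: along a chain of vertices with the same cluster \<open>j\<close> counts
  the vertices above the given one.\<close>

definition slots :: "nat set set \<Rightarrow> (nat set \<Rightarrow> nat) \<Rightarrow> (nat set \<times> nat) set"
  where "slots F n = Sigma F (\<lambda>A. {..<n A})"

definition slot_next :: "nat set set \<Rightarrow> (nat set \<Rightarrow> nat) \<Rightarrow> (nat set \<times> nat \<Rightarrow> nat) \<Rightarrow> nat set \<Rightarrow> nat \<Rightarrow> nat"
  where "slot_next F n \<phi> A j = (if Suc j < n A then \<phi> (A, Suc j)
    else if A \<in> maxes F then 0 else \<phi> (up_set F A, 0))"

text \<open>Only the parents of labelled vertices are prescribed. The other vertices remain free and
  make up the forest.\<close>

definition compat :: "nat set set \<Rightarrow> (nat set \<Rightarrow> nat) \<Rightarrow> (nat set \<times> nat \<Rightarrow> nat) \<Rightarrow> (nat \<Rightarrow> nat) \<Rightarrow> bool"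
  where "compat F n \<phi> p \<longleftrightarrow> (\<forall>A\<in>F. \<forall>j<n A. p (\<phi> (A, j)) = slot_next F n \<phi> A j)"

text \<open>This follows the way of the leaf \<open>i\<close> to \<open>\<Delta>\<close> slot by
  slot. A cluster \<open>A\<close> other than \<open>{i}\<close> is entered from the largest member
  \<open>C\<close> with \<open>i\<close> in \<open>C\<close> and \<open>C\<close> strictly inside
  \<open>A\<close>: maximality of \<open>C\<close> forces \<open>up_set F C = A\<close>.\<close>

lemma slot_induct:
  assumes F: "laminar_on L F" and n: "\<And>A. A \<in> F \<Longrightarrow> 0 < n A" and i: "i \<in> L"
    and start: "P {i} 0"
    and next_slot: "\<And>A j. A \<in> F \<Longrightarrow> i \<in> A \<Longrightarrow> Suc j < n A \<Longrightarrow> P A j \<Longrightarrow> P A (Suc j)"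
    and jump: "\<And>A. A \<in> F \<Longrightarrow> i \<in> A \<Longrightarrow> A \<notin> maxes F \<Longrightarrow> P A (n A - 1) \<Longrightarrow> P (up_set F A) 0"
    and A: "A \<in> F" "i \<in> A" "j < n A"
  shows "P A j"
  using A
proof (induction "card A" arbitrary: A j rule: less_induct)
  case less
  have P0: "P A 0"
  proof (cases "A = {i}")
    case True then show ?thesis using start by simp
  next
    case False
    let ?D = "{C \<in> F. i \<in> C \<and> C \<subset> A}"
    have "{i} \<in> ?D" using False less.prems laminar_onD(5)[OF F i] by auto
    moreover have "finite ?D" using laminar_onD(2)[OF F] by auto
    ultimately have "Max (card ` ?D) \<in> card ` ?D" by (intro Max_in) auto
    then obtain C where C: "C \<in> ?D" "card C = Max (card ` ?D)" unfolding image_iff by metis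
    have Cm: "C \<notin> maxes F" using C less.prems by (auto simp: maxes_def)
    have CF: "C \<in> F" using C by simp
    note u = up_set[OF F CF Cm]
    have "up_set F C = A"
    proof (rule ccontr)
      assume "up_set F C \<noteq> A"
      then have D: "up_set F C \<in> ?D" using u(1,2) u(3)[of A] C less.prems by blast
      have "card C < card (up_set F C)" using u laminar_onD(7)[OF F] by (intro psubset_card_mono) auto
      moreover have "card (up_set F C) \<le> card C" unfolding C(2) using D \<open>finite ?D\<close> by (intro Max_ge) auto
      ultimately show False by simp
    qed
    moreover have "card C < card A" using C laminar_onD(7)[OF F less.prems(1)] by (intro psubset_card_mono) auto
    then have "P C (n C - 1)" using less.hyps[of C] C n[OF CF] by auto
    ultimately show ?thesis using jump[OF CF _ Cm] C by auto
  qed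
  have "j < n A \<Longrightarrow> P A j" for j
  proof (induction j)
    case 0 then show ?case using P0 by simp
  next
    case (Suc j) then show ?case using next_slot[OF less.prems(1,2)] by simp
  qed
  then show ?case using less.prems by simp
qed

context
  fixes L F n \<phi> p
  assumes F: "laminar_on L F" and n: "\<And>A. A \<in> F \<Longrightarrow> 0 < n A"
    and inj: "inj_on \<phi> (slots F n)" and \<phi>0: "\<And>A j. A \<in> F \<Longrightarrow> j < n A \<Longrightarrow> \<phi> (A, j) \<noteq> 0"
    and pin: "\<And>i. i \<in> L \<Longrightarrow> \<phi> ({i}, 0) = i"
    and p0: "p 0 = 0" and cp: "compat F n \<phi> p"
begin

lemma compat_step: "A \<in> F \<Longrightarrow> j < n A \<Longrightarrow> p (\<phi> (A, j)) = slot_next F n \<phi> A j"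
  using cp by (simp add: compat_def)

lemma slot_orbit:
  assumes i: "i \<in> L" and a: "anc p i v" and v: "v \<noteq> 0"
  obtains B j where "B \<in> F" "j < n B" "i \<in> B" "v = \<phi> (B, j)"
proof -
  have "(p ^^ k) i = 0 \<or> (\<exists>B j. B \<in> F \<and> j < n B \<and> i \<in> B \<and> (p ^^ k) i = \<phi> (B, j))" for k
  proof (induction k)
    case 0
    have "(p ^^ 0) i = \<phi> ({i}, 0)" using pin[OF i] by simp
    then show ?case using laminar_onD(5)[OF F i] n[of "{i}"] by blast
  next
    case (Suc k)
    show ?case
    proof (cases "(p ^^ k) i = 0")
      case True then show ?thesis using p0 by simp
    next
      case False
      then obtain B j where B: "B \<in> F" "j < n B" "i \<in> B" "(p ^^ k) i = \<phi> (B, j)" using Suc by metis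
      then have e: "(p ^^ Suc k) i = slot_next F n \<phi> B j" using compat_step by simp
      consider "Suc j < n B" | "\<not> Suc j < n B" "B \<in> maxes F" | "\<not> Suc j < n B" "B \<notin> maxes F" by blast
      then show ?thesis
      proof cases
        case 1 then show ?thesis using e B by (auto simp: slot_next_def)
      next
        case 2 then show ?thesis using e by (simp add: slot_next_def)
      next
        case 3
        note u = up_set[OF F B(1) 3(2)]
        have "(p ^^ Suc k) i = \<phi> (up_set F B, 0)" using e 3 by (simp add: slot_next_def)
        then show ?thesis using u n[OF u(1)] B by blast
      qed
    qed
  qed
  then show ?thesis using a v that unfolding anc_def by metis
qed

text \<open>A leaf of \<open>A\<close> visits every slot of \<open>A\<close> by
  \<open>slot_induct\<close>. Conversely, the orbit of a leaf meets only slots of clusters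
  containing it, and injectivity of \<open>\<phi>\<close> identifies the slot from the
  vertex.\<close>

lemma clus_slot:
  assumes A: "A \<in> F" "j < n A" shows "clus p L (\<phi> (A, j)) = A"
proof (intro equalityI subsetI)
  fix i assume "i \<in> A"
  then have i: "i \<in> L" using laminar_onD(3)[OF F A(1)] by auto
  have "anc p i (\<phi> (A, j))"
  proof (rule slot_induct[OF F n i, where P = "\<lambda>A j. anc p i (\<phi> (A, j))"])
    show "anc p i (\<phi> ({i}, 0))" using pin[OF i] by simp
  next
    fix A j assume B: "A \<in> F" "i \<in> A" "Suc j < n A" "anc p i (\<phi> (A, j))"
    then have "p (\<phi> (A, j)) = \<phi> (A, Suc j)" using compat_step[of A j] by (simp add: slot_next_def)
    then show "anc p i (\<phi> (A, Suc j))" using anc_trans[OF B(4) anc_parent] by simp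
  next
    fix A assume B: "A \<in> F" "i \<in> A" "A \<notin> maxes F" "anc p i (\<phi> (A, n A - 1))"
    then have "p (\<phi> (A, n A - 1)) = \<phi> (up_set F A, 0)"
      using compat_step[of A "n A - 1"] n[of A] by (simp add: slot_next_def)
    then show "anc p i (\<phi> (up_set F A, 0))" using anc_trans[OF B(4) anc_parent] by simp
  qed (use A \<open>i \<in> A\<close> in auto)
  then show "i \<in> clus p L (\<phi> (A, j))" using i by (simp add: clus_def)
next
  fix i assume "i \<in> clus p L (\<phi> (A, j))"
  then obtain k where i: "i \<in> L" and k: "(p ^^ k) i = \<phi> (A, j)" by (auto simp: clus_def anc_def)
  have "anc p i (\<phi> (A, j))" using k by (auto simp: anc_def)
  then obtain B j' where B: "B \<in> F" "j' < n B" "i \<in> B" "\<phi> (A, j) = \<phi> (B, j')"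
    using slot_orbit[OF i _ \<phi>0[OF A]] by metis
  then have "(A, j) = (B, j')" using A by (intro inj_onD[OF inj]) (auto simp: slots_def)
  then show "i \<in> A" using B by simp
qed

text \<open>Two measures in lexicographic order: a jump enlarges the cluster, and between jumps the
  rest of the chain gets shorter.\<close>

lemma slot_reach: "A \<in> F \<Longrightarrow> j < n A \<Longrightarrow> \<exists>k. (p ^^ k) (\<phi> (A, j)) = 0"
proof (induction "card L - card A" arbitrary: A j rule: less_induct)
  case less
  have step: "\<exists>k. (p ^^ k) x = 0" if "\<exists>k. (p ^^ k) (p x) = 0" for x
    using that by (metis comp_apply funpow_Suc_right)
  have "\<forall>j. n A - j = m \<longrightarrow> j < n A \<longrightarrow> (\<exists>k. (p ^^ k) (\<phi> (A, j)) = 0)" for m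
  proof (induction m)
    case (Suc m)
    show ?case
    proof (intro allI impI)
      fix j assume j: "n A - j = Suc m" "j < n A"
      consider "Suc j < n A" | "\<not> Suc j < n A" "A \<in> maxes F" | "\<not> Suc j < n A" "A \<notin> maxes F" by blast
      then have "\<exists>k. (p ^^ k) (p (\<phi> (A, j))) = 0"
      proof cases
        case 1
        then have "p (\<phi> (A, j)) = \<phi> (A, Suc j)" using compat_step less.prems j by (simp add: slot_next_def)
        moreover have "n A - Suc j = m" using j by simp
        ultimately show ?thesis using Suc 1 by simp
      next
        case 2
        then have "p (\<phi> (A, j)) = 0" using compat_step less.prems j by (simp add: slot_next_def)
        then show ?thesis by (intro exI[of _ 0]) simp
      next
        case 3
        note u = up_set[OF F less.prems(1) 3(2)]
        have "p (\<phi> (A, j)) = \<phi> (up_set F A, 0)" using compat_step 3 less.prems j by (simp add: slot_next_def)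
        moreover have "card A < card (up_set F A)" "card (up_set F A) \<le> card L"
          using psubset_card_mono[OF laminar_onD(7)[OF F u(1)] u(2)]
            card_mono[OF laminar_onD(1)[OF F] laminar_onD(3)[OF F u(1)]] by auto
        ultimately show ?thesis using less.hyps[of "up_set F A" 0] u n[OF u(1)] by auto
      qed
      then show "\<exists>k. (p ^^ k) (\<phi> (A, j)) = 0" by (rule step)
    qed
  qed simp
  then show ?case using less.prems by blast
qed

end

text \<open>Two labellings of the same tree start at the same pinned leaves and follow the same
  orbit of \<open>p\<close>. Hence the events attached to different labellings are disjoint.\<close>

lemma compat_unique:
  assumes F: "laminar_on L F" and n: "\<And>A. A \<in> F \<Longrightarrow> 0 < n A"
    and c: "compat F n \<phi> p" "compat F n \<psi> p"
    and pin: "\<And>i. i \<in> L \<Longrightarrow> \<phi> ({i}, 0) = i" "\<And>i. i \<in> L \<Longrightarrow> \<psi> ({i}, 0) = i"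
    and A: "A \<in> F" "j < n A"
  shows "\<phi> (A, j) = \<psi> (A, j)"
proof -
  obtain i where i: "i \<in> A" "i \<in> L" using laminar_onD(3,4)[OF F A(1)] by blast
  show ?thesis
  proof (rule slot_induct[OF F n i(2), where P = "\<lambda>A j. \<phi> (A, j) = \<psi> (A, j)"])
    fix A j assume B: "A \<in> F" "i \<in> A" "Suc j < n A" "\<phi> (A, j) = \<psi> (A, j)"
    have "p (\<phi> (A, j)) = \<phi> (A, Suc j)" "p (\<psi> (A, j)) = \<psi> (A, Suc j)"
      using c B(1,3) unfolding compat_def slot_next_def by auto
    then show "\<phi> (A, Suc j) = \<psi> (A, Suc j)" using B(4) by simp
  next
    fix A assume B: "A \<in> F" "i \<in> A" "A \<notin> maxes F" "\<phi> (A, n A - 1) = \<psi> (A, n A - 1)"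
    have "p (\<phi> (A, n A - 1)) = \<phi> (up_set F A, 0)" "p (\<psi> (A, n A - 1)) = \<psi> (up_set F A, 0)"
      using c B(1,3) n[OF B(1)] unfolding compat_def slot_next_def by auto
    then show "\<phi> (up_set F A, 0) = \<psi> (up_set F A, 0)" using B(4) by simp
  qed (use A i pin in auto)
qed

section \<open>Binary bouquets and binary hierarchies\<close>

text \<open>Trees in which each vertex other than \<open>\<Delta>\<close> can be named by its
  nonempty cluster. Reductions with singleton leaf clusters and binary bouquets both belong to this
  class (\<open>red_reduced\<close>, \<open>bouquet_reduced\<close>).\<close>

definition reduced :: "nat set \<Rightarrow> (nat \<Rightarrow> nat) \<Rightarrow> nat set \<Rightarrow> bool"
  where "reduced V p L \<longleftrightarrow> rooted V p \<and> L \<subseteq> V - {0} \<and> inj_on (clus p L) (V - {0}) \<and>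
    (\<forall>v\<in>V - {0}. clus p L v \<noteq> {})"

lemma reducedD:
  assumes "reduced V p L"
  shows "rooted V p" "L \<subseteq> V - {0}" "inj_on (clus p L) (V - {0})"
    "v \<in> V \<Longrightarrow> v \<noteq> 0 \<Longrightarrow> clus p L v \<noteq> {}"
  using assms by (auto simp: reduced_def)

lemma reduced_inj:
  "reduced V p L \<Longrightarrow> v \<in> V \<Longrightarrow> v \<noteq> 0 \<Longrightarrow> w \<in> V \<Longrightarrow> w \<noteq> 0 \<Longrightarrow> clus p L v = clus p L w \<Longrightarrow> v = w"
  by (auto simp: reduced_def inj_on_def)

lemma reduced_phier: "reduced V p L \<Longrightarrow> phier p L = clus p L ` (V - {0})"
proof -
  assume r: "reduced V p L"
  note r1 = reducedD(1)[OF r] and r2 = reducedD(2)[OF r]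
  show ?thesis
  proof (intro equalityI subsetI)
    fix A assume "A \<in> phier p L"
    then obtain v where "A \<noteq> {}" "v \<noteq> 0" "A = clus p L v" by (auto simp: phier_iff)
    then show "A \<in> clus p L ` (V - {0})" using clus_in_verts[OF r1 r2] by auto
  next
    fix A assume "A \<in> clus p L ` (V - {0})"
    then show "A \<in> phier p L" using reducedD(4)[OF r] by (auto simp: phier_iff)
  qed
qed

lemma reduced_anc_iff:
  assumes "reduced V p L" "y \<in> V" "y \<noteq> 0" "z \<in> V" "z \<noteq> 0"
  shows "anc p y z \<longleftrightarrow> clus p L y \<subseteq> clus p L z"
proof
  assume s: "clus p L y \<subseteq> clus p L z"
  then have "anc p y z \<or> anc p z y" using clus_meet[of p L y z] reducedD(4)[OF assms(1-3)] by blast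
  moreover have "anc p z y \<Longrightarrow> y = z" using clus_mono[of p z y L] s reduced_inj[OF assms] by blast
  ultimately show "anc p y z" by auto
qed (rule clus_mono)

lemma reduced_top:
  assumes r: "reduced V p L" and v: "v \<in> V" "v \<noteq> 0"
  shows "p v = 0 \<longleftrightarrow> clus p L v \<in> maxes (phier p L)"
proof
  assume "p v = 0"
  then show "clus p L v \<in> maxes (phier p L)"
    using maxes_phier[OF reducedD(1,2)[OF r]] reducedD(4)[OF r v] v by blast
next
  assume "clus p L v \<in> maxes (phier p L)"
  then obtain w where w: "w \<noteq> 0" "p w = 0" "clus p L v = clus p L w"
    unfolding maxes_phier[OF reducedD(1,2)[OF r]] by blast
  then have "w \<in> V" using clus_in_verts[OF reducedD(1,2)[OF r]] reducedD(4)[OF r v] by metis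
  then show "p v = 0" using reduced_inj[OF r v _ _ w(3)] w by blast
qed

lemma card_maxes_reduced:
  assumes r: "reduced V p L"
  shows "card {y \<in> V - {0}. p y = 0} = card (maxes (phier p L))"
proof -
  have "clus p L ` {y \<in> V - {0}. p y = 0} = maxes (phier p L)"
    using reduced_top[OF r] by (auto simp: reduced_phier[OF r] maxes_def)
  moreover have "inj_on (clus p L) {y \<in> V - {0}. p y = 0}"
    using reducedD(3)[OF r] by (rule inj_on_subset) auto
  ultimately show ?thesis using card_image[of "clus p L" "{y \<in> V - {0}. p y = 0}"] by simp
qed

text \<open>The tree is read off its clusters: the two parts of the cluster of \<open>x\<close> name
  two vertices, which prove to be children of \<open>x\<close>, and a third child would have a
  nonempty cluster disjoint from both parts.\<close>

lemma reduced_bouquet: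
  assumes r: "reduced V p L" and b: "bin_hier L (phier p L)"
  shows "binary_bouquet L (card (maxes (phier p L))) (tree_of V p)"
proof -
  note r1 = reducedD(1)[OF r] and r2 = reducedD(2)[OF r]
  have lam: "laminar_on L (phier p L)" using b by (simp add: bin_hier_def)
  have sg: "clus p L i = {i}" if "i \<in> L" for i
    using clus_singleton[OF that laminar_onD(5)[OF lam that]] .
  have ch_L: "{y \<in> V - {0}. p y = x} = {}" if x: "x \<in> L" for x
  proof -
    have False if y: "y \<in> V" "y \<noteq> 0" "p y = x" for y
    proof -
      have "clus p L y \<subseteq> {x}" using clus_mono[OF anc_parent, of p L y] y sg[OF x] by simp
      then have "clus p L y = clus p L x" using reducedD(4)[OF r y(1,2)] sg[OF x] by auto
      then have "y = x" using reduced_inj[OF r y(1,2)] x r2 by blast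
      then show False using parent_neq[OF r1 y(2)] y by simp
    qed
    then show ?thesis by blast
  qed
  have leaf: "x \<in> L" if x: "x \<in> V - {0}" "{y \<in> V - {0}. p y = x} = {}" for x
  proof (rule ccontr)
    assume "x \<notin> L"
    then have "clus p L x = (\<Union>y\<in>{y. y \<noteq> 0 \<and> p y = x}. clus p L y)"
      by (rule clus_children[OF r1 r2])
    then obtain y where y: "y \<noteq> 0" "p y = x" "clus p L y \<noteq> {}" using reducedD(4)[OF r, of x] x by auto
    then have "y \<in> V" using clus_in_verts[OF r1 r2] by blast
    then show False using y x by blast
  qed
  have two: "card {y \<in> V - {0}. p y = x} = 2" if x: "x \<in> V - {0} - L" for x
  proof -
    have A: "clus p L x \<in> phier p L" using x reduced_phier[OF r] by auto
    have "card (clus p L x) \<noteq> 1"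
    proof
      assume "card (clus p L x) = 1"
      then obtain i where i: "clus p L x = {i}" by (auto simp: card_1_singleton_iff)
      then have "i \<in> L" using clus_subset[of p L x] by auto
      then have "i \<in> V" "i \<noteq> 0" using r2 by auto
      then have "x = i" using reduced_inj[OF r, of x i] sg[OF \<open>i \<in> L\<close>] i x by auto
      then show False using x \<open>i \<in> L\<close> by simp
    qed
    then obtain A1 A2 where A12: "A1 \<in> phier p L" "A2 \<in> phier p L" "A1 \<inter> A2 = {}" "A1 \<union> A2 = clus p L x"
      using b A unfolding bin_hier_def by blast
    then obtain y1 y2 where y: "y1 \<in> V" "y1 \<noteq> 0" "A1 = clus p L y1" "y2 \<in> V" "y2 \<noteq> 0" "A2 = clus p L y2"
      unfolding reduced_phier[OF r] by blast
    have ne: "A1 \<noteq> {}" "A2 \<noteq> {}" using A12 by (auto simp: phier_iff)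
    \<comment> \<open>Let \<open>z\<close> be the child of \<open>x\<close> through which
      \<open>w1\<close> reaches \<open>x\<close>. Its cluster is a proper part of that of
      \<open>x\<close>, so laminarity makes it disjoint from the cluster of \<open>w2\<close>; then
      it equals the cluster of \<open>w1\<close>, and \<open>z = w1\<close>.\<close>
    have child: "p w1 = x" if w: "w1 \<in> V" "w1 \<noteq> 0" "w2 \<in> V" "w2 \<noteq> 0"
      "clus p L w1 \<inter> clus p L w2 = {}" "clus p L w1 \<union> clus p L w2 = clus p L x" for w1 w2
    proof -
      have "clus p L w1 \<subseteq> clus p L x" using w(6) by blast
      then have "anc p w1 x" using reduced_anc_iff[OF r w(1,2), of x] x by auto
      moreover have "w1 \<noteq> x" using w(5,6) reducedD(4)[OF r w(3,4)] by auto
      ultimately obtain z where z: "anc p w1 z" "p z = x" "z \<noteq> 0" using anc_last_step[OF r1] by metis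
      have zV: "z \<in> V" using anc_closed[OF r1 z(1) w(1)] .
      have sub: "clus p L w1 \<subseteq> clus p L z" "clus p L z \<subseteq> clus p L x"
        using clus_mono[OF z(1)] clus_mono[OF anc_parent, of p L z] z(2) by auto
      have neq: "clus p L z \<noteq> clus p L x"
        using reduced_inj[OF r zV z(3), of x] x parent_neq[OF r1 z(3)] z(2) by auto
      have "clus p L z \<inter> clus p L w2 = {}"
      proof (rule ccontr)
        assume "clus p L z \<inter> clus p L w2 \<noteq> {}"
        then have "clus p L z \<subseteq> clus p L w2 \<or> clus p L w2 \<subseteq> clus p L z"
          using phier_laminar reduced_phier[OF r] zV z(3) w by (metis Diff_iff imageI singletonD)
        then show False using w(5,6) sub neq reducedD(4)[OF r w(1,2)] by blast
      qed
      then have "clus p L z = clus p L w1" using sub w(6) by blast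
      then have "z = w1" using reduced_inj[OF r zV z(3) w(1,2)] by simp
      then show ?thesis using z by simp
    qed
    have p1: "p y1 = x" using child[of y1 y2] y A12 by simp
    have p2: "p y2 = x" using child[of y2 y1] y A12 by (simp add: Int_commute Un_commute)
    have "z = y1 \<or> z = y2" if z: "z \<in> V" "z \<noteq> 0" "p z = x" for z
    proof (rule ccontr)
      assume "\<not> ?thesis"
      then have "clus p L z \<inter> clus p L y1 = {}" "clus p L z \<inter> clus p L y2 = {}"
        using siblings_disjoint[OF r1 r2] z y p1 p2 by auto
      moreover have "clus p L z \<subseteq> clus p L x" using clus_mono[OF anc_parent, of p L z] z by simp
      ultimately show False using A12(4) y(3,6) reducedD(4)[OF r z(1,2)] by auto
    qed
    then have "{y \<in> V - {0}. p y = x} = {y1, y2}" using y p1 p2 by auto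
    moreover have "y1 \<noteq> y2" using A12 y ne by auto
    ultimately show ?thesis by simp
  qed
  show ?thesis unfolding binary_bouquet_def verts_tree_of children_tree_of[OF r1]
  proof (intro conjI ballI impI)
    show "is_tree (tree_of V p)" "0 \<in> V" "L \<subseteq> V - {0}"
      using is_tree_tree_of[OF r1] rooted_0[OF r1] r2 by auto
  next
    fix x assume "x \<in> L" then show "{y \<in> V - {0}. p y = x} = {}" by (rule ch_L)
  next
    fix x assume "x \<in> V - {0}" "{y \<in> V - {0}. p y = x} = {}" then show "x \<in> L" by (rule leaf)
  next
    fix x assume "x \<in> V - {0} - L" then show "card {y \<in> V - {0}. p y = x} = 2" by (rule two)
  next
    show "card {y \<in> V - {0}. p y = 0} = card (maxes (phier p L))" by (rule card_maxes_reduced[OF r])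
  qed
qed

text \<open>Clusters are nonempty by induction from the leaves. If two distinct vertices on one path
  had the same cluster, the one nearer to \<open>\<Delta>\<close> would have a second child, whose
  leaves the other one misses.\<close>

lemma bouquet_reduced:
  assumes r1: "rooted V p" and b: "binary_bouquet L r (tree_of V p)"
  shows "reduced V p L" "bin_hier L (phier p L)" "card (maxes (phier p L)) = r"
proof -
  have r2: "L \<subseteq> V - {0}" and leaf: "\<And>x. x \<in> L \<Longrightarrow> {y \<in> V - {0}. p y = x} = {}"
    and nl: "\<And>x. x \<in> V - {0} \<Longrightarrow> {y \<in> V - {0}. p y = x} = {} \<Longrightarrow> x \<in> L"
    and two: "\<And>x. x \<in> V - {0} - L \<Longrightarrow> card {y \<in> V - {0}. p y = x} = 2"
    and top: "card {y \<in> V - {0}. p y = 0} = r"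
    using b unfolding binary_bouquet_def verts_tree_of children_tree_of[OF r1] by blast+
  have ne: "clus p L v \<noteq> {}" if "v \<in> V" "v \<noteq> 0" for v
    using that
  proof (induction v rule: up_induct[OF r1 r2, consumes 1, case_names up])
    case (up v)
    show ?case
    proof (cases "v \<in> L")
      case True then show ?thesis using clus_self by blast
    next
      case False
      then obtain y where y: "y \<in> V" "y \<noteq> 0" "p y = v" using nl[of v] up.hyps up.prems by blast
      then have "clus p L y \<noteq> {}" using up.IH by blast
      then show ?thesis using clus_mono[OF anc_parent, of p L y] y by auto
    qed
  qed
  have sg: "clus p L i = {i}" if i: "i \<in> L" for i
  proof -
    have "j = i" if "anc p j i" "j \<in> L" for j
    proof (rule ccontr)
      assume "j \<noteq> i"
      then obtain y where y: "anc p j y" "p y = i" "y \<noteq> 0" using anc_last_step[OF r1 \<open>anc p j i\<close>] by metis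
      then have "y \<in> V" using anc_closed[OF r1 y(1)] that r2 by auto
      then show False using leaf[OF i] y by blast
    qed
    then show ?thesis using i by (auto simp: clus_def)
  qed
  have split: "\<exists>y1 y2. y1 \<in> V \<and> y2 \<in> V \<and> y1 \<noteq> 0 \<and> y2 \<noteq> 0 \<and> p y1 = x \<and> p y2 = x \<and> y1 \<noteq> y2 \<and>
      clus p L y1 \<inter> clus p L y2 = {} \<and> clus p L y1 \<union> clus p L y2 = clus p L x" if x: "x \<in> V - {0} - L" for x
  proof -
    obtain y1 y2 where y: "{y \<in> V - {0}. p y = x} = {y1, y2}" "y1 \<noteq> y2"
      using two[OF x] by (auto simp: card_2_iff)
    then have y': "y1 \<in> V" "y2 \<in> V" "y1 \<noteq> 0" "y2 \<noteq> 0" "p y1 = x" "p y2 = x" by auto+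
    have "clus p L x = (\<Union>y\<in>{y. y \<noteq> 0 \<and> p y = x}. clus p L y)"
      using x by (intro clus_children[OF r1 r2]) auto
    also have "\<dots> = (\<Union>y\<in>{y \<in> V - {0}. p y = x}. clus p L y)" using clus_in_verts[OF r1 r2] by auto
    also have "\<dots> = clus p L y1 \<union> clus p L y2" unfolding y(1) by auto
    finally have "clus p L y1 \<union> clus p L y2 = clus p L x" by simp
    moreover have "clus p L y1 \<inter> clus p L y2 = {}"
      using siblings_disjoint[OF r1 r2] y(2) y' by auto
    ultimately show ?thesis using y' y(2) by blast
  qed
  have *: "v = z" if vz: "v \<in> V" "v \<noteq> 0" "z \<in> V" "z \<noteq> 0" "clus p L v = clus p L z" "anc p v z" for v z
  proof (rule ccontr)
    assume nvz: "v \<noteq> z"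
    obtain y where y: "anc p v y" "p y = z" "y \<noteq> 0" using anc_last_step[OF r1 vz(6) nvz] .
    have yV: "y \<in> V" using anc_closed[OF r1 y(1) vz(1)] .
    then have "z \<notin> L" using leaf[of z] y by blast
    then obtain y1 y2 where s: "y1 \<in> V" "y2 \<in> V" "y1 \<noteq> 0" "y2 \<noteq> 0" "p y1 = z" "p y2 = z" "y1 \<noteq> y2"
      using split[of z] vz by blast
    then obtain y' where y': "y' \<in> V" "y' \<noteq> 0" "p y' = z" "y' \<noteq> y" by metis
    have "clus p L y' \<inter> clus p L y = {}" using siblings_disjoint[OF r1 r2] y y' by auto
    moreover have "clus p L y' \<subseteq> clus p L z" using clus_mono[OF anc_parent, of p L y'] y' by simp
    moreover have "clus p L v \<subseteq> clus p L y" using clus_mono y by blast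
    ultimately show False using ne[OF y'(1,2)] vz by blast
  qed
  have "inj_on (clus p L) (V - {0})"
  proof (rule inj_onI)
    fix v z assume vz: "v \<in> V - {0}" "z \<in> V - {0}" "clus p L v = clus p L z"
    then have "anc p v z \<or> anc p z v" using clus_meet[of p L v z] ne[of v] by auto
    then show "v = z" using *[of v z] *[of z v] vz by auto
  qed
  then show red: "reduced V p L" using r1 r2 ne by (auto simp: reduced_def)
  then show "card (maxes (phier p L)) = r" using card_maxes_reduced top by metis
  have "finite L" using r2 rooted_finite[OF r1] finite_subset by auto
  moreover have "{i} \<in> phier p L" if "i \<in> L" for i
    using sg[OF that] that r2 unfolding phier_iff by blast
  ultimately have lam: "laminar_on L (phier p L)"
    using phier_laminar[of _ p L] unfolding laminar_on_def
    by (auto simp: phier_iff dest: clus_subset[THEN subsetD])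
  show "bin_hier L (phier p L)" unfolding bin_hier_def
  proof (intro conjI lam ballI impI)
    fix A assume A: "A \<in> phier p L" "card A \<noteq> 1"
    then obtain v where v: "v \<in> V" "v \<noteq> 0" "A = clus p L v" unfolding reduced_phier[OF red] by blast
    then have "v \<notin> L" using A sg by auto
    then obtain y1 y2 where "y1 \<in> V" "y2 \<in> V" "y1 \<noteq> 0" "y2 \<noteq> 0" "clus p L y1 \<inter> clus p L y2 = {}"
      "clus p L y1 \<union> clus p L y2 = A" using split[of v] v by blast
    then show "\<exists>A1\<in>phier p L. \<exists>A2\<in>phier p L. A1 \<inter> A2 = {} \<and> A1 \<union> A2 = A"
      unfolding reduced_phier[OF red] by blast
  qed
qed

lemma red_reduced:
  assumes r: "rooted V p" and L: "L \<subseteq> V - {0}" and s: "\<And>i. i \<in> L \<Longrightarrow> {i} \<in> phier p L"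
  shows "reduced (red_verts p L) (red_par p L) L"
proof -
  have "inj_on (clus (red_par p L) L) (red_verts p L - {0})"
    using inj_red[OF r L s] clus_red[OF r L] by (auto simp: inj_on_def)
  moreover have "clus (red_par p L) L v \<noteq> {}" if "v \<in> red_verts p L - {0}" for v
    using that clus_red[OF r L, of v] red_span[OF r L] by (auto simp: span_verts_def)
  ultimately show ?thesis unfolding reduced_def
    using rooted_red[OF r L] L_red[OF r L] L by auto
qed

lemma reduced_iso:
  assumes r: "reduced V p L" and r': "reduced V' p' L" and eq: "phier p L = phier p' L"
    and sg: "\<And>i. i \<in> L \<Longrightarrow> {i} \<in> phier p L"
  obtains s where "bij_betw s V V'" "s 0 = 0" "\<And>i. i \<in> L \<Longrightarrow> s i = i"
    "\<And>x. x \<in> V - {0} \<Longrightarrow> s (p x) = p' (s x)"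
proof -
  define s where "s = (\<lambda>x. if x = 0 then 0 else the_inv_into (V' - {0}) (clus p' L) (clus p L x))"
  have b': "bij_betw (clus p' L) (V' - {0}) (phier p L)"
    using reducedD(3)[OF r'] reduced_phier[OF r'] eq by (simp add: bij_betw_def)
  have b: "bij_betw (clus p L) (V - {0}) (phier p L)"
    using reducedD(3)[OF r] reduced_phier[OF r] by (simp add: bij_betw_def)
  have s: "s x \<in> V'" "s x \<noteq> 0" "clus p' L (s x) = clus p L x" if x: "x \<in> V" "x \<noteq> 0" for x
  proof -
    have c: "clus p L x \<in> clus p' L ` (V' - {0})"
      using x b b' by (auto simp: bij_betw_def)
    show "s x \<in> V'" "s x \<noteq> 0" "clus p' L (s x) = clus p L x"
      using x the_inv_into_into[OF reducedD(3)[OF r'] c subset_refl]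
        f_the_inv_into_f[OF reducedD(3)[OF r'] c] by (auto simp: s_def)
  qed
  have s0: "s 0 = 0" by (simp add: s_def)
  have "bij_betw (the_inv_into (V' - {0}) (clus p' L) \<circ> clus p L) (V - {0}) (V' - {0})"
    by (rule bij_betw_trans[OF b bij_betw_the_inv_into[OF b']])
  then have "bij_betw s (V - {0}) (V' - {0})"
    by (rule bij_betw_cong[THEN iffD1, rotated]) (simp add: s_def)
  then have "bij_betw s (insert 0 (V - {0})) (insert 0 (V' - {0}))"
    using notIn_Un_bij_betw[of 0 "V - {0}" s "V' - {0}"] s0 by simp
  then have bij: "bij_betw s V V'"
    using rooted_0[OF reducedD(1)[OF r]] rooted_0[OF reducedD(1)[OF r']] by (simp add: insert_absorb)
  have sL: "s i = i" if i: "i \<in> L" for i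
  proof -
    have iV: "i \<in> V" "i \<noteq> 0" "i \<in> V'" using i reducedD(2)[OF r] reducedD(2)[OF r'] by auto
    have "clus p L i = {i}" using clus_singleton[OF i sg[OF i]] .
    moreover have "clus p' L i = {i}" using clus_singleton[OF i] sg[OF i] eq by simp
    ultimately show ?thesis using s[OF iV(1,2)] iV by (intro reduced_inj[OF r']) auto
  qed
  have "s (p x) = p' (s x)" if x: "x \<in> V - {0}" for x
  proof (cases "p x = 0")
    case True
    then have "clus p L x \<in> maxes (phier p L)" using reduced_top[OF r] x by blast
    then have "p' (s x) = 0" using reduced_top[OF r', of "s x"] s[of x] x eq by auto
    then show ?thesis using True s0 by simp
  next
    case False
    then have "clus p L x \<notin> maxes (phier p L)" using reduced_top[OF r, of x] x by auto
    then have y'0: "p' (s x) \<noteq> 0" using reduced_top[OF r', of "s x"] s[of x] x eq by auto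
    have xx: "x \<in> V" "x \<noteq> 0" using x by auto
    have y: "p x \<in> V" using rooted_closed[OF reducedD(1)[OF r] xx(1)] .
    have y': "p' (s x) \<in> V'" using rooted_closed[OF reducedD(1)[OF r'] s(1)[OF xx]] .
    have "anc p' (s x) (s (p x))"
      using reduced_anc_iff[OF r' s(1,2)[OF xx] s(1,2)[OF y False]] s(3)[OF xx] s(3)[OF y False]
        clus_mono[OF anc_parent, of p L x] by simp
    moreover have "s x \<noteq> s (p x)"
      using bij x y parent_neq[OF reducedD(1)[OF r] xx(2)] by (auto simp: bij_betw_def inj_on_def)
    ultimately have a1: "anc p' (p' (s x)) (s (p x))" using anc_cases by blast
    obtain z where z: "z \<in> V" "s z = p' (s x)" using y' bij unfolding bij_betw_def by auto
    then have z0: "z \<noteq> 0" using y'0 s0 by metis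
    have cz: "clus p' L (p' (s x)) = clus p L z" using s(3)[OF z(1) z0] z by simp
    have "clus p L x \<subseteq> clus p L z"
      using clus_mono[OF anc_parent, of p' L "s x"] cz s(3)[OF xx] by simp
    then have "anc p x z" using reduced_anc_iff[OF r xx z(1) z0] by simp
    moreover have "x \<noteq> z" using z(2) parent_neq[OF reducedD(1)[OF r'] s(2)[OF xx]] by auto
    ultimately have "anc p (p x) z" using anc_cases by blast
    then have "clus p' L (s (p x)) \<subseteq> clus p' L (p' (s x))"
      using clus_mono[of p "p x" z L] cz s(3)[OF y False] by simp
    then have "anc p' (s (p x)) (p' (s x))"
      using reduced_anc_iff[OF r' s(1,2)[OF y False] y' y'0] by simp
    then show ?thesis using anc_antisym[OF reducedD(1)[OF r'] a1] by simp
  qed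
  then show ?thesis using that bij s0 sL by blast
qed

section \<open>Relabelling classes and configurations\<close>

definition hier :: "nat set \<Rightarrow> graph \<Rightarrow> nat set set"
  where "hier L G = phier (gpar G) L"

lemma hier_tree_of: "rooted V p \<Longrightarrow> hier L (tree_of V p) = phier p L"
  by (simp add: hier_def gpar_tree_of)

lemma bouquet_graph:
  assumes "binary_bouquet L r G"
  obtains V p where "G = tree_of V p" "reduced V p L" "bin_hier L (phier p L)"
    "card (maxes (phier p L)) = r" "hier L G = phier p L"
proof -
  have "is_tree G" "0 \<in> verts G" using assms by (auto simp: binary_bouquet_def)
  note t = tree_gpar[OF this]
  have b: "binary_bouquet L r (tree_of (verts G) (gpar G))" using assms t(2) by simp
  show ?thesis using that[OF t(2)[symmetric] bouquet_reduced[OF t(1) b]] by (simp add: hier_def)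
qed

lemma bouquet_hier:
  assumes "binary_bouquet L r G"
  shows "bin_hier L (hier L G)" "card (maxes (hier L G)) = r" "0 \<notin> L" "L \<union> {0} \<subseteq> verts G"
proof -
  show "0 \<notin> L" "L \<union> {0} \<subseteq> verts G" using assms by (auto simp: binary_bouquet_def)
  show "bin_hier L (hier L G)" "card (maxes (hier L G)) = r"
    using bouquet_graph[OF assms] by metis+
qed

section \<open>Relabelling preserves the hierarchy\<close>

lemma relabel_tree_of:
  assumes "s 0 = 0" "inj_on s V" "0 \<in> V" "\<And>x. x \<in> V - {0} \<Longrightarrow> p' (s x) = s (p x)"
  shows "relabel s (tree_of V p) = tree_of (s ` V) p'"
proof -
  have sV: "s ` V - {0} = s ` (V - {0})"
    using assms(1,2,3) by (auto simp: inj_on_def)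
  have "(`) s ` {{x, p x} | x. x \<in> V - {0}} = {{s x, s (p x)} | x. x \<in> V - {0}}"
  proof (intro equalityI subsetI)
    fix e assume "e \<in> {{s x, s (p x)} | x. x \<in> V - {0}}"
    then obtain x where x: "x \<in> V - {0}" "e = {s x, s (p x)}" by blast
    then have "{x, p x} \<in> {{x, p x} | x. x \<in> V - {0}}" "e = s ` {x, p x}" by auto
    then show "e \<in> (`) s ` {{x, p x} | x. x \<in> V - {0}}" by blast
  qed auto
  also have "\<dots> = {{s x, p' (s x)} | x. x \<in> V - {0}}" using assms(4) by (metis (no_types, lifting))
  also have "\<dots> = {{y, p' y} | y. y \<in> s ` V - {0}}" unfolding sV by auto
  finally show ?thesis by (simp add: relabel_def tree_of_def)
qed

lemma reduced_relabel:
  assumes r: "reduced V p L" and s: "inj_on s V" "s 0 = 0" "\<And>i. i \<in> L \<Longrightarrow> s i = i"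
  obtains p' where "reduced (s ` V) p' L" "phier p' L = phier p L"
    "relabel s (tree_of V p) = tree_of (s ` V) p'"
    "\<And>v. v \<in> V \<Longrightarrow> clus p' L (s v) = clus p L v" "\<And>v. v \<in> V \<Longrightarrow> p' (s v) = s (p v)"
proof -
  note r1 = reducedD(1)[OF r] and r2 = reducedD(2)[OF r]
  define p' where "p' = (\<lambda>y. if y \<in> s ` V then s (p (the_inv_into V s y)) else 0)"
  have p': "p' (s v) = s (p v)" if "v \<in> V" for v
    using that the_inv_into_f_f[OF s(1) that] by (simp add: p'_def)
  have it: "(p' ^^ k) (s v) = s ((p ^^ k) v) \<and> (p ^^ k) v \<in> V" if "v \<in> V" for k v
    using that by (induction k) (auto simp: p' rooted_closed[OF r1])
  have 0: "0 \<in> s ` V" using rooted_0[OF r1] s(2) by force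
  have rt: "rooted (s ` V) p'"
    unfolding rooted_def
  proof (intro conjI allI impI ballI)
    show "finite (s ` V)" using rooted_finite[OF r1] by simp
    show "0 \<in> s ` V" by (rule 0)
    show "p' x = 0" if "x \<notin> s ` V - {0}" for x
    proof (cases "x = 0")
      case True
      then show ?thesis using p'[OF rooted_0[OF r1]] s(2) rooted_p0[OF r1] by simp
    next
      case False then show ?thesis using that by (simp add: p'_def)
    qed
    show "p' x \<in> s ` V" if "x \<in> s ` V" for x using that p' rooted_closed[OF r1] by auto
    show "\<exists>k. (p' ^^ k) x = 0" for x
    proof (cases "x \<in> s ` V")
      case True
      then obtain v where v: "v \<in> V" "x = s v" by auto
      obtain k where "(p ^^ k) v = 0" using rooted_reach[OF r1] by blast
      then have "(p' ^^ k) x = 0" using it[OF v(1), of k] v(2) s(2) by simp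
      then show ?thesis by blast
    next
      case False then show ?thesis by (intro exI[of _ 1]) (simp add: p'_def)
    qed
  qed
  have an: "anc p' (s x) (s y) \<longleftrightarrow> anc p x y" if "x \<in> V" "y \<in> V" for x y
    unfolding anc_def using it[OF that(1)] that s(1) unfolding inj_on_def by metis
  have cl: "clus p' L (s v) = clus p L v" if "v \<in> V" for v
  proof -
    have "anc p' i (s v) \<longleftrightarrow> anc p i v" if "i \<in> L" for i
      using an[of i v] s(3)[OF that] that \<open>v \<in> V\<close> r2 by auto
    then show ?thesis by (auto simp: clus_def)
  qed
  have s0: "s v \<noteq> 0" if "v \<in> V" "v \<noteq> 0" for v
    using s that rooted_0[OF r1] unfolding inj_on_def by metis
  have sV: "s ` V - {0} = s ` (V - {0})"
  proof (intro equalityI subsetI)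
    fix y assume "y \<in> s ` V - {0}"
    then obtain v where v: "v \<in> V" "y = s v" "y \<noteq> 0" by auto
    then have "v \<noteq> 0" using s(2) by metis
    then show "y \<in> s ` (V - {0})" using v by auto
  next
    fix y assume "y \<in> s ` (V - {0})"
    then obtain v where "v \<in> V" "v \<noteq> 0" "y = s v" by auto
    then show "y \<in> s ` V - {0}" using s0[of v] by auto
  qed
  have red: "reduced (s ` V) p' L" unfolding reduced_def
  proof (intro conjI)
    show "rooted (s ` V) p'" by (rule rt)
    show "L \<subseteq> s ` V - {0}"
    proof
      fix i assume "i \<in> L"
      then have "i \<in> V" "i \<noteq> 0" "s i = i" using r2 s(3) by auto
      then show "i \<in> s ` V - {0}" by force
    qed
    show "inj_on (clus p' L) (s ` V - {0})" unfolding sV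
      using reducedD(3)[OF r] cl by (auto simp: inj_on_def)
    show "\<forall>v\<in>s ` V - {0}. clus p' L v \<noteq> {}" unfolding sV using reducedD(4)[OF r] cl by auto
  qed
  have "phier p' L = phier p L" unfolding reduced_phier[OF red] reduced_phier[OF r] sV
    using cl by (auto simp: image_iff)
  moreover have "relabel s (tree_of V p) = tree_of (s ` V) p'"
    by (rule relabel_tree_of[OF s(2,1) rooted_0[OF r1]]) (simp add: p')
  ultimately show ?thesis using that red cl p' by blast
qed

lemma bouquet_relabel:
  assumes b: "binary_bouquet L r G" and s: "inj_on s (verts G)" "s 0 = 0" "\<And>i. i \<in> L \<Longrightarrow> s i = i"
  shows "binary_bouquet L r (relabel s G)" "hier L (relabel s G) = hier L G"
proof -
  obtain V p where G: "G = tree_of V p" and r: "reduced V p L" and h: "bin_hier L (phier p L)"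
    "card (maxes (phier p L)) = r" "hier L G = phier p L" using bouquet_graph[OF b] .
  have "inj_on s V" using s(1) G by simp
  then obtain p' where p': "reduced (s ` V) p' L" "phier p' L = phier p L" "relabel s G = tree_of (s ` V) p'"
    using reduced_relabel[OF r _ s(2,3)] G by metis
  show "hier L (relabel s G) = hier L G"
    using p' h hier_tree_of[OF reducedD(1)[OF p'(1)]] by simp
  show "binary_bouquet L r (relabel s G)" using reduced_bouquet[OF p'(1)] p' h by simp
qed

text \<open>The sets \<open>V' - V\<close> and \<open>V - V'\<close> have the same size, so a
  bijection between them completes \<open>s\<close> to a permutation of the union of
  \<open>V\<close> and \<open>V'\<close>. It fixes \<open>K\<close>, so it moves only elements of
  \<open>S\<close>.\<close>

lemma extend_to_permutation:
  assumes s: "bij_betw s V V'" and fin: "finite V"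
    and V: "V \<subseteq> K \<union> S" "V' \<subseteq> K \<union> S" "K \<subseteq> V" and K: "K \<inter> S = {}" "\<And>x. x \<in> K \<Longrightarrow> s x = x"
  obtains s' where "s' permutes S" "\<And>x. x \<in> V \<Longrightarrow> s' x = s x"
proof -
  have fin': "finite V'" using bij_betw_finite[OF s] fin by simp
  have "card V = card V'" using bij_betw_same_card[OF s] .
  then have "card (V' - V) = card (V - V')"
    using card_Diff_subset_Int[of V V'] card_Diff_subset_Int[of V' V] fin fin'
    by (simp add: Int_commute)
  then obtain b where b: "bij_betw b (V' - V) (V - V')"
    using fin fin' finite_same_card_bij[of "V' - V" "V - V'"] by auto
  define s' where "s' = (\<lambda>x. if x \<in> V then s x else if x \<in> V' then b x else x)"
  have "bij_betw s' V V'" by (rule bij_betw_cong[THEN iffD1, OF _ s]) (simp add: s'_def)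
  moreover have "bij_betw s' (V' - V) (V - V')"
    by (rule bij_betw_cong[THEN iffD1, OF _ b]) (simp add: s'_def)
  ultimately have "bij_betw s' (V \<union> (V' - V)) (V' \<union> (V - V'))"
    by (rule bij_betw_combine) auto
  then have "bij_betw s' (V \<union> V') (V \<union> V')" by (simp add: Un_commute)
  then have "s' permutes (V \<union> V')" by (rule bij_imp_permutes) (simp add: s'_def)
  then have "s' permutes S"
    by (rule permutes_superset) (use V K in \<open>auto simp: s'_def\<close>)
  then show ?thesis using that by (simp add: s'_def)
qed

lemma relabel_cong: "(\<And>x. x \<in> verts G \<Longrightarrow> s x = t x) \<Longrightarrow> edges G \<subseteq> Pow (verts G) \<Longrightarrow> relabel s G = relabel t G"
  unfolding relabel_def by (auto simp: image_iff subset_iff intro!: bexI image_cong)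

lemma edges_Pow_tree_of: "rooted V p \<Longrightarrow> edges (tree_of V p) \<subseteq> Pow (verts (tree_of V p))"
  using rooted_closed by (auto simp: edges_tree_of)

text \<open>Relabelling fixes the leaves and so preserves clusters; conversely equal hierarchies
  give an isomorphism, which extends to a permutation of \<open>S\<close>. \<open>S\<close> is kept
  general because three ranges of labels occur: \<open>{l+1..N}\<close>, \<open>{l+1..}\<close> and
  the complement of a block with \<open>\<Delta>\<close>.\<close>

lemma relabel_class_bouquet:
  assumes b: "binary_bouquet L r G" and S: "S \<inter> (L \<union> {0}) = {}" and V: "verts G \<subseteq> L \<union> {0} \<union> S"
  shows "relabel_class S G = {G'. binary_bouquet L r G' \<and> hier L G' = hier L G \<and> verts G' \<subseteq> L \<union> {0} \<union> S}"
proof (intro equalityI subsetI CollectI)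
  fix G' assume "G' \<in> relabel_class S G"
  then obtain s where s: "s permutes S" "G' = relabel s G" by (auto simp: relabel_class_def)
  have fixed: "s x = x" if "x \<in> L \<union> {0}" for x using S that permutes_not_in[OF s(1), of x] by auto
  have "inj_on s (verts G)" using permutes_inj[OF s(1)] inj_on_subset by blast
  then have "binary_bouquet L r G'" "hier L G' = hier L G"
    using bouquet_relabel[OF b, of s] fixed s(2) by auto
  moreover have "verts G' \<subseteq> L \<union> {0} \<union> S"
  proof
    fix y assume "y \<in> verts G'"
    then obtain x where x: "x \<in> verts G" "y = s x" by (auto simp: s(2) relabel_def)
    then show "y \<in> L \<union> {0} \<union> S" using V fixed[of x] permutes_in_image[OF s(1), of x] by auto
  qed
  ultimately show "binary_bouquet L r G' \<and> hier L G' = hier L G \<and> verts G' \<subseteq> L \<union> {0} \<union> S" by simp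
next
  fix G' assume "G' \<in> {G'. binary_bouquet L r G' \<and> hier L G' = hier L G \<and> verts G' \<subseteq> L \<union> {0} \<union> S}"
  then have b': "binary_bouquet L r G'" and h': "hier L G' = hier L G" and V': "verts G' \<subseteq> L \<union> {0} \<union> S" by auto
  obtain W p where G: "G = tree_of W p" and r: "reduced W p L" and h: "bin_hier L (phier p L)"
    "hier L G = phier p L" using bouquet_graph[OF b] by metis
  obtain W' p' where G': "G' = tree_of W' p'" and r': "reduced W' p' L" "hier L G' = phier p' L"
    using bouquet_graph[OF b'] by metis
  obtain s where s: "bij_betw s W W'" "s 0 = 0" "\<And>i. i \<in> L \<Longrightarrow> s i = i"
    "\<And>x. x \<in> W - {0} \<Longrightarrow> s (p x) = p' (s x)"
    using reduced_iso[OF r r'(1)] h h' r'(2) laminar_onD(5)[of L "phier p L"]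
    unfolding bin_hier_def by (metis (no_types, lifting))
  obtain s' where s': "s' permutes S" "\<And>x. x \<in> W \<Longrightarrow> s' x = s x"
    using extend_to_permutation[of s W W' "L \<union> {0}" S] s V V' G G' S rooted_finite[OF reducedD(1)[OF r]]
      bouquet_hier(4)[OF b] by (metis (no_types, lifting) Int_commute Un_iff singletonD verts_tree_of)
  have "relabel s' G = relabel s G"
    unfolding G by (rule relabel_cong[OF _ edges_Pow_tree_of[OF reducedD(1)[OF r]]]) (simp add: s')
  also have "\<dots> = tree_of (s ` W) p'" unfolding G
    using s rooted_0[OF reducedD(1)[OF r]] by (intro relabel_tree_of) (auto simp: bij_betw_def)
  also have "\<dots> = G'" using s(1) G' by (simp add: bij_betw_def)
  finally show "G' \<in> relabel_class S G" using s' by (auto simp: relabel_class_def)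
qed

text \<open>The slot construction with one vertex per cluster: a singleton is labelled by its
  element, every other cluster by a fresh number \<open>g A\<close> outside \<open>L\<close> and
  \<open>\<Delta>\<close>.\<close>

lemma bin_hier_realised:
  assumes b: "bin_hier L F" and "0 \<notin> L"
  obtains G where "binary_bouquet L (card (maxes F)) G" "hier L G = F"
proof -
  have F: "laminar_on L F" using b by (simp add: bin_hier_def)
  note l = laminar_onD[OF F]
  obtain g where g: "inj_on g F" "g ` F \<subseteq> - (L \<union> {0})"
    using infinite_arbitrarily_large[of "- (L \<union> {0})" "card F"] l(1,2)
    by (metis Compl_eq_Diff_UNIV Diff_infinite_finite bij_betw_def finite.emptyI finite.insertI finite_UnI
        finite_same_card_bij infinite_UNIV_nat)
  define \<phi> where "\<phi> = (\<lambda>(A::nat set, j::nat). if card A = 1 then the_elem A else g A)"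
  define n where "n = (\<lambda>A::nat set. 1::nat)"
  have sing: "\<phi> ({i}, j) = i" for i j by (simp add: \<phi>_def)
  have big: "\<phi> (A, j) = g A" if "card A \<noteq> 1" for A j using that by (simp add: \<phi>_def)
  have elem: "\<exists>i\<in>L. A = {i}" if "A \<in> F" "card A = 1" for A
    using that l(3)[of A] by (auto simp: card_1_singleton_iff)
  have inj: "inj_on \<phi> (slots F n)"
  proof (rule inj_onI)
    fix x y assume xy: "x \<in> slots F n" "y \<in> slots F n" "\<phi> x = \<phi> y"
    then obtain A B where A: "x = (A, 0)" "y = (B, 0)" "A \<in> F" "B \<in> F" by (auto simp: slots_def n_def)
    have "A = B"
    proof (cases "card A = 1"; cases "card B = 1")
      assume "card A = 1" "card B = 1"
      then show ?thesis using elem A xy(3) sing by metis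
    next
      assume c: "card A = 1" "card B \<noteq> 1"
      then obtain i where "i \<in> L" "A = {i}" using elem A(3) by blast
      then have "g B = i" using A xy(3) sing[of i 0] big[OF c(2), of 0] by simp
      moreover have "g B \<in> - (L \<union> {0})" using g(2) A(4) by blast
      ultimately show ?thesis using \<open>i \<in> L\<close> by auto
    next
      assume c: "card A \<noteq> 1" "card B = 1"
      then obtain i where "i \<in> L" "B = {i}" using elem A(4) by blast
      then have "g A = i" using A xy(3) sing[of i 0] big[OF c(1), of 0] by simp
      moreover have "g A \<in> - (L \<union> {0})" using g(2) A(3) by blast
      ultimately show ?thesis using \<open>i \<in> L\<close> by auto
    next
      assume "card A \<noteq> 1" "card B \<noteq> 1"
      then show ?thesis using A xy(3) big g(1) by (auto dest: inj_onD)
    qed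
    then show "x = y" using A by simp
  qed
  have ne0: "\<phi> (A, j) \<noteq> 0" if "A \<in> F" "j < n A" for A j
  proof (cases "card A = 1")
    case True
    then have "\<exists>i\<in>L. A = {i}" using elem that by blast
    then obtain i where "i \<in> L" "A = {i}" by blast
    then have "\<phi> (A, j) = i" "i \<noteq> 0" using sing assms(2) by (simp, metis)
    then show ?thesis by simp
  next
    case False
    then have "\<phi> (A, j) = g A" "g A \<in> - (L \<union> {0})" using big g(2) that by auto
    then show ?thesis by auto
  qed
  define V where "V = insert 0 (\<phi> ` slots F n)"
  define p where "p = (\<lambda>x. if x \<in> \<phi> ` slots F n then
    (case the_inv_into (slots F n) \<phi> x of (A, j) \<Rightarrow> slot_next F n \<phi> A j) else 0)"
  have cp: "compat F n \<phi> p" unfolding compat_def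
  proof (intro ballI allI impI)
    fix A j assume "A \<in> F" "j < n A"
    then have "(A, j) \<in> slots F n" by (auto simp: slots_def)
    then show "p (\<phi> (A, j)) = slot_next F n \<phi> A j" by (simp add: p_def the_inv_into_f_f[OF inj])
  qed
  have n0: "\<And>A. A \<in> F \<Longrightarrow> 0 < n A" by (simp add: n_def)
  have "0 \<notin> \<phi> ` slots F n" using ne0 by (force simp: slots_def)
  then have p0: "p 0 = 0" by (simp add: p_def)
  note ctx = F n0 inj ne0 sing p0 cp
  have fin: "finite (slots F n)" using l(2) by (auto simp: slots_def)
  have pV: "p x \<in> V" for x
  proof (cases "x \<in> \<phi> ` slots F n")
    case True
    then obtain A j where Aj: "A \<in> F" "j < n A" "x = \<phi> (A, j)" by (auto simp: slots_def)
    then have px: "p x = slot_next F n \<phi> A j" using cp by (simp add: compat_def)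
    show ?thesis
    proof (cases "A \<in> maxes F")
      case True then show ?thesis using px by (auto simp: slot_next_def V_def n_def)
    next
      case False
      then have "up_set F A \<in> F" using up_set[OF F Aj(1)] by blast
      then show ?thesis using px False by (auto simp: slot_next_def V_def n_def slots_def)
    qed
  qed (simp add: p_def V_def)
  have r: "rooted V p" unfolding rooted_def
  proof (intro conjI allI impI ballI)
    show "finite V" "0 \<in> V" using fin by (auto simp: V_def)
    show "p x = 0" if "x \<notin> V - {0}" for x
      using that p0 by (cases "x = 0") (auto simp: V_def p_def)
    show "p x \<in> V" for x by (rule pV)
    show "\<exists>k. (p ^^ k) x = 0" for x
    proof (cases "x \<in> \<phi> ` slots F n")
      case True
      then obtain A j where "A \<in> F" "j < n A" "x = \<phi> (A, j)" by (auto simp: slots_def)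
      then show ?thesis using slot_reach[OF ctx] by blast
    next
      case False then show ?thesis by (intro exI[of _ 1]) (simp add: p_def)
    qed
  qed
  have cl: "clus p L (\<phi> (A, j)) = A" if "A \<in> F" "j < n A" for A j using clus_slot[OF ctx that] .
  have V0: "V - {0} = \<phi> ` slots F n" using ne0 by (force simp: V_def slots_def)
  have red: "reduced V p L" unfolding reduced_def
  proof (intro conjI)
    show "rooted V p" by (rule r)
    show "L \<subseteq> V - {0}" unfolding V0
    proof
      fix i assume "i \<in> L"
      then have "({i}, 0) \<in> slots F n" using l(5) by (auto simp: slots_def n_def)
      then show "i \<in> \<phi> ` slots F n" using sing[of i 0] by force
    qed
    show "inj_on (clus p L) (V - {0})" unfolding V0
    proof (rule inj_onI)
      fix x y assume xy: "x \<in> \<phi> ` slots F n" "y \<in> \<phi> ` slots F n" "clus p L x = clus p L y"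
      then obtain A B where "x = \<phi> (A, 0)" "y = \<phi> (B, 0)" "A \<in> F" "B \<in> F" by (auto simp: slots_def n_def)
      then show "x = y" using xy(3) cl n0 by metis
    qed
    show "\<forall>v\<in>V - {0}. clus p L v \<noteq> {}" unfolding V0 using cl l(4) by (auto simp: slots_def)
  qed
  have "phier p L = F"
  proof (unfold reduced_phier[OF red] V0, intro equalityI subsetI)
    fix A assume "A \<in> clus p L ` \<phi> ` slots F n"
    then show "A \<in> F" using cl by (auto simp: slots_def)
  next
    fix A assume A: "A \<in> F"
    then have "(A, 0) \<in> slots F n" by (simp add: slots_def n_def)
    then show "A \<in> clus p L ` \<phi> ` slots F n" using cl[OF A n0[OF A]] by force
  qed
  then show ?thesis
    using that[of "tree_of V p"] reduced_bouquet[OF red] b hier_tree_of[OF r] by simp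
qed

subsection \<open>Splitting a hierarchy into its maximal clusters\<close>

lemma bin_hier_restrict:
  assumes F: "bin_hier L F" and B: "B \<in> F"
  shows "bin_hier B {A \<in> F. A \<subseteq> B}" "maxes {A \<in> F. A \<subseteq> B} = {B}"
proof -
  have l: "laminar_on L F" using F by (simp add: bin_hier_def)
  have "laminar_on B {A \<in> F. A \<subseteq> B}"
    unfolding laminar_on_def
  proof (intro conjI ballI)
    show "finite B" using laminar_onD(7)[OF l B] .
    show "{A \<in> F. A \<subseteq> B} \<subseteq> Pow B - {{}}" using laminar_onD(4)[OF l] by auto
    show "{i} \<in> {A \<in> F. A \<subseteq> B}" if "i \<in> B" for i
      using that laminar_onD(5)[OF l] laminar_onD(3)[OF l B] by auto
    show "A \<inter> C = {} \<or> A \<subseteq> C \<or> C \<subseteq> A" if "A \<in> {A \<in> F. A \<subseteq> B}" "C \<in> {A \<in> F. A \<subseteq> B}" for A C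
      using laminar_onD(6)[OF l, of A C] that by auto
  qed
  then show "bin_hier B {A \<in> F. A \<subseteq> B}" unfolding bin_hier_def
  proof (intro conjI ballI impI)
    fix A assume "A \<in> {A \<in> F. A \<subseteq> B}" "card A \<noteq> 1"
    then obtain A1 A2 where "A1 \<in> F" "A2 \<in> F" "A1 \<inter> A2 = {}" "A1 \<union> A2 = A" "A \<subseteq> B"
      using F unfolding bin_hier_def by blast
    then show "\<exists>A1\<in>{A \<in> F. A \<subseteq> B}. \<exists>A2\<in>{A \<in> F. A \<subseteq> B}. A1 \<inter> A2 = {} \<and> A1 \<union> A2 = A" by blast
  qed
  show "maxes {A \<in> F. A \<subseteq> B} = {B}" using B by (auto simp: maxes_def)
qed

lemma below_max:
  assumes l: "laminar_on L F" and A: "A \<in> F"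
  shows "\<exists>B\<in>maxes F. A \<subseteq> B"
proof -
  let ?C = "{B \<in> F. A \<subseteq> B}"
  have C: "finite ?C" "?C \<noteq> {}" using laminar_onD(2)[OF l] A by auto
  obtain M where M: "M \<in> ?C" "\<And>B. B \<in> ?C \<Longrightarrow> M \<subseteq> B \<Longrightarrow> M = B"
    using finite_has_maximal[OF C] by meson
  then have "M \<in> maxes F" by (auto simp: maxes_def)
  then show ?thesis using M by blast
qed

lemma partition_maxes:
  assumes l: "laminar_on L F"
  shows "partition_on L (maxes F)" "F = (\<Union>B\<in>maxes F. {A \<in> F. A \<subseteq> B})"
proof -
  show "partition_on L (maxes F)"
  proof (rule partition_onI)
    show "\<Union> (maxes F) = L"
    proof (intro equalityI subsetI)
      fix i assume "i \<in> \<Union> (maxes F)"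
      then obtain A where "A \<in> F" "i \<in> A" by (auto simp: maxes_def)
      then show "i \<in> L" using laminar_onD(3)[OF l] by blast
    next
      fix i assume "i \<in> L"
      then obtain B where "B \<in> maxes F" "{i} \<subseteq> B" using below_max[OF l laminar_onD(5)[OF l]] by blast
      then show "i \<in> \<Union> (maxes F)" by blast
    qed
    show "disjnt A B" if "A \<in> maxes F" "B \<in> maxes F" "A \<noteq> B" for A B
      using that laminar_onD(6)[OF l, of A B] by (auto simp: maxes_def disjnt_def)
    show "{} \<notin> maxes F" using laminar_onD(4)[OF l] by (auto simp: maxes_def)
  qed
  show "F = (\<Union>B\<in>maxes F. {A \<in> F. A \<subseteq> B})" using below_max[OF l] by blast
qed

lemma single_max:
  assumes b: "bin_hier B F" and c: "card (maxes F) = 1"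
  shows "maxes F = {B}" "B \<in> F"
proof -
  have l: "laminar_on B F" using b by (simp add: bin_hier_def)
  obtain M where M: "maxes F = {M}" using c by (auto simp: card_1_singleton_iff)
  then have "M = B" using partition_maxes(1)[OF l] by (simp add: partition_on_def)
  then show "maxes F = {B}" using M by simp
  then show "B \<in> F" by (auto simp: maxes_def)
qed

text \<open>Members of \<open>f B\<close> are nonempty subsets of \<open>B\<close>, so the block of
  a member is determined by any of its elements. Since \<open>B\<close> itself belongs to
  \<open>f B\<close>, the blocks become the maximal members.\<close>

lemma glue_hierarchies:
  assumes P: "partition_on L \<pi>" "finite L"
    and f: "\<And>B. B \<in> \<pi> \<Longrightarrow> bin_hier B (f B)" "\<And>B. B \<in> \<pi> \<Longrightarrow> B \<in> f B"
  defines "F \<equiv> (\<Union>B\<in>\<pi>. f B)"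
  shows "bin_hier L F" "maxes F = \<pi>" "B \<in> \<pi> \<Longrightarrow> {A \<in> F. A \<subseteq> B} = f B"
proof -
  have l: "laminar_on B (f B)" if "B \<in> \<pi>" for B using f(1)[OF that] by (simp add: bin_hier_def)
  have disj: "B = B'" if "B \<in> \<pi>" "B' \<in> \<pi>" "x \<in> B" "x \<in> B'" for B B' x
    using that partition_onD2[OF P(1)] by (auto simp: disjoint_def)
  have U: "\<Union>\<pi> = L" using partition_onD1[OF P(1)] by simp
  have sub: "A \<subseteq> B" "A \<noteq> {}" if "B \<in> \<pi>" "A \<in> f B" for A B
    using laminar_onD(3,4)[OF l] that by auto
  have same: "B = B'" if "B \<in> \<pi>" "B' \<in> \<pi>" "A \<in> f B" "A \<inter> B' \<noteq> {}" for A B B'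
    using disj[of B B'] sub[of B A] that by blast
  have lam: "laminar_on L F" unfolding laminar_on_def
  proof (intro conjI ballI)
    show "F \<subseteq> Pow L - {{}}" using sub U unfolding F_def by blast
    show "{i} \<in> F" if "i \<in> L" for i
      using that U laminar_onD(5)[OF l] unfolding F_def by blast
    fix A A' assume "A \<in> F" "A' \<in> F"
    then obtain B B' where B: "B \<in> \<pi>" "B' \<in> \<pi>" "A \<in> f B" "A' \<in> f B'" by (auto simp: F_def)
    show "A \<inter> A' = {} \<or> A \<subseteq> A' \<or> A' \<subseteq> A"
    proof (cases "A \<inter> A' = {}")
      case False
      then have "B = B'" using same[of B B' A] B sub[of B' A'] by blast
      then show ?thesis using laminar_onD(6)[OF l, of B A A'] B False by auto
    qed simp
  qed (rule P(2))
  show "bin_hier L F" unfolding bin_hier_def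
  proof (intro conjI lam ballI impI)
    fix A assume A: "A \<in> F" "card A \<noteq> 1"
    then obtain B where B: "B \<in> \<pi>" "A \<in> f B" by (auto simp: F_def)
    then obtain A1 A2 where "A1 \<in> f B" "A2 \<in> f B" "A1 \<inter> A2 = {}" "A1 \<union> A2 = A"
      using f(1)[OF B(1)] A(2) unfolding bin_hier_def by blast
    then show "\<exists>A1\<in>F. \<exists>A2\<in>F. A1 \<inter> A2 = {} \<and> A1 \<union> A2 = A" using B unfolding F_def by blast
  qed
  show r: "{A \<in> F. A \<subseteq> B} = f B" if B: "B \<in> \<pi>" for B
  proof (intro equalityI subsetI)
    fix A assume "A \<in> {A \<in> F. A \<subseteq> B}"
    then obtain B' where B': "B' \<in> \<pi>" "A \<in> f B'" "A \<subseteq> B" by (auto simp: F_def)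
    then have "B' = B" using same[of B' B A] sub[of B' A] B by blast
    then show "A \<in> f B" using B' by simp
  next
    fix A assume "A \<in> f B" then show "A \<in> {A \<in> F. A \<subseteq> B}" using sub B by (auto simp: F_def)
  qed
  show "maxes F = \<pi>"
  proof (intro equalityI subsetI)
    fix A assume A: "A \<in> maxes F"
    then obtain B where B: "B \<in> \<pi>" "A \<in> f B" by (auto simp: maxes_def F_def)
    have "B \<in> F" using f(2) B unfolding F_def by blast
    then have "B = A" using A sub[OF B] by (auto simp: maxes_def)
    then show "A \<in> \<pi>" using B by simp
  next
    fix B assume B: "B \<in> \<pi>"
    have "B \<in> F" using f(2) B unfolding F_def by blast
    moreover have "A = B" if A: "A \<in> F" "B \<subseteq> A" for A
    proof -
      obtain B' where B': "B' \<in> \<pi>" "A \<in> f B'" using A by (auto simp: F_def)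
      have "B \<noteq> {}" using sub(2)[OF B f(2)[OF B]] .
      then have "B' = B" using same[of B' B A] A B B' by blast
      then show ?thesis using sub B' A by blast
    qed
    ultimately show "B \<in> maxes F" by (auto simp: maxes_def)
  qed
qed

subsection \<open>Configurations as hierarchies\<close>

definition tree_class :: "nat set \<Rightarrow> nat set set \<Rightarrow> graph set"
  where "tree_class B F = {G. binary_bouquet B 1 G \<and> hier B G = F}"

lemma binary_classes_eq:
  assumes "0 \<notin> B"
  shows "binary_classes B = tree_class B ` {F. bin_hier B F \<and> card (maxes F) = 1}"
proof -
  have cls: "relabel_class (- (B \<union> {0})) G = tree_class B (hier B G)" if "binary_bouquet B 1 G" for G
    using relabel_class_bouquet[OF that, of "- (B \<union> {0})"] by (auto simp: tree_class_def)
  show ?thesis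
  proof (intro equalityI subsetI)
    fix X assume "X \<in> binary_classes B"
    then obtain G where "X = relabel_class (- (B \<union> {0})) G" "binary_bouquet B 1 G"
      by (auto simp: binary_classes_def)
    then show "X \<in> tree_class B ` {F. bin_hier B F \<and> card (maxes F) = 1}"
      using cls bouquet_hier(1,2) by blast
  next
    fix X assume "X \<in> tree_class B ` {F. bin_hier B F \<and> card (maxes F) = 1}"
    then obtain F where F: "X = tree_class B F" "bin_hier B F" "card (maxes F) = 1" by blast
    obtain G where "binary_bouquet B 1 G" "hier B G = F"
      using bin_hier_realised[OF F(2) assms] F(3) by metis
    then show "X \<in> binary_classes B" using cls F(1) unfolding binary_classes_def by blast
  qed
qed

lemma inj_tree_class:
  assumes "0 \<notin> B" shows "inj_on (tree_class B) {F. bin_hier B F \<and> card (maxes F) = 1}"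
proof (rule inj_onI)
  fix F F' assume F: "F \<in> {F. bin_hier B F \<and> card (maxes F) = 1}" "tree_class B F = tree_class B F'"
  then have b: "bin_hier B F" and c: "card (maxes F) = 1" by auto
  obtain G where "binary_bouquet B (card (maxes F)) G" "hier B G = F"
    using bin_hier_realised[OF b assms] .
  then have "G \<in> tree_class B F" using c by (simp add: tree_class_def)
  then have "G \<in> tree_class B F'" using F(2) by simp
  then show "F = F'" using \<open>hier B G = F\<close> by (simp add: tree_class_def)
qed

definition class_hier :: "nat set \<Rightarrow> graph set \<Rightarrow> nat set set"
  where "class_hier B X = the_inv_into {F. bin_hier B F \<and> card (maxes F) = 1} (tree_class B) X"

lemma class_hier:
  assumes "0 \<notin> B" "X \<in> binary_classes B"
  shows "bin_hier B (class_hier B X)" "B \<in> class_hier B X" "tree_class B (class_hier B X) = X"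
proof -
  have X: "X \<in> tree_class B ` {F. bin_hier B F \<and> card (maxes F) = 1}"
    using assms binary_classes_eq by simp
  have "class_hier B X \<in> {F. bin_hier B F \<and> card (maxes F) = 1}" unfolding class_hier_def
    by (rule the_inv_into_into[OF inj_tree_class[OF assms(1)] X subset_refl])
  then show "bin_hier B (class_hier B X)" "B \<in> class_hier B X" using single_max by auto
  show "tree_class B (class_hier B X) = X" unfolding class_hier_def
    by (rule f_the_inv_into_f[OF inj_tree_class[OF assms(1)] X])
qed

definition conf_hier :: "nat set set \<Rightarrow> (nat set \<Rightarrow> graph set) \<Rightarrow> nat set set"
  where "conf_hier \<pi> \<alpha> = (\<Union>B\<in>\<pi>. class_hier B (\<alpha> B))"

lemma configurationsD:
  assumes "(\<pi>, \<alpha>) \<in> configurations l r"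
  shows "partition_on {1..l} \<pi>" "card \<pi> = r" "\<alpha> \<in> (\<Pi>\<^sub>E B\<in>\<pi>. binary_classes B)"
    "B \<in> \<pi> \<Longrightarrow> 0 \<notin> B" "B \<in> \<pi> \<Longrightarrow> \<alpha> B \<in> binary_classes B"
proof -
  show p: "partition_on {1..l} \<pi>" and "card \<pi> = r" and a: "\<alpha> \<in> (\<Pi>\<^sub>E B\<in>\<pi>. binary_classes B)"
    using assms by (auto simp: configurations_def)
  have "\<Union>\<pi> = {1..l}" using partition_onD1[OF p] by simp
  then show "B \<in> \<pi> \<Longrightarrow> 0 \<notin> B" by (metis UnionI atLeastAtMost_iff not_one_le_zero)
  show "B \<in> \<pi> \<Longrightarrow> \<alpha> B \<in> binary_classes B" using a by (rule PiE_mem)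
qed

lemma conf_hier:
  assumes c: "(\<pi>, \<alpha>) \<in> configurations l r"
  shows "bin_hier {1..l} (conf_hier \<pi> \<alpha>)" "maxes (conf_hier \<pi> \<alpha>) = \<pi>"
    "B \<in> \<pi> \<Longrightarrow> {A \<in> conf_hier \<pi> \<alpha>. A \<subseteq> B} = class_hier B (\<alpha> B)"
  unfolding conf_hier_def
  using glue_hierarchies[OF configurationsD(1)[OF c], of "\<lambda>B. class_hier B (\<alpha> B)"]
    class_hier[OF configurationsD(4,5)[OF c]] by auto

text \<open>As \<open>w\<close> is a child of \<open>\<Delta>\<close>, the vertices whose path meets
  \<open>w\<close>, together with \<open>\<Delta>\<close>, are closed under parents. Leaves reaching
  such a vertex also reach \<open>w\<close>, so its cluster is the same over the smaller leaf
  set.\<close>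

lemma hanging_tree_of:
  assumes r: "reduced V p L" and b: "bin_hier L (phier p L)" and w: "w \<in> V" "w \<noteq> 0" "p w = 0"
  shows "L \<inter> verts (hanging_tree (tree_of V p) w) = clus p L w"
    "binary_bouquet (clus p L w) 1 (hanging_tree (tree_of V p) w)"
    "hier (clus p L w) (hanging_tree (tree_of V p) w) = {A \<in> phier p L. A \<subseteq> clus p L w}"
proof -
  note r1 = reducedD(1)[OF r] and r2 = reducedD(2)[OF r]
  define W where "W = {0} \<union> {v \<in> V. anc p v w}"
  define B where "B = clus p L w"
  define q where "q = (\<lambda>x. if x \<in> W - {0} then p x else 0)"
  have W: "0 \<in> W" "W \<subseteq> V" using rooted_0[OF r1] by (auto simp: W_def)
  have Wc: "p x \<in> W" if "x \<in> W" for x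
  proof (cases "x = 0 \<or> x = w")
    case True then show ?thesis using w rooted_p0[OF r1] by (auto simp: W_def)
  next
    case False
    then have "anc p (p x) w" using that anc_cases[of p x w] by (auto simp: W_def)
    then show ?thesis using that W rooted_closed[OF r1] by (auto simp: W_def)
  qed
  note q = rooted_subset[OF r1 W Wc, folded q_def]
  have verts: "{0} \<union> {v \<in> V. w \<in> set (tree_path (tree_of V p) v 0)} = W"
    unfolding W_def using tree_path_tree_of[OF r1] set_tpath[OF r1] by auto
  have edges: "{e \<in> edges (tree_of V p). e \<subseteq> W} = edges (tree_of W q)"
  proof (intro equalityI subsetI)
    fix e assume "e \<in> {e \<in> edges (tree_of V p). e \<subseteq> W}"
    then obtain x where x: "x \<in> V" "x \<noteq> 0" "e = {x, p x}" "e \<subseteq> W" by (auto simp: edges_tree_of)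
    then have "x \<in> W" "q x = p x" by (auto simp: q_def)
    then show "e \<in> edges (tree_of W q)" using x by (auto simp: edges_tree_of)
  next
    fix e assume "e \<in> edges (tree_of W q)"
    then obtain x where x: "x \<in> W" "x \<noteq> 0" "e = {x, p x}" by (auto simp: edges_tree_of q_def)
    then have "e \<subseteq> W" "x \<in> V" using Wc W by auto
    then show "e \<in> {e \<in> edges (tree_of V p). e \<subseteq> W}" using x by (auto simp: edges_tree_of)
  qed
  have H: "hanging_tree (tree_of V p) w = tree_of W q"
    unfolding hanging_tree_def Let_def verts_tree_of verts edges by (simp add: prod_eq_iff)
  have LW: "L \<inter> W = B" using r2 by (auto simp: B_def W_def clus_def)
  have cl: "clus q B v = clus p L v" if v: "v \<in> W" "v \<noteq> 0" for v
  proof -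
    have "anc p v w" using v by (auto simp: W_def)
    then have "i \<in> B" if "i \<in> L" "anc p i v" for i using that anc_trans unfolding B_def clus_def by blast
    then show ?thesis using q(2) LW unfolding clus_def by blast
  qed
  have red: "reduced W q B" unfolding reduced_def
  proof (intro conjI ballI)
    show "rooted W q" by (rule q(1))
    show "B \<subseteq> W - {0}" using LW r2 by auto
    have "inj_on (clus p L) (W - {0})" using reducedD(3)[OF r] W by (auto intro: inj_on_subset)
    then show "inj_on (clus q B) (W - {0})" using cl by (auto simp: inj_on_def)
    show "clus q B v \<noteq> {}" if "v \<in> W - {0}" for v using that cl[of v] reducedD(4)[OF r, of v] W by auto
  qed
  have ph: "phier q B = {A \<in> phier p L. A \<subseteq> B}"
  proof -
    have "phier q B = clus p L ` (W - {0})" unfolding reduced_phier[OF red] using cl by (auto simp: image_iff)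
    also have "W - {0} = {v \<in> V - {0}. clus p L v \<subseteq> B}"
      using reduced_anc_iff[OF r _ _ w(1,2)] by (auto simp: W_def B_def)
    also have "clus p L ` \<dots> = {A \<in> phier p L. A \<subseteq> B}" unfolding reduced_phier[OF r] by auto
    finally show ?thesis .
  qed
  have "B \<in> phier p L" using w reduced_phier[OF r] by (auto simp: B_def)
  note br = bin_hier_restrict[OF b this]
  show "L \<inter> verts (hanging_tree (tree_of V p) w) = clus p L w" using H LW B_def by simp
  show "binary_bouquet (clus p L w) 1 (hanging_tree (tree_of V p) w)"
    using reduced_bouquet[OF red] br unfolding H B_def[symmetric] ph by simp
  show "hier (clus p L w) (hanging_tree (tree_of V p) w) = {A \<in> phier p L. A \<subseteq> clus p L w}"
    using hier_tree_of[OF q(1), of B] ph H by (simp add: B_def)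
qed

text \<open>A hierarchy is the union of its restrictions to its maximal members, and the hanging
  trees have exactly these restrictions as hierarchies. So the blockwise conditions on
  \<open>\<alpha>\<close> add up to one equality of families.\<close>

lemma represents_iff:
  assumes c: "(\<pi>, \<alpha>) \<in> configurations l r"
  shows "represents {1..l} G \<pi> \<alpha> \<longleftrightarrow> binary_bouquet {1..l} r G \<and> hier {1..l} G = conf_hier \<pi> \<alpha>"
proof (cases "binary_bouquet {1..l} r G")
  case True
  let ?L = "{1..l}"
  obtain V p where G: "G = tree_of V p" and red: "reduced V p ?L" and b: "bin_hier ?L (phier p ?L)"
    and h: "hier ?L G = phier p ?L" using bouquet_graph[OF True] by metis
  have ch: "children G 0 = {w \<in> V - {0}. p w = 0}" unfolding G by (rule children_tree_of[OF reducedD(1)[OF red]])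
  have mx: "clus p ?L ` children G 0 = maxes (hier ?L G)"
  proof -
    have "maxes (phier p ?L) = clus p ?L ` {w \<in> V - {0}. clus p ?L w \<in> maxes (phier p ?L)}"
      using reduced_phier[OF red] by (auto simp: maxes_def)
    also have "{w \<in> V - {0}. clus p ?L w \<in> maxes (phier p ?L)} = {w \<in> V - {0}. p w = 0}"
      using reduced_top[OF red] by auto
    finally show ?thesis unfolding h ch by simp
  qed
  note hang = hanging_tree_of[OF red b, folded G h]
  have im: "(\<lambda>w. ?L \<inter> verts (hanging_tree G w)) ` children G 0 = maxes (hier ?L G)"
    using hang(1) unfolding mx[symmetric] ch by (intro image_cong) auto
  have mem: "hanging_tree G w \<in> \<alpha> (?L \<inter> verts (hanging_tree G w)) \<longleftrightarrow>
      {A \<in> hier ?L G. A \<subseteq> clus p ?L w} = class_hier (clus p ?L w) (\<alpha> (clus p ?L w))"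
    if w: "w \<in> children G 0" and m: "maxes (hier ?L G) = \<pi>" for w
  proof -
    have B: "clus p ?L w \<in> \<pi>" using mx m w by blast
    have wV: "w \<in> V" "w \<noteq> 0" "p w = 0" using w ch by auto
    have "\<alpha> (clus p ?L w) = tree_class (clus p ?L w) (class_hier (clus p ?L w) (\<alpha> (clus p ?L w)))"
      using class_hier(3)[OF configurationsD(4)[OF c B] configurationsD(5)[OF c B]] by simp
    then show ?thesis unfolding hang(1)[OF wV] using hang(2,3)[OF wV] unfolding tree_class_def by auto
  qed
  have cd: "card \<pi> = r" using configurationsD(2)[OF c] .
  show ?thesis
  proof
    assume R: "represents ?L G \<pi> \<alpha>"
    then have m: "maxes (hier ?L G) = \<pi>" using im by (simp add: represents_def)
    have "{A \<in> hier ?L G. A \<subseteq> B} = class_hier B (\<alpha> B)" if B: "B \<in> \<pi>" for B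
    proof -
      obtain w where "w \<in> children G 0" "B = clus p ?L w" using B m mx by blast
      then show ?thesis using R mem[OF _ m] by (simp add: represents_def)
    qed
    moreover have "hier ?L G = (\<Union>B\<in>\<pi>. {A \<in> hier ?L G. A \<subseteq> B})"
      using partition_maxes(2)[of ?L "hier ?L G"] b h m by (simp add: bin_hier_def)
    ultimately show "binary_bouquet ?L r G \<and> hier ?L G = conf_hier \<pi> \<alpha>"
      using True by (simp add: conf_hier_def)
  next
    assume R: "binary_bouquet ?L r G \<and> hier ?L G = conf_hier \<pi> \<alpha>"
    then have m: "maxes (hier ?L G) = \<pi>" using conf_hier(2)[OF c] by simp
    have "hanging_tree G w \<in> \<alpha> (?L \<inter> verts (hanging_tree G w))" if w: "w \<in> children G 0" for w
    proof -
      have "clus p ?L w \<in> \<pi>" using mx m w by blast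
      then show ?thesis using mem[OF w m] conf_hier(3)[OF c] R by simp
    qed
    then show "represents ?L G \<pi> \<alpha>" using True im m cd by (simp add: represents_def)
  qed
next
  case False
  then show ?thesis using configurationsD(2)[OF c] by (auto simp: represents_def)
qed

lemma bij_conf_hier:
  "bij_betw (\<lambda>(\<pi>, \<alpha>). conf_hier \<pi> \<alpha>) (configurations l r) {F. bin_hier {1..l} F \<and> card (maxes F) = r}"
  unfolding bij_betw_def
proof (intro conjI)
  show "inj_on (\<lambda>(\<pi>, \<alpha>). conf_hier \<pi> \<alpha>) (configurations l r)"
  proof (rule inj_onI, clarify)
    fix \<pi> \<alpha> \<pi>' \<alpha>' assume c: "(\<pi>, \<alpha>) \<in> configurations l r" and c': "(\<pi>', \<alpha>') \<in> configurations l r"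
      and e: "conf_hier \<pi> \<alpha> = conf_hier \<pi>' \<alpha>'"
    have p: "\<pi> = \<pi>'" using conf_hier(2)[OF c] conf_hier(2)[OF c'] e by simp
    have "\<alpha> B = \<alpha>' B" if B: "B \<in> \<pi>" for B
    proof -
      have "class_hier B (\<alpha> B) = class_hier B (\<alpha>' B)"
        using conf_hier(3)[OF c B] conf_hier(3)[OF c', of B] B p e by simp
      then show ?thesis using class_hier(3)[OF configurationsD(4)[OF c B] configurationsD(5)[OF c B]]
          class_hier(3)[OF configurationsD(4)[OF c'] configurationsD(5)[OF c'], of B] B p by simp
    qed
    then have "\<alpha> = \<alpha>'" using PiE_ext configurationsD(3)[OF c] configurationsD(3)[OF c'] p by metis
    then show "\<pi> = \<pi>' \<and> \<alpha> = \<alpha>'" using p by simp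
  qed
  show "(\<lambda>(\<pi>, \<alpha>). conf_hier \<pi> \<alpha>) ` configurations l r = {F. bin_hier {1..l} F \<and> card (maxes F) = r}"
  proof (intro equalityI subsetI)
    fix F assume "F \<in> (\<lambda>(\<pi>, \<alpha>). conf_hier \<pi> \<alpha>) ` configurations l r"
    then obtain \<pi> \<alpha> where c: "(\<pi>, \<alpha>) \<in> configurations l r" "F = conf_hier \<pi> \<alpha>" by auto
    then show "F \<in> {F. bin_hier {1..l} F \<and> card (maxes F) = r}"
      using conf_hier(1,2)[OF c(1)] configurationsD(2)[OF c(1)] by simp
  next
    fix F assume "F \<in> {F. bin_hier {1..l} F \<and> card (maxes F) = r}"
    then have F: "bin_hier {1..l} F" "card (maxes F) = r" by auto
    then have lam: "laminar_on {1..l} F" by (simp add: bin_hier_def)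
    define \<alpha> where "\<alpha> = (\<lambda>B\<in>maxes F. tree_class B {A \<in> F. A \<subseteq> B})"
    have B: "B \<in> F" "0 \<notin> B" if "B \<in> maxes F" for B
      using that laminar_onD(3)[OF lam, of B] by (auto simp: maxes_def)
    have mem: "{A \<in> F. A \<subseteq> B} \<in> {F. bin_hier B F \<and> card (maxes F) = 1}" if "B \<in> maxes F" for B
      using bin_hier_restrict[OF F(1) B(1)[OF that]] by simp
    have c: "(maxes F, \<alpha>) \<in> configurations l r"
      using partition_maxes(1)[OF lam] F(2) binary_classes_eq[OF B(2)] mem
      by (auto simp: configurations_def \<alpha>_def)
    have "class_hier B (\<alpha> B) = {A \<in> F. A \<subseteq> B}" if "B \<in> maxes F" for B
      using the_inv_into_f_f[OF inj_tree_class[OF B(2)[OF that]] mem[OF that]] that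
      by (simp add: class_hier_def \<alpha>_def)
    then have "conf_hier (maxes F) \<alpha> = F" using partition_maxes(2)[OF lam] by (simp add: conf_hier_def)
    then show "F \<in> (\<lambda>(\<pi>, \<alpha>). conf_hier \<pi> \<alpha>) ` configurations l r" using c by force
  qed
qed

text \<open>If the classes agree, the reduction itself, being its own relabelling by the identity,
  lies in the bouquet class and has its hierarchy. Conversely both classes consist of all bouquets
  with labels up to \<open>N\<close> and that hierarchy.\<close>

lemma Q_class_iff:
  assumes c: "(\<pi>, \<alpha>) \<in> configurations l r" and p: "rooted {0..N} p" and N: "l \<le> N"
  shows "Q_class l N (tree_of {0..N} p) = bouquet_class l N \<pi> \<alpha> \<longleftrightarrow> phier p {1..l} = conf_hier \<pi> \<alpha>"
proof -
  let ?L = "{1..l}" and ?T = "tree_of {0..N} p"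
  have L: "?L \<subseteq> {0..N} - {0}" using N by auto
  have red: "reduction ?T ?L = tree_of (red_verts p ?L) (red_par p ?L)" by (rule reduction_tree_of[OF p L])
  have hr: "hier ?L (reduction ?T ?L) = phier p ?L"
    unfolding red hier_tree_of[OF rooted_red[OF p L]] by (rule phier_red[OF p L])
  have bc: "bouquet_class l N \<pi> \<alpha> =
      {G. binary_bouquet ?L r G \<and> hier ?L G = conf_hier \<pi> \<alpha> \<and> verts G \<subseteq> ?L \<union> {0} \<union> {l+1..N}}"
  proof -
    have "?L \<union> {0} \<union> {l+1..N} = {0..N}" using N by auto
    then show ?thesis unfolding bouquet_class_def represents_iff[OF c] by auto
  qed
  show ?thesis
  proof
    assume e: "Q_class l N ?T = bouquet_class l N \<pi> \<alpha>"
    have "relabel id (reduction ?T ?L) = reduction ?T ?L" by (simp add: relabel_def)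
    then have "reduction ?T ?L \<in> Q_class l N ?T"
      unfolding Q_class_def relabel_class_def using permutes_id by (metis (mono_tags, lifting) mem_Collect_eq)
    then show "phier p ?L = conf_hier \<pi> \<alpha>" using e bc hr by simp
  next
    assume e: "phier p ?L = conf_hier \<pi> \<alpha>"
    have b: "bin_hier ?L (phier p ?L)" using conf_hier(1)[OF c] e by simp
    have sg: "\<And>i. i \<in> ?L \<Longrightarrow> {i} \<in> phier p ?L" using b laminar_onD(5) unfolding bin_hier_def by blast
    have "binary_bouquet ?L r (reduction ?T ?L)"
      using reduced_bouquet[OF red_reduced[OF p L sg]] phier_red[OF p L] b e conf_hier(2)[OF c]
        configurationsD(2)[OF c] red by simp
    moreover have "verts (reduction ?T ?L) \<subseteq> ?L \<union> {0} \<union> {l+1..N}"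
    proof -
      have "red_verts p ?L \<subseteq> {0..N}" using red_span[OF p L] span_subset[OF p L] by blast
      then show ?thesis unfolding red by auto
    qed
    ultimately show "Q_class l N ?T = bouquet_class l N \<pi> \<alpha>"
      unfolding Q_class_def bc using relabel_class_bouquet[of ?L r "reduction ?T ?L" "{l+1..N}"] hr e by auto
  qed
qed

section \<open>Counting binary hierarchies\<close>

definition hiers :: "nat set \<Rightarrow> nat \<Rightarrow> nat set set set"
  where "hiers L r = {F. bin_hier L F \<and> card (maxes F) = r}"

text \<open>Insertion of a leaf \<open>x\<close> on the edge below the vertex with cluster \<open>A\<close>.\<close>

definition ins_leaf :: "nat \<Rightarrow> nat set set \<Rightarrow> nat set \<Rightarrow> nat set set"
  where "ins_leaf x F A = insert {x} ({C \<in> F. \<not> A \<subset> C} \<union> insert x ` {C \<in> F. A \<subseteq> C})"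

text \<open>Deleting \<open>x\<close> turns \<open>{x}\<close> into the empty set, which is
  discarded, and lets \<open>A\<close> and \<open>insert x A\<close> coincide again.\<close>

definition del_leaf :: "nat \<Rightarrow> nat set set \<Rightarrow> nat set set"
  where "del_leaf x F = (\<lambda>C. C - {x}) ` F - {{}}"

context
  fixes B :: "nat set" and x :: nat
  assumes x: "x \<notin> B"
begin

lemma ins_top:
  assumes F: "bin_hier B F"
  shows "bin_hier (insert x B) (insert {x} F)" "maxes (insert {x} F) = insert {x} (maxes F)"
    "{x} \<notin> F" "del_leaf x (insert {x} F) = F"
proof -
  have l: "laminar_on B F" using F by (simp add: bin_hier_def)
  have xC: "x \<notin> C" if "C \<in> F" for C using laminar_onD(3)[OF l that] x by auto
  show nx: "{x} \<notin> F" using xC by blast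
  have "laminar_on (insert x B) (insert {x} F)"
    unfolding laminar_on_def
  proof (intro conjI ballI)
    show "finite (insert x B)" using laminar_onD(1)[OF l] by simp
    show "insert {x} F \<subseteq> Pow (insert x B) - {{}}" using laminar_onD(3,4)[OF l] by auto
    show "{i} \<in> insert {x} F" if "i \<in> insert x B" for i using that laminar_onD(5)[OF l] by auto
    show "A \<inter> C = {} \<or> A \<subseteq> C \<or> C \<subseteq> A" if "A \<in> insert {x} F" "C \<in> insert {x} F" for A C
      using that laminar_onD(6)[OF l, of A C] xC[of A] xC[of C] by auto
  qed
  then show "bin_hier (insert x B) (insert {x} F)" using F unfolding bin_hier_def by auto
  show "maxes (insert {x} F) = insert {x} (maxes F)"
    using xC laminar_onD(4)[OF l] unfolding maxes_def by auto
  have "(\<lambda>C. C - {x}) ` F = F" using xC by (force simp: image_iff)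
  then show "del_leaf x (insert {x} F) = F" using laminar_onD(4)[OF l] by (auto simp: del_leaf_def)
qed

text \<open>Besides \<open>{x}\<close> there is one new member, the node \<open>insert x A\<close>;
  the members strictly above \<open>A\<close> just gain \<open>x\<close>. Deletion recovers
  \<open>F\<close>, and the least member strictly containing \<open>{x}\<close> recovers
  \<open>A\<close>, so insertion is injective in both arguments.\<close>

lemma ins_leaf:
  assumes F: "bin_hier B F" and A: "A \<in> F"
  shows "bin_hier (insert x B) (ins_leaf x F A)" "card (maxes (ins_leaf x F A)) = card (maxes F)"
    "del_leaf x (ins_leaf x F A) = F" "up_set (ins_leaf x F A) {x} = insert x A"
    "card (ins_leaf x F A) = card F + 2" "{x} \<notin> maxes (ins_leaf x F A)"
proof -
  let ?F = "ins_leaf x F A"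
  have l: "laminar_on B F" using F by (simp add: bin_hier_def)
  have xC: "x \<notin> C" if "C \<in> F" for C using laminar_onD(3)[OF l that] x by auto
  have ne: "C \<noteq> {}" if "C \<in> F" for C using laminar_onD(4)[OF l that] .
  have mem: "E \<in> ?F \<longleftrightarrow> E = {x} \<or> (E \<in> F \<and> \<not> A \<subset> E) \<or> (\<exists>C\<in>F. A \<subseteq> C \<and> E = insert x C)" for E
    by (auto simp: ins_leaf_def)
  have cmp: "C \<subseteq> D" if "C \<in> F" "\<not> A \<subset> C" "D \<in> F" "A \<subseteq> D" "C \<inter> D \<noteq> {}" for C D
    using laminar_onD(6)[OF l that(1,3,5)] that by blast
  have cmp2: "C \<subseteq> D \<or> D \<subseteq> C" if "C \<in> F" "D \<in> F" "A \<subseteq> C" "A \<subseteq> D" for C D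
    using laminar_onD(6)[OF l that(1,2)] that ne[OF A] by blast
  have lam: "laminar_on (insert x B) ?F"
    unfolding laminar_on_def
  proof (intro conjI ballI)
    show "finite (insert x B)" using laminar_onD(1)[OF l] by simp
    show "?F \<subseteq> Pow (insert x B) - {{}}"
    proof
      fix E assume "E \<in> ?F"
      then show "E \<in> Pow (insert x B) - {{}}" unfolding mem
      proof (elim disjE conjE bexE)
        assume "E \<in> F" then show ?thesis using laminar_onD(3)[OF l, of E] ne[of E] by auto
      next
        fix C assume "C \<in> F" "E = insert x C"
        then show ?thesis using laminar_onD(3)[OF l, of C] by auto
      qed simp
    qed
    show "{i} \<in> ?F" if "i \<in> insert x B" for i
    proof (cases "i = x")
      case False
      then have "{i} \<in> F" "\<not> A \<subset> {i}" using that laminar_onD(5)[OF l] ne[OF A] by auto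
      then show ?thesis by (simp add: mem)
    qed (simp add: mem)
    fix E E' assume E: "E \<in> ?F" "E' \<in> ?F"
    have main: "E \<inter> E' = {} \<or> E \<subseteq> E' \<or> E' \<subseteq> E" if "E \<in> F" "\<not> A \<subset> E" "E' \<in> ?F" for E E'
      using that(3) unfolding mem
    proof (elim disjE conjE bexE)
      assume "E' = {x}" then show ?thesis using xC that by auto
    next
      assume "E' \<in> F" then show ?thesis using laminar_onD(6)[OF l, of E E'] that by auto
    next
      fix C assume C: "C \<in> F" "A \<subseteq> C" "E' = insert x C"
      then show ?thesis using cmp[OF that(1,2) C(1,2)] xC[OF that(1)] by auto
    qed
    consider "E \<in> F \<and> \<not> A \<subset> E" | "E' \<in> F \<and> \<not> A \<subset> E'" | "E = {x} \<or> (\<exists>C\<in>F. A \<subseteq> C \<and> E = insert x C)"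
        "E' = {x} \<or> (\<exists>C\<in>F. A \<subseteq> C \<and> E' = insert x C)"
      using E unfolding mem by blast
    then show "E \<inter> E' = {} \<or> E \<subseteq> E' \<or> E' \<subseteq> E"
    proof cases
      case 1 then show ?thesis using main E by blast
    next
      case 2 then show ?thesis using main[of E' E] E by blast
    next
      case 3
      show ?thesis
      proof (cases "E = {x} \<or> E' = {x}")
        case True then show ?thesis using 3 by auto
      next
        case False
        then obtain C D where "C \<in> F" "A \<subseteq> C" "E = insert x C" "D \<in> F" "A \<subseteq> D" "E' = insert x D"
          using 3 by blast
        then show ?thesis using cmp2[of C D] by auto
      qed
    qed
  qed
  show "bin_hier (insert x B) ?F" unfolding bin_hier_def
  proof (intro conjI lam ballI impI)
    fix E assume E: "E \<in> ?F" "card E \<noteq> 1"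
    then consider "E \<in> F" "\<not> A \<subset> E" | C where "C \<in> F" "A \<subseteq> C" "E = insert x C" unfolding mem by auto
    then show "\<exists>A1\<in>?F. \<exists>A2\<in>?F. A1 \<inter> A2 = {} \<and> A1 \<union> A2 = E"
    proof cases
      case 1
      then obtain A1 A2 where s: "A1 \<in> F" "A2 \<in> F" "A1 \<inter> A2 = {}" "A1 \<union> A2 = E"
        using F E(2) unfolding bin_hier_def by blast
      then have "A1 \<in> ?F" "A2 \<in> ?F" using 1(2) unfolding mem by auto
      then show ?thesis using s by blast
    next
      case 2
      show ?thesis
      proof (cases "C = A")
        case True
        have "{x} \<in> ?F" "A \<in> ?F" using A by (auto simp: mem)
        moreover have "{x} \<inter> A = {}" "{x} \<union> A = E" using xC[OF A] 2 True by auto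
        ultimately show ?thesis by blast
      next
        case False
        have "card C \<noteq> 1"
        proof
          assume "card C = 1"
          then obtain c where "C = {c}" by (auto simp: card_1_singleton_iff)
          then show False using 2(2) False ne[OF A] by auto
        qed
        then obtain D1 D2 where s: "D1 \<in> F" "D2 \<in> F" "D1 \<inter> D2 = {}" "D1 \<union> D2 = C"
          using F 2(1) unfolding bin_hier_def by blast
        \<comment> \<open>If \<open>A\<close> lay in neither part it would meet both, hence contain
          both by laminarity, and so equal \<open>C\<close>.\<close>
        have or: "A \<subseteq> D1 \<or> A \<subseteq> D2"
        proof (rule ccontr)
          assume n: "\<not> ?thesis"
          then have "A \<inter> D1 \<noteq> {}" "A \<inter> D2 \<noteq> {}" using 2(2) s(4) by auto
          then have "D1 \<subseteq> A" "D2 \<subseteq> A" using laminar_onD(6)[OF l A s(1)] laminar_onD(6)[OF l A s(2)] n by auto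
          then show False using s(4) 2(2) False by auto
        qed
        have fin: "?thesis" if d: "D1 \<in> F" "D2 \<in> F" "D1 \<inter> D2 = {}" "D1 \<union> D2 = C" "A \<subseteq> D1" for D1 D2
        proof -
          have "insert x D1 \<in> ?F" using d by (auto simp: mem)
          moreover have "\<not> A \<subset> D2" using d ne[OF A] by auto
          then have "D2 \<in> ?F" using d by (auto simp: mem)
          moreover have "insert x D1 \<inter> D2 = {}" "insert x D1 \<union> D2 = E" using d xC[OF d(2)] 2(3) by auto
          ultimately show ?thesis by blast
        qed
        show ?thesis using or fin[OF s] fin[of D2 D1] s by (metis Int_commute Un_commute)
      qed
    qed
  qed
  have "(\<lambda>C. C - {x}) ` ?F - {{}} = {C \<in> F. \<not> A \<subset> C} \<union> {C \<in> F. A \<subseteq> C}" (is "?l = ?r")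
  proof (intro equalityI subsetI)
    fix E assume "E \<in> ?l"
    then obtain E' where E': "E' \<in> ?F" "E = E' - {x}" "E \<noteq> {}" by auto
    then show "E \<in> ?r" unfolding mem using xC by auto
  next
    fix E assume "E \<in> ?r"
    then have E: "E \<in> F" "\<not> A \<subset> E \<or> A \<subseteq> E" by auto
    have "E = E - {x}" "E = insert x E - {x}" using xC[OF E(1)] by auto
    moreover have "E \<in> ?F \<or> insert x E \<in> ?F" using E unfolding mem by blast
    ultimately show "E \<in> ?l" using ne[OF E(1)] by blast
  qed
  also have "\<dots> = F" by auto
  finally show "del_leaf x ?F = F" by (simp add: del_leaf_def)
  have "{E \<in> ?F. {x} \<subset> E} = insert x ` {C \<in> F. A \<subseteq> C}" (is "?l = ?r")
  proof (intro equalityI subsetI)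
    fix E assume "E \<in> ?l" then show "E \<in> ?r" using xC by (auto simp: mem)
  next
    fix E assume "E \<in> ?r"
    then obtain C where C: "C \<in> F" "A \<subseteq> C" "E = insert x C" by auto
    then have "{x} \<subset> E" using xC[OF C(1)] ne[OF C(1)] by auto
    then show "E \<in> ?l" using C by (auto simp: mem)
  qed
  then show "up_set ?F {x} = insert x A" using A unfolding up_set_def by auto
  have "insert x A \<in> ?F" using A by (auto simp: mem)
  then show "{x} \<notin> maxes ?F" using xC[OF A] ne[OF A] by (auto simp: maxes_def)
  \<comment> \<open>\<open>f\<close> carries the old maximal members to the new ones: only the one
    containing \<open>A\<close> gains \<open>x\<close>.\<close>
  define f where "f = (\<lambda>M. if A \<subseteq> M then insert x M else M)"
  have fF: "f M \<in> ?F" if "M \<in> F" for M using that by (auto simp: mem f_def)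
  have below: "\<exists>M\<in>maxes F. E \<subseteq> f M" if "E \<in> ?F" for E
    using that unfolding mem
  proof (elim disjE conjE bexE)
    assume "E = {x}"
    then show ?thesis using below_max[OF l A] by (auto simp: f_def)
  next
    assume "E \<in> F"
    then obtain M where "M \<in> maxes F" "E \<subseteq> M" using below_max[OF l] by blast
    then show ?thesis by (auto simp: f_def)
  next
    fix C assume C: "C \<in> F" "A \<subseteq> C" "E = insert x C"
    obtain M where "M \<in> maxes F" "C \<subseteq> M" using below_max[OF l C(1)] by blast
    then show ?thesis using C by (auto simp: f_def)
  qed
  have "maxes ?F = f ` maxes F"
  proof (intro equalityI subsetI)
    fix E assume E: "E \<in> maxes ?F"
    then have "E \<in> ?F" and mx: "\<And>C. C \<in> ?F \<Longrightarrow> E \<subseteq> C \<Longrightarrow> C = E" unfolding maxes_def by blast+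
    then obtain M where M: "M \<in> maxes F" "E \<subseteq> f M" using below by blast
    then have "M \<in> F" by (simp add: maxes_def)
    then have "f M = E" using mx[OF fF] M by simp
    then show "E \<in> f ` maxes F" using M by blast
  next
    fix E assume "E \<in> f ` maxes F"
    then obtain M where "M \<in> maxes F" and EM: "E = f M" by blast
    then have M: "M \<in> F" "\<And>C. C \<in> F \<Longrightarrow> M \<subseteq> C \<Longrightarrow> C = M" "E = f M" unfolding maxes_def by blast+
    have "E' = E" if E': "E' \<in> ?F" "E \<subseteq> E'" for E'
    proof -
      obtain M' where M': "M' \<in> maxes F" "E' \<subseteq> f M'" using below E' by blast
      have "M \<subseteq> M'" using E'(2) M'(2) M(3) xC[OF M(1)] by (auto simp: f_def split: if_splits)
      moreover have "M' \<in> F" using M'(1) by (simp add: maxes_def)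
      ultimately have "M' = M" using M(2)[of M'] by simp
      then show ?thesis using E' M' M(3) by auto
    qed
    then show "E \<in> maxes ?F" using fF[OF M(1)] M(3) unfolding maxes_def by blast
  qed
  moreover have "inj_on f (maxes F)"
  proof (rule inj_onI)
    fix M M' assume "M \<in> maxes F" "M' \<in> maxes F" "f M = f M'"
    moreover have "f C - {x} = C" if "C \<in> maxes F" for C
      using that xC[of C] by (auto simp: f_def maxes_def)
    ultimately show "M = M'" by metis
  qed
  ultimately show "card (maxes ?F) = card (maxes F)" by (simp add: card_image)
  have finF: "finite F" using laminar_onD(2)[OF l] .
  have c0: "card (insert x ` {C \<in> F. A \<subseteq> C}) = card {C \<in> F. A \<subseteq> C}"
  proof (rule card_image, rule inj_onI)
    fix C D assume "C \<in> {C \<in> F. A \<subseteq> C}" "D \<in> {C \<in> F. A \<subseteq> C}" "insert x C = insert x D"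
    then show "C = D" using xC[of C] xC[of D] by auto
  qed
  have "{C \<in> F. A \<subseteq> C} = insert A {C \<in> F. A \<subset> C}" using A by auto
  then have "card {C \<in> F. A \<subseteq> C} = Suc (card {C \<in> F. A \<subset> C})" using finF by simp
  then have c1: "card (insert x ` {C \<in> F. A \<subseteq> C}) = Suc (card {C \<in> F. A \<subset> C})" using c0 by simp
  have "F = {C \<in> F. \<not> A \<subset> C} \<union> {C \<in> F. A \<subset> C}" by auto
  then have "card F = card {C \<in> F. \<not> A \<subset> C} + card {C \<in> F. A \<subset> C}"
    using card_Un_disjoint[of "{C \<in> F. \<not> A \<subset> C}" "{C \<in> F. A \<subset> C}"] finF by auto
  moreover have "card ({C \<in> F. \<not> A \<subset> C} \<union> insert x ` {C \<in> F. A \<subseteq> C}) =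
      card {C \<in> F. \<not> A \<subset> C} + card (insert x ` {C \<in> F. A \<subseteq> C})"
    using finF xC by (intro card_Un_disjoint) auto
  moreover have "{x} \<notin> {C \<in> F. \<not> A \<subset> C} \<union> insert x ` {C \<in> F. A \<subseteq> C}"
  proof -
    have "insert x C \<noteq> {x}" if "C \<in> F" for C using xC[OF that] ne[OF that] by auto
    then show ?thesis using xC by blast
  qed
  ultimately show "card ?F = card F + 2" using c1 finF by (simp add: ins_leaf_def)
qed

text \<open>If \<open>{x}\<close> is maximal, \<open>x\<close> hangs directly from
  \<open>\<Delta>\<close> and is removed alone. Otherwise the least member \<open>P\<close> strictly
  above \<open>{x}\<close> splits into \<open>{x}\<close> and a set \<open>A\<close>, and
  \<open>x\<close> was inserted at \<open>A\<close>.\<close>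

lemma del_cases:
  assumes F': "bin_hier (insert x B) F'"
  obtains (top) F where "bin_hier B F" "F' = insert {x} F"
  | (leaf) F A where "bin_hier B F" "A \<in> F" "F' = ins_leaf x F A"
proof (cases "{x} \<in> maxes F'")
  case True
  have l: "laminar_on (insert x B) F'" using F' by (simp add: bin_hier_def)
  let ?F = "F' - {{x}}"
  have x': "x \<notin> C" if "C \<in> ?F" for C
  proof
    assume "x \<in> C"
    then have "{x} \<subseteq> C" by simp
    then have "C = {x}" using True that unfolding maxes_def by blast
    then show False using that by simp
  qed
  have "laminar_on B ?F" unfolding laminar_on_def
  proof (intro conjI ballI)
    show "finite B" using laminar_onD(1)[OF l] by simp
    show "?F \<subseteq> Pow B - {{}}" using laminar_onD(3,4)[OF l] x' by blast
    show "{i} \<in> ?F" if "i \<in> B" for i using that x laminar_onD(5)[OF l, of i] by auto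
    show "A \<inter> C = {} \<or> A \<subseteq> C \<or> C \<subseteq> A" if "A \<in> ?F" "C \<in> ?F" for A C
      using that laminar_onD(6)[OF l, of A C] by auto
  qed
  moreover have "\<exists>A1\<in>?F. \<exists>A2\<in>?F. A1 \<inter> A2 = {} \<and> A1 \<union> A2 = A" if A: "A \<in> ?F" "card A \<noteq> 1" for A
  proof -
    obtain A1 A2 where s: "A1 \<in> F'" "A2 \<in> F'" "A1 \<inter> A2 = {}" "A1 \<union> A2 = A"
      using F' A unfolding bin_hier_def by blast
    then have "A1 \<noteq> {x}" "A2 \<noteq> {x}" using x'[OF A(1)] by auto
    then show ?thesis using s by blast
  qed
  ultimately have "bin_hier B ?F" by (simp add: bin_hier_def)
  moreover have "F' = insert {x} ?F" using True by (auto simp: maxes_def)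
  ultimately show ?thesis using top by blast
next
  case False
  have l: "laminar_on (insert x B) F'" using F' by (simp add: bin_hier_def)
  have xF: "{x} \<in> F'" using laminar_onD(5)[OF l] by simp
  define P where "P = up_set F' {x}"
  note P = up_set[OF l xF False, folded P_def]
  have "card P \<noteq> 1" using P(2) by (auto simp: card_1_singleton_iff)
  then obtain A1 A2 where s: "A1 \<in> F'" "A2 \<in> F'" "A1 \<inter> A2 = {}" "A1 \<union> A2 = P"
    using F' P(1) unfolding bin_hier_def by blast
  \<comment> \<open>A part that contains \<open>x\<close> and is larger than \<open>{x}\<close>
    contains all of \<open>P\<close>, which leaves the other part empty.\<close>
  have one: "A1 = {x}" if "A1 \<in> F'" "A2 \<in> F'" "A1 \<inter> A2 = {}" "A1 \<union> A2 = P" "x \<in> A1" for A1 A2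
  proof (rule ccontr)
    assume "A1 \<noteq> {x}"
    then have "P \<subseteq> A1" using P(3)[OF that(1)] that(5) by blast
    then have "A2 = {}" using that by blast
    then show False using laminar_onD(4)[OF l that(2)] by simp
  qed
  define A where "A = P - {x}"
  have AF: "A \<in> F'"
  proof (cases "x \<in> A1")
    case True
    then have "A2 = A" using one[OF s True] s(3,4) by (auto simp: A_def)
    then show ?thesis using s by simp
  next
    case False
    then have "x \<in> A2" using P(2) s(4) by blast
    then have "A2 = {x}" using one[of A2 A1] s by (simp add: Int_commute Un_commute)
    then have "A1 = A" using s(3,4) by (auto simp: A_def)
    then show ?thesis using s by simp
  qed
  have xA: "x \<notin> A" and PA: "P = insert x A" using P(2) by (auto simp: A_def)
  have Ane: "A \<noteq> {}" using laminar_onD(4)[OF l AF] .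
  have big: "P \<subseteq> C" if "C \<in> F'" "x \<in> C" "C \<noteq> {x}" for C using P(3)[OF that(1)] that by blast
  have nA: "\<not> A \<subset> C" if C: "C \<in> F'" "x \<notin> C" for C
  proof
    assume a: "A \<subset> C"
    then have "C \<inter> P \<noteq> {}" using Ane PA by auto
    then have "C \<subseteq> P \<or> P \<subseteq> C" using laminar_onD(6)[OF l C(1) P(1)] by simp
    then show False using a C(2) PA by auto
  qed
  define F where "F = del_leaf x F'"
  have memF: "E \<in> F \<longleftrightarrow> (E \<in> F' \<and> x \<notin> E) \<or> (\<exists>C\<in>F'. P \<subseteq> C \<and> E = C - {x})" for E
  proof
    assume "E \<in> F"
    then obtain C where C: "C \<in> F'" "E = C - {x}" "E \<noteq> {}" by (auto simp: F_def del_leaf_def)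
    show "(E \<in> F' \<and> x \<notin> E) \<or> (\<exists>C\<in>F'. P \<subseteq> C \<and> E = C - {x})"
    proof (cases "x \<in> C")
      case True
      then have "P \<subseteq> C" using big[of C] C by auto
      then show ?thesis using C by blast
    next
      case False then show ?thesis using C by simp
    qed
  next
    assume "(E \<in> F' \<and> x \<notin> E) \<or> (\<exists>C\<in>F'. P \<subseteq> C \<and> E = C - {x})"
    then show "E \<in> F"
    proof (elim disjE conjE bexE)
      assume "E \<in> F'" "x \<notin> E"
      then have "E = E - {x}" "E \<noteq> {}" using laminar_onD(4)[OF l] by auto
      then show ?thesis using \<open>E \<in> F'\<close> unfolding F_def del_leaf_def by blast
    next
      fix C assume C: "C \<in> F'" "P \<subseteq> C" "E = C - {x}"
      then have "E \<noteq> {}" using PA Ane xA by auto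
      then show ?thesis using C unfolding F_def del_leaf_def by blast
    qed
  qed
  have rep: "\<exists>C\<in>F'. E = C - {x}" if "E \<in> F" for E using that by (auto simp: F_def del_leaf_def)
  have lamF: "laminar_on B F" unfolding laminar_on_def
  proof (intro conjI ballI)
    show "finite B" using laminar_onD(1)[OF l] by simp
    show "F \<subseteq> Pow B - {{}}" using laminar_onD(3)[OF l] by (fastforce simp: F_def del_leaf_def)
    show "{i} \<in> F" if "i \<in> B" for i using that x laminar_onD(5)[OF l, of i] by (auto simp: memF)
    fix E E' assume "E \<in> F" "E' \<in> F"
    then obtain C D where C: "C \<in> F'" "E = C - {x}" "D \<in> F'" "E' = D - {x}" using rep by metis
    show "E \<inter> E' = {} \<or> E \<subseteq> E' \<or> E' \<subseteq> E"
      using laminar_onD(6)[OF l C(1,3)] C by blast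
  qed
  have "bin_hier B F" unfolding bin_hier_def
  proof (intro conjI lamF ballI impI)
    fix E assume E: "E \<in> F" "card E \<noteq> 1"
    show "\<exists>A1\<in>F. \<exists>A2\<in>F. A1 \<inter> A2 = {} \<and> A1 \<union> A2 = E"
    proof (cases "E \<in> F' \<and> x \<notin> E")
      case True
      then obtain A1 A2 where s: "A1 \<in> F'" "A2 \<in> F'" "A1 \<inter> A2 = {}" "A1 \<union> A2 = E"
        using F' E(2) unfolding bin_hier_def by blast
      then have "A1 \<in> F" "A2 \<in> F" using True by (auto simp: memF)
      then show ?thesis using s by blast
    next
      case False
      then obtain C where C: "C \<in> F'" "P \<subseteq> C" "E = C - {x}" using E memF by blast
      have "C \<noteq> P" using False C AF xA by (auto simp: A_def)
      have "card C \<noteq> 1"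
      proof
        assume "card C = 1"
        then obtain c where "C = {c}" by (auto simp: card_1_singleton_iff)
        then show False using C(2) P(2) by auto
      qed
      then obtain D1 D2 where d: "D1 \<in> F'" "D2 \<in> F'" "D1 \<inter> D2 = {}" "D1 \<union> D2 = C"
        using F' C(1) unfolding bin_hier_def by blast
      have fin: ?thesis if d: "D1 \<in> F'" "D2 \<in> F'" "D1 \<inter> D2 = {}" "D1 \<union> D2 = C" "x \<in> D1" for D1 D2
      proof -
        have "D1 \<noteq> {x}"
        proof
          assume D1: "D1 = {x}"
          then have "A \<subseteq> D2" using C(2) d(4) PA xA by auto
          then have "D2 \<inter> P \<noteq> {}" using Ane PA by auto
          then have "D2 \<subseteq> P \<or> P \<subseteq> D2" using laminar_onD(6)[OF l d(2) P(1)] by simp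
          then have "C \<subseteq> P" using D1 d PA by auto
          then show False using C(2) \<open>C \<noteq> P\<close> by blast
        qed
        then have "P \<subseteq> D1" using big d by blast
        then have "D1 - {x} \<in> F" using d by (auto simp: memF)
        moreover have "D2 \<in> F" using d by (auto simp: memF)
        moreover have "(D1 - {x}) \<inter> D2 = {}" "(D1 - {x}) \<union> D2 = E" using d C(3) by auto
        ultimately show ?thesis by blast
      qed
      show ?thesis
      proof (cases "x \<in> D1")
        case True then show ?thesis using fin[OF d] by simp
      next
        case False
        then have "x \<in> D2" using C(2) P(2) d(4) by blast
        then show ?thesis using fin[of D2 D1] d by (simp add: Int_commute Un_commute)
      qed
    qed
  qed
  moreover have "A \<in> F" using AF xA by (simp add: memF)
  moreover have "F' = ins_leaf x F A"
  proof (intro equalityI subsetI)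
    fix C assume C: "C \<in> F'"
    show "C \<in> ins_leaf x F A"
    proof (cases "x \<in> C")
      case False
      then show ?thesis using C nA by (auto simp: ins_leaf_def memF)
    next
      case True
      show ?thesis
      proof (cases "C = {x}")
        case False
        then have "P \<subseteq> C" using big C True by blast
        then have "C - {x} \<in> F" "A \<subseteq> C - {x}" "C = insert x (C - {x})" using C True xA PA by (auto simp: memF)
        then show ?thesis unfolding ins_leaf_def by blast
      qed (simp add: ins_leaf_def)
    qed
  next
    fix E assume "E \<in> ins_leaf x F A"
    then consider "E = {x}" | "E \<in> F" "\<not> A \<subset> E" | C where "C \<in> F" "A \<subseteq> C" "E = insert x C"
      by (auto simp: ins_leaf_def)
    then show "E \<in> F'"
    proof cases
      case 1 then show ?thesis using xF by simp
    next
      case 2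
      show ?thesis
      proof (cases "E \<in> F' \<and> x \<notin> E")
        case False
        then obtain C where "C \<in> F'" "P \<subseteq> C" "E = C - {x}" using 2 memF by blast
        then have "A \<subseteq> E" using PA xA by auto
        then have "E = A" using 2 by auto
        then show ?thesis using AF by simp
      qed simp
    next
      case 3
      show ?thesis
      proof (cases "C \<in> F' \<and> x \<notin> C")
        case True
        then have "C = A" using nA[of C] 3 by auto
        then show ?thesis using 3 PA P(1) by simp
      next
        case False
        then obtain D where D: "D \<in> F'" "P \<subseteq> D" "C = D - {x}" using 3 memF by blast
        then have "E = D" using 3 PA by auto
        then show ?thesis using D by simp
      qed
    qed
  qed
  ultimately show ?thesis using leaf by blast
qed

end

lemma bin_hier_empty: "bin_hier {} F \<longleftrightarrow> F = {}"
  by (auto simp: bin_hier_def laminar_on_def)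

text \<open>Inserting a leaf at \<open>\<Delta>\<close> adds one member and one maximal member;
  inserting it elsewhere adds two members and no maximal one. The resulting 2l - r is the number of
  edges of a bouquet.\<close>

lemma card_hierarchy:
  assumes "finite L" "bin_hier L F"
  shows "card F + card (maxes F) = 2 * card L"
  using assms
proof (induction L arbitrary: F rule: finite_induct)
  case empty
  then show ?case by (simp add: bin_hier_empty maxes_def)
next
  case (insert x B)
  from insert.hyps(2) insert.prems show ?case
  proof (cases rule: del_cases)
    case (top F1)
    have "laminar_on B F1" using top by (simp add: bin_hier_def)
    then have fin: "finite F1" "finite (maxes F1)" using laminar_onD(2) by (auto simp: maxes_def)
    have "{x} \<notin> maxes F1" using ins_top(3)[OF insert.hyps(2) top(1)] by (auto simp: maxes_def)
    then show ?thesis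
      using insert.IH[OF top(1)] ins_top(2,3)[OF insert.hyps(2) top(1)] top(2) fin insert.hyps by simp
  next
    case (leaf F1 A)
    then show ?thesis using insert.IH[OF leaf(1)] ins_leaf(2,5)[OF insert.hyps(2) leaf(1,2)] insert.hyps by simp
  qed
qed

text \<open>The number K of the overview. Where the subtraction in \<open>2 * m - r\<close> is
  truncated, its cofactor vanishes by \<open>hier_count_big\<close>.\<close>

fun hier_count :: "nat \<Rightarrow> nat \<Rightarrow> nat"
  where "hier_count 0 r = (if r = 0 then 1 else 0)"
  | "hier_count (Suc m) r = (if r = 0 then 0 else hier_count m (r - 1)) + (2 * m - r) * hier_count m r"

lemma finite_hiers: "finite L \<Longrightarrow> finite (hiers L r)"
  by (rule finite_subset[of _ "Pow (Pow L)"]) (auto simp: hiers_def bin_hier_def laminar_on_def)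

text \<open>The hierarchies on the larger set are sorted by whether \<open>{x}\<close> is maximal.
  Both kinds of insertion are injective, and a hierarchy with \<open>r\<close> maximal members
  offers as many inner insertion places as it has members.\<close>

lemma card_hiers: "finite L \<Longrightarrow> card (hiers L r) = hier_count (card L) r"
proof (induction L arbitrary: r rule: finite_induct)
  case empty
  have "hiers {} r = (if r = 0 then {{}} else {})"
    by (auto simp: hiers_def bin_hier_empty maxes_def)
  then show ?case by simp
next
  case (insert x B)
  note x = insert.hyps(2)
  let ?T = "{F' \<in> hiers (insert x B) r. {x} \<in> maxes F'}" and ?U = "{F' \<in> hiers (insert x B) r. {x} \<notin> maxes F'}"
  have fin: "finite (maxes F)" if "bin_hier B F" for F
    using that laminar_onD(2)[of B F] by (auto simp: bin_hier_def maxes_def)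
  have cm: "card (maxes (insert {x} F)) = Suc (card (maxes F))" if "bin_hier B F" for F
    using ins_top(2,3)[OF x that] fin[OF that] by (simp add: maxes_def)
  have T: "?T = (if r = 0 then {} else insert {x} ` hiers B (r - 1))"
  proof (intro equalityI subsetI)
    fix F' assume F': "F' \<in> ?T"
    then have "bin_hier (insert x B) F'" by (simp add: hiers_def)
    from x this show "F' \<in> (if r = 0 then {} else insert {x} ` hiers B (r - 1))"
    proof (cases rule: del_cases)
      case (top F)
      have "card (maxes F) = r - 1" "r \<noteq> 0" using F' cm[OF top(1)] top(2) by (auto simp: hiers_def)
      then have "F \<in> hiers B (r - 1)" using top(1) by (simp add: hiers_def)
      then show ?thesis using top(2) \<open>r \<noteq> 0\<close> by simp
    next
      case (leaf F A)
      then show ?thesis using F' ins_leaf(6)[OF x leaf(1,2)] by simp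
    qed
  next
    fix F' assume "F' \<in> (if r = 0 then {} else insert {x} ` hiers B (r - 1))"
    then obtain F where F: "r \<noteq> 0" "bin_hier B F" "card (maxes F) = r - 1" "F' = insert {x} F"
      by (auto simp: hiers_def split: if_splits)
    then show "F' \<in> ?T" using ins_top(1,2)[OF x F(2)] cm[OF F(2)] by (simp add: hiers_def)
  qed
  have U: "?U = (\<lambda>(F, A). ins_leaf x F A) ` Sigma (hiers B r) (\<lambda>F. F)"
  proof (intro equalityI subsetI)
    fix F' assume F': "F' \<in> ?U"
    then have "bin_hier (insert x B) F'" by (simp add: hiers_def)
    from x this show "F' \<in> (\<lambda>(F, A). ins_leaf x F A) ` Sigma (hiers B r) (\<lambda>F. F)"
    proof (cases rule: del_cases)
      case (top F)
      then show ?thesis using F' ins_top(2)[OF x top(1)] by simp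
    next
      case (leaf F A)
      then have "(F, A) \<in> Sigma (hiers B r) (\<lambda>F. F)"
        using F' ins_leaf(2)[OF x leaf(1,2)] by (simp add: hiers_def)
      then show ?thesis using leaf(3) by force
    qed
  next
    fix F' assume "F' \<in> (\<lambda>(F, A). ins_leaf x F A) ` Sigma (hiers B r) (\<lambda>F. F)"
    then obtain F A where F: "bin_hier B F" "card (maxes F) = r" "A \<in> F" "F' = ins_leaf x F A"
      by (auto simp: hiers_def)
    then show "F' \<in> ?U" using ins_leaf(1,2,6)[OF x F(1,3)] by (simp add: hiers_def)
  qed
  have injT: "inj_on (insert {x}) (hiers B s)" for s
    using ins_top(4)[OF x] by (intro inj_on_inverseI[where g = "del_leaf x"]) (auto simp: hiers_def)
  have injU: "inj_on (\<lambda>(F, A). ins_leaf x F A) (Sigma (hiers B r) (\<lambda>F. F))"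
  proof (rule inj_on_inverseI[where g = "\<lambda>F'. (del_leaf x F', up_set F' {x} - {x})"], clarify)
    fix F A assume F: "F \<in> hiers B r" "A \<in> F"
    then have b: "bin_hier B F" by (simp add: hiers_def)
    then have "x \<notin> A" using laminar_onD(3)[of B F A] F x by (auto simp: bin_hier_def)
    then show "del_leaf x (ins_leaf x F A) = F \<and> up_set (ins_leaf x F A) {x} - {x} = A"
      using ins_leaf(3,4)[OF x b F(2)] by simp
  qed
  have finF: "finite F" "card F = 2 * card B - r" if "F \<in> hiers B r" for F
    using that card_hierarchy[OF insert.hyps(1), of F] laminar_onD(2)[of B F]
    by (auto simp: hiers_def bin_hier_def)
  have "card (Sigma (hiers B r) (\<lambda>F. F)) = (\<Sum>F\<in>hiers B r. card F)"
    using finite_hiers[OF insert.hyps(1)] finF by (intro card_SigmaI) auto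
  also have "\<dots> = (2 * card B - r) * card (hiers B r)" using finF by simp
  finally have cU: "card ?U = (2 * card B - r) * hier_count (card B) r"
    unfolding U card_image[OF injU] insert.IH .
  have cT: "card ?T = (if r = 0 then 0 else hier_count (card B) (r - 1))"
    unfolding T using card_image[OF injT] insert.IH by simp
  have "card (hiers (insert x B) r) = card ?T + card ?U"
  proof -
    have "finite (insert x B)" using insert.hyps by simp
    then have "finite (hiers (insert x B) r)" by (rule finite_hiers)
    moreover have "hiers (insert x B) r = ?T \<union> ?U" by auto
    ultimately show ?thesis using card_Un_disjoint[of ?T ?U] by auto
  qed
  then show ?case using cT cU insert.hyps by simp
qed

lemma hier_count_0: "m > 0 \<Longrightarrow> hier_count m 0 = 0"
proof (induction m)
  case (Suc m) then show ?case by (cases "m = 0") auto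
qed simp

text \<open>For one maximal cluster and at least one leaf the first term of the recursion is zero,
  and the second produces the odd factors one by one.\<close>

lemma hier_count_1: "hier_count (Suc m) 1 = c_num (Suc m)"
proof (induction m)
  case 0 then show ?case by (simp add: c_num_def)
next
  case (Suc m)
  have "hier_count (Suc (Suc m)) 1 = (2 * Suc m - 1) * hier_count (Suc m) 1"
    using hier_count_0[of "Suc m"] by (simp del: hier_count.simps add: hier_count.simps(2)[of "Suc m"])
  also have "\<dots> = c_num (Suc (Suc m))" unfolding Suc by (simp add: c_num_def mult.commute)
  finally show ?case .
qed

lemma hier_count_big: "m < r \<Longrightarrow> hier_count m r = 0"
  by (induction m arbitrary: r) auto

lemma card_binary_classes:
  assumes "finite B" "B \<noteq> {}" "0 \<notin> B"
  shows "finite (binary_classes B)" "card (binary_classes B) = c_num (card B)"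
proof -
  have e: "{F. bin_hier B F \<and> card (maxes F) = 1} = hiers B 1" by (simp add: hiers_def)
  show "finite (binary_classes B)" unfolding binary_classes_eq[OF assms(3)] e
    using finite_hiers[OF assms(1)] by simp
  obtain m where "card B = Suc m" using assms by (metis card_gt_0_iff gr0_implies_Suc)
  then show "card (binary_classes B) = c_num (card B)"
    unfolding binary_classes_eq[OF assms(3)] card_image[OF inj_tree_class[OF assms(3)]]
    unfolding e card_hiers[OF assms(1)] using hier_count_1 by simp
qed

text \<open>A double count: block by block through \<open>card_binary_classes\<close> it gives the
  sum over partitions, and through \<open>bij_conf_hier\<close> it gives the solution of the
  insertion recursion.\<close>

lemma configurations_count:
  shows "finite (configurations l r)" "card (configurations l r) = C_num l r" "C_num l r = hier_count l r"
proof -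
  let ?P = "{\<pi>. partition_on {1..l} \<pi> \<and> card \<pi> = r}"
  have S: "configurations l r = Sigma ?P (\<lambda>\<pi>. \<Pi>\<^sub>E B\<in>\<pi>. binary_classes B)"
    by (auto simp: configurations_def)
  have finP: "finite ?P"
    using finitely_many_partition_on[of "{1..l}"] by (rule rev_finite_subset) auto
  have B: "finite \<pi>" "\<And>B. B \<in> \<pi> \<Longrightarrow> finite B \<and> B \<noteq> {} \<and> 0 \<notin> B" if "\<pi> \<in> ?P" for \<pi>
  proof -
    have p: "partition_on {1..l} \<pi>" using that by simp
    show "finite \<pi>" using finite_elements[OF _ p] by simp
    fix B assume "B \<in> \<pi>"
    then have "B \<subseteq> {1..l}" "B \<noteq> {}" using partition_onD1[OF p] partition_onD3[OF p] by auto
    then show "finite B \<and> B \<noteq> {} \<and> 0 \<notin> B" using finite_subset by fastforce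
  qed
  have finPi: "finite (\<Pi>\<^sub>E B\<in>\<pi>. binary_classes B)" if "\<pi> \<in> ?P" for \<pi>
    using B[OF that] card_binary_classes(1) by (intro finite_PiE) auto
  show "finite (configurations l r)" unfolding S using finP finPi by (intro finite_SigmaI) auto
  have "card (configurations l r) = (\<Sum>\<pi>\<in>?P. card (\<Pi>\<^sub>E B\<in>\<pi>. binary_classes B))"
    unfolding S using finP finPi by (intro card_SigmaI) auto
  also have "\<dots> = (\<Sum>\<pi>\<in>?P. \<Prod>B\<in>\<pi>. c_num (card B))"
  proof (rule sum.cong[OF refl])
    fix \<pi> assume "\<pi> \<in> ?P"
    then show "card (\<Pi>\<^sub>E B\<in>\<pi>. binary_classes B) = (\<Prod>B\<in>\<pi>. c_num (card B))"
      using B[of \<pi>] card_binary_classes(2) by (subst card_PiE) (auto intro!: prod.cong)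
  qed
  finally show c: "card (configurations l r) = C_num l r" by (simp add: C_num_def)
  have "card (configurations l r) = card (hiers {1..l} r)"
    using bij_betw_same_card[OF bij_conf_hier] by (simp add: hiers_def)
  then show "C_num l r = hier_count l r" using c card_hiers[of "{1..l}" r] by simp
qed

section \<open>Weighted forests\<close>

text \<open>An inductive predicate instead of a statement about iterates: rule induction then
  follows the orbit until it enters \<open>R\<close>.\<close>

inductive grounded :: "('a \<Rightarrow> 'a) \<Rightarrow> 'a set \<Rightarrow> 'a \<Rightarrow> bool" for f R
  where base: "x \<in> R \<Longrightarrow> grounded f R x"
  | step: "grounded f R (f x) \<Longrightarrow> grounded f R x"

definition forests :: "'a set \<Rightarrow> 'a set \<Rightarrow> ('a \<Rightarrow> 'a) set"
  where "forests U R = {f \<in> U \<rightarrow>\<^sub>E (U \<union> R). \<forall>x\<in>U. grounded f R x}"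

text \<open>For a natural number W this is Cayley's count of forests on n further vertices over W
  given roots. The case n = 0 is separate since the truncated exponent would give W instead of
  1.\<close>

definition forest_weight :: "nat \<Rightarrow> real \<Rightarrow> real"
  where "forest_weight n W = (if n = 0 then 1 else W * (W + real n) ^ (n - 1))"

lemma finite_forests: "finite U \<Longrightarrow> finite R \<Longrightarrow> finite (forests U R)"
  by (rule finite_subset[of _ "U \<rightarrow>\<^sub>E (U \<union> R)"]) (auto simp: forests_def intro: finite_PiE)

text \<open>The term for k = 0 is zero because n > 0. For k > 0 the base in the second weight is k +
  (n-k) = n, and k (n choose k) = n (n-1 choose k-1) turns the sum into the binomial expansion of
  (W+n)^(n-1), times W.\<close>

lemma forest_weight_recursion:
  assumes "n > 0"
  shows "(\<Sum>k\<le>n. real (n choose k) * (W ^ k * forest_weight (n - k) (real k))) = forest_weight n W"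
proof -
  obtain m where n: "n = Suc m" using assms gr0_implies_Suc by blast
  have tm: "real (n choose Suc j) * (W ^ Suc j * forest_weight (n - Suc j) (real (Suc j)))
      = W * (real (m choose j) * W ^ j * real n ^ (m - j))" if j: "j \<le> m" for j
  proof (cases "j = m")
    case True then show ?thesis by (simp add: n forest_weight_def)
  next
    case False
    then have jm: "j < m" using j by simp
    have e: "real (Suc j) + real (n - Suc j) = real n" using jm by (simp add: n)
    have p: "real n ^ (m - j) = real n * real n ^ (n - Suc j - 1)"
      using jm by (simp add: n power_eq_if)
    have c: "real (Suc j) * real (n choose Suc j) = real n * real (m choose j)"
      using Suc_times_binomial[of j m] by (simp only: n of_nat_mult[symmetric])
    have "real (n choose Suc j) * (W ^ Suc j * forest_weight (n - Suc j) (real (Suc j))) =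
        (real (Suc j) * real (n choose Suc j)) * W ^ Suc j * real n ^ (n - Suc j - 1)"
      using jm by (simp add: forest_weight_def e n)
    also have "\<dots> = W * (real (m choose j) * W ^ j * real n ^ (m - j))" unfolding c p by simp
    finally show ?thesis .
  qed
  have "(\<Sum>k\<le>n. real (n choose k) * (W ^ k * forest_weight (n - k) (real k))) =
      (\<Sum>j\<le>m. real (n choose Suc j) * (W ^ Suc j * forest_weight (n - Suc j) (real (Suc j))))"
    unfolding n sum.atMost_Suc_shift by (simp add: forest_weight_def)
  also have "\<dots> = (\<Sum>j\<le>m. W * (real (m choose j) * W ^ j * real n ^ (m - j)))"
    using tm by (intro sum.cong) auto
  also have "\<dots> = W * (W + real n) ^ m" by (simp add: binomial_ring sum_distrib_left)
  also have "\<dots> = forest_weight n W" by (simp add: forest_weight_def n)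
  finally show ?thesis .
qed

lemma sum_Pow_card:
  fixes h :: "nat \<Rightarrow> real"
  assumes "finite U"
  shows "(\<Sum>S\<in>Pow U. h (card S)) = (\<Sum>k\<le>card U. real (card U choose k) * h k)"
proof -
  have "(\<Sum>S\<in>Pow U. h (card S)) = (\<Sum>k\<le>card U. \<Sum>S\<in>{S \<in> Pow U. card S = k}. h (card S))"
    using assms by (intro sum.group[symmetric]) (auto intro: card_mono)
  also have "\<dots> = (\<Sum>k\<le>card U. real (card U choose k) * h k)"
    using n_subsets[OF assms] by (intro sum.cong) auto
  finally show ?thesis .
qed

text \<open>Splitting a forest by the set \<open>S\<close> of vertices attached directly to \<open>R\<close>: the rest is a forest
  over \<open>S\<close>.\<close>

lemma forest_sum:
  fixes w :: "'a \<Rightarrow> real"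
  assumes "finite U" "finite R" "U \<inter> R = {}"
  shows "(\<Sum>f\<in>forests U R. \<Prod>x\<in>U. if f x \<in> R then w (f x) else 1) = forest_weight (card U) (sum w R)"
  using assms
proof (induction "card U" arbitrary: U R w rule: less_induct)
  case less
  note U = less.prems
  let ?h = "\<lambda>f. \<Prod>x\<in>U. if f x \<in> R then w (f x) else 1"
  let ?at = "\<lambda>f. {x \<in> U. f x \<in> R}"
  show ?case
  proof (cases "U = {}")
    case True
    then have "forests U R = {\<lambda>x. undefined}" by (auto simp: forests_def)
    then show ?thesis using True by (simp add: forest_weight_def)
  next
    case False
    have fib: "(\<Sum>f\<in>{f \<in> forests U R. ?at f = S}. ?h f) = sum w R ^ card S * forest_weight (card U - card S) (real (card S))"
      if S: "S \<in> Pow U" for S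
    proof -
      have finS: "finite S" "S \<subseteq> U" using S U finite_subset by auto
      have disj: "(U - S) \<inter> S = {}" by auto
      \<comment> \<open>The rest hangs from \<open>S\<close> with unit weights, so the induction
        hypothesis applies when \<open>S\<close> is nonempty. For empty \<open>S\<close> nothing is
        attached to \<open>R\<close>, no vertex is grounded, and both sides are 0.\<close>
      have cnt: "real (card (forests (U - S) S)) = forest_weight (card U - card S) (real (card S))"
      proof (cases "S = {}")
        case True
        have "\<not> grounded f {} x" for f :: "'a \<Rightarrow> 'a" and x
        proof
          assume "grounded f {} x" then show False by induction auto
        qed
        then have "forests (U - S) S = {}" using False True by (auto simp: forests_def)
        then show ?thesis using True False U by (simp add: forest_weight_def)
      next
        case False
        have "card (U - S) = card U - card S" using finS card_Diff_subset by blast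
        moreover have "card S > 0" "card S \<le> card U" using False finS U card_mono by (auto simp: card_gt_0_iff)
        ultimately have "card (U - S) < card U" by simp
        from less.hyps[OF this _ finS(1) disj, of "\<lambda>_. 1"] show ?thesis
          using U \<open>card (U - S) = card U - card S\<close> by simp
      qed
      have "(\<Sum>f\<in>{f \<in> forests U R. ?at f = S}. ?h f) =
          (\<Sum>(a, b)\<in>(S \<rightarrow>\<^sub>E R) \<times> forests (U - S) S. \<Prod>x\<in>S. w (a x))"
      proof (rule sum.reindex_bij_witness[where
            i = "\<lambda>(a, b). \<lambda>x. if x \<in> S then a x else b x" and
            j = "\<lambda>f. (restrict f S, restrict f (U - S))"])
        fix f assume "f \<in> {f \<in> forests U R. ?at f = S}"
        then have f: "f \<in> U \<rightarrow>\<^sub>E (U \<union> R)" "\<And>x. x \<in> U \<Longrightarrow> grounded f R x" "?at f = S" by (auto simp: forests_def)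
        show "(case (restrict f S, restrict f (U - S)) of (a, b) \<Rightarrow> \<lambda>x. if x \<in> S then a x else b x) = f"
          using f(1) finS by (auto simp: fun_eq_iff PiE_def extensional_def)
        have fS: "f x \<in> U - S \<union> S" if "x \<in> U - S" for x using that f(1,3) by auto
        have "x \<in> U \<union> R \<longrightarrow> x \<notin> R \<longrightarrow> grounded (restrict f (U - S)) S x" if "grounded f R x" for x
          using that
        proof (induction x rule: grounded.induct)
          case (step x)
          show ?case
          proof (intro impI)
            assume x: "x \<in> U \<union> R" "x \<notin> R"
            show "grounded (restrict f (U - S)) S x"
            proof (cases "x \<in> S")
              case True then show ?thesis by (rule grounded.base)
            next
              case False
              then have xU: "x \<in> U - S" using x by auto
              then have "f x \<in> U" "f x \<notin> R" using fS[OF xU] f(3) finS by auto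
              then have "grounded (restrict f (U - S)) S (f x)" using step.IH by blast
              then have "grounded (restrict f (U - S)) S (restrict f (U - S) x)" using xU by simp
              then show ?thesis by (rule grounded.step)
            qed
          qed
        qed auto
        then have "restrict f (U - S) \<in> forests (U - S) S"
          unfolding forests_def using fS f(2) U(3) by auto
        moreover have "restrict f S \<in> S \<rightarrow>\<^sub>E R" using f(3) by auto
        ultimately show "(restrict f S, restrict f (U - S)) \<in> (S \<rightarrow>\<^sub>E R) \<times> forests (U - S) S" by simp
        have "?h f = (\<Prod>x\<in>S. if f x \<in> R then w (f x) else 1) * (\<Prod>x\<in>U - S. if f x \<in> R then w (f x) else 1)"
          using prod.subset_diff[OF finS(2) U(1), of "\<lambda>x. if f x \<in> R then w (f x) else 1"]
          by (simp only: mult.commute)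
        also have "(\<Prod>x\<in>S. if f x \<in> R then w (f x) else 1) = (\<Prod>x\<in>S. w (f x))"
          using f(3) by (intro prod.cong) auto
        also have "(\<Prod>x\<in>U - S. if f x \<in> R then w (f x) else 1) = 1"
          using f(3) by (intro prod.neutral) auto
        finally show "(case (restrict f S, restrict f (U - S)) of (a, b) \<Rightarrow> \<Prod>x\<in>S. w (a x)) = ?h f" by simp
      next
        fix ab assume "ab \<in> (S \<rightarrow>\<^sub>E R) \<times> forests (U - S) S"
        then obtain a b where ab: "ab = (a, b)" "a \<in> S \<rightarrow>\<^sub>E R" "b \<in> (U - S) \<rightarrow>\<^sub>E (U - S \<union> S)"
          "\<And>x. x \<in> U - S \<Longrightarrow> grounded b S x" by (auto simp: forests_def)
        let ?f = "\<lambda>x. if x \<in> S then a x else b x"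
        have aS: "a x \<in> R" if "x \<in> S" for x using ab(2) that by auto
        have bU: "b x \<in> U" "b x \<notin> R" if "x \<in> U - S" for x using ab(3) that finS U by auto
        have gS: "grounded ?f R x" if "x \<in> S" for x
        proof (rule grounded.step, rule grounded.base)
          show "?f x \<in> R" using aS[OF that] that by simp
        qed
        have "x \<in> U \<longrightarrow> grounded ?f R x" if "grounded b S x" for x
          using that
        proof (induction x rule: grounded.induct)
          case (step x)
          show ?case
          proof
            assume xU: "x \<in> U"
            show "grounded ?f R x"
            proof (cases "x \<in> S")
              case True then show ?thesis by (rule gS)
            next
              case False
              then have "grounded ?f R (b x)" using step.IH bU xU by auto
              then have "grounded ?f R (?f x)" using False by simp
              then show ?thesis by (rule grounded.step)
            qed
          qed
        qed (use gS in auto)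
        then have "grounded ?f R x" if "x \<in> U" for x using that gS ab(4) by (cases "x \<in> S") auto
        moreover have "?f \<in> U \<rightarrow>\<^sub>E (U \<union> R)"
          using aS bU ab(3) finS by (auto simp: PiE_def extensional_def)
        moreover have "?at ?f = S" using aS bU finS by auto
        ultimately show "(case ab of (a, b) \<Rightarrow> \<lambda>x. if x \<in> S then a x else b x) \<in> {f \<in> forests U R. ?at f = S}"
          by (simp add: ab(1) forests_def)
        have "restrict ?f S = a" using ab(2) by (auto simp: fun_eq_iff PiE_def extensional_def)
        moreover have "restrict ?f (U - S) = b" using ab(3) by (auto simp: fun_eq_iff PiE_def extensional_def)
        ultimately show "(restrict (case ab of (a, b) \<Rightarrow> \<lambda>x. if x \<in> S then a x else b x) S,
            restrict (case ab of (a, b) \<Rightarrow> \<lambda>x. if x \<in> S then a x else b x) (U - S)) = ab"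
          by (simp add: ab(1))
      qed
      also have "\<dots> = (\<Sum>a\<in>S \<rightarrow>\<^sub>E R. \<Sum>b\<in>forests (U - S) S. \<Prod>x\<in>S. w (a x))"
        by (rule sum.cartesian_product[symmetric])
      also have "\<dots> = real (card (forests (U - S) S)) * (\<Sum>a\<in>S \<rightarrow>\<^sub>E R. \<Prod>x\<in>S. w (a x))"
        by (simp add: sum_distrib_left)
      also have "(\<Sum>a\<in>S \<rightarrow>\<^sub>E R. \<Prod>x\<in>S. w (a x)) = (\<Prod>x\<in>S. \<Sum>y\<in>R. w y)"
        by (rule prod_sum_PiE[symmetric]) (use finS U in auto)
      finally show ?thesis using cnt by simp
    qed
    have "(\<Sum>f\<in>forests U R. ?h f) = (\<Sum>S\<in>Pow U. \<Sum>f\<in>{f \<in> forests U R. ?at f = S}. ?h f)"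
      using finite_forests U by (intro sum.group[symmetric]) auto
    also have "\<dots> = (\<Sum>S\<in>Pow U. sum w R ^ card S * forest_weight (card U - card S) (real (card S)))"
      using fib by (intro sum.cong) auto
    also have "\<dots> = (\<Sum>k\<le>card U. real (card U choose k) * (sum w R ^ k * forest_weight (card U - k) (real k)))"
      by (rule sum_Pow_card[OF U(1)])
    also have "\<dots> = forest_weight (card U) (sum w R)"
      using False U by (intro forest_weight_recursion) (simp add: card_gt_0_iff)
    finally show ?thesis .
  qed
qed

section \<open>The law of the cluster counts\<close>

definition cnt :: "(nat \<Rightarrow> nat) \<Rightarrow> nat set \<Rightarrow> nat set \<Rightarrow> nat"
  where "cnt p L A = card {z. z \<noteq> 0 \<and> clus p L z = A}"

definition labellings :: "nat \<Rightarrow> nat set \<Rightarrow> nat set set \<Rightarrow> (nat set \<Rightarrow> nat) \<Rightarrow> (nat set \<times> nat \<Rightarrow> nat) set"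
  where "labellings N L F n = {\<phi> \<in> slots F n \<rightarrow>\<^sub>E {1..N}. inj_on \<phi> (slots F n) \<and> (\<forall>i\<in>L. \<phi> ({i}, 0) = i)}"

lemma card_slots: "finite F \<Longrightarrow> card (slots F n) = sum n F"
  by (simp add: slots_def)

text \<open>With the parents on the labelled set \<open>D\<close> fixed, the free vertices
  \<open>U\<close> form a forest over \<open>D\<close> and \<open>\<Delta>\<close>, where attachment
  to \<open>\<Delta>\<close> weighs \<kappa> and attachment to \<open>D\<close> weighs 1, in total
  \<kappa> + m. The labelled vertices themselves contribute one \<kappa> per maximal
  cluster.\<close>

lemma compat_weight:
  fixes \<kappa> :: real
  assumes F: "laminar_on L F" and n: "\<And>A. A \<in> F \<Longrightarrow> 0 < n A" and \<phi>: "\<phi> \<in> labellings N L F n"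
  shows "(\<Sum>p | rooted {0..N} p \<and> compat F n \<phi> p. \<kappa> ^ card {y \<in> {1..N}. p y = 0}) =
    \<kappa> ^ card (maxes F) * forest_weight (N - sum n F) (\<kappa> + real (sum n F))"
proof -
  let ?S = "slots F n"
  define D where "D = \<phi> ` ?S"
  define U where "U = {1..N} - D"
  define R where "R = insert 0 D"
  define w where "w = (\<lambda>y::nat. if y = 0 then \<kappa> else 1)"
  have finF: "finite F" using laminar_onD(2)[OF F] .
  have finS: "finite ?S" using finF by (simp add: slots_def)
  have inj: "inj_on \<phi> ?S" and rng: "\<And>s. s \<in> ?S \<Longrightarrow> \<phi> s \<in> {1..N}"
    and pin: "\<And>i. i \<in> L \<Longrightarrow> \<phi> ({i}, 0) = i" using \<phi> by (auto simp: labellings_def)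
  have \<phi>0: "\<phi> (A, j) \<noteq> 0" if "A \<in> F" "j < n A" for A j
    using rng[of "(A, j)"] that by (auto simp: slots_def)
  have D: "D \<subseteq> {1..N}" "finite D" "card D = sum n F"
    using rng finS card_image[OF inj] card_slots[OF finF] by (auto simp: D_def)
  have D0: "0 \<notin> D" using D by auto
  define d where "d = (\<lambda>x. case the_inv_into ?S \<phi> x of (A, j) \<Rightarrow> slot_next F n \<phi> A j)"
  have d: "d (\<phi> (A, j)) = slot_next F n \<phi> A j" if "A \<in> F" "j < n A" for A j
    using the_inv_into_f_f[OF inj, of "(A, j)"] that by (simp add: d_def slots_def)
  have compat_iff: "compat F n \<phi> p \<longleftrightarrow> (\<forall>x\<in>D. p x = d x)" for p
  proof
    assume "compat F n \<phi> p" then show "\<forall>x\<in>D. p x = d x" using d by (auto simp: D_def slots_def compat_def)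
  next
    assume "\<forall>x\<in>D. p x = d x" then show "compat F n \<phi> p" using d by (auto simp: D_def slots_def compat_def)
  qed
  have dR: "d x \<in> R" if "x \<in> D" for x
  proof -
    obtain A j where A: "A \<in> F" "j < n A" "x = \<phi> (A, j)" using \<open>x \<in> D\<close> by (auto simp: D_def slots_def)
    have "slot_next F n \<phi> A j \<in> R"
    proof (cases "Suc j < n A")
      case True then show ?thesis using A by (auto simp: slot_next_def R_def D_def slots_def)
    next
      case False
      show ?thesis
      proof (cases "A \<in> maxes F")
        case True then show ?thesis using False by (simp add: slot_next_def R_def)
      next
        case nm: False
        have "up_set F A \<in> F" using up_set(1)[OF F A(1) nm] .
        then have "(up_set F A, 0) \<in> ?S" using n by (simp add: slots_def)
        then show ?thesis using False nm by (simp add: slot_next_def R_def D_def)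
      qed
    qed
    then show ?thesis using d A by simp
  qed
  have UR: "U \<union> R = {0..N}" "U \<inter> R = {}" using D by (auto simp: U_def R_def)
  have top: "card {x \<in> D. d x = 0} = card (maxes F)"
  proof -
    \<comment> \<open>Only the last vertex in the chain of a maximal cluster is attached to
      \<open>\<Delta>\<close>, since labels are never 0.\<close>
    have "{x \<in> D. d x = 0} = (\<lambda>A. \<phi> (A, n A - 1)) ` maxes F"
    proof (intro equalityI subsetI)
      fix x assume "x \<in> {x \<in> D. d x = 0}"
      then obtain A j where A: "A \<in> F" "j < n A" "x = \<phi> (A, j)" "slot_next F n \<phi> A j = 0"
        using d by (auto simp: D_def slots_def)
      have 1: "\<not> Suc j < n A" using A \<phi>0[of A "Suc j"] by (auto simp: slot_next_def)
      then have "A \<in> maxes F"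
        using A \<phi>0[of "up_set F A" 0] up_set(1)[OF F A(1)] n[of "up_set F A"]
        by (auto simp: slot_next_def split: if_splits)
      moreover have "j = n A - 1" using 1 A by simp
      ultimately show "x \<in> (\<lambda>A. \<phi> (A, n A - 1)) ` maxes F" using A by blast
    next
      fix x assume "x \<in> (\<lambda>A. \<phi> (A, n A - 1)) ` maxes F"
      then obtain A where A: "A \<in> maxes F" "x = \<phi> (A, n A - 1)" by auto
      then have AF: "A \<in> F" by (simp add: maxes_def)
      have "(A, n A - 1) \<in> ?S" using AF n[OF AF] by (simp add: slots_def)
      then show "x \<in> {x \<in> D. d x = 0}" using A d[OF AF, of "n A - 1"] n[OF AF] by (simp add: D_def slot_next_def)
    qed
    moreover have "inj_on (\<lambda>A. \<phi> (A, n A - 1)) (maxes F)"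
    proof (rule inj_onI)
      fix A B assume "A \<in> maxes F" "B \<in> maxes F" "\<phi> (A, n A - 1) = \<phi> (B, n B - 1)"
      then have "(A, n A - 1) = (B, n B - 1)" using n by (intro inj_onD[OF inj]) (auto simp: slots_def maxes_def)
      then show "A = B" by simp
    qed
    ultimately show ?thesis using card_image[of "\<lambda>A. \<phi> (A, n A - 1)" "maxes F"] by simp
  qed
  have "(\<Sum>p | rooted {0..N} p \<and> compat F n \<phi> p. \<kappa> ^ card {y \<in> {1..N}. p y = 0}) =
      (\<Sum>f\<in>forests U R. \<kappa> ^ card (maxes F) * (\<Prod>x\<in>U. if f x \<in> R then w (f x) else 1))"
  proof (rule sum.reindex_bij_witness[where j = "\<lambda>p. restrict p U"
        and i = "\<lambda>f x. if x \<in> U then f x else if x \<in> D then d x else 0"])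
    fix p assume "p \<in> {p. rooted {0..N} p \<and> compat F n \<phi> p}"
    then have r: "rooted {0..N} p" and pd: "\<And>x. x \<in> D \<Longrightarrow> p x = d x" using compat_iff by auto
    show "(\<lambda>x. if x \<in> U then restrict p U x else if x \<in> D then d x else 0) = p"
    proof
      fix x
      have "p x = 0" if "x \<notin> U" "x \<notin> D" using that rooted_outside[OF r, of x] by (auto simp: U_def)
      then show "(if x \<in> U then restrict p U x else if x \<in> D then d x else 0) = p x" using pd by auto
    qed
    have pU: "p x \<in> U \<union> R" if "x \<in> U" for x
      unfolding UR(1) using rooted_closed[OF r, of x] that by (auto simp: U_def)
    have gr: "x \<in> U \<union> R \<Longrightarrow> (p ^^ k) x = 0 \<Longrightarrow> grounded (restrict p U) R x" for k x
    proof (induction k arbitrary: x)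
      case 0 then show ?case by (intro grounded.base) (simp add: R_def)
    next
      case (Suc k)
      show ?case
      proof (cases "x \<in> U")
        case True
        have "(p ^^ k) (p x) = 0" using Suc.prems by (simp add: funpow_swap1)
        then have "grounded (restrict p U) R (p x)" using Suc.IH pU[OF True] by blast
        then have "grounded (restrict p U) R (restrict p U x)" using True by simp
        then show ?thesis by (rule grounded.step)
      next
        case False then show ?thesis using Suc.prems by (intro grounded.base) auto
      qed
    qed
    have "grounded (restrict p U) R x" if "x \<in> U" for x
      using rooted_reach[OF r, of x] gr[of x] that by blast
    then show "restrict p U \<in> forests U R" unfolding forests_def using pU by auto
    have "{y \<in> {1..N}. p y = 0} = {x \<in> D. d x = 0} \<union> {x \<in> U. p x = 0}"
      using D pd by (auto simp: U_def)
    then have "card {y \<in> {1..N}. p y = 0} = card (maxes F) + card {x \<in> U. p x = 0}"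
      using card_Un_disjoint[of "{x \<in> D. d x = 0}" "{x \<in> U. p x = 0}"] D top by (auto simp: U_def)
    moreover have "(\<Prod>x\<in>U. if restrict p U x \<in> R then w (restrict p U x) else 1) = \<kappa> ^ card {x \<in> U. p x = 0}"
    proof -
      have "(\<Prod>x\<in>U. if restrict p U x \<in> R then w (restrict p U x) else 1) = (\<Prod>x\<in>U. if p x = 0 then \<kappa> else 1)"
        by (intro prod.cong) (auto simp: w_def R_def)
      also have "\<dots> = \<kappa> ^ card {x \<in> U. p x = 0}"
        by (subst prod.If_cases) (auto simp: U_def Int_def)
      finally show ?thesis .
    qed
    ultimately show "\<kappa> ^ card (maxes F) * (\<Prod>x\<in>U. if restrict p U x \<in> R then w (restrict p U x) else 1) =
        \<kappa> ^ card {y \<in> {1..N}. p y = 0}" by (simp add: power_add)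
  next
    fix f assume "f \<in> forests U R"
    then have f: "f \<in> U \<rightarrow>\<^sub>E (U \<union> R)" "\<And>x. x \<in> U \<Longrightarrow> grounded f R x" by (auto simp: forests_def)
    let ?p = "\<lambda>x. if x \<in> U then f x else if x \<in> D then d x else 0"
    show "restrict ?p U = f" using f(1) by (auto simp: fun_eq_iff PiE_def extensional_def)
    have c: "compat F n \<phi> ?p" unfolding compat_iff by (auto simp: U_def)
    have 0: "?p 0 = 0" using D0 by (simp add: U_def)
    have reachD: "\<exists>k. (?p ^^ k) x = 0" if "x \<in> D" for x
    proof -
      obtain A j where "A \<in> F" "j < n A" "x = \<phi> (A, j)" using \<open>x \<in> D\<close> by (auto simp: D_def slots_def)
      then show ?thesis using slot_reach[OF F n inj \<phi>0 pin 0 c] by blast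
    qed
    have reachR: "\<exists>k. (?p ^^ k) x = 0" if "x \<in> R" for x
      using that reachD by (auto simp: R_def intro: exI[of _ 0])
    have "x \<in> U \<union> R \<longrightarrow> (\<exists>k. (?p ^^ k) x = 0)" if "grounded f R x" for x
      using that
    proof (induction x rule: grounded.induct)
      case (base x) then show ?case using reachR by blast
    next
      case (step x)
      show ?case
      proof
        assume "x \<in> U \<union> R"
        show "\<exists>k. (?p ^^ k) x = 0"
        proof (cases "x \<in> U")
          case True
          then have "f x \<in> U \<union> R" using f(1) by auto
          then obtain k where "(?p ^^ k) (f x) = 0" using step.IH by blast
          moreover have "?p x = f x" using True by simp
          ultimately have "(?p ^^ Suc k) x = 0" by (simp only: funpow_Suc_right comp_apply)
          then show ?thesis by blast
        next
          case False then show ?thesis using \<open>x \<in> U \<union> R\<close> reachR by blast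
        qed
      qed
    qed
    then have reach: "\<exists>k. (?p ^^ k) x = 0" if "x \<in> U \<union> R" for x
      using that f(2) reachR by blast
    have "rooted {0..N} ?p" unfolding rooted_def
    proof (intro conjI allI impI ballI)
      show "?p x = 0" if "x \<notin> {0..N} - {0}" for x using that D by (auto simp: U_def)
      show "?p x \<in> {0..N}" if "x \<in> {0..N}" for x
      proof -
        have "f x \<in> U \<union> R" if "x \<in> U" using f(1) that by auto
        moreover have "d x \<in> U \<union> R" if "x \<in> D" using dR[OF that] by simp
        ultimately show ?thesis unfolding UR(1) by simp
      qed
      show "\<exists>k. (?p ^^ k) x = 0" for x
      proof (cases "x \<in> {0..N}")
        case True then show ?thesis using reach UR(1) by blast
      next
        case False
        then have "?p x = 0" using D by (auto simp: U_def)
        then have "(?p ^^ 1) x = 0" by simp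
        then show ?thesis by blast
      qed
    qed auto
    then show "?p \<in> {p. rooted {0..N} p \<and> compat F n \<phi> p}" using c by simp
  qed
  also have "\<dots> = \<kappa> ^ card (maxes F) * forest_weight (card U) (sum w R)"
    unfolding sum_distrib_left[symmetric]
    using forest_sum[of U R w] UR D by (simp add: U_def R_def)
  also have "card U = N - sum n F" using D card_Diff_subset[of D "{1..N}"] by (simp add: U_def)
  also have "sum w R = \<kappa> + real (sum n F)"
  proof -
    have "sum w D = (\<Sum>x\<in>D. 1)" using D0 by (intro sum.cong) (auto simp: w_def)
    then show ?thesis using D D0 by (simp add: R_def w_def)
  qed
  finally show ?thesis .
qed

text \<open>Vertices with the same nonempty cluster lie on one path, so counting those farther from
  \<open>\<Delta>\<close> numbers them injectively from 0. Sending a vertex to its cluster and this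
  number is a bijection onto the slots, and \<open>\<phi>\<close> is its inverse.\<close>

lemma labelling_exists:
  assumes r: "rooted {0..N} p" and L: "L \<subseteq> {1..N}" and F: "laminar_on L F" "phier p L = F"
    and n: "\<And>A. A \<in> F \<Longrightarrow> cnt p L A = n A"
  obtains \<phi> where "\<phi> \<in> labellings N L F n" "compat F n \<phi> p"
proof -
  have L': "L \<subseteq> {0..N} - {0}" using L by auto
  let ?c = "clus p L"
  define S where "S = (\<lambda>A. {y. y \<noteq> 0 \<and> ?c y = A})"
  define a where "a = (\<lambda>x. card {y \<in> S (?c x). anc p y x \<and> y \<noteq> x})"
  define e where "e = (\<lambda>x. (?c x, a x))"
  define X where "X = {x. x \<noteq> 0 \<and> ?c x \<noteq> {}}"
  have SV: "S A \<subseteq> {1..N}" if "A \<in> F" for A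
  proof
    fix y assume "y \<in> S A"
    then have "y \<noteq> 0" "?c y \<noteq> {}" using that laminar_onD(4)[OF F(1)] by (auto simp: S_def)
    then show "y \<in> {1..N}" using clus_in_verts[OF r L'] by force
  qed
  have finS: "finite (S A)" if "A \<in> F" for A using SV[OF that] finite_subset by blast
  have cS: "card (S A) = n A" if "A \<in> F" for A using n[OF that] by (simp add: S_def cnt_def)
  have XF: "?c x \<in> F" "x \<in> S (?c x)" "x \<noteq> 0" if "x \<in> X" for x
  proof -
    show "?c x \<in> F" unfolding F(2)[symmetric] phier_iff using that unfolding X_def by blast
    show "x \<in> S (?c x)" "x \<noteq> 0" using that by (auto simp: X_def S_def)
  qed
  have SX: "x \<in> X" "?c x = A" if "x \<in> S A" "A \<in> F" for x A
    using that laminar_onD(4)[OF F(1)] by (auto simp: X_def S_def)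
  have lin: "anc p x y \<or> anc p y x" if "x \<in> X" "?c x \<subseteq> ?c y \<or> ?c y \<subseteq> ?c x" "y \<in> X" for x y
    using that clus_meet[of p L x y] by (auto simp: X_def)
  have less: "a y < a x" if "x \<in> X" "y \<in> X" "?c x = ?c y" "anc p y x" "y \<noteq> x" for x y
  proof -
    have "{z \<in> S (?c y). anc p z y \<and> z \<noteq> y} \<subset> {z \<in> S (?c x). anc p z x \<and> z \<noteq> x}"
    proof (rule psubsetI)
      show "{z \<in> S (?c y). anc p z y \<and> z \<noteq> y} \<subseteq> {z \<in> S (?c x). anc p z x \<and> z \<noteq> x}"
      proof
        fix z assume "z \<in> {z \<in> S (?c y). anc p z y \<and> z \<noteq> y}"
        then have z: "z \<in> S (?c y)" "anc p z y" "z \<noteq> y" by auto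
        have "z \<noteq> x" using z(2) that anc_antisym[OF r] by blast
        moreover have "anc p z x" using anc_trans[OF z(2) that(4)] .
        ultimately show "z \<in> {z \<in> S (?c x). anc p z x \<and> z \<noteq> x}" using z(1) that(3) by simp
      qed
      have "y \<in> {z \<in> S (?c x). anc p z x \<and> z \<noteq> x}" using that XF(2)[OF that(2)] by simp
      then show "{z \<in> S (?c y). anc p z y \<and> z \<noteq> y} \<noteq> {z \<in> S (?c x). anc p z x \<and> z \<noteq> x}" by blast
    qed
    moreover have "finite {z \<in> S (?c x). anc p z x \<and> z \<noteq> x}" using finS[OF XF(1)[OF that(1)]] by simp
    ultimately show ?thesis unfolding a_def by (intro psubset_card_mono)
  qed
  have bound: "a x < n (?c x)" if "x \<in> X" for x
  proof -
    have "{y \<in> S (?c x). anc p y x \<and> y \<noteq> x} \<subset> S (?c x)" using XF(2)[OF that] by auto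
    then have "a x < card (S (?c x))" unfolding a_def using finS[OF XF(1)[OF that]] by (intro psubset_card_mono)
    then show ?thesis using cS[OF XF(1)[OF that]] by simp
  qed
  have inj: "inj_on e X"
  proof (rule inj_onI)
    fix x y assume xy: "x \<in> X" "y \<in> X" "e x = e y"
    then have eq: "?c x = ?c y" "a x = a y" by (auto simp: e_def)
    have "anc p x y \<or> anc p y x" using lin[of x y] xy eq by auto
    then show "x = y" using less[of x y] less[of y x] xy eq by auto
  qed
  have img: "e ` X = slots F n"
  proof (intro equalityI subsetI)
    fix s assume "s \<in> e ` X" then show "s \<in> slots F n" using XF bound by (auto simp: e_def slots_def)
  next
    fix s assume "s \<in> slots F n"
    then obtain A j where s: "s = (A, j)" "A \<in> F" "j < n A" by (auto simp: slots_def)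
    have "inj_on a (S A)"
    proof (rule inj_onI)
      fix x y assume "x \<in> S A" "y \<in> S A" "a x = a y"
      then show "x = y" using SX[OF _ s(2)] by (intro inj_onD[OF inj]) (auto simp: e_def)
    qed
    then have "card (a ` S A) = n A" using card_image cS[OF s(2)] by metis
    moreover have "a ` S A \<subseteq> {..<n A}" using bound SX[OF _ s(2)] by auto
    ultimately have "a ` S A = {..<n A}" by (intro card_subset_eq) auto
    then obtain x where "x \<in> S A" "a x = j" using s(3) by (metis imageE lessThan_iff)
    then show "s \<in> e ` X" using SX[OF _ s(2), of x] s(1) by (auto simp: e_def image_iff)
  qed
  define \<phi> where "\<phi> = restrict (the_inv_into X e) (slots F n)"
  have \<phi>e: "\<phi> (e x) = x" if "x \<in> X" for x
    using that img the_inv_into_f_f[OF inj that] by (auto simp: \<phi>_def)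
  have \<phi>X: "\<phi> s \<in> X \<and> e (\<phi> s) = s" if "s \<in> slots F n" for s
    using that img \<phi>e by (metis imageE)
  have "\<phi> \<in> labellings N L F n"
    unfolding labellings_def
  proof (intro CollectI conjI ballI)
    have "\<phi> s \<in> {1..N}" if "s \<in> slots F n" for s
      using \<phi>X[OF that] XF[of "\<phi> s"] SV[of "?c (\<phi> s)"] by blast
    then show "\<phi> \<in> slots F n \<rightarrow>\<^sub>E {1..N}" by (auto simp: \<phi>_def)
    show "inj_on \<phi> (slots F n)" using \<phi>X by (metis inj_onI)
    fix i assume i: "i \<in> L"
    have ci: "?c i = {i}" using clus_singleton[OF i] laminar_onD(5)[OF F(1) i] F(2) by simp
    have "y = i" if "?c y = {i}" "anc p y i" for y
    proof -
      have "anc p i y" using that(1) by (auto simp: clus_def)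
      then show ?thesis using anc_antisym[OF r] that(2) by blast
    qed
    then have "{y \<in> S (?c i). anc p y i \<and> y \<noteq> i} = {}" using ci by (auto simp: S_def)
    then have "a i = 0" unfolding a_def by (simp only: card.empty)
    moreover have "i \<noteq> 0" using subsetD[OF L' i] by simp
    then have "i \<in> X" using ci by (simp add: X_def)
    ultimately show "\<phi> ({i}, 0) = i" using \<phi>e[of i] ci by (simp add: e_def)
  qed
  moreover have "compat F n \<phi> p"
    unfolding compat_def
  proof (intro ballI allI impI)
    fix A j assume A: "A \<in> F" "j < n A"
    define x where "x = \<phi> (A, j)"
    have x: "x \<in> X" "?c x = A" "a x = j" using \<phi>X[of "(A, j)"] A by (auto simp: slots_def x_def e_def)
    have x0: "x \<noteq> 0" and xS: "x \<in> S A" using XF[OF x(1)] x(2) by auto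
    have sub: "A \<subseteq> ?c (p x)" using clus_mono[OF anc_parent, of p L x] x(2) by simp
    have Ane: "A \<noteq> {}" using laminar_onD(4)[OF F(1) A(1)] .
    show "p (\<phi> (A, j)) = slot_next F n \<phi> A j"
    \<comment> \<open>If the parent shares the cluster, its count is larger by one, for
      \<open>x\<close> itself. Otherwise \<open>x\<close> is the last of its chain, and its parent
      is either \<open>\<Delta>\<close> or the first vertex of the next larger cluster, which has
      count 0.\<close>
    proof (cases "p x \<noteq> 0 \<and> ?c (p x) = A")
      case True
      have pX: "p x \<in> X" using True Ane by (simp add: X_def)
      have "{y \<in> S A. anc p y (p x) \<and> y \<noteq> p x} = insert x {y \<in> S A. anc p y x \<and> y \<noteq> x}"
      proof (intro equalityI subsetI)
        fix y assume "y \<in> {y \<in> S A. anc p y (p x) \<and> y \<noteq> p x}"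
        then have y: "y \<in> S A" "anc p y (p x)" "y \<noteq> p x" by auto
        have "anc p x y \<or> anc p y x" using lin[OF x(1), of y] SX[OF y(1) A(1)] x(2) by auto
        moreover have "x = y" if "anc p x y"
        proof (rule ccontr)
          assume "x \<noteq> y"
          then have "anc p (p x) y" using anc_cases that by blast
          then show False using anc_antisym[OF r] y by blast
        qed
        ultimately show "y \<in> insert x {y \<in> S A. anc p y x \<and> y \<noteq> x}" using y by auto
      next
        fix y assume "y \<in> insert x {y \<in> S A. anc p y x \<and> y \<noteq> x}"
        then have y: "y \<in> S A" "anc p y x" using xS by auto
        have "y \<noteq> p x" using y(2) parent_not_anc[OF r x0] by auto
        then show "y \<in> {y \<in> S A. anc p y (p x) \<and> y \<noteq> p x}" using y anc_trans[OF y(2) anc_parent] by simp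
      qed
      then have "a (p x) = Suc j" using True x finS[OF A(1)] by (simp add: a_def)
      then have ep: "e (p x) = (A, Suc j)" using True by (simp add: e_def)
      then have "Suc j < n A" using bound[OF pX] True by (simp add: e_def)
      then show ?thesis using \<phi>e[OF pX] ep by (simp add: slot_next_def x_def)
    next
      case False
      have beyond: "p x \<noteq> 0 \<and> ?c (p x) \<subseteq> ?c y" if "anc p x y" "x \<noteq> y" "y \<noteq> 0" for y
      proof -
        have "anc p (p x) y" using anc_cases that by blast
        then show ?thesis using clus_mono[of p "p x" y L] that(3) anc_from_root[OF r, of y] by metis
      qed
      have SA: "S A = insert x {y \<in> S A. anc p y x \<and> y \<noteq> x}"
      proof (intro equalityI subsetI)
        fix y assume y: "y \<in> S A"
        have y': "y \<in> X" "?c y = A" using SX[OF y A(1)] by auto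
        have "\<not> (anc p x y \<and> x \<noteq> y)"
        proof
          assume "anc p x y \<and> x \<noteq> y"
          then have "p x \<noteq> 0" "?c (p x) \<subseteq> A" using beyond[of y] y'(2) XF(3)[OF y'(1)] by auto
          then show False using False sub by (metis subset_antisym)
        qed
        then have "anc p y x" using lin[OF x(1) _ y'(1)] x(2) y'(2) by auto
        then show "y \<in> insert x {y \<in> S A. anc p y x \<and> y \<noteq> x}" using y by auto
      qed (use xS in auto)
      have "card (insert x {y \<in> S A. anc p y x \<and> y \<noteq> x}) = Suc (card {y \<in> S A. anc p y x \<and> y \<noteq> x})"
        using finS[OF A(1)] by (intro card_insert_disjoint) auto
      then have "card (S A) = Suc (a x)" unfolding SA[symmetric] a_def x(2) .
      then have last: "\<not> Suc j < n A" using cS[OF A(1)] x(3) by simp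
      show ?thesis
      proof (cases "p x = 0")
        case True
        then have "A \<in> maxes F" using maxes_phier[OF r L'] F(2) x(2) x0 Ane by blast
        then show ?thesis using last True by (simp add: slot_next_def x_def)
      next
        case nz: False
        define C where "C = ?c (p x)"
        have AC: "A \<subset> C" using sub False nz by (auto simp: C_def)
        have pX: "p x \<in> X" using nz AC Ane by (auto simp: X_def C_def)
        have CF: "C \<in> F" using XF(1)[OF pX] by (simp add: C_def)
        have nm: "A \<notin> maxes F" using AC CF by (auto simp: maxes_def)
        note u = up_set[OF F(1) A(1) nm]
        obtain z where z: "z \<noteq> 0" "up_set F A = ?c z" using u(1) unfolding F(2)[symmetric] phier_iff by metis
        have zX: "z \<in> X" using z u(2) by (auto simp: X_def)
        have "\<not> anc p z x" using clus_mono[of p z x L] u(2) z(2) x(2) by auto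
        then have "anc p x z \<and> x \<noteq> z" using lin[OF x(1) _ zX] u(2) z(2) x(2) by auto
        then have "C \<subseteq> up_set F A" using beyond[of z] z by (simp add: C_def)
        then have up: "up_set F A = C" using u(3)[OF CF AC] by auto
        have "{y \<in> S C. anc p y (p x) \<and> y \<noteq> p x} = {}"
        proof -
          have False if y: "y \<in> S C" "anc p y (p x)" "y \<noteq> p x" for y
          proof -
            have y': "y \<in> X" "?c y = C" using SX[OF y(1) CF] by auto
            have "\<not> anc p y x" using clus_mono[of p y x L] AC y'(2) x(2) by auto
            then have "anc p x y" "x \<noteq> y" using lin[OF x(1) _ y'(1)] AC y'(2) x(2) by auto
            then have "anc p (p x) y" using anc_cases by blast
            then show False using anc_antisym[OF r] y by blast
          qed
          then show ?thesis by blast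
        qed
        then have "a (p x) = 0" unfolding a_def C_def by (simp only: card.empty)
        then have "e (p x) = (C, 0)" by (simp add: e_def C_def)
        then show ?thesis using \<phi>e[OF pX] last nm up by (simp add: slot_next_def x_def)
      qed
    qed
  qed
  ultimately show ?thesis using that by blast
qed

text \<open>A condition on clusters is exchanged for a choice of labels, for which the weight is
  known. One inclusion reads the labels off the tree, the other uses that labelled slots have the
  prescribed clusters and that nothing else has a nonempty one.\<close>

lemma cluster_counts_eq_compat:
  assumes F: "laminar_on L F" and L: "L \<subseteq> {1..N}" and n: "\<And>A. A \<in> F \<Longrightarrow> 0 < n A"
  shows "{p. rooted {0..N} p \<and> phier p L = F \<and> (\<forall>A\<in>F. cnt p L A = n A)} =
    (\<Union>\<phi>\<in>labellings N L F n. {p. rooted {0..N} p \<and> compat F n \<phi> p})"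
proof (intro equalityI subsetI)
  fix p assume "p \<in> {p. rooted {0..N} p \<and> phier p L = F \<and> (\<forall>A\<in>F. cnt p L A = n A)}"
  then have p: "rooted {0..N} p" "phier p L = F" "\<And>A. A \<in> F \<Longrightarrow> cnt p L A = n A" by auto
  obtain \<phi> where "\<phi> \<in> labellings N L F n" "compat F n \<phi> p"
    using labelling_exists[OF p(1) L F p(2,3)] .
  then show "p \<in> (\<Union>\<phi>\<in>labellings N L F n. {p. rooted {0..N} p \<and> compat F n \<phi> p})" using p(1) by blast
next
  fix p assume "p \<in> (\<Union>\<phi>\<in>labellings N L F n. {p. rooted {0..N} p \<and> compat F n \<phi> p})"
  then obtain \<phi> where \<phi>: "\<phi> \<in> labellings N L F n" and r: "rooted {0..N} p" and c: "compat F n \<phi> p" by blast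
  have inj: "inj_on \<phi> (slots F n)" and rng: "\<And>s. s \<in> slots F n \<Longrightarrow> \<phi> s \<in> {1..N}"
    and pin: "\<And>i. i \<in> L \<Longrightarrow> \<phi> ({i}, 0) = i" using \<phi> by (auto simp: labellings_def)
  have \<phi>0: "\<phi> (A, j) \<noteq> 0" if "A \<in> F" "j < n A" for A j
    using rng[of "(A, j)"] that by (auto simp: slots_def)
  note ctx = F n inj \<phi>0 pin rooted_p0[OF r] c
  have cl: "clus p L (\<phi> (A, j)) = A" if "A \<in> F" "j < n A" for A j using clus_slot[OF ctx that] .
  have orb: "\<exists>B j. B \<in> F \<and> j < n B \<and> v = \<phi> (B, j)" if v: "v \<noteq> 0" "clus p L v \<noteq> {}" for v
  proof -
    obtain i where i: "i \<in> L" "anc p i v" using v(2) by (auto simp: clus_def)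
    show ?thesis using slot_orbit[OF ctx i v(1)] by metis
  qed
  have "phier p L = F"
  proof (intro equalityI subsetI)
    fix A assume "A \<in> phier p L"
    then obtain v where v: "v \<noteq> 0" "A = clus p L v" "A \<noteq> {}" by (auto simp: phier_iff)
    then obtain B j where "B \<in> F" "j < n B" "v = \<phi> (B, j)" using orb by blast
    then show "A \<in> F" using cl v by simp
  next
    fix A assume A: "A \<in> F"
    then show "A \<in> phier p L" unfolding phier_iff
      using cl[OF A n[OF A]] \<phi>0[OF A n[OF A]] laminar_onD(4)[OF F A] by metis
  qed
  moreover have "cnt p L A = n A" if A: "A \<in> F" for A
  proof -
    have "{z. z \<noteq> 0 \<and> clus p L z = A} = (\<lambda>j. \<phi> (A, j)) ` {..<n A}"
    proof (intro equalityI subsetI)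
      fix z assume "z \<in> {z. z \<noteq> 0 \<and> clus p L z = A}"
      then have z: "z \<noteq> 0" "clus p L z = A" by auto
      then obtain B j where B: "B \<in> F" "j < n B" "z = \<phi> (B, j)" using orb[of z] laminar_onD(4)[OF F A] by blast
      then have "B = A" using cl z by simp
      then show "z \<in> (\<lambda>j. \<phi> (A, j)) ` {..<n A}" using B by auto
    next
      fix z assume "z \<in> (\<lambda>j. \<phi> (A, j)) ` {..<n A}"
      then show "z \<in> {z. z \<noteq> 0 \<and> clus p L z = A}" using cl[OF A] \<phi>0[OF A] by auto
    qed
    moreover have "inj_on (\<lambda>j. \<phi> (A, j)) {..<n A}"
    proof (rule inj_onI)
      fix j k assume "j \<in> {..<n A}" "k \<in> {..<n A}" "\<phi> (A, j) = \<phi> (A, k)"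
      then have "(A, j) = (A, k)" using A by (intro inj_onD[OF inj]) (auto simp: slots_def)
      then show "j = k" by simp
    qed
    ultimately show ?thesis unfolding cnt_def by (simp add: card_image)
  qed
  ultimately show "p \<in> {p. rooted {0..N} p \<and> phier p L = F \<and> (\<forall>A\<in>F. cnt p L A = n A)}" using r by simp
qed

text \<open>The slots \<open>({i}, 0)\<close> are occupied by the leaves; the other m - l slots
  receive distinct labels among the N - l remaining ones. If m > N the product contains a factor 0,
  as it should.\<close>

lemma card_labellings:
  assumes F: "laminar_on L F" and L: "L \<subseteq> {1..N}" and n: "\<And>A. A \<in> F \<Longrightarrow> 0 < n A"
  shows "card (labellings N L F n) = (\<Prod>k=0..<sum n F - card L. N - card L - k)" "finite (labellings N L F n)"
    "card L \<le> sum n F"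
proof -
  let ?S = "slots F n"
  define P where "P = (\<lambda>i. ({i}, 0::nat)) ` L"
  have finF: "finite F" and finL: "finite L" using laminar_onD(1,2)[OF F] by auto
  have finS: "finite ?S" using finF by (simp add: slots_def)
  have PS: "P \<subseteq> ?S" using laminar_onD(5)[OF F] n by (auto simp: P_def slots_def)
  have cP: "card P = card L" unfolding P_def by (rule card_image) (auto simp: inj_on_def)
  then show "card L \<le> sum n F" using card_mono[OF finS PS] card_slots[OF finF] by simp
  have cSP: "card (?S - P) = sum n F - card L"
    using card_Diff_subset[of P ?S] PS finS finite_subset[OF PS finS] cP card_slots[OF finF] by simp
  have cN: "card ({1..N} - L) = N - card L" using card_Diff_subset[OF finL L] by simp
  let ?Q = "{\<psi> \<in> (?S - P) \<rightarrow>\<^sub>E ({1..N} - L). inj_on \<psi> (?S - P)}"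
  have "bij_betw (\<lambda>\<phi>. restrict \<phi> (?S - P)) (labellings N L F n) ?Q"
  proof (rule bij_betw_byWitness[where f' = "\<lambda>\<psi> s. if s \<in> P then the_elem (fst s) else \<psi> s"])
    show "\<forall>\<phi>\<in>labellings N L F n. (\<lambda>s. if s \<in> P then the_elem (fst s) else restrict \<phi> (?S - P) s) = \<phi>"
      using PS by (auto simp: labellings_def fun_eq_iff P_def PiE_def extensional_def)
    show "\<forall>\<psi>\<in>?Q. restrict (\<lambda>s. if s \<in> P then the_elem (fst s) else \<psi> s) (?S - P) = \<psi>"
      by (auto simp: fun_eq_iff PiE_def extensional_def)
    show "(\<lambda>\<phi>. restrict \<phi> (?S - P)) ` labellings N L F n \<subseteq> ?Q"
    proof (rule image_subsetI)
      fix \<phi> assume \<phi>: "\<phi> \<in> labellings N L F n"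
      have "\<phi> s \<notin> L" if s: "s \<in> ?S - P" for s
      proof
        assume i: "\<phi> s \<in> L"
        then have "\<phi> ({\<phi> s}, 0) = \<phi> s" "({\<phi> s}, 0) \<in> P" using \<phi> by (auto simp: labellings_def P_def)
        then have "({\<phi> s}, 0) = s" using \<phi> s PS by (intro inj_onD[of \<phi> ?S]) (auto simp: labellings_def)
        then show False using s \<open>({\<phi> s}, 0) \<in> P\<close> by simp
      qed
      then show "restrict \<phi> (?S - P) \<in> ?Q" using \<phi> by (auto simp: labellings_def inj_on_def)
    qed
    show "(\<lambda>\<psi> s. if s \<in> P then the_elem (fst s) else \<psi> s) ` ?Q \<subseteq> labellings N L F n"
    proof (rule image_subsetI)
      fix \<psi> assume \<psi>: "\<psi> \<in> ?Q"
      let ?f = "\<lambda>s. if s \<in> P then the_elem (fst s) else \<psi> s"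
      have P1: "\<exists>i\<in>L. s = ({i}, 0) \<and> ?f s = i" if "s \<in> P" for s using that by (auto simp: P_def)
      have P2: "?f s \<in> {1..N} - L" "?f s = \<psi> s" if "s \<in> ?S - P" for s using that \<psi> by auto
      have "inj_on ?f ?S"
      proof (rule inj_onI)
        fix s t assume st: "s \<in> ?S" "t \<in> ?S" "?f s = ?f t"
        consider "s \<in> P" "t \<in> P" | "s \<in> P" "t \<in> ?S - P" | "s \<in> ?S - P" "t \<in> P" | "s \<in> ?S - P" "t \<in> ?S - P"
          using st by blast
        then show "s = t"
        proof cases
          case 1 then show ?thesis using P1[of s] P1[of t] st(3) by auto
        next
          case 2 then show ?thesis using P1[of s] P2[of t] st(3) by auto
        next
          case 3 then show ?thesis using P1[of t] P2[of s] st(3) by auto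
        next
          case 4 then show ?thesis using \<psi> st(3) by (auto dest: inj_onD)
        qed
      qed
      moreover have "?f \<in> ?S \<rightarrow>\<^sub>E {1..N}"
      proof
        fix s assume "s \<in> ?S"
        then show "?f s \<in> {1..N}" using P1[of s] P2[of s] L by (cases "s \<in> P") auto
      next
        fix s assume "s \<notin> ?S"
        moreover have "\<psi> \<in> extensional (?S - P)" using \<psi> by (auto simp: PiE_def)
        ultimately show "?f s = undefined" using PS extensional_arb[of \<psi> "?S - P" s] by auto
      qed
      moreover have "\<forall>i\<in>L. ?f ({i}, 0) = i" by (auto simp: P_def)
      ultimately show "?f \<in> labellings N L F n" by (simp add: labellings_def)
    qed
  qed
  then have c: "card (labellings N L F n) = card ?Q" by (rule bij_betw_same_card)
  have "card ?Q = (\<Prod>k=0..<sum n F - card L. N - card L - k)"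
    using card_inj_on_subset_funcset[of "?S - P" "{1..N} - L" "?S - P"] finS cSP cN by simp
  then show "card (labellings N L F n) = (\<Prod>k=0..<sum n F - card L. N - card L - k)" using c by simp
  show "finite (labellings N L F n)"
    by (rule finite_subset[of _ "?S \<rightarrow>\<^sub>E {1..N}"]) (use finS in \<open>auto simp: labellings_def intro: finite_PiE\<close>)
qed

lemma finite_rooted: "finite V \<Longrightarrow> finite {p. rooted V p}"
proof -
  assume V: "finite V"
  have "inj_on (\<lambda>p. restrict p V) {p. rooted V p}"
  proof (rule inj_onI)
    fix p q assume pq: "p \<in> {p. rooted V p}" "q \<in> {p. rooted V p}" "restrict p V = restrict q V"
    show "p = q"
    proof
      fix x
      show "p x = q x"
      proof (cases "x \<in> V")
        case True then show ?thesis using pq(3) by (metis restrict_apply')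
      next
        case False then show ?thesis using pq(1,2) by (simp add: rooted_def)
      qed
    qed
  qed
  moreover have "(\<lambda>p. restrict p V) ` {p. rooted V p} \<subseteq> V \<rightarrow>\<^sub>E V" by (auto simp: rooted_def)
  ultimately show ?thesis using V by (meson finite_PiE finite_imageD finite_subset)
qed

text \<open>The weight of \<open>compat_weight\<close> is the same for every labelling, and by
  \<open>compat_unique\<close> the labellings split the event disjointly, so their number enters as
  a factor.\<close>

lemma cluster_counts_weight:
  fixes \<kappa> :: real
  assumes F: "laminar_on L F" and L: "L \<subseteq> {1..N}" and n: "\<And>A. A \<in> F \<Longrightarrow> 0 < n A"
  shows "(\<Sum>p | rooted {0..N} p \<and> phier p L = F \<and> (\<forall>A\<in>F. cnt p L A = n A). \<kappa> ^ card {y \<in> {1..N}. p y = 0}) =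
    real (\<Prod>k=0..<sum n F - card L. N - card L - k) *
      (\<kappa> ^ card (maxes F) * forest_weight (N - sum n F) (\<kappa> + real (sum n F)))"
proof -
  let ?C = "\<lambda>\<phi>. {p. rooted {0..N} p \<and> compat F n \<phi> p}"
  have "(\<Sum>p | rooted {0..N} p \<and> phier p L = F \<and> (\<forall>A\<in>F. cnt p L A = n A). \<kappa> ^ card {y \<in> {1..N}. p y = 0}) =
      (\<Sum>p\<in>(\<Union>\<phi>\<in>labellings N L F n. ?C \<phi>). \<kappa> ^ card {y \<in> {1..N}. p y = 0})"
    by (rule arg_cong[OF cluster_counts_eq_compat[OF F L n]])
  also have "\<dots> = (\<Sum>\<phi>\<in>labellings N L F n. \<Sum>p\<in>?C \<phi>. \<kappa> ^ card {y \<in> {1..N}. p y = 0})"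
  proof (rule sum.UNION_disjoint)
    show "finite (labellings N L F n)" by (rule card_labellings(2)[OF F L n])
    show "\<forall>\<phi>\<in>labellings N L F n. finite (?C \<phi>)"
      using finite_rooted[of "{0..N}"] by (auto intro: rev_finite_subset)
    show "\<forall>\<phi>\<in>labellings N L F n. \<forall>\<psi>\<in>labellings N L F n. \<phi> \<noteq> \<psi> \<longrightarrow> ?C \<phi> \<inter> ?C \<psi> = {}"
    proof (intro ballI impI)
      fix \<phi> \<psi> assume l: "\<phi> \<in> labellings N L F n" "\<psi> \<in> labellings N L F n" "\<phi> \<noteq> \<psi>"
      have "\<phi> = \<psi>" if "compat F n \<phi> p" "compat F n \<psi> p" for p
      proof (rule PiE_ext)
        show "\<phi> \<in> slots F n \<rightarrow>\<^sub>E {1..N}" "\<psi> \<in> slots F n \<rightarrow>\<^sub>E {1..N}" using l by (auto simp: labellings_def)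
        fix s assume "s \<in> slots F n"
        then obtain A j where "s = (A, j)" "A \<in> F" "j < n A" by (auto simp: slots_def)
        then show "\<phi> s = \<psi> s" using compat_unique[OF F n that] l by (auto simp: labellings_def)
      qed
      then show "?C \<phi> \<inter> ?C \<psi> = {}" using l(3) by blast
    qed
  qed
  also have "\<dots> = (\<Sum>\<phi>\<in>labellings N L F n. \<kappa> ^ card (maxes F) * forest_weight (N - sum n F) (\<kappa> + real (sum n F)))"
    using compat_weight[OF F n] by (intro sum.cong) auto
  finally show ?thesis using card_labellings(1)[OF F L n] by simp
qed

section \<open>From parent functions to the law of the tree\<close>

lemma spanning_trees_eq: "spanning_trees N = tree_of {0..N} ` {p. rooted {0..N} p}"
proof (intro equalityI subsetI)
  fix T assume "T \<in> spanning_trees N"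
  then have T: "is_tree T" "verts T = {0..N}" by (auto simp: spanning_trees_def complete_graph_def)
  then have "rooted {0..N} (gpar T)" "T = tree_of {0..N} (gpar T)" using tree_gpar[of T] by auto
  then show "T \<in> tree_of {0..N} ` {p. rooted {0..N} p}" by blast
next
  fix T assume "T \<in> tree_of {0..N} ` {p. rooted {0..N} p}"
  then obtain p where p: "rooted {0..N} p" "T = tree_of {0..N} p" by blast
  then have t: "is_tree T" using is_tree_tree_of by blast
  then have "edges T \<subseteq> all_edges {0..N}" using p by (simp add: is_tree_def simple_graph_def)
  then show "T \<in> spanning_trees N" using t p by (simp add: spanning_trees_def subgraph_def complete_graph_def)
qed

lemma inj_tree_of: "inj_on (tree_of V) {p. rooted V p}"
  using gpar_tree_of by (intro inj_on_inverseI[where g = gpar]) auto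

lemma degree_tree_of:
  assumes r: "rooted V p"
  shows "degree (tree_of V p) 0 = card {y \<in> V - {0}. p y = 0}"
proof -
  have "{e \<in> edges (tree_of V p). 0 \<in> e} = (\<lambda>y. {y, 0}) ` {y \<in> V - {0}. p y = 0}"
    by (auto simp: edges_tree_of)
  moreover have "inj_on (\<lambda>y. {y, 0::nat}) {y \<in> V - {0}. p y = 0}" by (auto simp: inj_on_def doubleton_eq_iff)
  ultimately show ?thesis unfolding degree_def by (simp add: card_image)
qed

lemma tree_sum:
  fixes \<kappa> :: real
  shows "(\<Sum>T\<in>{T \<in> spanning_trees N. P T}. \<kappa> ^ degree T 0) =
    (\<Sum>p | rooted {0..N} p \<and> P (tree_of {0..N} p). \<kappa> ^ card {y \<in> {1..N}. p y = 0})"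
proof -
  have e: "{0..N} - {0} = {1..N}" by auto
  have s: "{T \<in> spanning_trees N. P T} = tree_of {0..N} ` {p. rooted {0..N} p \<and> P (tree_of {0..N} p)}"
    unfolding spanning_trees_eq by auto
  have "inj_on (tree_of {0..N}) {p. rooted {0..N} p \<and> P (tree_of {0..N} p)}"
    by (rule inj_on_subset[OF inj_tree_of]) auto
  then have "(\<Sum>T\<in>{T \<in> spanning_trees N. P T}. \<kappa> ^ degree T 0) =
      (\<Sum>p | rooted {0..N} p \<and> P (tree_of {0..N} p). \<kappa> ^ degree (tree_of {0..N} p) 0)"
    unfolding s by (subst sum.reindex) auto
  also have "\<dots> = (\<Sum>p | rooted {0..N} p \<and> P (tree_of {0..N} p). \<kappa> ^ card {y \<in> {1..N}. p y = 0})"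
    using degree_tree_of[of "{0..N}"] e by (intro sum.cong) auto
  finally show ?thesis .
qed

text \<open>The instance without leaves and clusters: there \<open>compat\<close> demands nothing,
  so every rooted parent function is summed.\<close>

lemma partition_function:
  fixes \<kappa> :: real
  shows "(\<Sum>T\<in>spanning_trees N. \<kappa> ^ degree T 0) = forest_weight N \<kappa>"
proof -
  have l: "laminar_on {} {}" by (simp add: laminar_on_def)
  have \<phi>: "(\<lambda>_. undefined) \<in> labellings N {} {} (\<lambda>_. 0)" by (simp add: labellings_def slots_def)
  have "(\<Sum>T\<in>spanning_trees N. \<kappa> ^ degree T 0) =
      (\<Sum>p | rooted {0..N} p. \<kappa> ^ card {y \<in> {1..N}. p y = 0})"
    using tree_sum[of \<kappa> N "\<lambda>_. True"] by simp
  also have "\<dots> = forest_weight N \<kappa>"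
    using compat_weight[OF l _ \<phi>, of \<kappa>] by (simp add: compat_def maxes_def)
  finally show ?thesis .
qed

lemma tree_law_prob:
  assumes "\<kappa> > 0"
  shows "\<P>(T in tree_law N \<kappa>. P T) =
    (\<Sum>p | rooted {0..N} p \<and> P (tree_of {0..N} p). \<kappa> ^ card {y \<in> {1..N}. p y = 0}) / forest_weight N \<kappa>"
proof -
  let ?Z = "\<Sum>S\<in>spanning_trees N. \<kappa> ^ degree S 0"
  have Z: "?Z > 0" using assms star_in_spanning_trees[of N] by (intro sum_pos finite_spanning_trees) auto
  have sp: "space (tree_law N \<kappa>) = spanning_trees N" by (simp add: tree_law_def space_point_measure)
  let ?A = "{T \<in> spanning_trees N. P T}"
  have "emeasure (tree_law N \<kappa>) ?A = (\<Sum>T\<in>?A. ennreal (\<kappa> ^ degree T 0 / ?Z))"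
    unfolding tree_law_def by (rule emeasure_point_measure_finite) (auto simp: finite_spanning_trees)
  also have "\<dots> = ennreal (\<Sum>T\<in>?A. \<kappa> ^ degree T 0 / ?Z)"
    using assms Z by (intro sum_ennreal) auto
  finally have "measure (tree_law N \<kappa>) ?A = (\<Sum>T\<in>?A. \<kappa> ^ degree T 0 / ?Z)"
    unfolding measure_def using assms Z by (simp add: sum_nonneg)
  also have "\<dots> = (\<Sum>T\<in>?A. \<kappa> ^ degree T 0) / ?Z" by (simp add: sum_divide_distrib)
  finally show ?thesis unfolding sp tree_sum partition_function .
qed

text \<open>The product is (N-l)!/(N-m)!, in a form that is 0 for N < m when l \<le> N.\<close>

definition law_weight :: "nat \<Rightarrow> real \<Rightarrow> nat \<Rightarrow> nat \<Rightarrow> nat \<Rightarrow> real"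
  where "law_weight N \<kappa> l r m =
    (\<Prod>k<m - l. real (N - l - k)) * \<kappa> ^ (r - 1) * (\<kappa> + real m) / (\<kappa> + real N) ^ m"

text \<open>Both forest weights have the base \<kappa> + N, so their quotient is (\<kappa> + m) /
  \<kappa> times a negative power of that base; the division by \<kappa> turns the exponent r into r
  - 1.\<close>

lemma cluster_counts_law:
  assumes F: "laminar_on {1..l} F" and l: "1 \<le> l" "l \<le> N" and n: "\<And>A. A \<in> F \<Longrightarrow> 0 < n A" and \<kappa>: "\<kappa> > 0"
  shows "\<P>(T in tree_law N \<kappa>. phier (gpar T) {1..l} = F \<and> (\<forall>A\<in>F. cnt (gpar T) {1..l} A = n A)) =
    law_weight N \<kappa> l (card (maxes F)) (sum n F)"
proof -
  define m where "m = sum n F"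
  define r where "r = card (maxes F)"
  have L: "{1..l} \<subseteq> {1..N}" using l by auto
  have lm: "l \<le> m" using card_labellings(3)[OF F L n] by (simp add: m_def)
  have "{1} \<in> F" using laminar_onD(5)[OF F] l by auto
  then have "maxes F \<noteq> {}" using below_max[OF F] by blast
  then have r: "r \<ge> 1" using laminar_onD(2)[OF F] by (simp add: r_def maxes_def Suc_le_eq card_gt_0_iff)
  have "\<P>(T in tree_law N \<kappa>. phier (gpar T) {1..l} = F \<and> (\<forall>A\<in>F. cnt (gpar T) {1..l} A = n A)) =
      (\<Sum>p | rooted {0..N} p \<and> phier p {1..l} = F \<and> (\<forall>A\<in>F. cnt p {1..l} A = n A). \<kappa> ^ card {y \<in> {1..N}. p y = 0})
        / forest_weight N \<kappa>"
    unfolding tree_law_prob[OF \<kappa>] by (intro arg_cong2[where f = "(/)"] sum.cong) (auto simp: gpar_tree_of)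
  also have "(\<Sum>p | rooted {0..N} p \<and> phier p {1..l} = F \<and> (\<forall>A\<in>F. cnt p {1..l} A = n A). \<kappa> ^ card {y \<in> {1..N}. p y = 0})
      = real (\<Prod>k=0..<sum n F - card {1..l}. N - card {1..l} - k) *
        (\<kappa> ^ card (maxes F) * forest_weight (N - sum n F) (\<kappa> + real (sum n F)))"
    by (rule cluster_counts_weight[OF F L n])
  also have "card {1..l} = l" by simp
  also have "real (\<Prod>k=0..<sum n F - l. N - l - k) *
      (\<kappa> ^ card (maxes F) * forest_weight (N - sum n F) (\<kappa> + real (sum n F))) / forest_weight N \<kappa> =
      real (\<Prod>k=0..<m - l. N - l - k) * (\<kappa> ^ r * forest_weight (N - m) (\<kappa> + real m)) / forest_weight N \<kappa>"
    by (simp only: m_def r_def)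
  also have "\<dots> = law_weight N \<kappa> l r m"
  proof (cases "m \<le> N")
    case True
    have K: "\<kappa> + real N > 0" using \<kappa> by simp
    \<comment> \<open>The quotient form also covers N = m, where the forest is empty and both sides
      are 1.\<close>
    have f1: "forest_weight (N - m) (\<kappa> + real m) = (\<kappa> + real m) * (\<kappa> + real N) ^ (N - m) / (\<kappa> + real N)"
      using True \<kappa> K by (cases "N = m") (auto simp: forest_weight_def power_eq_if of_nat_diff)
    have f2: "forest_weight N \<kappa> = \<kappa> * (\<kappa> + real N) ^ N / (\<kappa> + real N)"
      using l K by (auto simp: forest_weight_def power_eq_if)
    have f3: "(\<kappa> + real N) ^ N = (\<kappa> + real N) ^ m * (\<kappa> + real N) ^ (N - m)"
      using True by (simp flip: power_add)
    have f4: "\<kappa> ^ r = \<kappa> * \<kappa> ^ (r - 1)" using r by (simp add: power_eq_if)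
    have alg: "P * (\<kappa> * q * (b * Y / X)) / (\<kappa> * (M * Y) / X) = P * q * b / M"
      if "X > 0" "Y > 0" "M > 0" for P q b Y X M :: real
      using that \<kappa> by (simp add: field_simps)
    show ?thesis unfolding f1 f2 f3 f4 law_weight_def lessThan_atLeast0 of_nat_prod
      using K by (intro alg) auto
  next
    case False
    then have "N - l \<in> {0..<m - l}" using l by auto
    then have "(\<Prod>k=0..<m - l. N - l - k) = 0" by (intro prod_zero bexI[of _ "N - l"]) auto
    moreover have "(\<Prod>k<m - l. real (N - l - k)) = 0"
      using \<open>N - l \<in> {0..<m - l}\<close> by (intro prod_zero bexI[of _ "N - l"]) auto
    ultimately show ?thesis by (simp only: law_weight_def of_nat_0 mult_zero_left div_0)
  qed
  finally show ?thesis by (simp only: m_def r_def)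
qed

section \<open>Asymptotics\<close>

text \<open>The powers of N are distributed over the factors of \<open>law_weight\<close> so that
  each factor converges by itself when m is of order sqrt N.\<close>

definition scaled_weight :: "nat \<Rightarrow> real \<Rightarrow> nat \<Rightarrow> nat \<Rightarrow> nat \<Rightarrow> real"
  where "scaled_weight N c l r m =
    (\<Prod>k<m - l. real (N - l - k) / real N) * c ^ (r - 1) * (c + real m / sqrt (real N)) / (1 + c / sqrt (real N)) ^ m"

lemma scaled_weight:
  assumes N: "N \<ge> 1" and c: "c > 0" and r: "1 \<le> r" "r \<le> 2 * l" and m: "l \<le> m"
  shows "sqrt (real N) ^ (2 * l - r) * law_weight N (c * sqrt (real N)) l r m = scaled_weight N c l r m"
proof -
  define s where "s = sqrt (real N)"
  have s: "s > 0" "real N = s ^ 2" using N by (auto simp: s_def)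
  have P: "(\<Prod>k<m - l. real (N - l - k) / real N) = (\<Prod>k<m - l. real (N - l - k)) / (s ^ 2) ^ (m - l)"
    unfolding prod_dividef by (simp add: s(2))
  have e: "c * s + real N = s ^ 2 * (1 + c / s)" "c * s + real m = s * (c + real m / s)"
    using s by (auto simp: field_simps power2_eq_square)
  \<comment> \<open>Bookkeeping of powers of s = sqrt N: 2l - r from the normalisation, r - 1 from
    \<kappa>, one from \<kappa> + m and 2(m-l) from the product, against 2m in the
    denominator.\<close>
  have pw: "s ^ (2 * l - r) * (s ^ (r - 1) * s) * (s ^ 2) ^ (m - l) = (s ^ 2) ^ m"
  proof -
    have "s ^ (2 * l - r) * (s ^ (r - 1) * s) * (s ^ 2) ^ (m - l) = s ^ ((2 * l - r) + (r - 1 + 1) + 2 * (m - l))"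
      by (simp only: power_add power_mult power_one_right mult.assoc)
    also have "(2 * l - r) + (r - 1 + 1) + 2 * (m - l) = 2 * m" using r m by simp
    finally show ?thesis by (simp add: power_mult)
  qed
  have pos: "1 + c / s > 0" using s c by (simp add: add_pos_pos)
  have pos2: "(s ^ 2) ^ (m - l) > 0" using s by simp
  have "s ^ (2 * l - r) * law_weight N (c * s) l r m =
      s ^ (2 * l - r) * ((\<Prod>k<m - l. real (N - l - k)) * (c * s) ^ (r - 1) * (s * (c + real m / s))
        / ((s ^ 2) ^ m * (1 + c / s) ^ m))"
    unfolding law_weight_def e by (simp add: power_mult_distrib)
  also have "\<dots> = (\<Prod>k<m - l. real (N - l - k)) * c ^ (r - 1) * (c + real m / s) / (1 + c / s) ^ m *
      ((s ^ (2 * l - r) * (s ^ (r - 1) * s)) / (s ^ 2) ^ m)"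
    by (simp add: power_mult_distrib mult_ac)
  also have "(s ^ (2 * l - r) * (s ^ (r - 1) * s)) / (s ^ 2) ^ m = 1 / (s ^ 2) ^ (m - l)"
    unfolding pw[symmetric] using pos2 s by simp
  also have "(\<Prod>k<m - l. real (N - l - k)) * c ^ (r - 1) * (c + real m / s) / (1 + c / s) ^ m * (1 / (s ^ 2) ^ (m - l))
      = scaled_weight N c l r m"
    unfolding scaled_weight_def P s_def[symmetric] by simp
  finally show ?thesis by (simp add: s_def)
qed

section \<open>The falling factorial and the power of 1 + c / sqrt N\<close>

lemma sum_arith: "(\<Sum>k<M. real (l + k)) = real l * real M + real M * (real M - 1) / 2"
  by (induction M) (auto simp: field_simps)

lemma falling_upper:
  assumes "N \<ge> 1"
  shows "(\<Prod>k<M. real (N - l - k) / real N) \<le> exp (- (real l * real M + real M * (real M - 1) / 2) / real N)"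
proof -
  have "(\<Prod>k<M. real (N - l - k) / real N) \<le> (\<Prod>k<M. exp (- real (l + k) / real N))"
  proof (rule prod_mono, intro conjI)
    fix k
    show "0 \<le> real (N - l - k) / real N" by simp
    show "real (N - l - k) / real N \<le> exp (- real (l + k) / real N)"
    proof (cases "l + k \<le> N")
      case True
      then have "real (N - l - k) / real N = 1 + - real (l + k) / real N"
        using assms by (simp add: of_nat_diff field_simps)
      then show ?thesis using exp_ge_add_one_self[of "- real (l + k) / real N"] by simp
    qed simp
  qed
  also have "\<dots> = exp (\<Sum>k<M. - real (l + k) / real N)" by (simp add: exp_sum)
  also have "(\<Sum>k<M. - real (l + k) / real N) = - (real l * real M + real M * (real M - 1) / 2) / real N"
    unfolding sum_arith[symmetric] by (simp only: sum_divide_distrib[symmetric] sum_negf)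
  finally show ?thesis .
qed

text \<open>Each factor is 1 - x with x \<le> 1/2 by the hypothesis on N, and there ln (1 - x) \<ge>
  - x - 2 x^2. The quadratic term is replaced by its largest possible value.\<close>

lemma falling_lower:
  assumes N: "N \<ge> 1" and M: "2 * (l + M) \<le> N"
  shows "exp (- (real l * real M + real M * (real M - 1) / 2) / real N - real M * (2 * (real (l + M) / real N)\<^sup>2))
    \<le> (\<Prod>k<M. real (N - l - k) / real N)"
proof -
  have "exp (- (real l * real M + real M * (real M - 1) / 2) / real N - real M * (2 * (real (l + M) / real N)\<^sup>2)) =
      exp (\<Sum>k<M. - real (l + k) / real N - 2 * (real (l + M) / real N)\<^sup>2)"
    unfolding sum_arith[symmetric]
    by (simp only: sum_subtractf sum_divide_distrib[symmetric] sum_negf sum_constant card_lessThan)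
  also have "\<dots> = (\<Prod>k<M. exp (- real (l + k) / real N - 2 * (real (l + M) / real N)\<^sup>2))" by (simp add: exp_sum)
  also have "\<dots> \<le> (\<Prod>k<M. real (N - l - k) / real N)"
  proof (rule prod_mono, intro conjI)
    fix k assume "k \<in> {..<M}"
    then have k: "k < M" by simp
    define x where "x = real (l + k) / real N"
    have x: "0 \<le> x" "x \<le> 1 / 2" using k M N by (auto simp: x_def field_simps)
    have eq: "real (N - l - k) / real N = 1 - x"
      using k M N by (simp add: x_def of_nat_diff field_simps)
    have "x \<le> real (l + M) / real N" using k by (simp add: x_def divide_right_mono)
    then have "x\<^sup>2 \<le> (real (l + M) / real N)\<^sup>2" using x by (intro power_mono) auto
    moreover have "- real (l + k) / real N = - x" unfolding x_def by (simp only: minus_divide_left)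
    ultimately have "- real (l + k) / real N - 2 * (real (l + M) / real N)\<^sup>2 \<le> - x - 2 * x\<^sup>2" by linarith
    also have "\<dots> \<le> ln (1 - x)" using ln_one_minus_pos_lower_bound[OF x] .
    finally have "exp (- real (l + k) / real N - 2 * (real (l + M) / real N)\<^sup>2) \<le> exp (ln (1 - x))" by simp
    moreover have "exp (ln (1 - x)) = 1 - x" using x by simp
    ultimately show "exp (- real (l + k) / real N - 2 * (real (l + M) / real N)\<^sup>2) \<le> real (N - l - k) / real N"
      unfolding eq by (simp only:)
  qed simp
  finally show ?thesis .
qed

lemma sqrt_nat_at_top: "filterlim (\<lambda>N. sqrt (real N)) at_top sequentially"
  by (rule filterlim_compose[OF sqrt_at_top filterlim_real_sequentially])

lemma inverse_sqrt_tendsto: "(\<lambda>N. a / sqrt (real N)) \<longlonglongrightarrow> 0"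
  by (rule real_tendsto_divide_at_top[OF tendsto_const sqrt_nat_at_top])

context
  fixes m :: "nat \<Rightarrow> nat" and \<sigma> :: real
  assumes m: "(\<lambda>N. real (m N) / sqrt (real N)) \<longlonglongrightarrow> \<sigma>"
begin

text \<open>The two exponential bounds share the exponent \<open>?E\<close>, which tends to
  \<sigma>^2/2. They differ by \<open>?R\<close>, of the order of M^3/N^2, which vanishes for M of
  order sqrt N.\<close>

lemma falling_tendsto:
  assumes lm: "\<And>N. l \<le> m N"
  shows "(\<lambda>N. \<Prod>k<m N - l. real (N - l - k) / real N) \<longlonglongrightarrow> exp (- \<sigma>\<^sup>2 / 2)"
proof -
  define M where "M = (\<lambda>N. m N - l)"
  have M: "(\<lambda>N. real (M N) / sqrt (real N)) \<longlonglongrightarrow> \<sigma>"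
  proof -
    have "(\<lambda>N. real (m N) / sqrt (real N) - real l / sqrt (real N)) \<longlonglongrightarrow> \<sigma> - 0"
      by (intro tendsto_diff m inverse_sqrt_tendsto)
    moreover have "real (m N) / sqrt (real N) - real l / sqrt (real N) = real (M N) / sqrt (real N)" for N
      using lm[of N] by (simp add: M_def of_nat_diff diff_divide_distrib)
    ultimately show ?thesis by simp
  qed
  have sq: "sqrt (real N) * sqrt (real N) = real N" for N by simp
  let ?E = "\<lambda>N. (real l * real (M N) + real (M N) * (real (M N) - 1) / 2) / real N"
  let ?R = "\<lambda>N. real (M N) * (2 * (real (l + M N) / real N)\<^sup>2)"
  have E: "?E \<longlonglongrightarrow> \<sigma>\<^sup>2 / 2"
  proof -
    have "(\<lambda>N. real (M N) / sqrt (real N) * (real l / sqrt (real N)) + (real (M N) / sqrt (real N))\<^sup>2 / 2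
        - real (M N) / sqrt (real N) * ((1 / 2) / sqrt (real N))) \<longlonglongrightarrow> \<sigma> * 0 + \<sigma>\<^sup>2 / 2 - \<sigma> * 0"
      by (intro tendsto_intros M inverse_sqrt_tendsto) simp
    moreover have "\<forall>\<^sub>F N in sequentially. real (M N) / sqrt (real N) * (real l / sqrt (real N)) + (real (M N) / sqrt (real N))\<^sup>2 / 2
        - real (M N) / sqrt (real N) * ((1 / 2) / sqrt (real N)) = ?E N"
      using eventually_gt_at_top[of 0]
      by eventually_elim (simp add: field_simps power2_eq_square)
    ultimately show ?thesis by (auto intro: Lim_transform_eventually)
  qed
  have R: "?R \<longlonglongrightarrow> 0"
  proof -
    have "(\<lambda>N. real (M N) / sqrt (real N) * (real l / sqrt (real N) + real (M N) / sqrt (real N))\<^sup>2 * (2 / sqrt (real N)))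
        \<longlonglongrightarrow> \<sigma> * (0 + \<sigma>)\<^sup>2 * 0"
      by (intro tendsto_intros M inverse_sqrt_tendsto)
    moreover have "\<forall>\<^sub>F N in sequentially. real (M N) / sqrt (real N) * (real l / sqrt (real N) + real (M N) / sqrt (real N))\<^sup>2 * (2 / sqrt (real N)) = ?R N"
      using eventually_gt_at_top[of 0]
    proof eventually_elim
      case (elim N)
      define s where "s = sqrt (real N)"
      have s: "s > 0" "real N = s * s" using elim by (auto simp: s_def)
      show ?case unfolding s_def[symmetric] s(2) using s(1)
        by (simp add: field_simps power2_eq_square)
    qed
    ultimately show ?thesis by (auto intro: Lim_transform_eventually)
  qed
  have half: "\<forall>\<^sub>F N in sequentially. 2 * (l + M N) \<le> N"
  proof -
    have "(\<lambda>N. 2 * (real l / sqrt (real N) + real (M N) / sqrt (real N)) * (1 / sqrt (real N))) \<longlonglongrightarrow> 2 * (0 + \<sigma>) * 0"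
      by (intro tendsto_intros M inverse_sqrt_tendsto)
    then have "\<forall>\<^sub>F N in sequentially. 2 * (real l / sqrt (real N) + real (M N) / sqrt (real N)) * (1 / sqrt (real N)) < 1"
      by (intro order_tendstoD) auto
    then show ?thesis using eventually_gt_at_top[of 0]
    proof eventually_elim
      case (elim N)
      have "2 * (real l + real (M N)) / real N < 1"
        using elim sq[of N] by (simp add: field_simps)
      then have "2 * (real l + real (M N)) < real N" using elim by (simp add: field_simps)
      then have "real (2 * (l + M N)) < real N" by simp
      then show ?case by (simp only: of_nat_less_iff)
    qed
  qed
  have up: "\<forall>\<^sub>F N in sequentially. (\<Prod>k<M N. real (N - l - k) / real N) \<le> exp (- ?E N)"
    using eventually_ge_at_top[of 1]
    by eventually_elim (use falling_upper in \<open>simp only: minus_divide_left\<close>)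
  have lo: "\<forall>\<^sub>F N in sequentially. exp (- ?E N - ?R N) \<le> (\<Prod>k<M N. real (N - l - k) / real N)"
    using eventually_ge_at_top[of 1] half
    by eventually_elim (use falling_lower in \<open>simp only: minus_divide_left\<close>)
  have "(\<lambda>N. exp (- ?E N)) \<longlonglongrightarrow> exp (- (\<sigma>\<^sup>2 / 2))" by (intro tendsto_intros E)
  moreover have "(\<lambda>N. exp (- ?E N - ?R N)) \<longlonglongrightarrow> exp (- (\<sigma>\<^sup>2 / 2) - 0)" by (intro tendsto_intros E R)
  ultimately have "(\<lambda>N. \<Prod>k<M N. real (N - l - k) / real N) \<longlonglongrightarrow> exp (- (\<sigma>\<^sup>2 / 2))"
    using tendsto_sandwich[OF lo up] by simp
  then show ?thesis by (simp add: M_def)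
qed

lemma power_tendsto_exp:
  assumes c: "c > 0"
  shows "(\<lambda>N. (1 + c / sqrt (real N)) ^ m N) \<longlonglongrightarrow> exp (c * \<sigma>)"
proof -
  have L: "(\<lambda>N. sqrt (real N) * ln (1 + c / sqrt (real N))) \<longlonglongrightarrow> c"
  proof (rule tendsto_sandwich)
    show "\<forall>\<^sub>F N in sequentially. sqrt (real N) * ln (1 + c / sqrt (real N)) \<le> c"
      using eventually_gt_at_top[of 0]
    proof eventually_elim
      case (elim N)
      have "ln (1 + c / sqrt (real N)) \<le> c / sqrt (real N)" using c by (intro ln_add_one_self_le_self) simp
      then show ?case using elim by (simp add: field_simps)
    qed
    have "(\<lambda>N. c / sqrt (real N)) \<longlonglongrightarrow> 0" by (rule inverse_sqrt_tendsto)
    then have "\<forall>\<^sub>F N in sequentially. c / sqrt (real N) < 1" by (intro order_tendstoD) auto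
    then show "\<forall>\<^sub>F N in sequentially. c - c\<^sup>2 / sqrt (real N) \<le> sqrt (real N) * ln (1 + c / sqrt (real N))"
      using eventually_gt_at_top[of 0]
    proof eventually_elim
      case (elim N)
      define s where "s = sqrt (real N)"
      have s: "s > 0" using elim by (simp add: s_def)
      have "c / s - (c / s)\<^sup>2 \<le> ln (1 + c / s)"
        using elim c by (intro ln_one_plus_pos_lower_bound) (auto simp: s_def)
      then have "s * (c / s - (c / s)\<^sup>2) \<le> s * ln (1 + c / s)" using s by (intro mult_left_mono) auto
      also have "s * (c / s - (c / s)\<^sup>2) = c - c\<^sup>2 / s" using s by (simp add: field_simps power2_eq_square)
      finally show ?case by (simp add: s_def)
    qed
    show "(\<lambda>N. c - c\<^sup>2 / sqrt (real N)) \<longlonglongrightarrow> c"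
      using tendsto_diff[OF tendsto_const inverse_sqrt_tendsto, of c "c\<^sup>2"] by simp
  qed simp
  have "(\<lambda>N. exp (real (m N) / sqrt (real N) * (sqrt (real N) * ln (1 + c / sqrt (real N))))) \<longlonglongrightarrow> exp (\<sigma> * c)"
    by (intro tendsto_intros m L)
  moreover have "\<forall>\<^sub>F N in sequentially. exp (real (m N) / sqrt (real N) * (sqrt (real N) * ln (1 + c / sqrt (real N)))) =
      (1 + c / sqrt (real N)) ^ m N"
    using eventually_gt_at_top[of 0]
  proof eventually_elim
    case (elim N)
    have p: "1 + c / sqrt (real N) > 0" using c by (intro add_pos_nonneg) auto
    have "real (m N) / sqrt (real N) * (sqrt (real N) * ln (1 + c / sqrt (real N))) = real (m N) * ln (1 + c / sqrt (real N))"
      using elim by simp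
    then show ?case using p by (simp add: exp_of_nat_mult)
  qed
  ultimately show ?thesis by (auto intro: Lim_transform_eventually simp: mult.commute)
qed

lemma scaled_weight_tendsto:
  assumes c: "c > 0" and lm: "\<And>N. l \<le> m N"
  shows "(\<lambda>N. scaled_weight N c l r (m N)) \<longlonglongrightarrow> c ^ (r - 1) * (\<sigma> + c) * exp (- \<sigma>\<^sup>2 / 2 - c * \<sigma>)"
proof -
  have "(\<lambda>N. scaled_weight N c l r (m N)) \<longlonglongrightarrow> exp (- \<sigma>\<^sup>2 / 2) * c ^ (r - 1) * (c + \<sigma>) / exp (c * \<sigma>)"
    unfolding scaled_weight_def
    by (intro tendsto_intros falling_tendsto lm m power_tendsto_exp c) simp
  also have "exp (- \<sigma>\<^sup>2 / 2) * c ^ (r - 1) * (c + \<sigma>) / exp (c * \<sigma>) =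
      c ^ (r - 1) * (\<sigma> + c) * exp (- \<sigma>\<^sup>2 / 2 - c * \<sigma>)" by (simp add: exp_diff)
  finally show ?thesis .
qed

end

lemma powr_half_eq: "N \<ge> 1 \<Longrightarrow> real N powr (real k / 2) = sqrt (real N) ^ k"
proof -
  assume "N \<ge> 1"
  then have "real N powr (real k / 2) = (real N powr (1 / 2)) powr real k" by (simp add: powr_powr)
  also have "\<dots> = sqrt (real N) ^ k" using \<open>N \<ge> 1\<close> by (simp add: powr_half_sqrt powr_realpow)
  finally show ?thesis .
qed

lemma law_weight_limit:
  assumes m: "(\<lambda>N. real (m N) / sqrt (real N)) \<longlonglongrightarrow> \<sigma>" and lm: "\<And>N. l \<le> m N"
    and c: "c > 0" and r: "1 \<le> r" "r \<le> 2 * l"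
  shows "(\<lambda>N. real N powr (real (2 * l - r) / 2) * law_weight N (c * sqrt (real N)) l r (m N))
    \<longlonglongrightarrow> c ^ (r - 1) * (\<sigma> + c) * exp (- \<sigma>\<^sup>2 / 2 - c * \<sigma>)"
proof -
  have "\<forall>\<^sub>F N in sequentially. scaled_weight N c l r (m N) =
      real N powr (real (2 * l - r) / 2) * law_weight N (c * sqrt (real N)) l r (m N)"
    using eventually_ge_at_top[of 1]
    by eventually_elim (use scaled_weight[OF _ c r lm] powr_half_eq in simp)
  then show ?thesis using scaled_weight_tendsto[OF m c lm] by (rule Lim_transform_eventually[rotated])
qed

section \<open>Integer parts and binomial coefficients at scale sqrt N\<close>

lemma floor_sqrt_tendsto:
  assumes "t \<ge> 0"
  shows "(\<lambda>N. real (nat \<lfloor>t * sqrt (real N)\<rfloor>) / sqrt (real N)) \<longlonglongrightarrow> t"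
proof (rule tendsto_sandwich)
  show "\<forall>\<^sub>F N in sequentially. t - 1 / sqrt (real N) \<le> real (nat \<lfloor>t * sqrt (real N)\<rfloor>) / sqrt (real N)"
    using eventually_gt_at_top[of 0]
  proof eventually_elim
    case (elim N)
    have "t * sqrt (real N) - 1 \<le> real (nat \<lfloor>t * sqrt (real N)\<rfloor>)" by linarith
    then have "(t * sqrt (real N) - 1) / sqrt (real N) \<le> real (nat \<lfloor>t * sqrt (real N)\<rfloor>) / sqrt (real N)"
      by (intro divide_right_mono) auto
    then show ?case using elim by (simp add: diff_divide_distrib)
  qed
  show "\<forall>\<^sub>F N in sequentially. real (nat \<lfloor>t * sqrt (real N)\<rfloor>) / sqrt (real N) \<le> t"
    using eventually_gt_at_top[of 0]
  proof eventually_elim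
    case (elim N)
    have "0 \<le> t * sqrt (real N)" using assms by simp
    then have "real (nat \<lfloor>t * sqrt (real N)\<rfloor>) \<le> t * sqrt (real N)" by linarith
    then show ?case using elim by (simp add: field_simps)
  qed
  show "(\<lambda>N. t - 1 / sqrt (real N)) \<longlonglongrightarrow> t"
    using tendsto_diff[OF tendsto_const inverse_sqrt_tendsto, of t 1] by simp
qed simp

lemma binomial_tendsto:
  assumes J: "(\<lambda>N. real (J N) / sqrt (real N)) \<longlonglongrightarrow> s"
  shows "(\<lambda>N. real ((J N + q) choose q) / sqrt (real N) ^ q) \<longlonglongrightarrow> s ^ q / fact q"
proof -
  have "(\<lambda>N. \<Prod>i=0..<q. (real (J N) / sqrt (real N) + real (q - i) / sqrt (real N)) / real (q - i)) \<longlonglongrightarrow>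
      (\<Prod>i=0..<q. (s + 0) / real (q - i))"
    by (intro tendsto_prod tendsto_divide tendsto_add J inverse_sqrt_tendsto tendsto_const) auto
  also have "(\<Prod>i=0..<q. (s + 0) / real (q - i)) = s ^ q / fact q"
    by (simp add: prod_dividef fact_prod_rev)
  finally have *: "(\<lambda>N. \<Prod>i=0..<q. (real (J N) / sqrt (real N) + real (q - i) / sqrt (real N)) / real (q - i)) \<longlonglongrightarrow> s ^ q / fact q" .
  have "(\<Prod>i=0..<q. (real (J N) / sqrt (real N) + real (q - i) / sqrt (real N)) / real (q - i)) =
      real ((J N + q) choose q) / sqrt (real N) ^ q" for N
  proof -
    have "(\<Prod>i=0..<q. (real (J N) / sqrt (real N) + real (q - i) / sqrt (real N)) / real (q - i)) =
        (\<Prod>i=0..<q. real (J N + q - i) / real (q - i) / sqrt (real N))"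
      by (intro prod.cong) (auto simp: of_nat_diff add_divide_distrib[symmetric] algebra_simps)
    also have "\<dots> = (\<Prod>i=0..<q. real (J N + q - i) / real (q - i)) / sqrt (real N) ^ q"
      by (simp add: prod_dividef prod.distrib)
    also have "(\<Prod>i=0..<q. real (J N + q - i) / real (q - i)) = real ((J N + q) choose q)"
      by (rule binomial_altdef_of_nat[symmetric]) simp
    finally show ?thesis .
  qed
  then show ?thesis using * by simp
qed

lemma binomial_le_power: "real ((J + q) choose q) \<le> real (J + q) ^ q"
proof -
  have "real ((J + q) choose q) = (\<Prod>i=0..<q. real (J + q - i) / real (q - i))"
    by (rule binomial_altdef_of_nat) simp
  also have "\<dots> \<le> (\<Prod>i=0..<q. real (J + q))"
  proof (rule prod_mono, intro conjI)
    fix i assume "i \<in> {0..<q}"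
    then have "1 \<le> real (q - i)" by simp
    then have "real (J + q - i) / real (q - i) \<le> real (J + q - i) / 1" by (intro divide_left_mono) auto
    also have "\<dots> \<le> real (J + q)" by simp
    finally show "real (J + q - i) / real (q - i) \<le> real (J + q)" .
  qed simp
  finally show ?thesis by simp
qed

subsection \<open>The limiting integrals\<close>

text \<open>Completing the square gives a multiple of the normal density with mean \<open>b\<close>.
  The linear term is needed because polynomial factors will be majorised by exponentials.\<close>

lemma integrable_gauss: "integrable lborel (\<lambda>s::real. exp (- s\<^sup>2 / 2 + b * s))"
proof -
  have "exp (- s\<^sup>2 / 2 + b * s) = sqrt (2 * pi) * exp (b\<^sup>2 / 2) * normal_density b 1 s" for s
  proof -
    have e: "- s\<^sup>2 / 2 + b * s = b\<^sup>2 / 2 + - (s - b)\<^sup>2 / 2" by (simp add: power2_eq_square field_simps)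
    show ?thesis unfolding e exp_add normal_density_def by simp
  qed
  then show ?thesis by simp
qed

lemma gauss_dominated:
  fixes f :: "real \<Rightarrow> real"
  assumes [measurable]: "f \<in> borel_measurable borel"
    and b: "\<And>s. s \<ge> 0 \<Longrightarrow> \<bar>f s\<bar> \<le> C * exp (- s\<^sup>2 / 2 + b * s)"
  shows "set_integrable lborel {0..} f"
  unfolding set_integrable_def
proof (rule Bochner_Integration.integrable_bound)
  show "integrable lborel (\<lambda>s. C * exp (- s\<^sup>2 / 2 + b * s))"
    by (intro integrable_mult_right integrable_gauss)
  show "(\<lambda>s. indicator {0..} s *\<^sub>R f s) \<in> borel_measurable lborel" by measurable
  show "AE s in lborel. norm (indicator {0..} s *\<^sub>R f s) \<le> norm (C * exp (- s\<^sup>2 / 2 + b * s))"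
  proof (rule AE_I2)
    fix s :: real
    show "norm (indicator {0..} s *\<^sub>R f s) \<le> norm (C * exp (- s\<^sup>2 / 2 + b * s))"
      using b[of s] by (cases "s \<ge> 0") (auto simp: indicator_def)
  qed
qed

lemma set_integrable_moment:
  assumes c: "c > (0::real)"
  shows "set_integrable lborel {0..} (\<lambda>s. s ^ k * exp (- s\<^sup>2 / 2 - c * s))"
proof (rule gauss_dominated[where C = 1 and b = "real k"])
  fix s :: real assume s: "s \<ge> 0"
  have "s ^ k \<le> exp s ^ k" using s exp_ge_add_one_self[of s] by (intro power_mono) linarith+
  also have "\<dots> = exp (real k * s)" by (simp add: exp_of_nat_mult)
  finally have "s ^ k * exp (- s\<^sup>2 / 2 - c * s) \<le> exp (real k * s) * exp (- s\<^sup>2 / 2)"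
    using s c by (intro mult_mono) auto
  also have "\<dots> = 1 * exp (- s\<^sup>2 / 2 + real k * s)" unfolding exp_add by simp
  finally show "\<bar>s ^ k * exp (- s\<^sup>2 / 2 - c * s)\<bar> \<le> 1 * exp (- s\<^sup>2 / 2 + real k * s)"
    using s by (subst abs_of_nonneg) auto
qed measurable

text \<open>With index 2l - r - 1 this is \<open>I_lim l r c\<close> without its power of c. The
  index 0, reached for l = r = 1, needs no separate case here.\<close>

definition moment :: "real \<Rightarrow> nat \<Rightarrow> real"
  where "moment c k = (LBINT \<sigma>:{0..}. (\<sigma> + c) * \<sigma> ^ k * exp (- \<sigma>\<^sup>2 / 2 - c * \<sigma>)) / fact k"

context
  fixes c :: real assumes c: "c > 0"
begin

lemma set_integrable_density:
  "set_integrable lborel {0..} (\<lambda>s. (s + c) * s ^ k * exp (- s\<^sup>2 / 2 - c * s))"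
proof -
  have "set_integrable lborel {0..} (\<lambda>s. s ^ Suc k * exp (- s\<^sup>2 / 2 - c * s) + c * (s ^ k * exp (- s\<^sup>2 / 2 - c * s)))"
    by (intro set_integral_add set_integrable_mult_right set_integrable_moment c)
  then show ?thesis by (simp add: algebra_simps)
qed

lemma density_integral:
  "(LBINT s:{0..}. (s + c) * s ^ k * exp (- s\<^sup>2 / 2 - c * s)) =
    (LBINT s:{0..}. s ^ Suc k * exp (- s\<^sup>2 / 2 - c * s)) + c * (LBINT s:{0..}. s ^ k * exp (- s\<^sup>2 / 2 - c * s))"
proof -
  have "(LBINT s:{0..}. (s + c) * s ^ k * exp (- s\<^sup>2 / 2 - c * s)) =
      (LBINT s:{0..}. s ^ Suc k * exp (- s\<^sup>2 / 2 - c * s) + c * (s ^ k * exp (- s\<^sup>2 / 2 - c * s)))"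
    by (simp add: algebra_simps)
  also have "\<dots> = (LBINT s:{0..}. s ^ Suc k * exp (- s\<^sup>2 / 2 - c * s)) +
      (LBINT s:{0..}. c * (s ^ k * exp (- s\<^sup>2 / 2 - c * s)))"
    by (intro set_integral_add set_integrable_mult_right set_integrable_moment c)
  finally show ?thesis by simp
qed

text \<open>The integrand is the derivative of - exp (- s^2/2 - c s). This is why the separate value
  1 in \<open>I_lim\<close> fits the general formula.\<close>

lemma moment_0: "moment c 0 = 1"
proof -
  let ?f = "\<lambda>s::real. (s + c) * exp (- s\<^sup>2 / 2 - c * s)"
  have "(\<integral>\<^sup>+ s. ennreal (?f s) * indicator {0..} s \<partial>lborel) = ennreal (0 - - exp (- 0\<^sup>2 / 2 - c * 0))"
  proof (rule nn_integral_FTC_atLeast)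
    show "?f \<in> borel_measurable borel" by measurable
    show "DERIV (\<lambda>s. - exp (- s\<^sup>2 / 2 - c * s)) s :> ?f s" for s
      by (auto intro!: derivative_eq_intros simp: algebra_simps)
    show "0 \<le> ?f s" if "0 \<le> s" for s using that c by simp
    have "((\<lambda>s. exp (- s\<^sup>2 / 2 - c * s)) \<longlongrightarrow> 0) at_top"
    proof (rule tendsto_sandwich[OF _ _ tendsto_const])
      show "\<forall>\<^sub>F s in at_top. exp (- s\<^sup>2 / 2 - c * s) \<le> exp (- (c * s))" by (rule always_eventually) simp
      have "filterlim (\<lambda>s. c * s) at_top at_top"
        using c by (intro filterlim_tendsto_pos_mult_at_top[OF tendsto_const]) (auto simp: filterlim_ident)
      then have "filterlim (\<lambda>s. - (c * s)) at_bot at_top" by (simp add: filterlim_uminus_at_bot)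
      then show "((\<lambda>s. exp (- (c * s))) \<longlongrightarrow> 0) at_top" by (rule filterlim_compose[OF exp_at_bot])
    qed simp
    from tendsto_minus[OF this]
    show "((\<lambda>s. - exp (- s\<^sup>2 / 2 - c * s)) \<longlongrightarrow> 0) at_top" by simp
  qed
  moreover have "ennreal (?f s) * indicator {0..} s = ennreal (indicator {0..} s *\<^sub>R ?f s)" for s
    by (simp add: indicator_def)
  ultimately have n: "(\<integral>\<^sup>+ s. ennreal (indicator {0..} s *\<^sub>R ?f s) \<partial>lborel) = ennreal 1" by simp
  have "(\<integral> s. indicator {0..} s *\<^sub>R ?f s \<partial>lborel) = enn2real (\<integral>\<^sup>+ s. ennreal (indicator {0..} s *\<^sub>R ?f s) \<partial>lborel)"
    using c by (intro integral_eq_nn_integral) (auto simp: indicator_def)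
  then have "(\<integral> s. indicator {0..} s *\<^sub>R ?f s \<partial>lborel) = 1" unfolding n by simp
  then show ?thesis by (simp add: moment_def set_lebesgue_integral_def)
qed

lemma moment_Suc: "moment c (Suc k) = (LBINT s:{0..}. s ^ k * exp (- s\<^sup>2 / 2 - c * s)) / fact k"
proof -
  \<comment> \<open>Every k is 2l - r - 2 with r = 2 or r = 1 according to parity, so the
    integration by parts already proved for \<open>I_lim\<close> covers all moments.\<close>
  obtain l r where lr: "l \<ge> 2" "1 \<le> r" "r \<le> l" "k = 2 * l - r - 2"
  proof (cases "even k")
    case True
    then obtain j where "k = 2 * j" by blast
    then show ?thesis using that[of "j + 2" 2] by simp
  next
    case False
    then obtain j where "k = 2 * j + 1" by (auto elim: oddE)
    then show ?thesis using that[of "j + 2" 1] by simp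
  qed
  have e: "2 * l - r - 1 = Suc k" using lr by simp
  have cp: "c ^ (r - 1) > 0" using c by simp
  have "c ^ (r - 1) * moment c (Suc k) = I_lim l r c"
  proof -
    have n: "\<not> (l = 1 \<and> r = 1)" using lr(1) by simp
    show ?thesis unfolding I_lim_def if_not_P[OF n] e moment_def by simp
  qed
  also have "\<dots> = c ^ (r - 1) * ((LBINT s:{0..}. s ^ k * exp (- s\<^sup>2 / 2 - c * s)) / fact k)"
    using I_lim_altdef[OF lr(1-3) c] by (simp add: lr(4))
  finally show ?thesis unfolding mult_cancel_left using cp by linarith
qed

text \<open>Splitting the factor s + c in \<open>moment c j\<close> leaves two plain Gaussian
  integrals, and \<open>moment_Suc\<close> recognises them as the two moments on the left.\<close>

lemma moment_recursion: "real (Suc j) * moment c (j + 2) + c * moment c (Suc j) = moment c j"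
proof -
  have "real (Suc j) * moment c (Suc (Suc j)) = (LBINT s:{0..}. s ^ Suc j * exp (- s\<^sup>2 / 2 - c * s)) / fact j"
    unfolding moment_Suc[of "Suc j"] fact_Suc of_nat_mult by simp
  moreover have "c * moment c (Suc j) = c * (LBINT s:{0..}. s ^ j * exp (- s\<^sup>2 / 2 - c * s)) / fact j"
    unfolding moment_Suc by simp
  moreover have "moment c j = ((LBINT s:{0..}. s ^ Suc j * exp (- s\<^sup>2 / 2 - c * s)) +
      c * (LBINT s:{0..}. s ^ j * exp (- s\<^sup>2 / 2 - c * s))) / fact j"
    unfolding moment_def density_integral ..
  ultimately show ?thesis by (simp add: add_divide_distrib)
qed

lemma moment_pos: "moment c k > 0"
proof -
  let ?f = "\<lambda>s::real. (s + c) * s ^ k * exp (- s\<^sup>2 / 2 - c * s)"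
  \<comment> \<open>On [1, 2] the exponent is least at s = 2, where it equals - 2 - 2 c, and the
    remaining factors (s + c)/c and s^k are at least 1.\<close>
  let ?g = "\<lambda>s::real. indicator {1..2} s *\<^sub>R exp (- 2 - 2 * c)"
  have "integral\<^sup>L lborel ?g \<le> integral\<^sup>L lborel (\<lambda>s. indicator {0..} s *\<^sub>R ((1 / c) * ?f s))"
  proof (rule integral_mono)
    show "integrable lborel ?g" by (simp add: integrable_indicator_iff)
    show "integrable lborel (\<lambda>s. indicator {0..} s *\<^sub>R ((1 / c) * ?f s))"
      using set_integrable_mult_right[OF set_integrable_density, of "1 / c" k] by (simp add: set_integrable_def)
    fix s :: real
    show "?g s \<le> indicator {0..} s *\<^sub>R ((1 / c) * ?f s)"
    proof (cases "s \<in> {1..2}")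
      case True
      then have s: "1 \<le> s" "s \<le> 2" by auto
      have "s\<^sup>2 \<le> 2\<^sup>2" using s by (intro power_mono) auto
      moreover have "c * s \<le> c * 2" using s c by (intro mult_left_mono) auto
      ultimately have e: "exp (- 2 - 2 * c) \<le> exp (- s\<^sup>2 / 2 - c * s)" by simp
      have "1 \<le> (1 / c) * (s + c)" using s c by (simp add: field_simps)
      moreover have "1 \<le> s ^ k" using s by simp
      ultimately have "1 * 1 \<le> (1 / c) * (s + c) * s ^ k" using s c by (intro mult_mono) auto
      then have "1 * exp (- 2 - 2 * c) \<le> ((1 / c) * (s + c) * s ^ k) * exp (- s\<^sup>2 / 2 - c * s)"
        using e by (intro mult_mono) auto
      then show ?thesis using s by (simp add: indicator_def mult.assoc)
    next
      case False
      then show ?thesis using c by (auto simp: indicator_def)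
    qed
  qed
  moreover have "integral\<^sup>L lborel ?g = exp (- 2 - 2 * c)" by simp
  ultimately have "0 < integral\<^sup>L lborel (\<lambda>s. indicator {0..} s *\<^sub>R ((1 / c) * ?f s))"
    using exp_gt_zero[of "- 2 - 2 * c"] by linarith
  also have "\<dots> = (1 / c) * (LBINT s:{0..}. ?f s)"
    unfolding set_lebesgue_integral_def by (simp flip: integral_mult_right_zero add: mult_ac)
  finally show ?thesis using c by (simp add: moment_def zero_less_divide_iff)
qed

lemma I_lim_moment:
  assumes "1 \<le> l" "1 \<le> r" "r \<le> l"
  shows "I_lim l r c = c ^ (r - 1) * moment c (2 * l - r - 1)"
proof (cases "l = 1 \<and> r = 1")
  case True then show ?thesis by (simp add: I_lim_def moment_0)
next
  case False then show ?thesis unfolding I_lim_def if_not_P[OF False] moment_def by simp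
qed

text \<open>Expanding the count by its recursion and shifting the index in the first sum, the
  coefficient of K m r becomes c^(r-1) times (j+1) M_(j+2) + c M_(j+1) with j = 2m - r - 1. By
  \<open>moment_recursion\<close> this is c^(r-1) M_j, the term for m leaves.\<close>

lemma hier_count_moment_sum:
  "(\<Sum>r=1..Suc l. real (hier_count (Suc l) r) * (c ^ (r - 1) * moment c (2 * Suc l - r - 1))) = 1"
proof (induction l)
  case 0
  show ?case by (simp add: moment_0)
next
  case (Suc l)
  define m where "m = Suc l"
  let ?h = "\<lambda>r. real (hier_count m r)" and ?M = "moment c"
  have "(\<Sum>r=1..Suc m. real (hier_count (Suc m) r) * (c ^ (r - 1) * ?M (2 * Suc m - r - 1))) =
      (\<Sum>r=1..Suc m. ?h (r - 1) * (c ^ (r - 1) * ?M (2 * m + 1 - r)) + real (2 * m - r) * ?h r * (c ^ (r - 1) * ?M (2 * m + 1 - r)))"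
  proof (rule sum.cong[OF refl])
    fix r assume r: "r \<in> {1..Suc m}"
    have "hier_count (Suc m) r = hier_count m (r - 1) + (2 * m - r) * hier_count m r" using r by simp
    then have h: "real (hier_count (Suc m) r) = ?h (r - 1) + real (2 * m - r) * ?h r"
      by (simp only: of_nat_add of_nat_mult)
    have "2 * Suc m - r - 1 = 2 * m + 1 - r" by simp
    then show "real (hier_count (Suc m) r) * (c ^ (r - 1) * ?M (2 * Suc m - r - 1)) =
      ?h (r - 1) * (c ^ (r - 1) * ?M (2 * m + 1 - r)) + real (2 * m - r) * ?h r * (c ^ (r - 1) * ?M (2 * m + 1 - r))"
      by (simp only: h distrib_right)
  qed
  also have "\<dots> = (\<Sum>r=1..Suc m. ?h (r - 1) * (c ^ (r - 1) * ?M (2 * m + 1 - r))) +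
      (\<Sum>r=1..Suc m. real (2 * m - r) * ?h r * (c ^ (r - 1) * ?M (2 * m + 1 - r)))"
    by (rule sum.distrib)
  also have "(\<Sum>r=1..Suc m. ?h (r - 1) * (c ^ (r - 1) * ?M (2 * m + 1 - r))) =
      (\<Sum>r=0..m. ?h r * (c ^ r * ?M (2 * m - r)))"
    using sum.shift_bounds_cl_Suc_ivl[of "\<lambda>r. ?h (r - 1) * (c ^ (r - 1) * ?M (2 * m + 1 - r))" 0 m] by simp
  also have "\<dots> = (\<Sum>r=1..m. ?h r * (c ^ r * ?M (2 * m - r)))"
    using sum.atLeast_Suc_atMost[of 0 m "\<lambda>r. ?h r * (c ^ r * ?M (2 * m - r))"] hier_count_0[of m]
    by (simp add: m_def)
  also have "(\<Sum>r=1..Suc m. real (2 * m - r) * ?h r * (c ^ (r - 1) * ?M (2 * m + 1 - r))) =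
      (\<Sum>r=1..m. real (2 * m - r) * ?h r * (c ^ (r - 1) * ?M (2 * m + 1 - r)))"
    using hier_count_big[of m "Suc m"] by simp
  also have "(\<Sum>r=1..m. ?h r * (c ^ r * ?M (2 * m - r))) +
      (\<Sum>r=1..m. real (2 * m - r) * ?h r * (c ^ (r - 1) * ?M (2 * m + 1 - r))) =
      (\<Sum>r=1..m. ?h r * (c ^ (r - 1) * ?M (2 * m - r - 1)))"
    unfolding sum.distrib[symmetric]
  proof (rule sum.cong[OF refl])
    fix r assume "r \<in> {1..m}"
    then have r: "1 \<le> r" "r \<le> m" by auto
    define j where "j = 2 * m - r - 1"
    have j: "2 * m - r = Suc j" "2 * m + 1 - r = j + 2" using r by (auto simp: j_def)
    have "c ^ r = c * c ^ (r - 1)" using r by (simp add: power_eq_if)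
    then have "?h r * (c ^ r * ?M (2 * m - r)) + real (2 * m - r) * ?h r * (c ^ (r - 1) * ?M (2 * m + 1 - r)) =
        ?h r * (c ^ (r - 1) * (real (Suc j) * ?M (j + 2) + c * ?M (Suc j)))"
      unfolding j by (simp add: algebra_simps)
    then show "?h r * (c ^ r * ?M (2 * m - r)) + real (2 * m - r) * ?h r * (c ^ (r - 1) * ?M (2 * m + 1 - r)) =
        ?h r * (c ^ (r - 1) * ?M (2 * m - r - 1))"
      unfolding moment_recursion by (simp add: j_def)
  qed
  also have "\<dots> = 1" using Suc by (simp only: m_def)
  finally show ?case by (simp only: m_def)
qed

end

lemma sum_C_num_I_lim:
  assumes "1 \<le> l" "c > 0"
  shows "(\<Sum>r=1..l. real (C_num l r) * I_lim l r c) = 1"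
proof -
  obtain l' where l: "l = Suc l'" using assms by (metis Suc_le_D One_nat_def)
  have "(\<Sum>r=1..l. real (C_num l r) * I_lim l r c) =
      (\<Sum>r=1..l. real (hier_count l r) * (c ^ (r - 1) * moment c (2 * l - r - 1)))"
    using I_lim_moment[OF assms(2,1)] configurations_count(3) by (intro sum.cong) auto
  then show ?thesis using hier_count_moment_sum[OF assms(2), of l'] l by simp
qed

text \<open>Writing the sum as the integral of a step function with mesh 1/a puts all N on one
  measure space, as dominated convergence requires.\<close>

lemma step_integral:
  fixes g :: "nat \<Rightarrow> real"
  assumes a: "a > 0" and g: "\<And>j. j \<ge> J \<Longrightarrow> g j = 0"
  shows "(LBINT s:{0..}. g (nat \<lfloor>s * a\<rfloor>)) = (\<Sum>j<J. g j) / a"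
proof -
  have eq: "indicator {0..} s *\<^sub>R g (nat \<lfloor>s * a\<rfloor>) = (\<Sum>j<J. g j * indicator {real j / a..<real (Suc j) / a} s)" for s
  proof (cases "s \<ge> 0")
    case True
    define i where "i = nat \<lfloor>s * a\<rfloor>"
    have i: "real i \<le> s * a" "s * a < real i + 1" using True a unfolding i_def by (auto simp: of_nat_nat)
    have ind: "indicator {real j / a..<real (Suc j) / a} s = (if j = i then 1 else 0 :: real)" for j
    proof -
      have "s \<in> {real j / a..<real (Suc j) / a} \<longleftrightarrow> real j \<le> s * a \<and> s * a < real j + 1"
        using a by (auto simp: field_simps)
      also have "\<dots> \<longleftrightarrow> j = i" using i by linarith
      finally show ?thesis by (simp add: indicator_def)
    qed
    have "(\<Sum>j<J. g j * indicator {real j / a..<real (Suc j) / a} s) = (\<Sum>j<J. if j = i then g j else 0)"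
      unfolding ind by (intro sum.cong) auto
    also have "\<dots> = (if i < J then g i else 0)" by (simp add: sum.delta)
    also have "\<dots> = g i" using g[of i] by simp
    finally show ?thesis using True by (simp add: i_def)
  next
    case False
    have "indicator {real j / a..<real (Suc j) / a} s = (0::real)" for j
    proof -
      have "real j / a \<ge> 0" using a by simp
      then show ?thesis using False by (simp add: indicator_def)
    qed
    then show ?thesis using False by simp
  qed
  have "(LBINT s:{0..}. g (nat \<lfloor>s * a\<rfloor>)) = (\<integral>s. (\<Sum>j<J. g j * indicator {real j / a..<real (Suc j) / a} s) \<partial>lborel)"
    unfolding set_lebesgue_integral_def eq ..
  also have "\<dots> = (\<Sum>j<J. \<integral>s. g j * indicator {real j / a..<real (Suc j) / a} s \<partial>lborel)"
    by (rule Bochner_Integration.integral_sum)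
       (use a in \<open>auto intro!: integrable_mult_right simp: integrable_indicator_iff divide_right_mono\<close>)
  also have "\<dots> = (\<Sum>j<J. g j / a)"
  proof (rule sum.cong[OF refl])
    fix j
    have "real (Suc j) / a - real j / a = 1 / a" by (simp add: diff_divide_distrib[symmetric])
    moreover have "real j / a \<le> real (Suc j) / a" using a by (intro divide_right_mono) auto
    ultimately show "(\<integral>s. g j * indicator {real j / a..<real (Suc j) / a} s \<partial>lborel) = g j / a" by simp
  qed
  finally show ?thesis by (simp add: sum_divide_distrib)
qed

text \<open>A Gaussian majorant independent of N. The number of factors in the product is at least
  J, and l \<ge> 1 lets the linear term absorb the loss in M(M-1)/2; the extra + s in the exponent
  pays for the integer part.\<close>

lemma scaled_weight_bound:
  assumes N: "N \<ge> 1" and c: "c > 0" and l: "1 \<le> l" "l \<le> k" and s: "s \<ge> 0"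
  defines "J \<equiv> nat \<lfloor>s * sqrt (real N)\<rfloor>"
  shows "0 \<le> scaled_weight N c l r (J + k)"
    "scaled_weight N c l r (J + k) \<le> c ^ (r - 1) * (c + (s + real k)) * exp (- s\<^sup>2 / 2 + s)"
proof -
  define a where "a = sqrt (real N)"
  have a: "a \<ge> 1" "real N = a\<^sup>2" using N by (auto simp: a_def)
  have J: "real J \<le> s * a" "s * a - 1 \<le> real J"
    using s a unfolding J_def a_def[symmetric] by (auto simp: of_nat_nat)
  define P where "P = (\<Prod>i<J + k - l. real (N - l - i) / real N)"
  have P0: "0 \<le> P" unfolding P_def by (intro prod_nonneg) auto
  have "P \<le> exp (- s\<^sup>2 / 2 + s)"
  proof -
    let ?M = "real (J + k - l)"
    have M: "?M \<ge> real J" using l by simp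
    have "(real J)\<^sup>2 \<le> ?M\<^sup>2" using M by (intro power_mono) auto
    moreover have "?M * 1 \<le> ?M * real l" using l by (intro mult_left_mono) auto
    ultimately have "(real J)\<^sup>2 / 2 \<le> real l * ?M + ?M * (?M - 1) / 2"
      by (simp add: field_simps power2_eq_square)
    then have "(real J)\<^sup>2 / 2 / real N \<le> (real l * ?M + ?M * (?M - 1) / 2) / real N"
      by (intro divide_right_mono) auto
    \<comment> \<open>From J \<ge> s a - 1 one gets J^2 \<ge> (s a)^2 - 2 s a. When s a < 1 squaring
      is not monotone, but then s \<le> 1 and the left side is not positive.\<close>
    moreover have "s\<^sup>2 / 2 - s \<le> (real J)\<^sup>2 / 2 / real N"
    proof (cases "s * a \<ge> 1")
      case True
      have "(s * a - 1)\<^sup>2 \<le> (real J)\<^sup>2" using J True by (intro power_mono) auto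
      then have "(s * a)\<^sup>2 - 2 * (s * a) \<le> (real J)\<^sup>2" by (simp add: power2_eq_square algebra_simps)
      moreover have "s * a \<le> s * a\<^sup>2" using a s by (intro mult_left_mono) (auto simp: power2_eq_square)
      ultimately have "s\<^sup>2 * a\<^sup>2 - 2 * (s * a\<^sup>2) \<le> (real J)\<^sup>2" by (simp add: power_mult_distrib)
      then have "(s\<^sup>2 / 2 - s) * a\<^sup>2 \<le> (real J)\<^sup>2 / 2" by (simp add: algebra_simps)
      then show ?thesis using a by (simp add: pos_le_divide_eq)
    next
      case False
      have "s * 1 \<le> s * a" using a s by (intro mult_left_mono) auto
      then have "s \<le> 1" using False by simp
      then have "s * s \<le> s * 1" using s by (intro mult_left_mono) auto
      then have "s\<^sup>2 / 2 - s \<le> 0" using s by (simp add: power2_eq_square)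
      also have "0 \<le> (real J)\<^sup>2 / 2 / real N" by simp
      finally show ?thesis .
    qed
    ultimately have "- ((real l * ?M + ?M * (?M - 1) / 2) / real N) \<le> - s\<^sup>2 / 2 + s" by simp
    then have "exp (- (real l * ?M + ?M * (?M - 1) / 2) / real N) \<le> exp (- s\<^sup>2 / 2 + s)"
      by (simp only: minus_divide_left exp_le_cancel_iff)
    then show ?thesis using falling_upper[OF N, of l "J + k - l"] unfolding P_def by linarith
  qed
  have q: "1 \<le> (1 + c / a) ^ (J + k)" using c a by (intro one_le_power) auto
  have "real (J + k) / a \<le> s + real k"
  proof -
    have "real J / a \<le> s" using J a by (simp add: field_simps)
    moreover have "real k * 1 \<le> real k * a" using a by (intro mult_left_mono) auto
    then have "real k / a \<le> real k" using a by (simp add: field_simps)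
    ultimately show ?thesis by (simp add: add_divide_distrib)
  qed
  then have t: "c + real (J + k) / a \<le> c + (s + real k)" "0 \<le> c + real (J + k) / a" using c a by auto
  have e: "scaled_weight N c l r (J + k) = P * c ^ (r - 1) * (c + real (J + k) / a) / (1 + c / a) ^ (J + k)"
    by (simp add: scaled_weight_def P_def a_def)
  have num: "0 \<le> P * c ^ (r - 1) * (c + real (J + k) / a)" using P0 c t by auto
  show "0 \<le> scaled_weight N c l r (J + k)" unfolding e using num c a by (intro divide_nonneg_nonneg) auto
  have "scaled_weight N c l r (J + k) \<le> P * c ^ (r - 1) * (c + real (J + k) / a) / 1"
    unfolding e using num q by (intro divide_left_mono) auto
  also have "\<dots> \<le> exp (- s\<^sup>2 / 2 + s) * c ^ (r - 1) * (c + (s + real k))"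
    using \<open>P \<le> exp (- s\<^sup>2 / 2 + s)\<close> P0 c t s by (simp, intro mult_mono) auto
  finally show "scaled_weight N c l r (J + k) \<le> c ^ (r - 1) * (c + (s + real k)) * exp (- s\<^sup>2 / 2 + s)"
    by (simp add: mult_ac)
qed

text \<open>There are k clusters, and the vectors of total j + k number about j^(k-1)/(k-1)!. This
  order N^((k-1)/2), against the order N^(-k/2) of the weight, leaves the mesh N^(-1/2) of a Riemann
  sum; the factorial is the one in \<open>I_lim\<close>.\<close>

lemma composition_sum_limit:
  assumes c: "c > 0" and l: "1 \<le> l" and r: "1 \<le> r" "r \<le> l"
  defines "k \<equiv> 2 * l - r"
  shows "(\<lambda>N. \<Sum>j<Suc N. real ((j + (k - 1)) choose (k - 1)) * law_weight N (c * sqrt (real N)) l r (j + k))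
    \<longlonglongrightarrow> I_lim l r c"
proof -
  define q where "q = k - 1"
  have k: "k = Suc q" "l \<le> k" using r l by (auto simp: k_def q_def)
  define J where "J = (\<lambda>s N. nat \<lfloor>s * sqrt (real N)\<rfloor>)"
  define f where "f = (\<lambda>N s. indicator {0..} s *\<^sub>R
    (real ((J s N + q) choose q) / sqrt (real N) ^ q * scaled_weight N c l r (J s N + k)))"
  define g where "g = (\<lambda>s::real. indicator {0..} s *\<^sub>R
    (s ^ q / fact q * (c ^ (r - 1) * (s + c) * exp (- s\<^sup>2 / 2 - c * s))))"
  \<comment> \<open>The majorant collects exp(q (s+k)) for the binomial factor and exp(c+s+k) for
    the linear one, both from x \<le> exp x, with the Gaussian bound of
    \<open>scaled_weight_bound\<close>.\<close>
  define w where "w = (\<lambda>s::real. exp (real q * real k + c + real k) * c ^ (r - 1) * exp (- s\<^sup>2 / 2 + (real q + 2) * s))"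
  have conv: "(\<lambda>N. f N s) \<longlonglongrightarrow> g s" for s
  proof (cases "s \<ge> 0")
    case True
    have J: "(\<lambda>N. real (J s N) / sqrt (real N)) \<longlonglongrightarrow> s" unfolding J_def by (rule floor_sqrt_tendsto[OF True])
    have "(\<lambda>N. real (J s N) / sqrt (real N) + real k / sqrt (real N)) \<longlonglongrightarrow> s + 0"
      by (intro tendsto_add J inverse_sqrt_tendsto)
    then have m: "(\<lambda>N. real (J s N + k) / sqrt (real N)) \<longlonglongrightarrow> s" by (simp add: add_divide_distrib)
    have "l \<le> J s N + k" for N using k by simp
    then have "(\<lambda>N. real ((J s N + q) choose q) / sqrt (real N) ^ q * scaled_weight N c l r (J s N + k)) \<longlonglongrightarrow>
        s ^ q / fact q * (c ^ (r - 1) * (s + c) * exp (- s\<^sup>2 / 2 - c * s))"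
      by (intro tendsto_mult binomial_tendsto J scaled_weight_tendsto[OF m c])
    then show ?thesis using True by (simp add: f_def g_def)
  next
    case False then show ?thesis by (simp add: f_def g_def)
  qed
  have bound: "norm (f N s) \<le> w s" if N: "N \<ge> 1" for N s
  proof (cases "s \<ge> 0")
    case True
    define a where "a = sqrt (real N)"
    have a: "a \<ge> 1" using N by (simp add: a_def)
    have Ja: "real (J s N) \<le> s * a" using True a unfolding J_def a_def[symmetric] by (auto simp: of_nat_nat)
    have "real (J s N + q) / a \<le> s + real k"
    proof -
      have "real (J s N) / a \<le> s" using Ja a by (simp add: field_simps)
      moreover have "real q * 1 \<le> real k * a" using a k by (intro mult_mono) auto
      then have "real q / a \<le> real k" using a by (simp add: field_simps)
      ultimately show ?thesis by (simp add: add_divide_distrib)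
    qed
    also have "\<dots> \<le> exp (s + real k)" using exp_ge_add_one_self[of "s + real k"] by linarith
    finally have "(real (J s N + q) / a) ^ q \<le> exp (s + real k) ^ q" using a by (intro power_mono) auto
    moreover have "real ((J s N + q) choose q) / a ^ q \<le> (real (J s N + q) / a) ^ q"
      unfolding power_divide using a binomial_le_power by (intro divide_right_mono) auto
    ultimately have 1: "real ((J s N + q) choose q) / a ^ q \<le> exp (real q * (s + real k))"
      by (simp add: exp_of_nat_mult)
    have Js: "nat \<lfloor>s * sqrt (real N)\<rfloor> = J s N" by (simp add: J_def)
    note sw = scaled_weight_bound[OF N c l k(2) True, of r, unfolded Js]
    have "c + (s + real k) \<le> exp (c + (s + real k))" using exp_ge_add_one_self[of "c + (s + real k)"] by linarith
    then have "c ^ (r - 1) * (c + (s + real k)) * exp (- s\<^sup>2 / 2 + s) \<le> c ^ (r - 1) * exp (c + (s + real k)) * exp (- s\<^sup>2 / 2 + s)"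
      using c by (intro mult_right_mono mult_left_mono) auto
    then have 2: "scaled_weight N c l r (J s N + k) \<le> c ^ (r - 1) * exp (c + (s + real k)) * exp (- s\<^sup>2 / 2 + s)"
      using sw(2) by linarith
    have "real ((J s N + q) choose q) / a ^ q * scaled_weight N c l r (J s N + k) \<le>
        exp (real q * (s + real k)) * (c ^ (r - 1) * exp (c + (s + real k)) * exp (- s\<^sup>2 / 2 + s))"
      using 1 2 sw(1) a by (intro mult_mono) auto
    also have "\<dots> = w s"
    proof -
      have e: "real q * real k + c + real k + (- s\<^sup>2 / 2 + (real q + 2) * s) =
          real q * (s + real k) + ((c + (s + real k)) + (- s\<^sup>2 / 2 + s))" by (simp add: algebra_simps)
      have "w s = c ^ (r - 1) * exp (real q * real k + c + real k + (- s\<^sup>2 / 2 + (real q + 2) * s))"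
        unfolding w_def exp_add[of "real q * real k + c + real k"] by (simp only: mult_ac)
      also have "\<dots> = c ^ (r - 1) * (exp (real q * (s + real k)) * (exp (c + (s + real k)) * exp (- s\<^sup>2 / 2 + s)))"
        unfolding e exp_add[of "real q * (s + real k)"] exp_add[of "c + (s + real k)"] by simp
      finally show ?thesis by (simp only: mult_ac)
    qed
    finally show ?thesis using True sw(1) a by (simp add: f_def a_def abs_mult)
  next
    case False then show ?thesis using c by (simp add: f_def w_def)
  qed
  have meas: "f N \<in> borel_measurable lborel" for N
  proof -
    have "(\<lambda>s. real ((nat \<lfloor>s * sqrt (real N)\<rfloor> + q) choose q) / sqrt (real N) ^ q *
        scaled_weight N c l r (nat \<lfloor>s * sqrt (real N)\<rfloor> + k)) \<in> borel_measurable borel"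
      by (rule measurable_compose[of "\<lambda>s. \<lfloor>s * sqrt (real N)\<rfloor>" borel "count_space UNIV"
        "\<lambda>i. real ((nat i + q) choose q) / sqrt (real N) ^ q * scaled_weight N c l r (nat i + k)"]) measurable
    then show ?thesis unfolding f_def J_def by measurable
  qed
  \<comment> \<open>The index is shifted because the majorant is available only for N \<ge> 1, while
    dominated convergence asks for it at every index.\<close>
  have "(\<lambda>N. integral\<^sup>L lborel (f (Suc N))) \<longlonglongrightarrow> integral\<^sup>L lborel g"
  proof (rule integral_dominated_convergence[where w = w])
    show "g \<in> borel_measurable lborel" unfolding g_def by measurable
    show "f (Suc N) \<in> borel_measurable lborel" for N by (rule meas)
    show "integrable lborel w" unfolding w_def by (intro integrable_mult_right integrable_gauss)
    show "AE s in lborel. (\<lambda>N. f (Suc N) s) \<longlonglongrightarrow> g s" using conv by (intro AE_I2 LIMSEQ_Suc)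
    show "AE s in lborel. norm (f (Suc N) s) \<le> w s" for N by (intro AE_I2 bound) simp
  qed
  then have lim: "(\<lambda>N. integral\<^sup>L lborel (f N)) \<longlonglongrightarrow> integral\<^sup>L lborel g" by (rule LIMSEQ_imp_Suc)
  have "integral\<^sup>L lborel g = c ^ (r - 1) * moment c (2 * l - r - 1)"
  proof -
    have ge: "g = (\<lambda>s. c ^ (r - 1) / fact q * (indicator {0..} s *\<^sub>R ((s + c) * s ^ q * exp (- s\<^sup>2 / 2 - c * s))))"
      by (simp add: g_def mult_ac)
    have "integral\<^sup>L lborel g = c ^ (r - 1) / fact q * (LBINT s:{0..}. (s + c) * s ^ q * exp (- s\<^sup>2 / 2 - c * s))"
      unfolding ge set_lebesgue_integral_def by (rule integral_mult_right_zero)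
    then show ?thesis by (simp add: moment_def q_def k_def)
  qed
  then have gI: "integral\<^sup>L lborel g = I_lim l r c" using I_lim_moment[OF c l r] by simp
  have "integral\<^sup>L lborel (f N) = (\<Sum>j<Suc N. real ((j + q) choose q) * law_weight N (c * sqrt (real N)) l r (j + k))"
    if N: "N \<ge> l" for N
  proof -
    define a where "a = sqrt (real N)"
    have N1: "N \<ge> 1" using N l by simp
    have a: "a > 0" using N1 by (simp add: a_def)
    let ?g = "\<lambda>j. real ((j + q) choose q) / a ^ q * scaled_weight N c l r (j + k)"
    have "?g j = 0" if "j \<ge> Suc N" for j
    proof -
      have "N - l \<in> {..<j + k - l}" using that k N by auto
      then have "(\<Prod>i<j + k - l. real (N - l - i) / real N) = 0" by (intro prod_zero bexI[of _ "N - l"]) auto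
      then show ?thesis by (simp add: scaled_weight_def)
    qed
    then have "(LBINT s:{0..}. ?g (nat \<lfloor>s * a\<rfloor>)) = (\<Sum>j<Suc N. ?g j) / a" by (rule step_integral[OF a])
    also have "\<dots> = (\<Sum>j<Suc N. real ((j + q) choose q) * law_weight N (c * sqrt (real N)) l r (j + k))"
      unfolding sum_divide_distrib
    proof (rule sum.cong[OF refl])
      fix j
      have "l \<le> j + k" "r \<le> 2 * l" using k r by auto
      then have "scaled_weight N c l r (j + k) = a ^ k * law_weight N (c * sqrt (real N)) l r (j + k)"
        using scaled_weight[OF N1 c r(1), of l "j + k"] by (simp add: a_def k_def)
      also have "a ^ k = a ^ q * a" using k by simp
      finally show "?g j / a = real ((j + q) choose q) * law_weight N (c * sqrt (real N)) l r (j + k)"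
        using a by simp
    qed
    finally show ?thesis by (simp add: f_def set_lebesgue_integral_def J_def a_def)
  qed
  then have "\<forall>\<^sub>F N in sequentially. integral\<^sup>L lborel (f N) =
      (\<Sum>j<Suc N. real ((j + q) choose q) * law_weight N (c * sqrt (real N)) l r (j + k))"
    using eventually_ge_at_top[of l] by (rule eventually_mono[rotated])
  then show ?thesis using lim gI unfolding q_def by (auto intro: Lim_transform_eventually)
qed

section \<open>The probability of a hierarchy\<close>

text \<open>Subtracting 1 from every entry, in some enumeration of \<open>F\<close>, gives the lists
  of length k with sum j. Going back, no entry exceeds j + 1, which is at most N.\<close>

lemma card_compositions:
  assumes F: "finite F" "card F = k" "k \<ge> 1" and N: "j + k \<le> N"
  shows "card {n \<in> F \<rightarrow>\<^sub>E {1..N}. sum n F = j + k} = (j + (k - 1)) choose (k - 1)"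
proof -
  obtain f where f: "bij_betw f {0..<k} F" using ex_bij_betw_nat_finite[OF F(1)] F(2) by auto
  let ?A = "{n \<in> F \<rightarrow>\<^sub>E {1..N}. sum n F = j + k}" and ?B = "{ys::nat list. size ys = k \<and> sum_list ys = j}"
  let ?g = "\<lambda>n. map (\<lambda>i. n (f i) - 1) [0..<k]"
  let ?h = "\<lambda>ys. restrict (\<lambda>A. Suc (ys ! the_inv_into {0..<k} f A)) F"
  have inv: "the_inv_into {0..<k} f (f i) = i" if "i < k" for i
    using f that by (intro the_inv_into_f_f) (auto simp: bij_betw_def)
  have inv': "the_inv_into {0..<k} f A < k" "f (the_inv_into {0..<k} f A) = A" if "A \<in> F" for A
  proof -
    have "A \<in> f ` {0..<k}" using f that by (simp add: bij_betw_def)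
    then obtain i where "i < k" "A = f i" by auto
    then show "the_inv_into {0..<k} f A < k" "f (the_inv_into {0..<k} f A) = A" using inv by auto
  qed
  have fF: "f i \<in> F" if "i < k" for i using f that by (auto simp: bij_betw_def)
  have sumf: "(\<Sum>i=0..<k. G (f i)) = (\<Sum>A\<in>F. G A)" for G :: "_ \<Rightarrow> nat"
    by (rule sum.reindex_bij_betw[OF f])
  have "bij_betw ?g ?A ?B"
  proof (rule bij_betw_byWitness[where f' = ?h])
    show "\<forall>n\<in>?A. ?h (?g n) = n"
    proof
      fix n assume n: "n \<in> ?A"
      show "?h (?g n) = n"
      proof (rule PiE_ext[where k = F and s = "\<lambda>_. UNIV"])
        show "?h (?g n) \<in> F \<rightarrow>\<^sub>E UNIV" by auto
        show "n \<in> F \<rightarrow>\<^sub>E UNIV" using n by auto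
        fix A assume A: "A \<in> F"
        have "1 \<le> n A" using n A by auto
        then show "?h (?g n) A = n A" using A inv'[OF A] by simp
      qed
    qed
    show "\<forall>ys\<in>?B. ?g (?h ys) = ys"
      using fF inv by (auto intro!: nth_equalityI)
    show "?g ` ?A \<subseteq> ?B"
    proof (rule image_subsetI)
      fix n assume n: "n \<in> ?A"
      have "sum_list (?g n) = (\<Sum>A\<in>F. n A - 1)"
        using sumf[of "\<lambda>A. n A - 1"] by (simp add: interv_sum_list_conv_sum_set_nat)
      moreover have "(\<Sum>A\<in>F. n A - 1) + k = (\<Sum>A\<in>F. (n A - 1) + 1)" unfolding sum.distrib using F(2) by simp
      moreover have "(\<Sum>A\<in>F. (n A - 1) + 1) = (\<Sum>A\<in>F. n A)"
      proof (intro sum.cong refl le_add_diff_inverse2)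
        fix A assume "A \<in> F" then show "1 \<le> n A" using n by auto
      qed
      ultimately show "?g n \<in> ?B" using n by simp
    qed
    show "?h ` ?B \<subseteq> ?A"
    proof (rule image_subsetI)
      fix ys assume "ys \<in> ?B"
      then have ys: "length ys = k" "sum_list ys = j" by auto
      have le: "ys ! i \<le> j" if "i < k" for i using elem_le_sum_list[of i ys] that ys by simp
      have "(\<Sum>A\<in>F. ?h ys A) = (\<Sum>A\<in>F. ys ! the_inv_into {0..<k} f A + 1)" by (intro sum.cong) auto
      also have "\<dots> = (\<Sum>A\<in>F. ys ! the_inv_into {0..<k} f A) + k" unfolding sum.distrib using F(2) by simp
      also have "(\<Sum>A\<in>F. ys ! the_inv_into {0..<k} f A) = (\<Sum>i=0..<k. ys ! i)"
        unfolding sumf[symmetric] using inv by (intro sum.cong) auto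
      also have "\<dots> = j" using ys by (simp add: sum_list_sum_nth)
      finally have "sum (?h ys) F = j + k" .
      moreover have "?h ys \<in> F \<rightarrow>\<^sub>E {1..N}"
      proof
        fix A assume A: "A \<in> F"
        show "?h ys A \<in> {1..N}" using A le[OF inv'(1)[OF A]] N F(3) by simp
      qed simp
      ultimately show "?h ys \<in> ?A" by blast
    qed
  qed
  then have "card ?A = card ?B" by (rule bij_betw_same_card)
  also have "\<dots> = (j + k - 1) choose j" by (rule card_length_sum_list)
  also have "\<dots> = (j + (k - 1)) choose (k - 1)"
    using F(3) binomial_symmetric[of j "j + (k - 1)"] by simp
  finally show ?thesis .
qed

lemma prob_cong:
  assumes "\<kappa> > 0" "\<And>p. rooted {0..N} p \<Longrightarrow> P (tree_of {0..N} p) \<longleftrightarrow> Q (tree_of {0..N} p)"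
  shows "\<P>(T in tree_law N \<kappa>. P T) = \<P>(T in tree_law N \<kappa>. Q T)"
  unfolding tree_law_prob[OF assms(1)] using assms(2) by (intro arg_cong2[where f = "(/)"] sum.cong) auto

lemma prob_partition:
  assumes \<kappa>: "\<kappa> > 0" and S: "finite S" and f: "\<And>p. rooted {0..N} p \<Longrightarrow> P (tree_of {0..N} p) \<Longrightarrow> f (tree_of {0..N} p) \<in> S"
  shows "\<P>(T in tree_law N \<kappa>. P T) = (\<Sum>s\<in>S. \<P>(T in tree_law N \<kappa>. P T \<and> f T = s))"
proof -
  let ?A = "{p. rooted {0..N} p \<and> P (tree_of {0..N} p)}" and ?w = "\<lambda>p. \<kappa> ^ card {y \<in> {1..N}. p y = 0}"
  have "finite ?A" using finite_rooted[of "{0..N}"] by (auto intro: rev_finite_subset)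
  then have "(\<Sum>p\<in>?A. ?w p) = (\<Sum>s\<in>S. \<Sum>p\<in>{p \<in> ?A. f (tree_of {0..N} p) = s}. ?w p)"
    using S f by (intro sum.group[symmetric]) auto
  also have "\<dots> = (\<Sum>s\<in>S. \<Sum>p | rooted {0..N} p \<and> P (tree_of {0..N} p) \<and> f (tree_of {0..N} p) = s. ?w p)"
    by (intro sum.cong) auto
  finally show ?thesis unfolding tree_law_prob[OF \<kappa>] by (simp add: sum_divide_distrib)
qed

lemma law_weight_zero: "l \<le> N \<Longrightarrow> N < m \<Longrightarrow> law_weight N \<kappa> l r m = 0"
proof -
  assume a: "l \<le> N" "N < m"
  then have "(\<Prod>k<m - l. real (N - l - k)) = 0" by (intro prod_zero bexI[of _ "N - l"]) auto
  then show ?thesis by (simp only: law_weight_def mult_zero_left div_0)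
qed

text \<open>The exact law depends on the vector of counts only through its total, so the vectors are
  grouped by total; those with total beyond N have weight 0.\<close>

lemma hierarchy_prob:
  assumes F: "laminar_on {1..l} F" and l: "1 \<le> l" "l \<le> N" and \<kappa>: "\<kappa> > 0"
  shows "\<P>(T in tree_law N \<kappa>. phier (gpar T) {1..l} = F) =
    (\<Sum>j<Suc N. real ((j + (card F - 1)) choose (card F - 1)) * law_weight N \<kappa> l (card (maxes F)) (j + card F))"
proof -
  define k where "k = card F"
  let ?L = "{1..l}" and ?h = "law_weight N \<kappa> l (card (maxes F))"
  let ?S = "F \<rightarrow>\<^sub>E {1..N}" and ?f = "\<lambda>T. restrict (cnt (gpar T) ?L) F"
  have L: "?L \<subseteq> {0..N} - {0}" using l by auto
  have finF: "finite F" using laminar_onD(2)[OF F] .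
  have "F \<noteq> {}" using laminar_onD(5)[OF F, of 1] l by auto
  then have k1: "k \<ge> 1" using finF by (simp add: k_def Suc_le_eq card_gt_0_iff)
  have finS: "finite ?S" using finF by (intro finite_PiE) auto
  have mem: "?f (tree_of {0..N} p) \<in> ?S" if p: "rooted {0..N} p" "phier p ?L = F" for p
  proof -
    have "cnt p ?L A \<in> {1..N}" if A: "A \<in> F" for A
    proof -
      let ?Z = "{z. z \<noteq> 0 \<and> clus p ?L z = A}"
      have "A \<noteq> {}" using laminar_onD(4)[OF F A] .
      have "?Z \<subseteq> {1..N}"
      proof
        fix z assume "z \<in> ?Z"
        then have "z \<noteq> 0" "clus p ?L z \<noteq> {}" using \<open>A \<noteq> {}\<close> by auto
        then have "z \<in> {0..N}" using clus_in_verts[OF p(1) L] by blast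
        then show "z \<in> {1..N}" using \<open>z \<noteq> 0\<close> by simp
      qed
      then have "finite ?Z" "card ?Z \<le> N" using finite_subset card_mono[of "{1..N}" ?Z] by auto
      moreover have "?Z \<noteq> {}" using A p(2) unfolding phier_def by blast
      ultimately show ?thesis by (simp add: cnt_def Suc_le_eq card_gt_0_iff)
    qed
    then show ?thesis by (simp add: gpar_tree_of[OF p(1)])
  qed
  have "\<P>(T in tree_law N \<kappa>. phier (gpar T) ?L = F) =
      (\<Sum>n\<in>?S. \<P>(T in tree_law N \<kappa>. phier (gpar T) ?L = F \<and> ?f T = n))"
    by (rule prob_partition[OF \<kappa> finS]) (use mem gpar_tree_of in auto)
  also have "\<dots> = (\<Sum>n\<in>?S. ?h (sum n F))"
  proof (rule sum.cong[OF refl])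
    fix n assume n: "n \<in> ?S"
    have "?f T = n \<longleftrightarrow> (\<forall>A\<in>F. cnt (gpar T) ?L A = n A)" for T
    proof
      assume "?f T = n" then show "\<forall>A\<in>F. cnt (gpar T) ?L A = n A" by (metis restrict_apply')
    next
      assume "\<forall>A\<in>F. cnt (gpar T) ?L A = n A"
      then show "?f T = n" using n by (auto simp: fun_eq_iff PiE_def extensional_def)
    qed
    then have "\<P>(T in tree_law N \<kappa>. phier (gpar T) ?L = F \<and> ?f T = n) =
        \<P>(T in tree_law N \<kappa>. phier (gpar T) ?L = F \<and> (\<forall>A\<in>F. cnt (gpar T) ?L A = n A))" by simp
    also have "\<dots> = ?h (sum n F)"
      by (rule cluster_counts_law[OF F l _ \<kappa>]) (use n in \<open>auto simp: Suc_le_eq\<close>)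
    finally show "\<P>(T in tree_law N \<kappa>. phier (gpar T) ?L = F \<and> ?f T = n) = ?h (sum n F)" .
  qed
  also have "\<dots> = (\<Sum>n\<in>{n \<in> ?S. sum n F \<le> N}. ?h (sum n F))"
    using finS by (intro sum.mono_neutral_right) (auto intro!: law_weight_zero[OF l(2)])
  also have "\<dots> = (\<Sum>j<Suc N. \<Sum>n\<in>{n \<in> {n \<in> ?S. sum n F \<le> N}. sum n F - k = j}. ?h (sum n F))"
    using finS by (intro sum.group[symmetric]) (auto simp: less_Suc_eq_le)
  also have "\<dots> = (\<Sum>j<Suc N. real ((j + (k - 1)) choose (k - 1)) * ?h (j + k))"
  proof (rule sum.cong[OF refl])
    fix j
    have ge: "k \<le> sum n F" if "n \<in> ?S" for n
    proof -
      have "(\<Sum>A\<in>F. 1) \<le> sum n F" using that by (intro sum_mono) auto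
      then show ?thesis by (simp add: k_def)
    qed
    show "(\<Sum>n\<in>{n \<in> {n \<in> ?S. sum n F \<le> N}. sum n F - k = j}. ?h (sum n F)) =
        real ((j + (k - 1)) choose (k - 1)) * ?h (j + k)"
    proof (cases "j + k \<le> N")
      case True
      have "{n \<in> {n \<in> ?S. sum n F \<le> N}. sum n F - k = j} = {n \<in> ?S. sum n F = j + k}"
      proof (intro equalityI subsetI)
        fix n assume "n \<in> {n \<in> {n \<in> ?S. sum n F \<le> N}. sum n F - k = j}"
        then have n: "n \<in> ?S" "sum n F - k = j" by auto
        then have "sum n F = j + k" using ge[OF n(1)] by linarith
        then show "n \<in> {n \<in> ?S. sum n F = j + k}" using n(1) by simp
      next
        fix n assume "n \<in> {n \<in> ?S. sum n F = j + k}"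
        then show "n \<in> {n \<in> {n \<in> ?S. sum n F \<le> N}. sum n F - k = j}" using True by simp
      qed
      then show ?thesis using card_compositions[OF finF k_def[symmetric] k1 True] by simp
    next
      case False
      then have "n \<notin> {n \<in> {n \<in> ?S. sum n F \<le> N}. sum n F - k = j}" for n using ge[of n] by auto
      then have e: "{n \<in> {n \<in> ?S. sum n F \<le> N}. sum n F - k = j} = {}" by blast
      have "?h (j + k) = 0" using False by (intro law_weight_zero[OF l(2)]) simp
      then show ?thesis unfolding e by simp
    qed
  qed
  finally show ?thesis by (simp add: k_def)
qed

lemma bin_hier_range:
  assumes b: "bin_hier {1..l} F" and l: "1 \<le> l"
  shows "1 \<le> card (maxes F)" "card (maxes F) \<le> l" "card F = 2 * l - card (maxes F)"
proof -
  have lam: "laminar_on {1..l} F" using b by (simp add: bin_hier_def)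
  have sum: "card F + card (maxes F) = 2 * l" using card_hierarchy[OF _ b] by simp
  then show "card F = 2 * l - card (maxes F)" by simp
  have "{1} \<in> F" using laminar_onD(5)[OF lam] l by auto
  then have "maxes F \<noteq> {}" using below_max[OF lam] by blast
  then show "1 \<le> card (maxes F)" using laminar_onD(2)[OF lam] by (simp add: maxes_def Suc_le_eq card_gt_0_iff)
  have "(\<lambda>i. {i}) ` {1..l} \<subseteq> F" using laminar_onD(5)[OF lam] by auto
  then have "card ((\<lambda>i. {i}) ` {1..l}) \<le> card F" using laminar_onD(2)[OF lam] by (rule card_mono[rotated])
  then have "l \<le> card F" by (simp add: card_image)
  then show "card (maxes F) \<le> l" using sum by simp
qed

lemma hierarchy_prob_limit:
  assumes b: "bin_hier {1..l} F" and l: "1 \<le> l" and c: "c > 0"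
  shows "(\<lambda>N. \<P>(T in tree_law N (c * sqrt (real N)). phier (gpar T) {1..l} = F)) \<longlonglongrightarrow> I_lim l (card (maxes F)) c"
proof -
  let ?r = "card (maxes F)"
  note r = bin_hier_range[OF b l]
  have lam: "laminar_on {1..l} F" using b by (simp add: bin_hier_def)
  have "\<forall>\<^sub>F N in sequentially. (\<Sum>j<Suc N. real ((j + (2 * l - ?r - 1)) choose (2 * l - ?r - 1)) *
      law_weight N (c * sqrt (real N)) l ?r (j + (2 * l - ?r))) =
      \<P>(T in tree_law N (c * sqrt (real N)). phier (gpar T) {1..l} = F)"
    using eventually_ge_at_top[of l]
  proof eventually_elim
    case (elim N)
    then have "c * sqrt (real N) > 0" using c l by simp
    then show ?case using hierarchy_prob[OF lam l elim] r(3) by simp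
  qed
  then show ?thesis using composition_sum_limit[OF c l r(1,2)] by (rule Lim_transform_eventually[rotated])
qed

section \<open>The vector of edge counts\<close>

text \<open>An edge of \<open>G\<close> is named by the cluster \<open>C i\<close> of its end
  farther from \<open>\<Delta>\<close>. The relabelling picked in \<open>edge_count\<close> is
  arbitrary but preserves clusters, so the transported edge carries the same name and its count is a
  cluster multiplicity.\<close>

lemma edge_count_eq:
  assumes c: "(\<pi>, \<alpha>) \<in> configurations l r" and R: "represents {1..l} G \<pi> \<alpha>"
    and \<epsilon>: "bij_betw \<epsilon> {..<2 * l - r} (edges G)"
  obtains C where "bij_betw C {..<2 * l - r} (conf_hier \<pi> \<alpha>)"
    "\<And>N p i. rooted {0..N} p \<Longrightarrow> l \<le> N \<Longrightarrow> phier p {1..l} = conf_hier \<pi> \<alpha> \<Longrightarrow> i < 2 * l - r \<Longrightarrow>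
      edge_count l G \<epsilon> (tree_of {0..N} p) i = cnt p {1..l} (C i) - 1"
proof -
  let ?L = "{1..l}" and ?k = "2 * l - r" and ?F = "conf_hier \<pi> \<alpha>"
  have b: "binary_bouquet ?L r G" and h: "hier ?L G = ?F" using R represents_iff[OF c] by auto
  obtain W g where G: "G = tree_of W g" and red: "reduced W g ?L" and ph: "phier g ?L = ?F"
    using bouquet_graph[OF b] h by metis
  note r1 = reducedD(1)[OF red]
  have "\<exists>x. x \<in> W - {0} \<and> \<epsilon> i = {x, g x}" if "i < ?k" for i
  proof -
    have "\<epsilon> i \<in> edges G" using bij_betwE[OF \<epsilon>] that by auto
    then show ?thesis unfolding G edges_tree_of by blast
  qed
  then obtain v where v: "\<And>i. i < ?k \<Longrightarrow> v i \<in> W - {0}" "\<And>i. i < ?k \<Longrightarrow> \<epsilon> i = {v i, g (v i)}" by metis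
  \<comment> \<open>If an edge had both its ends as farther end, each would be the parent of the
    other.\<close>
  have injE: "x = y" if "x \<in> W - {0}" "y \<in> W - {0}" "{x, g x} = {y, g y}" for x y
  proof (rule ccontr)
    assume "x \<noteq> y"
    then have "x = g y" "y = g x" using that(3) by (auto simp: doubleton_eq_iff)
    then have "anc g (g x) x" using anc_parent[of g y] by simp
    then show False using parent_not_anc[OF r1, of x] that(1) by simp
  qed
  have bv: "bij_betw v {..<?k} (W - {0})" unfolding bij_betw_def
  proof (intro conjI equalityI subsetI)
    show "inj_on v {..<?k}"
    proof (rule inj_onI)
      fix i j assume ij: "i \<in> {..<?k}" "j \<in> {..<?k}" "v i = v j"
      then have "\<epsilon> i = \<epsilon> j" using v(2) by simp
      then show "i = j" using \<epsilon> ij by (auto simp: bij_betw_def inj_on_def)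
    qed
    fix x assume "x \<in> v ` {..<?k}" then show "x \<in> W - {0}" using v(1) by auto
  next
    fix x assume x: "x \<in> W - {0}"
    then have "{x, g x} \<in> edges G" unfolding G edges_tree_of by blast
    then obtain i where i: "i < ?k" "\<epsilon> i = {x, g x}" using \<epsilon> unfolding bij_betw_def by (metis imageE lessThan_iff)
    then have "v i = x" using injE[OF v(1)[OF i(1)] x] v(2)[OF i(1)] by simp
    then show "x \<in> v ` {..<?k}" using i by blast
  qed
  have bc: "bij_betw (clus g ?L) (W - {0}) ?F"
    using reducedD(3)[OF red] reduced_phier[OF red] ph by (simp add: bij_betw_def)
  define C where "C = (\<lambda>i. clus g ?L (v i))"
  have bC: "bij_betw C {..<?k} ?F" using bij_betw_trans[OF bv bc] by (simp add: C_def comp_def)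
  have main: "edge_count l G \<epsilon> (tree_of {0..N} p) i = cnt p ?L (C i) - 1"
    if p: "rooted {0..N} p" "l \<le> N" "phier p ?L = ?F" and i: "i < ?k" for N p i
  proof -
    let ?T = "tree_of {0..N} p"
    have L: "?L \<subseteq> {0..N} - {0}" using p(2) by auto
    have bF: "bin_hier ?L ?F" using conf_hier(1)[OF c] .
    have sg: "{i} \<in> phier p ?L" if "i \<in> ?L" for i
      using bF laminar_onD(5)[of ?L ?F i] that p(3) by (simp add: bin_hier_def)
    have redT: "reduction ?T ?L = tree_of (red_verts p ?L) (red_par p ?L)" by (rule reduction_tree_of[OF p(1) L])
    note rr = red_reduced[OF p(1) L sg]
    have mx: "card (maxes (phier (red_par p ?L) ?L)) = r"
      using phier_red[OF p(1) L] p(3) conf_hier(2)[OF c] configurationsD(2)[OF c] by simp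
    have bR: "binary_bouquet ?L r (reduction ?T ?L)"
      using reduced_bouquet[OF rr] phier_red[OF p(1) L] bF p(3) mx redT by simp
    have hR: "hier ?L (reduction ?T ?L) = ?F"
      unfolding redT hier_tree_of[OF rooted_red[OF p(1) L]] phier_red[OF p(1) L] by (rule p(3))
    have univ: "?L \<union> {0} \<union> {l+1..} = UNIV" by auto
    have "reduction ?T ?L \<in> relabel_class {l+1..} G"
      using relabel_class_bouquet[OF b, of "{l+1..}"] bR hR h univ by auto
    then have "\<exists>s. s permutes {l+1..} \<and> relabel s G = reduction ?T ?L" by (auto simp: relabel_class_def)
    then have "(SOME s. s permutes {l+1..} \<and> relabel s G = reduction ?T ?L) permutes {l+1..} \<and>
        relabel (SOME s. s permutes {l+1..} \<and> relabel s G = reduction ?T ?L) G = reduction ?T ?L" by (rule someI_ex)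
    then obtain s where s: "s = (SOME s. s permutes {l+1..} \<and> relabel s G = reduction ?T ?L)"
      "s permutes {l+1..}" "relabel s G = reduction ?T ?L" by blast
    have fixed: "s x = x" if "x \<le> l" for x using permutes_not_in[OF s(2), of x] that by simp
    have "inj_on s W" using permutes_inj[OF s(2)] inj_on_subset by blast
    then obtain p' where p': "reduced (s ` W) p' ?L" "relabel s (tree_of W g) = tree_of (s ` W) p'"
      "\<And>v. v \<in> W \<Longrightarrow> clus p' ?L (s v) = clus g ?L v" "\<And>v. v \<in> W \<Longrightarrow> p' (s v) = s (g v)"
      using reduced_relabel[OF red, of s] fixed by (metis atLeastAtMost_iff le0)
    have eq: "tree_of (s ` W) p' = tree_of (red_verts p ?L) (red_par p ?L)" using p'(2) s(3) G redT by simp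
    then have V: "s ` W = red_verts p ?L" by (metis verts_tree_of)
    have q: "p' = red_par p ?L" using eq gpar_tree_of[OF reducedD(1)[OF p'(1)]] gpar_tree_of[OF rooted_red[OF p(1) L]] by simp
    have vi: "v i \<in> W" "v i \<noteq> 0" using v(1)[OF i] by auto
    have sv: "s (v i) \<in> red_verts p ?L" using V vi by blast
    have sv0: "s (v i) \<noteq> 0" using permutes_inj[OF s(2)] fixed[of 0] vi(2) by (metis injD le0)
    have se: "s ` \<epsilon> i = {s (v i), red_par p ?L (s (v i))}" using v(2)[OF i] p'(4)[OF vi(1)] q by simp
    have "edge_count l G \<epsilon> ?T i = card (intermediate (spanned_subtree ?T ?L) (s ` \<epsilon> i))"
      unfolding edge_count_def Let_def s(1)[symmetric] ..
    also have "\<dots> = card {z. z \<noteq> 0 \<and> clus p ?L z = clus p ?L (s (v i))} - 1"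
      unfolding se spanned_subtree_tree_of[OF p(1) L] by (rule card_intermediate[OF p(1) L sg sv sv0])
    also have "clus p ?L (s (v i)) = C i"
      using clus_red[OF p(1) L sv] p'(3)[OF vi(1)] q by (simp add: C_def)
    finally show ?thesis by (simp add: cnt_def)
  qed
  show ?thesis by (rule that[OF bC main])
qed

text \<open>Makes the truncated \<open>cnt - 1\<close> invertible, so that a prescribed edge count
  is equivalent to a prescribed multiplicity.\<close>

lemma cnt_pos:
  assumes "rooted {0..N} p" "L \<subseteq> {0..N} - {0}" "A \<in> phier p L"
  shows "cnt p L A > 0"
proof -
  let ?Z = "{z. z \<noteq> 0 \<and> clus p L z = A}"
  have "A \<noteq> {}" using assms(3) by (simp add: phier_iff)
  have "?Z \<subseteq> {0..N}"
  proof
    fix z assume "z \<in> ?Z"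
    then have "clus p L z \<noteq> {}" using \<open>A \<noteq> {}\<close> by simp
    then show "z \<in> {0..N}" by (rule clus_in_verts[OF assms(1,2)])
  qed
  then have "finite ?Z" using finite_subset by blast
  moreover have "?Z \<noteq> {}" using assms(3) unfolding phier_def by blast
  ultimately show ?thesis by (simp add: cnt_def card_gt_0_iff)
qed

lemma edge_count_limit:
  assumes cf: "(\<pi>, \<alpha>) \<in> configurations l r" and l: "1 \<le> l" and c: "c > 0"
    and R: "represents {1..l} G \<pi> \<alpha>" and \<epsilon>: "bij_betw \<epsilon> {..<2 * l - r} (edges G)"
    and t: "\<And>i. i < 2 * l - r \<Longrightarrow> 0 \<le> t i"
  defines "\<sigma> \<equiv> \<Sum>i<2 * l - r. t i"
  shows "(\<lambda>N. real N powr (real (2 * l - r) / 2) *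
      \<P>(T in tree_law N (c * sqrt (real N)). Q_class l N T = bouquet_class l N \<pi> \<alpha> \<and>
        (\<forall>i<2 * l - r. edge_count l G \<epsilon> T i = nat \<lfloor>t i * sqrt (real N)\<rfloor>)))
    \<longlonglongrightarrow> c ^ (r - 1) * (\<sigma> + c) * exp (- \<sigma>\<^sup>2 / 2 - c * \<sigma>)"
proof -
  let ?L = "{1..l}" and ?k = "2 * l - r" and ?F = "conf_hier \<pi> \<alpha>"
  obtain C where C: "bij_betw C {..<?k} ?F" and ec: "\<And>N p i. rooted {0..N} p \<Longrightarrow> l \<le> N \<Longrightarrow>
      phier p ?L = ?F \<Longrightarrow> i < ?k \<Longrightarrow> edge_count l G \<epsilon> (tree_of {0..N} p) i = cnt p ?L (C i) - 1"
    using edge_count_eq[OF cf R \<epsilon>] by blast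
  have b: "bin_hier ?L ?F" using conf_hier(1)[OF cf] .
  have lam: "laminar_on ?L ?F" using b by (simp add: bin_hier_def)
  have mr: "card (maxes ?F) = r" using conf_hier(2)[OF cf] configurationsD(2)[OF cf] by simp
  have r: "1 \<le> r" "r \<le> l" using bin_hier_range[OF b l] mr by auto
  define u where "u = (\<lambda>N i. nat \<lfloor>t i * sqrt (real N)\<rfloor>)"
  \<comment> \<open>Each cluster has one vertex more than its edge has intermediate ones. The
    resulting constant \<open>?k\<close> disappears at scale sqrt N, so m N / sqrt N tends to
    \<sigma>.\<close>
  define m where "m = (\<lambda>N. ?k + (\<Sum>i<?k. u N i))"
  define nn where "nn = (\<lambda>N A. Suc (u N (the_inv_into {..<?k} C A)))"
  have nnC: "nn N (C i) = Suc (u N i)" if "i < ?k" for N i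
    using the_inv_into_f_f[of C "{..<?k}" i] C that by (simp add: nn_def bij_betw_def)
  have sum_nn: "sum (nn N) ?F = m N" for N
  proof -
    have "sum (nn N) ?F = (\<Sum>i<?k. nn N (C i))" by (rule sum.reindex_bij_betw[OF C, symmetric])
    also have "\<dots> = (\<Sum>i<?k. u N i + 1)" using nnC by (intro sum.cong) auto
    also have "\<dots> = m N" by (simp only: sum.distrib m_def) simp
    finally show ?thesis .
  qed
  have ev: "\<P>(T in tree_law N (c * sqrt (real N)). Q_class l N T = bouquet_class l N \<pi> \<alpha> \<and>
        (\<forall>i<?k. edge_count l G \<epsilon> T i = u N i)) = law_weight N (c * sqrt (real N)) l r (m N)" if N: "l \<le> N" for N
  proof -
    have \<kappa>: "c * sqrt (real N) > 0" using c l N by simp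
    have L: "?L \<subseteq> {0..N} - {0}" using N by auto
    have "\<P>(T in tree_law N (c * sqrt (real N)). Q_class l N T = bouquet_class l N \<pi> \<alpha> \<and>
        (\<forall>i<?k. edge_count l G \<epsilon> T i = u N i)) =
      \<P>(T in tree_law N (c * sqrt (real N)). phier (gpar T) ?L = ?F \<and> (\<forall>A\<in>?F. cnt (gpar T) ?L A = nn N A))"
    proof (rule prob_cong[OF \<kappa>])
      fix p assume p: "rooted {0..N} p"
      let ?T = "tree_of {0..N} p"
      have "(\<forall>i<?k. edge_count l G \<epsilon> ?T i = u N i) \<longleftrightarrow> (\<forall>A\<in>?F. cnt p ?L A = nn N A)" if ph: "phier p ?L = ?F"
      proof -
        have "(\<forall>i<?k. edge_count l G \<epsilon> ?T i = u N i) \<longleftrightarrow> (\<forall>i<?k. cnt p ?L (C i) = nn N (C i))"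
        proof (intro all_cong1 imp_cong refl)
          fix i assume i: "i < ?k"
          have "C i \<in> ?F" using bij_betwE[OF C] i by auto
          then have "cnt p ?L (C i) > 0" using cnt_pos[OF p L] ph by simp
          then show "edge_count l G \<epsilon> ?T i = u N i \<longleftrightarrow> cnt p ?L (C i) = nn N (C i)"
            using ec[OF p N ph i] nnC[OF i] by auto
        qed
        also have "\<dots> \<longleftrightarrow> (\<forall>A\<in>C ` {..<?k}. cnt p ?L A = nn N A)" by auto
        also have "C ` {..<?k} = ?F" using C by (simp add: bij_betw_def)
        finally show ?thesis .
      qed
      then show "Q_class l N ?T = bouquet_class l N \<pi> \<alpha> \<and> (\<forall>i<?k. edge_count l G \<epsilon> ?T i = u N i) \<longleftrightarrow>
          phier (gpar ?T) ?L = ?F \<and> (\<forall>A\<in>?F. cnt (gpar ?T) ?L A = nn N A)"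
        unfolding Q_class_iff[OF cf p N] gpar_tree_of[OF p] by blast
    qed
    also have "\<dots> = law_weight N (c * sqrt (real N)) l (card (maxes ?F)) (sum (nn N) ?F)"
      by (rule cluster_counts_law[OF lam l N _ \<kappa>]) (simp add: nn_def)
    finally show ?thesis by (simp only: mr sum_nn)
  qed
  have lm: "l \<le> m N" for N using r by (simp add: m_def)
  have "(\<lambda>N. real ?k / sqrt (real N) + (\<Sum>i<?k. real (u N i) / sqrt (real N))) \<longlonglongrightarrow> 0 + (\<Sum>i<?k. t i)"
    unfolding u_def using t by (intro tendsto_add inverse_sqrt_tendsto tendsto_sum floor_sqrt_tendsto) auto
  then have "(\<lambda>N. real (m N) / sqrt (real N)) \<longlonglongrightarrow> \<sigma>"
    by (simp add: m_def \<sigma>_def add_divide_distrib sum_divide_distrib)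
  then have "(\<lambda>N. real N powr (real ?k / 2) * law_weight N (c * sqrt (real N)) l r (m N))
      \<longlonglongrightarrow> c ^ (r - 1) * (\<sigma> + c) * exp (- \<sigma>\<^sup>2 / 2 - c * \<sigma>)"
    using r by (intro law_weight_limit lm c) auto
  moreover have "\<forall>\<^sub>F N in sequentially. real N powr (real ?k / 2) * law_weight N (c * sqrt (real N)) l r (m N) =
      real N powr (real ?k / 2) * \<P>(T in tree_law N (c * sqrt (real N)). Q_class l N T = bouquet_class l N \<pi> \<alpha> \<and>
        (\<forall>i<?k. edge_count l G \<epsilon> T i = nat \<lfloor>t i * sqrt (real N)\<rfloor>))"
    using eventually_ge_at_top[of l] by eventually_elim (simp add: ev[unfolded u_def])
  ultimately show ?thesis by (rule Lim_transform_eventually)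
qed

section \<open>The limit theorem\<close>

context
  fixes l :: nat and c :: real
  assumes l: "l \<ge> 1" and c: "c > 0"
begin

definition hierarchies :: "nat set set set" where "hierarchies = {F. bin_hier {1..l} F}"

lemma hierarchies_UN: "hierarchies = (\<Union>r\<in>{1..l}. hiers {1..l} r)"
  using bin_hier_range[OF _ l] unfolding hierarchies_def hiers_def by auto

lemma finite_hierarchies: "finite hierarchies"
  unfolding hierarchies_UN using finite_hiers by auto

lemma sum_hierarchies:
  fixes g :: "nat \<Rightarrow> real"
  shows "(\<Sum>F\<in>hierarchies. g (card (maxes F))) = (\<Sum>r=1..l. real (C_num l r) * g r)"
proof -
  have "(\<Sum>F\<in>hierarchies. g (card (maxes F))) = (\<Sum>r\<in>{1..l}. \<Sum>F\<in>hiers {1..l} r. g (card (maxes F)))"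
    unfolding hierarchies_UN using finite_hiers by (intro sum.UNION_disjoint) (auto simp: hiers_def)
  also have "\<dots> = (\<Sum>r=1..l. real (C_num l r) * g r)"
  proof (rule sum.cong[OF refl])
    fix r
    have "(\<Sum>F\<in>hiers {1..l} r. g (card (maxes F))) = (\<Sum>F\<in>hiers {1..l} r. g r)" by (intro sum.cong) (auto simp: hiers_def)
    then show "(\<Sum>F\<in>hiers {1..l} r. g (card (maxes F))) = real (C_num l r) * g r"
      using card_hiers[of "{1..l}" r] configurations_count(3)[of l r] by simp
  qed
  finally show ?thesis .
qed

abbreviation (input) law where "law N \<equiv> tree_law N (c * sqrt (real N))"
abbreviation (input) HP where "HP N F \<equiv> \<P>(T in law N. phier (gpar T) {1..l} = F)"

lemma weight_pos: "N \<ge> 1 \<Longrightarrow> c * sqrt (real N) > 0"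
  using c by simp

text \<open>There are finitely many hierarchies on a fixed \<open>L\<close>, so the limit passes
  through the sum; tightness of the family of reductions is a consequence.\<close>

lemma total_limit: "(\<lambda>N. \<Sum>F\<in>hierarchies. HP N F) \<longlonglongrightarrow> 1"
proof -
  have "(\<lambda>N. \<Sum>F\<in>hierarchies. HP N F) \<longlonglongrightarrow> (\<Sum>F\<in>hierarchies. I_lim l (card (maxes F)) c)"
    by (intro tendsto_sum hierarchy_prob_limit l c) (simp add: hierarchies_def)
  then show ?thesis using sum_hierarchies[of "\<lambda>r. I_lim l r c"] sum_C_num_I_lim[OF l c] by simp
qed

lemma prob_hierarchies:
  assumes N: "N \<ge> 1" and S: "finite S"
  shows "\<P>(T in law N. phier (gpar T) {1..l} \<in> S) = (\<Sum>F\<in>S. HP N F)"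
proof -
  have "\<P>(T in law N. phier (gpar T) {1..l} \<in> S) =
      (\<Sum>F\<in>S. \<P>(T in law N. phier (gpar T) {1..l} \<in> S \<and> phier (gpar T) {1..l} = F))"
    by (rule prob_partition[OF weight_pos[OF N] S])
  also have "\<dots> = (\<Sum>F\<in>S. HP N F)"
    by (intro sum.cong refl prob_cong[OF weight_pos[OF N]]) auto
  finally show ?thesis .
qed

lemma prob_mono:
  assumes N: "N \<ge> 1" and PQ: "\<And>p. rooted {0..N} p \<Longrightarrow> P (tree_of {0..N} p) \<Longrightarrow> Q (tree_of {0..N} p)"
  shows "\<P>(T in law N. P T) \<le> \<P>(T in law N. Q T)"
proof -
  have Z: "forest_weight N (c * sqrt (real N)) \<ge> 0" using weight_pos[OF N] by (simp add: forest_weight_def)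
  have "finite {p. rooted {0..N} p \<and> Q (tree_of {0..N} p)}"
    using finite_rooted[of "{0..N}"] by (auto intro: rev_finite_subset)
  then show ?thesis unfolding tree_law_prob[OF weight_pos[OF N]]
    using PQ weight_pos[OF N] Z by (intro divide_right_mono sum_mono2) auto
qed

lemma prob_compl:
  assumes N: "N \<ge> 1" shows "\<P>(T in law N. \<not> P T) = 1 - \<P>(T in law N. P T)"
proof -
  interpret prob_space "law N" by (rule prob_space_tree_law[OF weight_pos[OF N]])
  have "{T \<in> space (law N). P T} \<in> events" by (auto simp: tree_law_def sets_point_measure space_point_measure)
  then show ?thesis by (rule prob_neg)
qed

lemma not_hierarchy_limit: "(\<lambda>N. \<P>(T in law N. phier (gpar T) {1..l} \<notin> hierarchies)) \<longlonglongrightarrow> 0"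
proof -
  have "\<forall>\<^sub>F N in sequentially. 1 - (\<Sum>F\<in>hierarchies. HP N F) = \<P>(T in law N. phier (gpar T) {1..l} \<notin> hierarchies)"
    using eventually_ge_at_top[of 1]
    by eventually_elim (simp only: prob_compl prob_hierarchies[OF _ finite_hierarchies])
  moreover have "(\<lambda>N. 1 - (\<Sum>F\<in>hierarchies. HP N F)) \<longlonglongrightarrow> 1 - 1" by (intro tendsto_diff tendsto_const total_limit)
  ultimately show ?thesis by (auto intro: Lim_transform_eventually)
qed

lemma prob_nonneg: "\<P>(T in law N. P T) \<ge> 0"
  by (rule measure_nonneg)

text \<open>One implication is enough: a binary cluster family forces the reduction to be a bouquet,
  so failure is contained in an event whose probability is already known to vanish.\<close>

lemma not_bouquet_limit:
  "(\<lambda>N. \<P>(T in law N. \<not> (\<exists>r. binary_bouquet {1..l} r (reduction T {1..l})))) \<longlonglongrightarrow> 0"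
proof (rule tendsto_sandwich[OF _ _ tendsto_const not_hierarchy_limit])
  show "\<forall>\<^sub>F N in sequentially. 0 \<le> \<P>(T in law N. \<not> (\<exists>r. binary_bouquet {1..l} r (reduction T {1..l})))"
    by (intro always_eventually allI prob_nonneg)
  show "\<forall>\<^sub>F N in sequentially. \<P>(T in law N. \<not> (\<exists>r. binary_bouquet {1..l} r (reduction T {1..l}))) \<le>
      \<P>(T in law N. phier (gpar T) {1..l} \<notin> hierarchies)"
    using eventually_ge_at_top[of l]
  proof eventually_elim
    case (elim N)
    show ?case
    proof (rule prob_mono)
      show "1 \<le> N" using elim l by simp
      fix p assume p: "rooted {0..N} p"
      let ?L = "{1..l}" and ?T = "tree_of {0..N} p"
      have L: "?L \<subseteq> {0..N} - {0}" using elim by auto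
      assume nb: "\<not> (\<exists>r. binary_bouquet ?L r (reduction ?T ?L))"
      show "phier (gpar ?T) ?L \<notin> hierarchies"
      proof
        assume "phier (gpar ?T) ?L \<in> hierarchies"
        then have b: "bin_hier ?L (phier p ?L)" by (simp add: hierarchies_def gpar_tree_of[OF p])
        have sg: "{i} \<in> phier p ?L" if "i \<in> ?L" for i
          using b laminar_onD(5)[of ?L "phier p ?L" i] that by (simp add: bin_hier_def)
        have "binary_bouquet ?L (card (maxes (phier p ?L))) (reduction ?T ?L)"
          using reduced_bouquet[OF red_reduced[OF p L sg]] b phier_red[OF p L] reduction_tree_of[OF p L] by simp
        then show False using nb by blast
      qed
    qed
  qed
qed

lemma Q_class_prob:
  assumes cf: "(\<pi>, \<alpha>) \<in> configurations l r" and N: "N \<ge> l"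
  shows "\<P>(T in law N. Q_class l N T = bouquet_class l N \<pi> \<alpha>) = HP N (conf_hier \<pi> \<alpha>)"
proof (rule prob_cong)
  show "c * sqrt (real N) > 0" using weight_pos l N by simp
  fix p assume p: "rooted {0..N} p"
  show "Q_class l N (tree_of {0..N} p) = bouquet_class l N \<pi> \<alpha> \<longleftrightarrow> phier (gpar (tree_of {0..N} p)) {1..l} = conf_hier \<pi> \<alpha>"
    unfolding gpar_tree_of[OF p] by (rule Q_class_iff[OF cf p N])
qed

lemma Q_class_limit:
  assumes cf: "(\<pi>, \<alpha>) \<in> configurations l r"
  shows "(\<lambda>N. \<P>(T in law N. Q_class l N T = bouquet_class l N \<pi> \<alpha>)) \<longlonglongrightarrow> I_lim l r c"
proof -
  have "card (maxes (conf_hier \<pi> \<alpha>)) = r" using conf_hier(2)[OF cf] configurationsD(2)[OF cf] by simp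
  then have "(\<lambda>N. HP N (conf_hier \<pi> \<alpha>)) \<longlonglongrightarrow> I_lim l r c"
    using hierarchy_prob_limit[OF conf_hier(1)[OF cf] l c] by simp
  moreover have "\<forall>\<^sub>F N in sequentially. HP N (conf_hier \<pi> \<alpha>) = \<P>(T in law N. Q_class l N T = bouquet_class l N \<pi> \<alpha>)"
    using eventually_ge_at_top[of l] by eventually_elim (simp add: Q_class_prob[OF cf])
  ultimately show ?thesis by (rule Lim_transform_eventually)
qed

lemma component_count_iff:
  assumes p: "rooted {0..N} p" and N: "N \<ge> l"
  shows "component_partition (tree_of {0..N} p) {1..l} = maxes (phier p {1..l})"
  using N by (intro component_partition_tree_of[OF p]) auto

text \<open>Trees with a non-binary cluster family can also have r components. The event therefore
  lies between the binary hierarchies with r maximal clusters and their union with the event of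
  vanishing probability.\<close>

lemma component_count_limit:
  assumes r: "r \<in> {1..l}"
  shows "(\<lambda>N. \<P>(T in law N. card (component_partition T {1..l}) = r)) \<longlonglongrightarrow> real (C_num l r) * I_lim l r c"
proof -
  let ?H = "hiers {1..l} r" and ?U = "\<lambda>N. \<P>(T in law N. phier (gpar T) {1..l} \<notin> hierarchies)"
  have finH: "finite ?H" by (intro finite_hiers) simp
  have "(\<lambda>N. \<Sum>F\<in>?H. HP N F) \<longlonglongrightarrow> (\<Sum>F\<in>?H. I_lim l (card (maxes F)) c)"
    by (intro tendsto_sum hierarchy_prob_limit l c) (simp add: hiers_def)
  also have "(\<Sum>F\<in>?H. I_lim l (card (maxes F)) c) = (\<Sum>F\<in>?H. I_lim l r c)"
    by (intro sum.cong) (auto simp: hiers_def)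
  also have "\<dots> = real (C_num l r) * I_lim l r c"
    using card_hiers[of "{1..l}" r] configurations_count(3)[of l r] by simp
  finally have lim: "(\<lambda>N. \<Sum>F\<in>?H. HP N F) \<longlonglongrightarrow> real (C_num l r) * I_lim l r c" .
  show ?thesis
  proof (rule tendsto_sandwich[OF _ _ lim])
    show "(\<lambda>N. (\<Sum>F\<in>?H. HP N F) + ?U N) \<longlonglongrightarrow> real (C_num l r) * I_lim l r c"
      using tendsto_add[OF lim not_hierarchy_limit] by simp
    show "\<forall>\<^sub>F N in sequentially. (\<Sum>F\<in>?H. HP N F) \<le> \<P>(T in law N. card (component_partition T {1..l}) = r)"
      using eventually_ge_at_top[of l]
    proof eventually_elim
      case (elim N)
      have N1: "1 \<le> N" using elim l by simp
      show ?case unfolding prob_hierarchies[OF N1 finH, symmetric]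
        by (rule prob_mono[OF N1]) (auto simp: gpar_tree_of component_count_iff[OF _ elim] hiers_def simp del: One_nat_def)
    qed
    show "\<forall>\<^sub>F N in sequentially. \<P>(T in law N. card (component_partition T {1..l}) = r) \<le> (\<Sum>F\<in>?H. HP N F) + ?U N"
      using eventually_ge_at_top[of l]
    proof eventually_elim
      case (elim N)
      have N1: "1 \<le> N" using elim l by simp
      interpret prob_space "law N" by (rule prob_space_tree_law[OF weight_pos[OF N1]])
      have ev: "{T \<in> space (law N). P T} \<in> events" for P
        by (auto simp: tree_law_def sets_point_measure space_point_measure)
      have "\<P>(T in law N. card (component_partition T {1..l}) = r) \<le>
          \<P>(T in law N. phier (gpar T) {1..l} \<in> ?H \<or> phier (gpar T) {1..l} \<notin> hierarchies)"
        by (rule prob_mono[OF N1])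
           (auto simp: gpar_tree_of component_count_iff[OF _ elim] hiers_def hierarchies_def simp del: One_nat_def)
      also have "\<dots> = prob ({T \<in> space (law N). phier (gpar T) {1..l} \<in> ?H} \<union>
          {T \<in> space (law N). phier (gpar T) {1..l} \<notin> hierarchies})"
        by (rule arg_cong[where f = prob]) auto
      also have "\<dots> \<le> \<P>(T in law N. phier (gpar T) {1..l} \<in> ?H) + ?U N"
        by (rule measure_Un_le[OF ev ev])
      also have "\<P>(T in law N. phier (gpar T) {1..l} \<in> ?H) = (\<Sum>F\<in>?H. HP N F)"
        by (rule prob_hierarchies[OF N1 finH])
      finally show ?case .
    qed
  qed
qed

text \<open>The number of blocks is part of the reduced configuration, so the joint event is the
  event on \<open>Q_class\<close> and the quotient of two known limits remains.
  \<open>moment_pos\<close> and the given configuration keep the denominator away from 0.\<close>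

lemma conditional_limit:
  assumes r: "r \<in> {1..l}" and cf: "(\<pi>, \<alpha>) \<in> configurations l r"
  shows "(\<lambda>N. \<P>(T in law N. Q_class l N T = bouquet_class l N \<pi> \<alpha> \<bar> card (component_partition T {1..l}) = r))
    \<longlonglongrightarrow> 1 / real (C_num l r)"
proof -
  have "I_lim l r c > 0" using I_lim_moment[OF c l, of r] moment_pos[OF c] c r by simp
  moreover have "C_num l r > 0"
    using cf configurations_count(1,2)[of l r] card_gt_0_iff by (metis empty_iff)
  ultimately have nz: "real (C_num l r) * I_lim l r c \<noteq> 0" and Inz: "I_lim l r c \<noteq> 0" by auto
  have "(\<lambda>N. \<P>(T in law N. Q_class l N T = bouquet_class l N \<pi> \<alpha>) /
      \<P>(T in law N. card (component_partition T {1..l}) = r)) \<longlonglongrightarrow> I_lim l r c / (real (C_num l r) * I_lim l r c)"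
    by (rule tendsto_divide[OF Q_class_limit[OF cf] component_count_limit[OF r] nz])
  moreover have "\<forall>\<^sub>F N in sequentially. \<P>(T in law N. Q_class l N T = bouquet_class l N \<pi> \<alpha>) /
      \<P>(T in law N. card (component_partition T {1..l}) = r) =
      \<P>(T in law N. Q_class l N T = bouquet_class l N \<pi> \<alpha> \<bar> card (component_partition T {1..l}) = r)"
    using eventually_ge_at_top[of l]
  proof eventually_elim
    case (elim N)
    have N1: "1 \<le> N" using elim l by simp
    have "card (maxes (conf_hier \<pi> \<alpha>)) = r" using conf_hier(2)[OF cf] configurationsD(2)[OF cf] by simp
    then have "\<P>(T in law N. Q_class l N T = bouquet_class l N \<pi> \<alpha>) =
        \<P>(T in law N. Q_class l N T = bouquet_class l N \<pi> \<alpha> \<and> card (component_partition T {1..l}) = r)"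
      by (intro prob_cong[OF weight_pos[OF N1]])
         (auto simp: Q_class_iff[OF cf _ elim] component_count_iff[OF _ elim] simp del: One_nat_def)
    then show ?case by (simp add: cond_prob_def)
  qed
  ultimately show ?thesis using Inz by (auto intro: Lim_transform_eventually)
qed

end

theorem theorem2:
  fixes l :: nat and c :: real
  assumes "l \<ge> 1" and "c > 0"
  shows
    "((\<lambda>N. \<P>(T in tree_law N (c * sqrt (real N)). \<not> (\<exists>r. binary_bouquet {1..l} r (reduction T {1..l})))) \<longlonglongrightarrow> 0) \<and>
     (\<forall>r. \<forall>(\<pi>, \<alpha>)\<in>configurations l r.
        (\<lambda>N. \<P>(T in tree_law N (c * sqrt (real N)). Q_class l N T = bouquet_class l N \<pi> \<alpha>)) \<longlonglongrightarrow> I_lim l r c) \<and>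
     (\<forall>r\<in>{1..l}.
        (\<lambda>N. \<P>(T in tree_law N (c * sqrt (real N)). card (component_partition T {1..l}) = r))
          \<longlonglongrightarrow> real (C_num l r) * I_lim l r c) \<and>
     (\<forall>r\<in>{1..l}.
        finite (configurations l r) \<and> card (configurations l r) = C_num l r \<and>
        (\<forall>(\<pi>, \<alpha>)\<in>configurations l r.
          (\<lambda>N. \<P>(T in tree_law N (c * sqrt (real N)). Q_class l N T = bouquet_class l N \<pi> \<alpha>
                 \<bar> card (component_partition T {1..l}) = r))
            \<longlonglongrightarrow> 1 / real (C_num l r))) \<and>
     (\<forall>r. \<forall>(\<pi>, \<alpha>)\<in>configurations l r. \<forall>G \<epsilon> t.
        represents {1..l} G \<pi> \<alpha> \<longrightarrow>
        bij_betw \<epsilon> {..<2 * l - r} (edges G) \<longrightarrow>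
        (\<forall>i<2 * l - r. 0 \<le> t i) \<longrightarrow>
        (let \<sigma> = (\<Sum>i<2 * l - r. t i) in
          (\<lambda>N. real N powr (real (2 * l - r) / 2) *
             \<P>(T in tree_law N (c * sqrt (real N)). Q_class l N T = bouquet_class l N \<pi> \<alpha> \<and>
                (\<forall>i<2 * l - r. edge_count l G \<epsilon> T i = nat \<lfloor>t i * sqrt (real N)\<rfloor>)))
            \<longlonglongrightarrow> c ^ (r - 1) * (\<sigma> + c) * exp (- \<sigma>\<^sup>2 / 2 - c * \<sigma>)))"
proof (intro conjI allI ballI)
  show "(\<lambda>N. \<P>(T in tree_law N (c * sqrt (real N)). \<not> (\<exists>r. binary_bouquet {1..l} r (reduction T {1..l})))) \<longlonglongrightarrow> 0"
    by (rule not_bouquet_limit[OF assms])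
next
  fix r x assume "x \<in> configurations l r"
  then show "case x of (\<pi>, \<alpha>) \<Rightarrow> (\<lambda>N. \<P>(T in tree_law N (c * sqrt (real N)). Q_class l N T = bouquet_class l N \<pi> \<alpha>))
      \<longlonglongrightarrow> I_lim l r c"
    using Q_class_limit[OF assms] by (cases x) simp
next
  fix r assume "r \<in> {1..l}"
  then show "(\<lambda>N. \<P>(T in tree_law N (c * sqrt (real N)). card (component_partition T {1..l}) = r))
      \<longlonglongrightarrow> real (C_num l r) * I_lim l r c"
    by (rule component_count_limit[OF assms])
next
  fix r assume "r \<in> {1..l}"
  show "finite (configurations l r)" "card (configurations l r) = C_num l r"
    by (rule configurations_count)+
next
  fix r x assume "r \<in> {1..l}" "x \<in> configurations l r"
  then show "case x of (\<pi>, \<alpha>) \<Rightarrow> (\<lambda>N. \<P>(T in tree_law N (c * sqrt (real N)). Q_class l N T = bouquet_class l N \<pi> \<alpha>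
      \<bar> card (component_partition T {1..l}) = r)) \<longlonglongrightarrow> 1 / real (C_num l r)"
    using conditional_limit[OF assms] by (cases x) simp
next
  fix r x assume x: "x \<in> configurations l r"
  obtain \<pi> \<alpha> where x': "x = (\<pi>, \<alpha>)" by (cases x)
  show "case x of (\<pi>, \<alpha>) \<Rightarrow> \<forall>G \<epsilon> t.
        represents {1..l} G \<pi> \<alpha> \<longrightarrow>
        bij_betw \<epsilon> {..<2 * l - r} (edges G) \<longrightarrow>
        (\<forall>i<2 * l - r. 0 \<le> t i) \<longrightarrow>
        (let \<sigma> = (\<Sum>i<2 * l - r. t i) in
          (\<lambda>N. real N powr (real (2 * l - r) / 2) *
             \<P>(T in tree_law N (c * sqrt (real N)). Q_class l N T = bouquet_class l N \<pi> \<alpha> \<and>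
                (\<forall>i<2 * l - r. edge_count l G \<epsilon> T i = nat \<lfloor>t i * sqrt (real N)\<rfloor>)))
            \<longlonglongrightarrow> c ^ (r - 1) * (\<sigma> + c) * exp (- \<sigma>\<^sup>2 / 2 - c * \<sigma>))"
    unfolding x' prod.case Let_def
  proof (intro allI impI)
    fix G \<epsilon> and t :: "nat \<Rightarrow> real"
    assume G: "represents {1..l} G \<pi> \<alpha>" "bij_betw \<epsilon> {..<2 * l - r} (edges G)" "\<forall>i<2 * l - r. 0 \<le> t i"
    show "(\<lambda>N. real N powr (real (2 * l - r) / 2) *
             \<P>(T in tree_law N (c * sqrt (real N)). Q_class l N T = bouquet_class l N \<pi> \<alpha> \<and>
                (\<forall>i<2 * l - r. edge_count l G \<epsilon> T i = nat \<lfloor>t i * sqrt (real N)\<rfloor>)))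
            \<longlonglongrightarrow> c ^ (r - 1) * (sum t {..<2 * l - r} + c) * exp (- (sum t {..<2 * l - r})\<^sup>2 / 2 - c * sum t {..<2 * l - r})"
      using G by (intro edge_count_limit[OF x[unfolded x'] assms]) auto
  qed
qed

end
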